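(* Suppose that $\|a\|_\infty=\sup_x|a(x)|<\infty$ and that there are constants $0<c\le C<\infty$ with $c\le \bar r_S(x_S)\le C$ for all $x_S\in\mathbb R^S$ and $S\in\mathbb S$. For some fixed $\beta_1,\beta_2,\beta_3,L_1,L_2,L_3>0$ suppose that: (A1) for all $x,x'\in\mathbb R^d$ with $\|x-x'\|_\infty\le 1$, $|a(x)-a(x')|\le L_1\|x-x'\|_\infty^{\beta_1}$; (A2) for all $S\in\mathbb S$ and $x_S,x_S'\in\mathbb R^S$ with $\|x_S-x_S'\|_\infty\le 1$, the total variation distance between the conditional distribution of $X_{S^c}$ given $X_S=x_S$ and that of $X_{S^c}$ given $X_S=x_S'$ is at most $L_2\|x_S-x_S'\|_\infty^{\beta_2}$; (A3) for all $S\in\mathbb S$ and $x_S,x_S'\in\mathbb R^S$ with $\|x_S-x_S'\|_\infty\le 1$, $|\bar r_S(x_S)-\bar r_S(x_S')|\le L_3\|x_S-x_S'\|_\infty^{\beta_3}$. Suppose also that $n_S/n\to\lambda_S\in(0,\infty)$ as $n\to\infty$ and $|n\lambda_S/n_S-1|\le 1/n$ for all $n\in\mathbb N$, for each $S\in\mathbb S$. Then: (i) There exists an estimator $\hat\theta\equiv\hat\theta_n$, namely the cross-fitting estimator defined in the context with suitable sequences of tuning parameters $h=h_n$, $T=T_n$, $M=M_n$, such that $$\limsup_{n\to\infty}\mathbb E_f\bigl[n\{\hat\theta-\theta(f)\}^2\bigr]\le\inf_{\alpha_{\mathbb S}\in H_{\mathbb S}}\mathcal L(\alpha_{\mathbb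 S}).$$ (ii) For any measurable estimator sequence $(\theta_n)$ we have $$\sup_{I\subset L^2}\ \liminf_{n\to\infty}\ \max_{h\in I}\ \mathbb E_{f_{n^{-1/2}h}}\bigl[n\{\theta_n-\theta(f_{n^{-1/2}h})\}^2\bigr]\ \ge\ \inf_{\alpha_{\mathbb S}\in H_{\mathbb S}}\mathcal L(\alpha_{\mathbb S}),$$ where the supremum is over all finite subsets $I$ of $L^2$.
   Context: Setting. Let $d\ge 2$, $[d]=\{1,\dots,d\}$, let $f$ be a probability density on $\mathbb R^d$ and $X\sim f$. For $x\in\mathbb R^d$, $S\subseteq[d]$ write $x_S=(x_j:j\in S)\in\mathbb R^S$, $S^c=[d]\setminus S$, and $f_S$ for the density of $X_S$. Let $\mathbb S\subseteq 2^{[d]}\setminus\{[d]\}$ be a nonempty collection, and for $S\in\mathbb S$ let $r_S:\mathbb R^S\to(0,\infty)$ be a known measurable function with normalised version $\bar r_S=r_S/\int r_Sf_S$. Functions of $x_S$ are also regarded as functions of $x$. Let $a:\mathbb R^d\to\mathbb R$ be a known measurable function and $\theta=\theta(f)=\int af=\mathbb E\{a(X)\}$. Data. For sample sizes $n$ and $n_S\ge 1$ ($S\in\mathbb S$, depending on $n$) we observe mutually independent samples: $X_1,\dots,X_n$ i.i.d. with density $f$; and, for each $S\in\mathbb S$, $X_{S,1},\dots,X_{S,n_S}$ for which only the coordinates in $S$ are observed, with $(X_{S,i})_S$ i.i.d. with density $\bar r_Sf_S$. Functions of $x_S$ may therefore be evaluated at $X_{S,i}$. An estimator is a measurable function of the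 observed data. For a density $g$, $\mathbb E_g$ denotes expectation when $f$ is replaced by $g$ (so complete data have density $g$ and the data on $S$ have density proportional to $r_Sg_S$, with the same $r_S$). Objective. $L^2=\{\alpha:\mathbb R^d\to\mathbb R:\int\alpha^2f<\infty\}$, $H_S=\{\alpha_S\in L^2:\alpha_S(x)\equiv\alpha_S(x_S),\int\alpha_Sf=0\}$, $H_{\mathbb S}=\prod_{S\in\mathbb S}H_S$, and for $\alpha_{\mathbb S}=(\alpha_S:S\in\mathbb S)\in H_{\mathbb S}$ $$\mathcal L(\alpha_{\mathbb S})=\mathrm{Var}\Bigl(a(X)-\sum_{S\in\mathbb S}\alpha_S(X_S)\Bigr)+\sum_{S\in\mathbb S}\mathbb E\Bigl[\frac{\alpha_S(X_S)^2}{\lambda_S\bar r_S(X_S)}\Bigr].$$ Perturbations. Let $k(u)=1/2+(1+e^{-4u})^{-1}$; for $h\in L^2$, $f_h$ is the probability density with $f_h(x)\propto k(h(x))f(x)$. Cross-fitting estimator. Let $M\in\mathbb N$ with $n\ge 2M$, $h\in(0,1)$, $T\ge 1$ and $\eta=|\mathbb S|^{-1}$. Let $\mathcal D_1=\{X_1,\dots,X_{\lceil n/2\rceil}\}$, $\mathcal D_2=\{X_{\lceil n/2\rceil+1},\dots,X_n\}$, and split each $\mathcal D_\ell$ into $M$ disjoint pieces $\mathcal D_{\ell,1},\dots,\mathcal D_{\ell,M}$ of sizes as equal as possible. Let $K_h^S(u_S)=(2h)^{-|S|}\mathbf 1\{\|u_S\|_\infty\le h\}$, $B_T=\{x\in\mathbb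 R^d:\|x\|_\infty\le T\}$, $\hat r_{S,(\ell)}=|\mathcal D_\ell|^{-1}\sum_{x\in\mathcal D_\ell}r_S(x)$. For fixed $\ell\in\{1,2\}$ put $\hat r_S^{(m)}=|\mathcal D_{\ell,m}|^{-1}\sum_{y\in\mathcal D_{\ell,m}}r_S(y)$, $\hat f_S^{(m)}(x_S)=|\mathcal D_{\ell,m}|^{-1}\sum_{y\in\mathcal D_{\ell,m}}K_h^S(x_S-y_S)$ and $\hat w_S^{(m)}(x_S)=\lambda_Sr_S(x_S)/\{\hat r_S^{(m)}+\lambda_Sr_S(x_S)\}$. Set $\hat\alpha_{S,(\ell)}^{(0)}\equiv 0$ and, for $m=1,\dots,M$, $S\in\mathbb S$, $\|x_S\|_\infty\le T$, $$\hat\alpha_{S,(\ell)}^{(m)}(x_S)=(1-\eta)\hat\alpha_{S,(\ell)}^{(m-1)}(x_S)+\eta\,\hat w_S^{(m)}(x_S)\Bigl[\frac1{|\mathcal D_{\ell,m}|}\sum_{y\in\mathcal D_{\ell,m}}g_S(y)\mathbf 1_{B_T}(y)\frac{K_h^S(x_S-y_S)}{\hat f_S^{(m)}(x_S)}-\frac{\sum_{y\in\mathcal D_{\ell,m}}\hat w_S^{(m)}(y)g_S(y)\mathbf 1_{B_T}(y)}{\sum_{y\in\mathcal D_{\ell,m}}\hat w_S^{(m)}(y)}\Bigr],$$ where $g_S(y)=a(y)-\sum_{S'\in\mathbb S\setminus\{S\}}\hat\alpha_{S',(\ell)}^{(m-1)}(y)$ and $0/0=0$; set $\hat\alpha_{S,(\ell)}^{(m)}(x_S)=0$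 if $\|x_S\|_\infty>T$. Then $$\hat\theta_{(\ell)}^{(M)}=\frac1{|\mathcal D_{3-\ell}|}\sum_{x\in\mathcal D_{3-\ell}}\Bigl\{a(x)-\sum_{S\in\mathbb S}\hat\alpha_{S,(\ell)}^{(M)}(x)\Bigr\}+\sum_{S\in\mathbb S}\frac1{n_S}\sum_{j=1}^{n_S}\frac{\hat\alpha_{S,(\ell)}^{(M)}(X_{S,j})\,\hat r_{S,(3-\ell)}}{r_S(X_{S,j})},$$ and $\hat\theta=(|\mathcal D_2|\hat\theta_{(1)}^{(M)}+|\mathcal D_1|\hat\theta_{(2)}^{(M)})/n$. *)

theory Defs
  imports "HOL-Probability.Probability"
begin

text \<open>
  Points of \<open>\<real>^d\<close> are functions \<open>'d \<Rightarrow> real\<close> on a finite index type \<open>'d\<close>. For \<open>S :: 'd set\<close>, the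
  space \<open>\<real>^S\<close> is the extensional function space underlying the product measure \<open>PiM S\<close>, and \<open>x_S\<close>
  is \<open>restrict x S\<close>. As \<open>\<real>^S\<close> and \<open>\<real>^d\<close> share a type, a function of \<open>x_S\<close> is a function
  \<open>\<phi>\<close> on \<open>'d \<Rightarrow> real\<close> satisfying \<open>depends_on S \<phi>\<close>; it may be evaluated at \<open>x\<close> or at \<open>x_S\<close>.
\<close>

abbreviation leb :: "'d::finite set \<Rightarrow> ('d \<Rightarrow> real) measure" where
  "leb S \<equiv> (\<Pi>\<^sub>M i\<in>S. lborel)"

definition depends_on :: "'d set \<Rightarrow> (('d \<Rightarrow> real) \<Rightarrow> real) \<Rightarrow> bool" where
  "depends_on S \<phi> \<longleftrightarrow> (\<forall>x. \<phi> x = \<phi> (restrict x S))"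

text \<open>The sup norm of \<open>x_S\<close>; the inserted 0 only matters for \<open>S = {}\<close>.\<close>

definition sup_norm :: "'d::finite set \<Rightarrow> ('d \<Rightarrow> real) \<Rightarrow> real" where
  "sup_norm S x = Max (insert 0 ((\<lambda>i. \<bar>x i\<bar>) ` S))"

definition prob_density :: "(('d::finite \<Rightarrow> real) \<Rightarrow> real) \<Rightarrow> bool" where
  "prob_density f \<longleftrightarrow> f \<in> borel_measurable (leb UNIV) \<and> (\<forall>x. 0 \<le> f x) \<and>
     (\<integral>\<^sup>+x. ennreal (f x) \<partial>leb UNIV) = 1"

definition law :: "(('d::finite \<Rightarrow> real) \<Rightarrow> real) \<Rightarrow> ('d \<Rightarrow> real) measure" where
  "law f = density (leb UNIV) (\<lambda>x. ennreal (f x))"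

definition marginal :: "(('d::finite \<Rightarrow> real) \<Rightarrow> real) \<Rightarrow> 'd set \<Rightarrow> ('d \<Rightarrow> real) \<Rightarrow> real" where
  "marginal f S x = (\<integral>y. f (merge S (-S) (x, y)) \<partial>leb (-S))"

definition r_bar ::
  "('d::finite set \<Rightarrow> ('d \<Rightarrow> real) \<Rightarrow> real) \<Rightarrow> (('d \<Rightarrow> real) \<Rightarrow> real) \<Rightarrow> 'd set \<Rightarrow> ('d \<Rightarrow> real) \<Rightarrow> real"
where
  "r_bar r f S x = r S x / (\<integral>y. r S y * marginal f S y \<partial>leb S)"

definition biased_law ::
  "('d::finite set \<Rightarrow> ('d \<Rightarrow> real) \<Rightarrow> real) \<Rightarrow> (('d \<Rightarrow> real) \<Rightarrow> real) \<Rightarrow> 'd set \<Rightarrow> ('d \<Rightarrow> real) measure"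
where
  "biased_law r f S = density (leb S) (\<lambda>x. ennreal (r_bar r f S x * marginal f S x))"

text \<open>\<open>\<kappa>\<close> is a version of the conditional distribution of \<open>X_{S^c}\<close> given \<open>X_S\<close> when \<open>X\<close> has
  density \<open>f\<close>.\<close>

definition cond_dist ::
  "(('d::finite \<Rightarrow> real) \<Rightarrow> real) \<Rightarrow> 'd set \<Rightarrow> (('d \<Rightarrow> real) \<Rightarrow> ('d \<Rightarrow> real) measure) \<Rightarrow> bool"
where
  "cond_dist f S \<kappa> \<longleftrightarrow> \<kappa> \<in> leb S \<rightarrow>\<^sub>M prob_algebra (leb (-S)) \<and>
     (\<forall>A\<in>sets (leb S). \<forall>B\<in>sets (leb (-S)).
        emeasure (law f) {x. restrict x S \<in> A \<and> restrict x (-S) \<in> B} =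
        (\<integral>\<^sup>+x. indicator A (restrict x S) * emeasure (\<kappa> (restrict x S)) B \<partial>law f))"

definition tv_dist :: "'b measure \<Rightarrow> 'b measure \<Rightarrow> real" where
  "tv_dist \<mu> \<nu> = (SUP A\<in>sets \<mu>. \<bar>measure \<mu> A - measure \<nu> A\<bar>)"

definition theta :: "(('d::finite \<Rightarrow> real) \<Rightarrow> real) \<Rightarrow> (('d \<Rightarrow> real) \<Rightarrow> real) \<Rightarrow> real" where
  "theta a f = (\<integral>x. a x * f x \<partial>leb UNIV)"

definition Lsq :: "(('d::finite \<Rightarrow> real) \<Rightarrow> real) \<Rightarrow> (('d \<Rightarrow> real) \<Rightarrow> real) set" where
  "Lsq f = {\<alpha> \<in> borel_measurable (leb UNIV). integrable (leb UNIV) (\<lambda>x. (\<alpha> x)\<^sup>2 * f x)}"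

definition HS :: "(('d::finite \<Rightarrow> real) \<Rightarrow> real) \<Rightarrow> 'd set \<Rightarrow> (('d \<Rightarrow> real) \<Rightarrow> real) set" where
  "HS f S = {\<alpha> \<in> Lsq f. depends_on S \<alpha> \<and> (\<integral>x. \<alpha> x * f x \<partial>leb UNIV) = 0}"

definition H_prod ::
  "(('d::finite \<Rightarrow> real) \<Rightarrow> real) \<Rightarrow> 'd set set \<Rightarrow> ('d set \<Rightarrow> ('d \<Rightarrow> real) \<Rightarrow> real) set"
where
  "H_prod f \<S> = (\<Pi>\<^sub>E S\<in>\<S>. HS f S)"

definition objective ::
  "(('d::finite \<Rightarrow> real) \<Rightarrow> real) \<Rightarrow> 'd set set \<Rightarrow> (('d \<Rightarrow> real) \<Rightarrow> real) \<Rightarrow>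
   ('d set \<Rightarrow> ('d \<Rightarrow> real) \<Rightarrow> real) \<Rightarrow> ('d set \<Rightarrow> real) \<Rightarrow> ('d set \<Rightarrow> ('d \<Rightarrow> real) \<Rightarrow> real) \<Rightarrow> real"
where
  "objective f \<S> a r lam \<alpha> =
     prob_space.variance (law f) (\<lambda>x. a x - (\<Sum>S\<in>\<S>. \<alpha> S x)) +
     (\<Sum>S\<in>\<S>. prob_space.expectation (law f) (\<lambda>x. (\<alpha> S x)\<^sup>2 / (lam S * r_bar r f S x)))"

definition k_fun :: "real \<Rightarrow> real" where
  "k_fun u = 1 / 2 + inverse (1 + exp (- 4 * u))"

definition perturb ::
  "(('d::finite \<Rightarrow> real) \<Rightarrow> real) \<Rightarrow> (('d \<Rightarrow> real) \<Rightarrow> real) \<Rightarrow> ('d \<Rightarrow> real) \<Rightarrow> real"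
where
  "perturb f h x = k_fun (h x) * f x / (\<integral>y. k_fun (h y) * f y \<partial>leb UNIV)"

text \<open>The observed data are a pair \<open>(X, Y)\<close> with \<open>X i\<close> the complete observation \<open>X_i\<close> and \<open>Y S j\<close>
  the observed part, a point of \<open>\<real>^S\<close>, of \<open>X_{S,j}\<close>. The argument \<open>N\<close> gives the sizes \<open>n_S\<close>.\<close>

type_synonym 'd data = "(nat \<Rightarrow> 'd \<Rightarrow> real) \<times> ('d set \<Rightarrow> nat \<Rightarrow> 'd \<Rightarrow> real)"

definition data_space :: "'d::finite set set \<Rightarrow> nat \<Rightarrow> ('d set \<Rightarrow> nat) \<Rightarrow> 'd data measure" where
  "data_space \<S> n N =
     (\<Pi>\<^sub>M i\<in>{1..n}. leb UNIV) \<Otimes>\<^sub>M (\<Pi>\<^sub>M S\<in>\<S>. \<Pi>\<^sub>M j\<in>{1..N S}. leb S)"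

definition data_law ::
  "'d::finite set set \<Rightarrow> ('d set \<Rightarrow> ('d \<Rightarrow> real) \<Rightarrow> real) \<Rightarrow> nat \<Rightarrow> ('d set \<Rightarrow> nat) \<Rightarrow>
   (('d \<Rightarrow> real) \<Rightarrow> real) \<Rightarrow> 'd data measure"
where
  "data_law \<S> r n N g =
     (\<Pi>\<^sub>M i\<in>{1..n}. law g) \<Otimes>\<^sub>M (\<Pi>\<^sub>M S\<in>\<S>. \<Pi>\<^sub>M j\<in>{1..N S}. biased_law r g S)"

definition estimators :: "'d::finite set set \<Rightarrow> nat \<Rightarrow> ('d set \<Rightarrow> nat) \<Rightarrow> ('d data \<Rightarrow> real) set" where
  "estimators \<S> n N = borel_measurable (data_space \<S> n N)"

definition scaled_risk ::
  "'d::finite set set \<Rightarrow> (('d \<Rightarrow> real) \<Rightarrow> real) \<Rightarrow> ('d set \<Rightarrow> ('d \<Rightarrow> real) \<Rightarrow> real) \<Rightarrow> nat \<Rightarrow>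
   ('d set \<Rightarrow> nat) \<Rightarrow> (('d \<Rightarrow> real) \<Rightarrow> real) \<Rightarrow> ('d data \<Rightarrow> real) \<Rightarrow> ennreal"
where
  "scaled_risk \<S> a r n N g est =
     (\<integral>\<^sup>+\<omega>. ennreal (real n * (est \<omega> - theta a g)\<^sup>2) \<partial>data_law \<S> r n N g)"

text \<open>Subsamples are represented by their sets of indices.\<close>

definition half :: "nat \<Rightarrow> nat \<Rightarrow> nat set" where
  "half n l = (if l = 1 then {1..nat \<lceil>real n / 2\<rceil>} else {nat \<lceil>real n / 2\<rceil> + 1..n})"

text \<open>\<open>D n M l m\<close> is the \<open>m\<close>-th of the \<open>M\<close> pieces of the \<open>l\<close>-th half.\<close>

definition balanced_split :: "(nat \<Rightarrow> nat \<Rightarrow> nat \<Rightarrow> nat \<Rightarrow> nat set) \<Rightarrow> bool" where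
  "balanced_split D \<longleftrightarrow>
     (\<forall>n M. \<forall>l\<in>{1, 2}. 1 \<le> M \<and> 2 * M \<le> n \<longrightarrow>
        disjoint_family_on (D n M l) {1..M} \<and>
        (\<Union>m\<in>{1..M}. D n M l m) = half n l \<and>
        (\<forall>m\<in>{1..M}. \<forall>m'\<in>{1..M}. card (D n M l m) \<le> card (D n M l m') + 1))"

definition avg :: "nat set \<Rightarrow> (nat \<Rightarrow> real) \<Rightarrow> real" where
  "avg I \<phi> = (\<Sum>i\<in>I. \<phi> i) / real (card I)"

definition kern :: "real \<Rightarrow> 'd::finite set \<Rightarrow> ('d \<Rightarrow> real) \<Rightarrow> real" where
  "kern h S u = inverse ((2 * h) ^ card S) * of_bool (sup_norm S u \<le> h)"

definition r_hat ::
  "('d::finite set \<Rightarrow> ('d \<Rightarrow> real) \<Rightarrow> real) \<Rightarrow> (nat \<Rightarrow> 'd \<Rightarrow> real) \<Rightarrow> nat set \<Rightarrow> 'd set \<Rightarrow> real"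
where
  "r_hat r X I S = avg I (\<lambda>i. r S (X i))"

definition f_hat ::
  "real \<Rightarrow> (nat \<Rightarrow> 'd::finite \<Rightarrow> real) \<Rightarrow> nat set \<Rightarrow> 'd set \<Rightarrow> ('d \<Rightarrow> real) \<Rightarrow> real"
where
  "f_hat h X I S x = avg I (\<lambda>i. kern h S (\<lambda>j. x j - X i j))"

definition w_hat ::
  "('d::finite set \<Rightarrow> ('d \<Rightarrow> real) \<Rightarrow> real) \<Rightarrow> ('d set \<Rightarrow> real) \<Rightarrow> (nat \<Rightarrow> 'd \<Rightarrow> real) \<Rightarrow> nat set \<Rightarrow>
   'd set \<Rightarrow> ('d \<Rightarrow> real) \<Rightarrow> real"
where
  "w_hat r lam X I S x = lam S * r S x / (r_hat r X I S + lam S * r S x)"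

text \<open>One backfitting step, using the subsample \<open>I\<close> to update \<open>\<alpha>\<close>.\<close>

definition backfit_step ::
  "'d::finite set set \<Rightarrow> (('d \<Rightarrow> real) \<Rightarrow> real) \<Rightarrow> ('d set \<Rightarrow> ('d \<Rightarrow> real) \<Rightarrow> real) \<Rightarrow> ('d set \<Rightarrow> real) \<Rightarrow>
   real \<Rightarrow> real \<Rightarrow> (nat \<Rightarrow> 'd \<Rightarrow> real) \<Rightarrow> nat set \<Rightarrow>
   ('d set \<Rightarrow> ('d \<Rightarrow> real) \<Rightarrow> real) \<Rightarrow> 'd set \<Rightarrow> ('d \<Rightarrow> real) \<Rightarrow> real"
where
  "backfit_step \<S> a r lam h T X I \<alpha> S x =
     (let \<eta> = 1 / real (card \<S>);
          w = w_hat r lam X I S;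
          g = (\<lambda>y. a y - (\<Sum>S'\<in>\<S> - {S}. \<alpha> S' y));
          inB = (\<lambda>y. of_bool (sup_norm UNIV y \<le> T))
      in if sup_norm S x \<le> T
         then (1 - \<eta>) * \<alpha> S x +
              \<eta> * w x *
              (avg I (\<lambda>i. g (X i) * inB (X i) * (kern h S (\<lambda>j. x j - X i j) / f_hat h X I S x)) -
               (\<Sum>i\<in>I. w (X i) * g (X i) * inB (X i)) / (\<Sum>i\<in>I. w (X i)))
         else 0)"

primrec alpha_hat ::
  "'d::finite set set \<Rightarrow> (('d \<Rightarrow> real) \<Rightarrow> real) \<Rightarrow> ('d set \<Rightarrow> ('d \<Rightarrow> real) \<Rightarrow> real) \<Rightarrow> ('d set \<Rightarrow> real) \<Rightarrow>
   real \<Rightarrow> real \<Rightarrow> (nat \<Rightarrow> nat set) \<Rightarrow> (nat \<Rightarrow> 'd \<Rightarrow> real) \<Rightarrow> nat \<Rightarrow> 'd set \<Rightarrow> ('d \<Rightarrow> real) \<Rightarrow> real"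
where
  "alpha_hat \<S> a r lam h T piece X 0 = (\<lambda>S x. 0)"
| "alpha_hat \<S> a r lam h T piece X (Suc m) =
     backfit_step \<S> a r lam h T X (piece (Suc m)) (alpha_hat \<S> a r lam h T piece X m)"

definition theta_fold ::
  "'d::finite set set \<Rightarrow> (('d \<Rightarrow> real) \<Rightarrow> real) \<Rightarrow> ('d set \<Rightarrow> ('d \<Rightarrow> real) \<Rightarrow> real) \<Rightarrow> ('d set \<Rightarrow> real) \<Rightarrow>
   (nat \<Rightarrow> nat \<Rightarrow> nat \<Rightarrow> nat \<Rightarrow> nat set) \<Rightarrow> nat \<Rightarrow> ('d set \<Rightarrow> nat) \<Rightarrow> real \<Rightarrow> real \<Rightarrow> nat \<Rightarrow> nat \<Rightarrow>
   'd data \<Rightarrow> real"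
where
  "theta_fold \<S> a r lam D n N h T M l =
     (\<lambda>(X, Y).
        let \<alpha> = alpha_hat \<S> a r lam h T (D n M l) X M
        in avg (half n (3 - l)) (\<lambda>i. a (X i) - (\<Sum>S\<in>\<S>. \<alpha> S (X i))) +
           (\<Sum>S\<in>\<S>. avg {1..N S}
              (\<lambda>j. \<alpha> S (Y S j) * r_hat r X (half n (3 - l)) S / r S (Y S j))))"

definition cross_fit ::
  "'d::finite set set \<Rightarrow> (('d \<Rightarrow> real) \<Rightarrow> real) \<Rightarrow> ('d set \<Rightarrow> ('d \<Rightarrow> real) \<Rightarrow> real) \<Rightarrow> ('d set \<Rightarrow> real) \<Rightarrow>
   (nat \<Rightarrow> nat \<Rightarrow> nat \<Rightarrow> nat \<Rightarrow> nat set) \<Rightarrow> nat \<Rightarrow> ('d set \<Rightarrow> nat) \<Rightarrow> real \<Rightarrow> real \<Rightarrow> nat \<Rightarrow>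
   'd data \<Rightarrow> real"
where
  "cross_fit \<S> a r lam D n N h T M \<omega> =
     (real (card (half n 2)) * theta_fold \<S> a r lam D n N h T M 1 \<omega> +
      real (card (half n 1)) * theta_fold \<S> a r lam D n N h T M 2 \<omega>) / real n"

end

theory Submission
  imports Defs "HOL-Real_Asymp.Real_Asymp"
begin

text \<open>
  Write \<open>\<rho>\<^sub>S\<close> for the normalised weight and \<open>w\<^sub>S = \<lambda>\<^sub>S\<rho>\<^sub>S / (1 + \<lambda>\<^sub>S\<rho>\<^sub>S)\<close>. The objective is a convex quadratic
  functional whose minimiser in the coordinate \<open>S\<close> is \<open>w\<^sub>S (E(g\<^sub>S | X\<^sub>S) - m\<^sub>S)\<close>, where \<open>g\<^sub>S\<close> is the partial
  residual and the constant \<open>m\<^sub>S\<close> centres the function. Damped simultaneous updates with step \<open>1/|\<S>|\<close>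
  starting from 0 give bounded functions \<open>pop m\<close>; each step lowers the objective by a multiple of a
  weighted squared length (\<open>gap\<close>) of the update, so the gap tends to 0 and by convexity the objective
  tends to its infimum \<open>V\<close>.

  (i) Up to the error caused by replacing \<open>pop M\<close> by the fitted functions, the estimator is an average
  of centred independent terms whose scaled variance tends to the objective at \<open>pop M\<close>. Conditionally
  on the half of the data used for fitting, that error has risk of order \<open>1/n\<close> times the squared
  \<open>L\<^sup>2\<close> distance between fitted and population functions, plus \<open>O(1/n\<^sup>2)\<close>. Each fitted step uses a fresh
  piece of data, so its distance to the population step is controlled by a local averaging argument:
  the bias is small with \<open>h\<close> because conditional expectations are uniformly continuous, the tail is small
  with \<open>T\<close>, and the variance vanishes as \<open>n\<close> grows. One lets \<open>n\<close> grow for fixed \<open>M\<close>, \<open>h\<close>, \<open>T\<close> and then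
  chooses these slowly varying with \<open>n\<close>.

  (ii) Perturb \<open>f\<close> in the direction of the residual \<open>h\<close> of a nearly optimal \<open>pop m\<close>. For this direction
  both the derivative of \<open>\<theta>\<close> and the information are close to \<open>V\<close>. On the grid of models \<open>f\<^bsub>k\<delta>h/\<surd>n\<^esub>\<close>,
  \<open>k = 0, \<dots>, K\<close>, neighbouring models have chi-square distance about \<open>exp(\<delta>\<^sup>2 I) - 1\<close>, so under a risk
  bound \<open>v\<close> the means of the estimator under neighbouring models are close, whereas \<open>\<theta>\<close> changes by
  \<open>K \<delta> V\<close> along the grid; large \<open>K\<close> and small \<open>\<delta>\<close> exclude \<open>v < V\<close>.
\<close>

section \<open>Bounded measurable functions and averages\<close>

text \<open>No bound or continuity is assumed of f itself, so the mass of a kernel window around a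
  point may be arbitrarily small. Smoothing errors are therefore integrated over the evaluation
  point: the reciprocal window mass that they carry is unbounded, but its integral over a cube is
  finite. All functions met by the estimator are bounded everywhere (a is, and so are the weights
  and their inverses); hence \<open>bfun\<close> serves as the notion of integrability. Unbounded
  are only the competitors in \<open>H_prod\<close>, treated by truncation, and the estimators in
  (ii), treated by positivity of the likelihood. The step length 1/|\<S>| stems from (\<Sum>u)^2
  \<le> |\<S>| \<Sum>u^2, which decouples the simultaneous updates. In (ii) the residual is the
  right direction because at the optimum its conditional mean given X_S equals, up to a constant,
  the minimiser's component divided by lam_S times the normalised weight. Derivative and information
  then both reduce to V, so derivative^2/information, the Cramer-Rao bound, is V as well.\<close>

definition bfun :: "'a measure \<Rightarrow> ('a \<Rightarrow> real) \<Rightarrow> bool" where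
  "bfun M \<phi> \<longleftrightarrow> \<phi> \<in> borel_measurable M \<and> (\<exists>B. \<forall>x. \<bar>\<phi> x\<bar> \<le> B)"

named_theorems bfun_intros

lemma bfunI: "\<phi> \<in> borel_measurable M \<Longrightarrow> (\<And>x. \<bar>\<phi> x\<bar> \<le> B) \<Longrightarrow> bfun M \<phi>"
  unfolding bfun_def by blast

lemma bfun_measurable [dest]: "bfun M \<phi> \<Longrightarrow> \<phi> \<in> borel_measurable M"
  unfolding bfun_def by blast

lemma bfun_bound:
  assumes "bfun M \<phi>" obtains B where "0 \<le> B" "\<And>x. \<bar>\<phi> x\<bar> \<le> B"
proof -
  from assms obtain B where B: "\<And>x. \<bar>\<phi> x\<bar> \<le> B" unfolding bfun_def by blast
  moreover have "0 \<le> B" using abs_ge_zero B order_trans by blast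
  ultimately show ?thesis using that by blast
qed

lemma bfun_const [bfun_intros]: "bfun M (\<lambda>x. c)"
  by (rule bfunI[where B="\<bar>c\<bar>"]) auto

lemma bfun_add [bfun_intros]:
  assumes "bfun M f" "bfun M g" shows "bfun M (\<lambda>x. f x + g x)"
proof -
  obtain B1 where 1: "\<And>x. \<bar>f x\<bar> \<le> B1" using bfun_bound[OF assms(1)] by blast
  obtain B2 where 2: "\<And>x. \<bar>g x\<bar> \<le> B2" using bfun_bound[OF assms(2)] by blast
  show ?thesis
    by (rule bfunI[where B="B1+B2"])
      (use assms[THEN bfun_measurable] in measurable, use 1 2 in \<open>metis abs_triangle_ineq add_mono order_trans\<close>)
qed

lemma bfun_mult [bfun_intros]:
  assumes "bfun M f" "bfun M g" shows "bfun M (\<lambda>x. f x * g x)"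
proof -
  obtain B1 where 1: "\<And>x. \<bar>f x\<bar> \<le> B1" "0 \<le> B1" using bfun_bound[OF assms(1)] by blast
  obtain B2 where 2: "\<And>x. \<bar>g x\<bar> \<le> B2" using bfun_bound[OF assms(2)] by blast
  show ?thesis
    by (rule bfunI[where B="B1*B2"])
      (use assms[THEN bfun_measurable] in measurable, use 1 2 in \<open>auto simp: abs_mult intro: mult_mono\<close>)
qed

lemma bfun_uminus [bfun_intros]: "bfun M f \<Longrightarrow> bfun M (\<lambda>x. - f x)"
  using bfun_mult[OF bfun_const[of M "-1"]] by simp

lemma bfun_diff [bfun_intros]: "bfun M f \<Longrightarrow> bfun M g \<Longrightarrow> bfun M (\<lambda>x. f x - g x)"
  using bfun_add[OF _ bfun_uminus] by simp

lemma bfun_divide_const [bfun_intros]: "bfun M f \<Longrightarrow> bfun M (\<lambda>x. f x / c)"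
  using bfun_mult[OF _ bfun_const[of M "inverse c"]] by (simp add: divide_inverse)

lemma bfun_power [bfun_intros]: "bfun M f \<Longrightarrow> bfun M (\<lambda>x. f x ^ k)"
  by (induction k) (auto intro: bfun_intros)

lemma bfun_abs [bfun_intros]: "bfun M f \<Longrightarrow> bfun M (\<lambda>x. \<bar>f x\<bar>)"
  unfolding bfun_def by auto

lemma bfun_sum [bfun_intros]: "(\<And>i. i \<in> I \<Longrightarrow> bfun M (f i)) \<Longrightarrow> bfun M (\<lambda>x. \<Sum>i\<in>I. f i x)"
  by (induction I rule: infinite_finite_induct) (auto intro: bfun_intros)

lemma bfun_prod [bfun_intros]: "(\<And>i. i \<in> I \<Longrightarrow> bfun M (f i)) \<Longrightarrow> bfun M (\<lambda>x. \<Prod>i\<in>I. f i x)"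
  by (induction I rule: infinite_finite_induct) (auto intro: bfun_intros)

text \<open>The bound in \<open>bfun\<close> is asked at every point of the type, not only on the
  space, so pointwise estimates carry no range conditions through compositions.\<close>

lemma bfun_comp:
  "bfun N f \<Longrightarrow> g \<in> M \<rightarrow>\<^sub>M N \<Longrightarrow> bfun M (\<lambda>x. f (g x))"
  unfolding bfun_def by auto

lemma bfun_cong_sets: "sets M = sets N \<Longrightarrow> bfun M f = bfun N f"
  unfolding bfun_def by (metis measurable_cong_sets)

lemma bfun_of_bool [bfun_intros]: "Measurable.pred M P \<Longrightarrow> bfun M (\<lambda>x. of_bool (P x))"
  by (rule bfunI[where B=1]) auto

lemma bfun_avg [bfun_intros]:
  "(\<And>i. i \<in> I \<Longrightarrow> bfun M (f i)) \<Longrightarrow> bfun M (\<lambda>x. avg I (\<lambda>i. f i x))"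
  unfolding avg_def by (intro bfun_intros)

lemma bfun_inverse_ge:
  assumes "bfun M f" "\<And>x. e \<le> f x" "0 < e" shows "bfun M (\<lambda>x. inverse (f x))"
proof (rule bfunI[where B="inverse e"])
  show "\<bar>inverse (f x)\<bar> \<le> inverse e" for x
    using assms(2)[of x] assms(3) by (simp add: abs_if)
qed (use assms in auto)

lemma bfun_divide_ge:
  assumes "bfun M g" "bfun M f" "\<And>x. e \<le> f x" "0 < e" shows "bfun M (\<lambda>x. g x / f x)"
  unfolding divide_inverse by (intro bfun_intros bfun_inverse_ge[OF assms(2-4)] assms(1))

lemma (in finite_measure) bfun_integrable: "bfun M f \<Longrightarrow> integrable M f"
  unfolding bfun_def by (auto intro!: integrable_const_bound AE_I2)

lemma (in prob_space) integral_le_const_bfun: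
  assumes "bfun M f" "\<And>x. f x \<le> B" shows "(\<integral>x. f x \<partial>M) \<le> B"
proof -
  have "(\<integral>x. f x \<partial>M) \<le> (\<integral>x. B \<partial>M)"
    by (rule integral_mono) (use assms bfun_integrable in auto)
  then show ?thesis by (simp add: prob_space)
qed

lemma (in prob_space) integral_abs_le_const_bfun:
  assumes "bfun M f" "\<And>x. \<bar>f x\<bar> \<le> B" shows "\<bar>\<integral>x. f x \<partial>M\<bar> \<le> B"
proof -
  have "(\<integral>x. f x \<partial>M) \<le> B"
    by (rule integral_le_const_bfun) (use assms in \<open>auto simp: abs_le_iff\<close>)
  moreover have "(\<integral>x. - f x \<partial>M) \<le> B"
    by (rule integral_le_const_bfun) (use assms in \<open>auto simp: abs_le_iff intro: bfun_intros\<close>)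
  ultimately show ?thesis by auto
qed

lemma (in prob_space) bfun_integral_mono:
  "bfun M f \<Longrightarrow> bfun M g \<Longrightarrow> (\<And>x. f x \<le> g x) \<Longrightarrow> (\<integral>x. f x \<partial>M) \<le> (\<integral>x. g x \<partial>M)"
  by (intro integral_mono bfun_integrable) auto

lemma (in prob_space) square_integral_le:
  assumes "bfun M f" shows "(\<integral>x. f x \<partial>M)^2 \<le> (\<integral>x. (f x)^2 \<partial>M)"
proof -
  have "0 \<le> variance f" by simp
  also have "\<dots> = (\<integral>x. (f x)^2 \<partial>M) - (\<integral>x. f x \<partial>M)^2"
    by (intro variance_eq bfun_integrable bfun_intros assms)
  finally show ?thesis by simp
qed

text \<open>Cauchy-Schwarz from the nonnegative quadratic t -> E (f - t g)^2.\<close>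

lemma (in prob_space) integral_mult_square_le:
  assumes "bfun M f" "bfun M g"
  shows "(\<integral>x. f x * g x \<partial>M)^2 \<le> (\<integral>x. (f x)^2 \<partial>M) * (\<integral>x. (g x)^2 \<partial>M)"
proof -
  let ?F = "\<integral>x. (f x)^2 \<partial>M" and ?G = "\<integral>x. (g x)^2 \<partial>M" and ?H = "\<integral>x. f x * g x \<partial>M"
  note I = bfun_integrable bfun_intros assms
  have q: "0 \<le> ?F - 2 * t * ?H + t^2 * ?G" for t
  proof -
    have "0 \<le> (\<integral>x. (f x - t * g x)^2 \<partial>M)" by simp
    also have "\<dots> = (\<integral>x. (f x)^2 - 2 * t * (f x * g x) + t^2 * (g x)^2 \<partial>M)"
      by (rule Bochner_Integration.integral_cong) (auto simp: power2_eq_square algebra_simps)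
    also have "\<dots> = ?F - 2 * t * ?H + t^2 * ?G"
      by (subst Bochner_Integration.integral_add Bochner_Integration.integral_diff, (intro I)+)+
        simp
    finally show ?thesis .
  qed
  show ?thesis
  proof (cases "?G = 0")
    case True
    have "?H = 0"
    proof (rule ccontr)
      assume "?H \<noteq> 0"
      \<comment> \<open>With \<open>?G = 0\<close> the quadratic is affine in t, and this t gives it
        the value -1.\<close>
      with q[of "(?F + 1) / (2 * ?H)"] True show False by (simp add: field_simps)
    qed
    then show ?thesis using True by simp
  next
    case False
    have "0 \<le> ?G" by simp
    with False have "0 < ?G" by linarith
    then show ?thesis using q[of "?H / ?G"] by (simp add: power2_eq_square field_simps)
  qed
qed

lemma sum_square_le: "(\<Sum>i\<in>I. f i)^2 \<le> real (card I) * (\<Sum>i\<in>I. (f i :: real)^2)"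
proof (cases "finite I")
  case True
  have "(\<Sum>i\<in>I. 1 * f i)^2 \<le> (\<Sum>i\<in>I. 1^2) * (\<Sum>i\<in>I. (f i)^2)"
    by (rule Cauchy_Schwarz_ineq_sum)
  then show ?thesis by simp
qed simp

lemma two_square_le: "(p + q)^2 \<le> 2 * p^2 + 2 * (q :: real)^2"
  using zero_le_power2[of "p - q"] by (simp add: power2_eq_square algebra_simps)

lemma three_square_le: "(p + q + u)^2 \<le> 3 * (p^2 + q^2 + (u :: real)^2)"
proof -
  have "0 \<le> (p - q)^2 + (p - u)^2 + (q - u)^2" by simp
  then show ?thesis by (simp add: power2_eq_square algebra_simps)
qed

lemma four_square_le: "(p + q + u + y)^2 \<le> 4 * (p^2 + q^2 + u^2 + (y :: real)^2)"
proof -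
  have "0 \<le> (p - q)^2 + (p - u)^2 + (p - y)^2 + (q - u)^2 + (q - y)^2 + (u - y)^2" by simp
  then show ?thesis by (simp add: power2_eq_square algebra_simps)
qed

lemma avg_square_le_avg: "(avg I f)^2 \<le> avg I (\<lambda>i. (f i)^2)"
proof (cases "finite I \<and> I \<noteq> {}")
  case True
  then have c: "0 < real (card I)" by (simp add: card_gt_0_iff)
  show ?thesis using sum_square_le[of f I] c
    by (simp add: avg_def power_divide field_simps power2_eq_square)
qed (auto simp: avg_def)

lemma avg_add: "avg I (\<lambda>i. f i + g i) = avg I f + avg I g"
  by (simp add: avg_def sum.distrib add_divide_distrib)

lemma avg_diff: "avg I (\<lambda>i. f i - g i) = avg I f - avg I g"
  by (simp add: avg_def sum_subtractf diff_divide_distrib)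

lemma avg_cmult: "avg I (\<lambda>i. c * f i) = c * avg I f"
  by (simp add: avg_def sum_distrib_left)

lemma avg_const: "finite I \<Longrightarrow> I \<noteq> {} \<Longrightarrow> avg I (\<lambda>i. c) = c"
  by (simp add: avg_def)

lemma avg_mono: "(\<And>i. i \<in> I \<Longrightarrow> f i \<le> g i) \<Longrightarrow> avg I f \<le> avg I g"
  unfolding avg_def by (intro divide_right_mono sum_mono) auto

lemma avg_abs_le: "\<bar>avg I f\<bar> \<le> avg I (\<lambda>i. \<bar>f i\<bar>)"
  unfolding avg_def by (simp add: abs_divide divide_right_mono)

lemma avg_nonneg: "(\<And>i. i \<in> I \<Longrightarrow> 0 \<le> f i) \<Longrightarrow> 0 \<le> avg I f"
  unfolding avg_def by (intro divide_nonneg_nonneg sum_nonneg) auto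

text \<open>Only the factors indexed by \<open>I\<close> matter, so the measures outside \<open>I\<close> may be replaced.\<close>

lemma PiM_as_product_prob_space:
  assumes "\<And>i. i \<in> I \<Longrightarrow> prob_space (M i)"
  shows "\<exists>M'. product_prob_space M' \<and> PiM I M = PiM I M' \<and> (\<forall>i\<in>I. M' i = M i)"
proof (intro exI conjI ballI)
  let ?M = "\<lambda>i. if i \<in> I then M i else return (count_space UNIV) undefined"
  have "prob_space (?M i)" for i using assms by (auto intro: prob_space_return)
  then show "product_prob_space ?M"
    unfolding product_prob_space_def product_prob_space_axioms_def product_sigma_finite_def
    using prob_space_imp_sigma_finite by blast
  show "PiM I M = PiM I ?M" by (rule PiM_cong) auto
  show "?M i = M i" if "i \<in> I" for i using that by simp
qed

text \<open>Fubini for splitting one sample into two independent blocks. Later the block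
  \<open>I\<close> holds the data on which a function was fitted and \<open>J\<close> the fresh data
  on which it is used.\<close>

lemma PiM_fold_bfun:
  assumes "I \<inter> J = {}" "finite I" "finite J" "\<And>i. i \<in> I \<union> J \<Longrightarrow> prob_space (M i)"
    and "bfun (PiM (I \<union> J) M) F"
  shows "(\<integral>x. F x \<partial>PiM (I \<union> J) M) = (\<integral>x. (\<integral>y. F (merge I J (x, y)) \<partial>PiM J M) \<partial>PiM I M)"
proof -
  obtain M' where M': "product_prob_space M'" "PiM (I \<union> J) M = PiM (I \<union> J) M'"
    "\<And>i. i \<in> I \<union> J \<Longrightarrow> M' i = M i"
    using PiM_as_product_prob_space[of "I \<union> J" M] assms(4) by blast
  interpret product_prob_space M' by fact
  have e: "PiM I M = PiM I M'" "PiM J M = PiM J M'"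
    using M'(3) by (auto intro!: PiM_cong)
  interpret IJ: prob_space "PiM (I \<union> J) M'"
    by (intro prob_space_PiM prob_space)
  have "integrable (PiM (I \<union> J) M') F"
    using IJ.bfun_integrable assms(5) unfolding M'(2) by blast
  then show ?thesis unfolding M'(2) e
    by (rule product_integral_fold[OF assms(1-3)])
qed

lemma integral_PiM_component:
  assumes "\<And>i. i \<in> I \<Longrightarrow> prob_space (M i)" "i \<in> I" "f \<in> borel_measurable (M i)"
  shows "(\<integral>x. f (x i) \<partial>PiM I M) = (\<integral>x. (f x :: real) \<partial>M i)"
proof -
  have "(\<integral>x. f x \<partial>M i) = (\<integral>x. f x \<partial>distr (PiM I M) (M i) (\<lambda>x. x i))"
    using distr_PiM_component[of I M i] assms(1,2) by simp
  also have "\<dots> = (\<integral>x. f (x i) \<partial>PiM I M)"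
    by (rule integral_distr) (use assms in auto)
  finally show ?thesis ..
qed

lemma integral_PiM_prod:
  fixes f :: "'i \<Rightarrow> 'a \<Rightarrow> real"
  assumes "finite I" "\<And>i. i \<in> I \<Longrightarrow> prob_space (M i)" "\<And>i. i \<in> I \<Longrightarrow> bfun (M i) (f i)"
  shows "(\<integral>x. (\<Prod>i\<in>I. f i (x i)) \<partial>PiM I M) = (\<Prod>i\<in>I. \<integral>x. f i x \<partial>M i)"
proof -
  obtain M' where M': "product_prob_space M'" "PiM I M = PiM I M'" "\<And>i. i \<in> I \<Longrightarrow> M' i = M i"
    using PiM_as_product_prob_space[of I M] assms(2) by blast
  interpret product_prob_space M' by fact
  have "integrable (M' i) (f i)" if "i \<in> I" for i
    using assms(3)[OF that] M.bfun_integrable[of i "f i"] M'(3)[OF that] by simp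
  then show ?thesis unfolding M'(2)
    using product_integral_prod[OF assms(1), of f] M'(3) by simp
qed

text \<open>Pythagoras for independent centred variables: a mixed second moment factors into means,
  which vanish.\<close>

lemma integral_PiM_sum_square:
  fixes \<psi> :: "'i \<Rightarrow> 'a \<Rightarrow> real"
  assumes I: "finite I" and P: "\<And>i. i \<in> I \<Longrightarrow> prob_space (M i)"
    and b: "\<And>i. i \<in> I \<Longrightarrow> bfun (M i) (\<psi> i)" and z: "\<And>i. i \<in> I \<Longrightarrow> (\<integral>x. \<psi> i x \<partial>M i) = 0"
  shows "(\<integral>x. (\<Sum>i\<in>I. \<psi> i (x i))^2 \<partial>PiM I M) = (\<Sum>i\<in>I. \<integral>x. (\<psi> i x)^2 \<partial>M i)"
proof -
  interpret PI: prob_space "PiM I M" by (intro prob_space_PiM P)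
  have bc: "bfun (PiM I M) (\<lambda>x. \<psi> i (x i))" if "i \<in> I" for i
    by (rule bfun_comp[OF b[OF that]]) (use that in simp)
  have off: "(\<integral>x. \<psi> i (x i) * \<psi> j (x j) \<partial>PiM I M) = (if i = j then \<integral>x. (\<psi> i x)^2 \<partial>M i else 0)"
    if ij: "i \<in> I" "j \<in> I" for i j
  proof (cases "i = j")
    case True
    then show ?thesis
      using integral_PiM_component[OF P ij(1), where f="\<lambda>x. (\<psi> i x)^2"] b[OF ij(1)]
      by (auto simp: power2_eq_square)
  next
    case False
    \<comment> \<open>All other coordinates get the factor 1, so the mixed moment becomes a full
      product over \<open>I\<close> and \<open>integral_PiM_prod\<close> applies.\<close>
    define f where "f k = (if k = i then \<psi> i else if k = j then \<psi> j else (\<lambda>x. 1))" for k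
    have "(\<Prod>k\<in>I. f k (x k)) = \<psi> i (x i) * \<psi> j (x j)" for x
    proof -
      have "(\<Prod>k\<in>I. f k (x k)) = (\<Prod>k\<in>{i, j}. f k (x k))"
        by (rule prod.mono_neutral_right) (use I ij f_def in auto)
      then show ?thesis using False by (simp add: f_def)
    qed
    then have "(\<integral>x. \<psi> i (x i) * \<psi> j (x j) \<partial>PiM I M) = (\<integral>x. (\<Prod>k\<in>I. f k (x k)) \<partial>PiM I M)"
      by simp
    also have "\<dots> = (\<Prod>k\<in>I. \<integral>x. f k x \<partial>M k)"
      by (rule integral_PiM_prod) (use I P b in \<open>auto simp: f_def intro: bfun_intros\<close>)
    also have "\<dots> = 0"
      using ij(1) I z[OF ij(1)] by (intro prod_zero) (auto simp: f_def intro!: bexI[of _ i])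
    finally show ?thesis using False by simp
  qed
  have "(\<integral>x. (\<Sum>i\<in>I. \<psi> i (x i))^2 \<partial>PiM I M) =
      (\<integral>x. (\<Sum>i\<in>I. \<Sum>j\<in>I. \<psi> i (x i) * \<psi> j (x j)) \<partial>PiM I M)"
    by (simp add: power2_eq_square sum_product)
  also have "\<dots> = (\<Sum>i\<in>I. \<Sum>j\<in>I. \<integral>x. \<psi> i (x i) * \<psi> j (x j) \<partial>PiM I M)"
    by (subst Bochner_Integration.integral_sum, intro PI.bfun_integrable bfun_intros bc, assumption+)+
      (intro sum.cong refl Bochner_Integration.integral_sum PI.bfun_integrable bfun_intros bc)
  also have "\<dots> = (\<Sum>i\<in>I. \<integral>x. (\<psi> i x)^2 \<partial>M i)"
    using I by (intro sum.cong refl) (simp add: off)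
  finally show ?thesis .
qed

section \<open>Moments of averages of independent observations\<close>

context prob_space
begin

lemma prob_space_PiM_const: "prob_space (PiM I (\<lambda>_. M))"
  by (intro prob_space_PiM) unfold_locales

lemma bfun_PiM_component: "bfun M \<phi> \<Longrightarrow> i \<in> I \<Longrightarrow> bfun (PiM I (\<lambda>_. M)) (\<lambda>x. \<phi> (x i))"
  by (rule bfun_comp) auto

lemma integral_avg:
  assumes "finite I" "I \<noteq> {}" "bfun M \<phi>"
  shows "(\<integral>x. avg I (\<lambda>i. \<phi> (x i)) \<partial>PiM I (\<lambda>_. M)) = (\<integral>x. \<phi> x \<partial>M)"
proof -
  interpret P: prob_space "PiM I (\<lambda>_. M)" by (rule prob_space_PiM_const)
  have "(\<integral>x. (\<Sum>i\<in>I. \<phi> (x i)) \<partial>PiM I (\<lambda>_. M)) = (\<Sum>i\<in>I. \<integral>x. \<phi> (x i) \<partial>PiM I (\<lambda>_. M))"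
    by (intro Bochner_Integration.integral_sum P.bfun_integrable bfun_PiM_component assms)
  also have "\<dots> = (\<Sum>i\<in>I. \<integral>x. \<phi> x \<partial>M)"
    by (intro sum.cong refl integral_PiM_component) (use assms in \<open>auto intro: prob_space_axioms\<close>)
  finally show ?thesis using assms by (simp add: avg_def)
qed

lemma integral_avg_centered_square:
  assumes "finite I" "I \<noteq> {}" "bfun M \<phi>" "(\<integral>x. \<phi> x \<partial>M) = 0"
  shows "(\<integral>x. (avg I (\<lambda>i. \<phi> (x i)))^2 \<partial>PiM I (\<lambda>_. M)) = (\<integral>x. (\<phi> x)^2 \<partial>M) / real (card I)"
proof -
  have "(\<integral>x. (\<Sum>i\<in>I. \<phi> (x i))^2 \<partial>PiM I (\<lambda>_. M)) = real (card I) * (\<integral>x. (\<phi> x)^2 \<partial>M)"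
    using integral_PiM_sum_square[of I "\<lambda>_. M" "\<lambda>_. \<phi>"] assms prob_space_axioms by simp
  then show ?thesis using assms by (simp add: avg_def power_divide power2_eq_square)
qed

lemma integral_avg_deviation_le:
  assumes "finite I" "I \<noteq> {}" "bfun M \<phi>"
  shows "(\<integral>x. (avg I (\<lambda>i. \<phi> (x i)) - (\<integral>x. \<phi> x \<partial>M))^2 \<partial>PiM I (\<lambda>_. M)) \<le>
    (\<integral>x. (\<phi> x)^2 \<partial>M) / real (card I)"
proof -
  let ?\<psi> = "\<lambda>x. \<phi> x - (\<integral>x. \<phi> x \<partial>M)"
  have b: "bfun M ?\<psi>" by (intro bfun_intros assms)
  have "(\<integral>x. (avg I (\<lambda>i. \<phi> (x i)) - (\<integral>x. \<phi> x \<partial>M))^2 \<partial>PiM I (\<lambda>_. M)) =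
     (\<integral>x. (avg I (\<lambda>i. ?\<psi> (x i)))^2 \<partial>PiM I (\<lambda>_. M))"
    using assms by (simp add: avg_diff avg_const)
  also have "\<dots> = variance \<phi> / real (card I)"
    by (rule integral_avg_centered_square) (use assms b bfun_integrable in \<open>auto simp: prob_space\<close>)
  also have "variance \<phi> \<le> (\<integral>x. (\<phi> x)^2 \<partial>M)"
    by (subst variance_eq) (intro bfun_integrable bfun_power assms | simp)+
  finally show ?thesis by (simp add: divide_right_mono)
qed

lemma integral_avg_square_le:
  assumes "finite I" "I \<noteq> {}" "bfun M \<phi>"
  shows "(\<integral>x. (avg I (\<lambda>i. \<phi> (x i)))^2 \<partial>PiM I (\<lambda>_. M)) \<le> (\<integral>x. (\<phi> x)^2 \<partial>M)"
proof -
  interpret P: prob_space "PiM I (\<lambda>_. M)" by (rule prob_space_PiM_const)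
  have "(\<integral>x. (avg I (\<lambda>i. \<phi> (x i)))^2 \<partial>PiM I (\<lambda>_. M)) \<le>
    (\<integral>x. avg I (\<lambda>i. (\<phi> (x i))^2) \<partial>PiM I (\<lambda>_. M))"
    by (intro P.bfun_integral_mono bfun_intros bfun_PiM_component assms avg_square_le_avg)
  also have "\<dots> = (\<integral>x. (\<phi> x)^2 \<partial>M)"
    by (intro integral_avg assms bfun_intros)
  finally show ?thesis .
qed

text \<open>Variance and squared mean are kept apart: only the first shrinks with the sample size,
  the second has to be small for another reason, as in \<open>local_average_error\<close>.\<close>

lemma integral_avg_square_le2:
  assumes "finite I" "I \<noteq> {}" "bfun M \<phi>"
  shows "(\<integral>x. (avg I (\<lambda>i. \<phi> (x i)))^2 \<partial>PiM I (\<lambda>_. M)) \<le>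
    (\<integral>x. (\<phi> x)^2 \<partial>M) / real (card I) + (\<integral>x. \<phi> x \<partial>M)^2"
proof -
  interpret P: prob_space "PiM I (\<lambda>_. M)" by (rule prob_space_PiM_const)
  let ?A = "\<lambda>x. avg I (\<lambda>i. \<phi> (x i))"
  have b: "bfun (PiM I (\<lambda>_. M)) ?A" by (intro bfun_intros bfun_PiM_component assms)
  have "(\<integral>x. (?A x)^2 \<partial>PiM I (\<lambda>_. M)) = P.variance ?A + (P.expectation ?A)^2"
    by (subst P.variance_eq) (intro P.bfun_integrable bfun_power b | simp)+
  then show ?thesis
    using integral_avg_deviation_le[OF assms] integral_avg[OF assms] by simp
qed

end

section \<open>Total variation and integrals of bounded functions\<close>

lemma tv_dist_ge:
  assumes "prob_space \<mu>" "prob_space \<nu>" "A \<in> sets \<mu>"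
  shows "\<bar>measure \<mu> A - measure \<nu> A\<bar> \<le> tv_dist \<mu> \<nu>"
  unfolding tv_dist_def
proof (rule cSUP_upper[OF assms(3)])
  show "bdd_above ((\<lambda>A. \<bar>measure \<mu> A - measure \<nu> A\<bar>) ` sets \<mu>)"
  proof (rule bdd_aboveI2[where M=1])
    fix A
    show "\<bar>measure \<mu> A - measure \<nu> A\<bar> \<le> 1"
      using prob_space.prob_le_1[OF assms(1), of A] prob_space.prob_le_1[OF assms(2), of A]
        measure_nonneg[of \<mu> A] measure_nonneg[of \<nu> A] by linarith
  qed
qed

text \<open>The function is approximated within \<open>1/K\<close> by the average of the indicators of
  its level sets at heights \<open>k/K\<close>.\<close>

lemma tv_dist_integral_unit:
  assumes p: "prob_space \<mu>" "prob_space \<nu>" and s: "sets \<nu> = sets \<mu>"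
    and m: "\<phi> \<in> borel_measurable \<mu>" and b: "\<And>y. 0 \<le> \<phi> y" "\<And>y. \<phi> y \<le> 1"
  shows "\<bar>(\<integral>y. \<phi> y \<partial>\<mu>) - (\<integral>y. \<phi> y \<partial>\<nu>)\<bar> \<le> tv_dist \<mu> \<nu>"
proof -
  interpret M: prob_space \<mu> by fact
  interpret N: prob_space \<nu> by fact
  have approx: "\<bar>(\<integral>y. \<phi> y \<partial>\<mu>) - (\<integral>y. \<phi> y \<partial>\<nu>)\<bar> \<le> tv_dist \<mu> \<nu> + 2 / real K" if K: "K > 0" for K
  proof -
    define \<phi>' where "\<phi>' y = (\<Sum>k=1..K. of_bool (real k / real K \<le> \<phi> y)) / real K" for y
    have fl: "\<phi>' y = real_of_int \<lfloor>\<phi> y * real K\<rfloor> / real K" for y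
    proof -
      have "{k\<in>{1..K}. real k / real K \<le> \<phi> y} = {1..nat \<lfloor>\<phi> y * real K\<rfloor>}"
      proof -
        have "(real k / real K \<le> \<phi> y) = (k \<le> nat \<lfloor>\<phi> y * real K\<rfloor>)" if "1 \<le> k" for k
          using K that by (simp add: pos_divide_le_eq le_nat_iff le_floor_iff b)
        moreover have "nat \<lfloor>\<phi> y * real K\<rfloor> \<le> K"
        proof -
          have "\<phi> y * real K \<le> 1 * real K" using b(2) by (rule mult_right_mono) simp
          then have "\<lfloor>\<phi> y * real K\<rfloor> \<le> int K" by (simp add: floor_le_iff)
          then show ?thesis by simp
        qed
        ultimately show ?thesis by auto
      qed
      then have "(\<Sum>k=1..K. of_bool (real k / real K \<le> \<phi> y)) = real (nat \<lfloor>\<phi> y * real K\<rfloor>)"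
        by (simp add: of_bool_def sum.If_cases Int_def)
      then show ?thesis using b(1)[of y] by (simp add: \<phi>'_def)
    qed
    have near: "\<bar>\<phi> y - \<phi>' y\<bar> \<le> 1 / real K" for y
    proof -
      have "\<bar>\<phi> y * real K - real_of_int \<lfloor>\<phi> y * real K\<rfloor>\<bar> \<le> 1" by linarith
      then have "\<bar>\<phi> y * real K - real_of_int \<lfloor>\<phi> y * real K\<rfloor>\<bar> / real K \<le> 1 / real K"
        by (rule divide_right_mono) simp
      moreover have "\<bar>\<phi> y - \<phi>' y\<bar> = \<bar>\<phi> y * real K - real_of_int \<lfloor>\<phi> y * real K\<rfloor>\<bar> / real K"
        using K unfolding fl by (simp add: field_simps flip: abs_divide)
      ultimately show ?thesis by simp
    qed
    have meas[measurable]: "\<phi> \<in> borel_measurable \<mu>" "\<phi> \<in> borel_measurable \<nu>"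
      using m s by (auto cong: measurable_cong_sets)
    have gen: "\<bar>(\<integral>y. \<phi> y \<partial>L) - (\<Sum>k=1..K. measure L {y\<in>space L. real k / real K \<le> \<phi> y}) / real K\<bar>
        \<le> 1 / real K" if L: "prob_space L" and [measurable]: "\<phi> \<in> borel_measurable L" for L
    proof -
      interpret L: prob_space L by fact
      have b1: "bfun L \<phi>" by (rule bfunI[where B=1]) (use b in \<open>auto simp: abs_le_iff intro: order_trans[OF _ b(1)]\<close>)
      have b2: "bfun L \<phi>'" unfolding \<phi>'_def by (intro bfun_intros) measurable
      have "(\<integral>y. \<phi>' y \<partial>L) = (\<Sum>k=1..K. \<integral>y. of_bool (real k / real K \<le> \<phi> y) \<partial>L) / real K"
        unfolding \<phi>'_def
        by (subst Bochner_Integration.integral_divide_zero, subst Bochner_Integration.integral_sum)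
          (auto intro!: L.bfun_integrable bfun_intros)
      also have "\<dots> = (\<Sum>k=1..K. measure L {y\<in>space L. real k / real K \<le> \<phi> y}) / real K"
      proof (intro arg_cong2[where f="(/)"] sum.cong refl)
        fix k
        have "(\<integral>y. (of_bool (real k / real K \<le> \<phi> y) :: real) \<partial>L) =
            (\<integral>y. indicator {y\<in>space L. real k / real K \<le> \<phi> y} y \<partial>L)"
          by (rule Bochner_Integration.integral_cong) (auto simp: indicator_def)
        then show "(\<integral>y. (of_bool (real k / real K \<le> \<phi> y) :: real) \<partial>L) =
            measure L {y\<in>space L. real k / real K \<le> \<phi> y}"
          by (simp add: Collect_conj_eq Int_ac)
      qed
      finally have e: "(\<integral>y. \<phi>' y \<partial>L) =
        (\<Sum>k=1..K. measure L {y\<in>space L. real k / real K \<le> \<phi> y}) / real K" .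
      have "\<bar>\<integral>y. \<phi> y - \<phi>' y \<partial>L\<bar> \<le> 1 / real K"
        by (rule L.integral_abs_le_const_bfun) (intro bfun_intros b1 b2, rule near)
      then show ?thesis
        by (subst (asm) Bochner_Integration.integral_diff)
          (auto intro: L.bfun_integrable b1 b2 simp: e)
    qed
    have sp: "space \<nu> = space \<mu>" using s by (rule sets_eq_imp_space_eq)
    have "\<bar>(\<Sum>k=1..K. measure \<mu> {y\<in>space \<mu>. real k / real K \<le> \<phi> y}) / real K -
       (\<Sum>k=1..K. measure \<nu> {y\<in>space \<nu>. real k / real K \<le> \<phi> y}) / real K\<bar> \<le>
       (\<Sum>k=1..K. tv_dist \<mu> \<nu>) / real K"
      unfolding diff_divide_distrib[symmetric] sum_subtractf[symmetric] abs_divide sp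
      by (simp only: abs_of_nat, intro divide_right_mono order_trans[OF sum_abs] sum_mono
          tv_dist_ge p) auto
    also have "\<dots> = tv_dist \<mu> \<nu>" using K by simp
    finally show ?thesis
      using gen[OF p(1) meas(1)] gen[OF p(2) meas(2)] by linarith
  qed
  show ?thesis
  proof (rule ccontr)
    assume "\<not> ?thesis"
    then obtain e where e: "e > 0" "tv_dist \<mu> \<nu> + e < \<bar>(\<integral>y. \<phi> y \<partial>\<mu>) - (\<integral>y. \<phi> y \<partial>\<nu>)\<bar>"
      by (metis add.commute diff_gt_0_iff_gt dense less_diff_eq not_le)
    obtain K :: nat where K: "2 / e < real K" using reals_Archimedean2 by blast
    with e(1) have "K > 0" by (metis divide_pos_pos gr0I less_asym of_nat_0 zero_less_numeral)
    moreover have "2 / real K < e" using K e(1) \<open>K > 0\<close> by (simp add: field_simps)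
    ultimately show False using approx[of K] e(2) by linarith
  qed
qed

text \<open>An affine map of [-B, B] onto [0, 1] reduces this to
  \<open>tv_dist_integral_unit\<close>; the factor 2 B is the length of the interval.\<close>

lemma tv_dist_integral:
  assumes p: "prob_space \<mu>" "prob_space \<nu>" and s: "sets \<nu> = sets \<mu>"
    and m: "\<phi> \<in> borel_measurable \<mu>" and b: "\<And>y. \<bar>\<phi> y\<bar> \<le> B"
  shows "\<bar>(\<integral>y. \<phi> y \<partial>\<mu>) - (\<integral>y. \<phi> y \<partial>\<nu>)\<bar> \<le> 2 * B * tv_dist \<mu> \<nu>"
proof (cases "B = 0")
  case True
  then have "\<phi> y = 0" for y using b[of y] by simp
  then show ?thesis using True by simp
next
  case False
  have "0 \<le> B" using b[of undefined] by linarith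
  with False have B: "0 < B" by simp
  interpret M: prob_space \<mu> by fact
  interpret N: prob_space \<nu> by fact
  have "bfun \<mu> \<phi>" "bfun \<nu> \<phi>" using m s b by (auto intro!: bfunI cong: measurable_cong_sets)
  note i = M.bfun_integrable[OF this(1)] N.bfun_integrable[OF this(2)]
  let ?\<psi> = "\<lambda>y. (\<phi> y + B) / (2 * B)"
  have "\<bar>(\<integral>y. ?\<psi> y \<partial>\<mu>) - (\<integral>y. ?\<psi> y \<partial>\<nu>)\<bar> \<le> tv_dist \<mu> \<nu>"
  proof (rule tv_dist_integral_unit[OF p s])
    show "0 \<le> ?\<psi> y" "?\<psi> y \<le> 1" for y using b[of y] B by (auto simp: field_simps abs_le_iff)
  qed (use m in auto)
  moreover have "(\<integral>y. ?\<psi> y \<partial>\<mu>) = ((\<integral>y. \<phi> y \<partial>\<mu>) + B) / (2 * B)"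
    "(\<integral>y. ?\<psi> y \<partial>\<nu>) = ((\<integral>y. \<phi> y \<partial>\<nu>) + B) / (2 * B)"
    using i by (auto simp: M.prob_space N.prob_space)
  ultimately have "\<bar>(\<integral>y. \<phi> y \<partial>\<mu>) - (\<integral>y. \<phi> y \<partial>\<nu>)\<bar> / (2 * B) \<le> tv_dist \<mu> \<nu>"
    using B by (simp add: abs_divide flip: diff_divide_distrib)
  then show ?thesis using B by (simp add: field_simps)
qed

text \<open>The local average over a cell of probability \<open>p\<close>; the deviation of the empirical mass of the
  cell from \<open>p\<close> also pays for the event that this mass is below \<open>p / 2\<close>.\<close>

lemma (in prob_space) local_average_error:
  fixes I :: "nat set"
  assumes I: "finite I" "I \<noteq> {}" and A: "A \<in> events" "0 < prob A"
    and G: "G \<in> borel_measurable M" "\<And>x. \<bar>G x\<bar> \<le> B" and m: "\<bar>m\<bar> \<le> B"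
    and g: "bfun M g" "\<bar>\<integral>x. (g x - m) * indicator A x \<partial>M\<bar> \<le> \<epsilon> * prob A"
  shows "(\<integral>X. ((\<Sum>i\<in>I. G (X i) * indicator A (X i)) / (\<Sum>i\<in>I. indicator A (X i)) - m)^2 \<partial>PiM I (\<lambda>_. M))
    \<le> 32 * B^2 / (real (card I) * prob A) + 8 * \<epsilon>^2 +
      8 * (\<integral>x. (G x - g x)^2 * indicator A x \<partial>M) / prob A"
proof -
  interpret P: prob_space "PiM I (\<lambda>_. M)" by (rule prob_space_PiM_const)
  let ?p = "prob A" and ?N = "real (card I)"
  let ?\<psi> = "\<lambda>x. (G x - m) * indicator A x"
  let ?num = "\<lambda>X. avg I (\<lambda>i. ?\<psi> (X i))" and ?den = "\<lambda>X. avg I (\<lambda>i. indicator A (X i) :: real)"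
  let ?E = "\<lambda>X. (\<Sum>i\<in>I. G (X i) * indicator A (X i)) / (\<Sum>i\<in>I. indicator A (X i) :: real)"
  have N: "0 < ?N" using I by (simp add: card_gt_0_iff)
  have B: "0 \<le> B" using m by linarith
  have bG: "bfun M G" by (rule bfunI[OF G])
  have bi: "bfun M (indicator A)" by (rule bfunI[where B=1]) (use A in \<open>auto simp: indicator_def\<close>)
  have b\<psi>: "bfun M ?\<psi>" by (intro bfun_intros bG bi)
  \<comment> \<open>A cell without data gives 0/0 = 0, which respects the same bound.\<close>
  have E_bd: "\<bar>?E X\<bar> \<le> B" for X
  proof (cases "(\<Sum>i\<in>I. indicator A (X i) :: real) = 0")
    case False
    then have pos: "0 < (\<Sum>i\<in>I. indicator A (X i) :: real)"
      by (metis indicator_pos_le less_eq_real_def sum_nonneg)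
    have "\<bar>\<Sum>i\<in>I. G (X i) * indicator A (X i)\<bar> \<le> (\<Sum>i\<in>I. B * indicator A (X i))"
      by (rule order_trans[OF sum_abs]) (intro sum_mono, use G in \<open>auto simp: abs_mult indicator_def\<close>)
    then show ?thesis using pos by (simp add: abs_divide field_simps sum_distrib_left)
  qed (use B in simp)
  have E_avg: "?E X = avg I (\<lambda>i. G (X i) * indicator A (X i)) / ?den X" for X
    using N by (simp add: avg_def)
  have bE: "bfun (PiM I (\<lambda>_. M)) ?E"
  proof (rule bfunI[OF _ E_bd])
    show "?E \<in> borel_measurable (PiM I (\<lambda>_. M))"
      using bfun_measurable[OF bG] A(1) by measurable
  qed
  have pw: "(?E X - m)^2 \<le> 4 / ?p^2 * (?num X)^2 + 16 * B^2 / ?p^2 * (?den X - ?p)^2" for X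
  proof (cases "?p / 2 \<le> ?den X")
    case True
    then have d: "0 < ?den X" using A by linarith
    have num: "?num X = avg I (\<lambda>i. G (X i) * indicator A (X i)) - m * ?den X"
      by (simp add: left_diff_distrib avg_diff avg_cmult)
    have "?E X - m = ?num X / ?den X"
      unfolding E_avg num using d by (simp add: field_simps)
    then have "(?E X - m)^2 = (?num X)^2 / (?den X)^2" by (simp add: power_divide)
    also have "\<dots> \<le> (?num X)^2 / (?p / 2)^2"
      using True A d by (intro divide_left_mono power_mono mult_pos_pos zero_less_power) auto
    also have "\<dots> = 4 / ?p^2 * (?num X)^2" by (simp add: power_divide)
    finally show ?thesis by (smt (verit) divide_nonneg_nonneg mult_nonneg_nonneg zero_le_power2)
  next
    case False
    then have "(?p / 2)^2 \<le> (?p - ?den X)^2" using A by (intro power_mono) auto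
    then have "?p^2 \<le> 4 * (?den X - ?p)^2" by (simp add: power_divide power2_commute)
    then have 1: "1 \<le> 4 * (?den X - ?p)^2 / ?p^2" using A by simp
    have "\<bar>?E X - m\<bar> \<le> 2 * B" using E_bd[of X] m by linarith
    then have "(?E X - m)^2 \<le> (2 * B)^2" by (metis abs_le_square_iff B abs_of_nonneg mult_nonneg_nonneg zero_le_numeral)
    also have "\<dots> \<le> 4 * B^2 * (4 * (?den X - ?p)^2 / ?p^2)"
      using mult_left_mono[OF 1, of "4 * B^2"] by (simp add: power_mult_distrib)
    also have "\<dots> = 16 * B^2 / ?p^2 * (?den X - ?p)^2" by simp
    finally show ?thesis by (smt (verit) divide_nonneg_nonneg mult_nonneg_nonneg zero_le_power2)
  qed
  have mean_i: "(\<integral>x. indicator A x \<partial>M) = ?p" using A by simp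
  have sq_i: "(\<integral>x. (indicator A x)^2 \<partial>M) = ?p"
  proof -
    have "(\<integral>x. (indicator A x :: real)^2 \<partial>M) = (\<integral>x. indicator A x \<partial>M)"
      by (rule Bochner_Integration.integral_cong) (auto simp: indicator_def)
    then show ?thesis using mean_i by simp
  qed
  have sq_\<psi>: "(\<integral>x. (?\<psi> x)^2 \<partial>M) \<le> 4 * B^2 * ?p"
  proof -
    have "(\<integral>x. (?\<psi> x)^2 \<partial>M) \<le> (\<integral>x. 4 * B^2 * indicator A x \<partial>M)"
    proof (intro bfun_integral_mono bfun_intros bG bi)
      fix x
      have "\<bar>G x - m\<bar> \<le> 2 * B" using G(2)[of x] m by linarith
      then have "(G x - m)^2 \<le> (2 * B)^2" by (metis abs_le_square_iff B abs_of_nonneg mult_nonneg_nonneg zero_le_numeral)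
      then show "(?\<psi> x)^2 \<le> 4 * B^2 * indicator A x"
        by (auto simp: indicator_def power_mult_distrib)
    qed
    then show ?thesis using mean_i by simp
  qed
  let ?F = "\<lambda>x. (G x - g x)^2 * indicator A x"
  \<comment> \<open>On \<open>A\<close> the misfit \<open>G - g\<close> is paired with the indicator
    by Cauchy-Schwarz, which yields one factor \<open>prob A\<close>; the remainder
    \<open>g - m\<close> is the bias, whose integral over \<open>A\<close> is at most \<epsilon>
    times \<open>prob A\<close> in absolute value.\<close>
  have mean_\<psi>: "(\<integral>x. ?\<psi> x \<partial>M)^2 \<le>
      2 * ?p * (\<integral>x. ?F x \<partial>M) + 2 * (\<epsilon> * ?p)^2"
  proof -
    let ?u = "\<integral>x. ((G x - g x) * indicator A x) * indicator A x \<partial>M"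
      and ?v = "\<integral>x. (g x - m) * indicator A x \<partial>M"
    have "(\<integral>x. ?\<psi> x \<partial>M) = (\<integral>x. ((G x - g x) * indicator A x) * indicator A x + (g x - m) * indicator A x \<partial>M)"
      by (rule Bochner_Integration.integral_cong) (auto simp: indicator_def)
    also have "\<dots> = ?u + ?v"
      by (intro Bochner_Integration.integral_add bfun_integrable bfun_intros bG bi g)
    finally have e: "(\<integral>x. ?\<psi> x \<partial>M) = ?u + ?v" .
    have "(\<integral>x. ((G x - g x) * indicator A x)^2 \<partial>M) = (\<integral>x. ?F x \<partial>M)"
      by (rule Bochner_Integration.integral_cong) (auto simp: indicator_def)
    with integral_mult_square_le[of "\<lambda>x. (G x - g x) * indicator A x" "indicator A"] sq_i
    have u: "?u^2 \<le> (\<integral>x. ?F x \<partial>M) * ?p"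
      by (metis bG bfun_diff bfun_mult bi g(1))
    have v: "?v^2 \<le> (\<epsilon> * ?p)^2" using g(2) by (metis abs_ge_zero power2_abs power_mono)
    have "(?u + ?v)^2 \<le> 2 * ?u^2 + 2 * ?v^2"
      using zero_le_power2[of "?u - ?v"] by (simp add: power2_eq_square algebra_simps)
    then show ?thesis using e u v by (simp add: mult.commute mult.left_commute)
  qed
  have "(\<integral>X. (?E X - m)^2 \<partial>PiM I (\<lambda>_. M)) \<le>
     (\<integral>X. 4 / ?p^2 * (?num X)^2 + 16 * B^2 / ?p^2 * (?den X - ?p)^2 \<partial>PiM I (\<lambda>_. M))"
    by (intro P.bfun_integral_mono bfun_intros bE pw bfun_PiM_component b\<psi> bi)
  also have "\<dots> = 4 / ?p^2 * (\<integral>X. (?num X)^2 \<partial>PiM I (\<lambda>_. M)) +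
      16 * B^2 / ?p^2 * (\<integral>X. (?den X - ?p)^2 \<partial>PiM I (\<lambda>_. M))"
    by (subst Bochner_Integration.integral_add)
      (intro P.bfun_integrable bfun_intros bfun_PiM_component b\<psi> bi | simp)+
  also have "\<dots> \<le> 4 / ?p^2 * (4 * B^2 * ?p / ?N + (2 * ?p * (\<integral>x. ?F x \<partial>M) + 2 * (\<epsilon> * ?p)^2)) +
      16 * B^2 / ?p^2 * (?p / ?N)"
  proof (intro add_mono mult_left_mono)
    show "(\<integral>X. (?num X)^2 \<partial>PiM I (\<lambda>_. M)) \<le>
      4 * B^2 * ?p / ?N + (2 * ?p * (\<integral>x. ?F x \<partial>M) + 2 * (\<epsilon> * ?p)^2)"
      using integral_avg_square_le2[OF I b\<psi>] divide_right_mono[OF sq_\<psi>, of ?N] mean_\<psi> by simp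
    show "(\<integral>X. (?den X - ?p)^2 \<partial>PiM I (\<lambda>_. M)) \<le> ?p / ?N"
      using integral_avg_deviation_le[OF I bi] unfolding mean_i sq_i .
  qed auto
  \<comment> \<open>Half of the 32 is the variance of the numerator, the other half the deviation of
    the cell mass.\<close>
  also have "\<dots> = 32 * B^2 / (?N * ?p) + 8 * \<epsilon>^2 +
      8 * (\<integral>x. ?F x \<partial>M) / ?p"
    using A N by (simp add: field_simps power2_eq_square)
  finally show ?thesis .
qed

section \<open>The missing data model\<close>

lemma sup_norm_le_iff: "0 \<le> t \<Longrightarrow> sup_norm S x \<le> t \<longleftrightarrow> (\<forall>i\<in>S. \<bar>x i\<bar> \<le> t)"
  unfolding sup_norm_def by (subst Max_le_iff) auto

lemma sup_norm_nonneg: "0 \<le> sup_norm S x"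
  unfolding sup_norm_def by (intro Max_ge) auto

lemma sup_norm_mono: "sup_norm S x \<le> sup_norm UNIV x"
  using sup_norm_le_iff[OF sup_norm_nonneg, of UNIV x UNIV x]
  by (subst sup_norm_le_iff[OF sup_norm_nonneg]) simp

lemma pred_sup_norm [measurable]:
  assumes "x \<in> M \<rightarrow>\<^sub>M leb (UNIV :: 'd::finite set)"
  shows "Measurable.pred M (\<lambda>z. sup_norm S (x z) \<le> T)"
proof (cases "0 \<le> T")
  case True
  have [measurable]: "(\<lambda>z. x z i) \<in> borel_measurable M" for i
    using measurable_compose[OF assms measurable_component_singleton[of i UNIV "\<lambda>_. lborel"]] by simp
  show ?thesis unfolding sup_norm_le_iff[OF True] by measurable
next
  case False
  then have "\<not> sup_norm S y \<le> T" for y :: "'d \<Rightarrow> real"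
    using sup_norm_nonneg[of S y] by linarith
  then show ?thesis by simp
qed

section \<open>Restricting and merging coordinates\<close>

lemma space_leb_UNIV [simp]: "space (leb UNIV) = UNIV"
  by (simp add: space_PiM)

lemma UNIV_in_sets_leb [simp]: "UNIV \<in> sets (leb UNIV)"
  using sets.top[of "leb UNIV"] by simp

lemma restrict_in_space_leb [simp]: "restrict x S \<in> space (leb S)"
  by (simp add: space_PiM)

lemma depends_onD: "depends_on S \<phi> \<Longrightarrow> (\<And>i. i \<in> S \<Longrightarrow> x i = y i) \<Longrightarrow> \<phi> x = \<phi> y"
  unfolding depends_on_def by (metis restrict_ext)

lemma depends_on_restrict: "depends_on S \<phi> \<Longrightarrow> \<phi> (restrict x S) = \<phi> x"
  unfolding depends_on_def by metis

lemma depends_onI: "(\<And>x y. (\<And>i. i \<in> S \<Longrightarrow> x i = y i) \<Longrightarrow> \<phi> x = \<phi> y) \<Longrightarrow> depends_on S \<phi>"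
  unfolding depends_on_def by (metis restrict_apply')

lemma measurable_restrict_leb [measurable]: "(\<lambda>x. restrict x S) \<in> leb UNIV \<rightarrow>\<^sub>M leb S"
  by (rule measurable_restrict_subset) simp

lemma measurable_merge_leb [measurable]: "merge S (-S) \<in> leb S \<Otimes>\<^sub>M leb (-S) \<rightarrow>\<^sub>M leb UNIV"
  using measurable_merge[of S "-S" "\<lambda>_. lborel"] by (simp add: Compl_partition)

text \<open>\<open>merge\<close> reads its first argument only on \<open>S\<close>, so a full point
  may stand in for its restriction. This allows conditional expectations to be treated as functions
  on the full space.\<close>

lemma measurable_merge_leb_UNIV [measurable]: "merge S (-S) \<in> leb UNIV \<Otimes>\<^sub>M leb (-S) \<rightarrow>\<^sub>M leb UNIV"
proof -
  have "(\<lambda>z. merge S (-S) (restrict (fst z) S, snd z)) \<in> leb UNIV \<Otimes>\<^sub>M leb (-S) \<rightarrow>\<^sub>M leb UNIV"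
    by measurable
  moreover have "(\<lambda>z. merge S (-S) (restrict (fst z) S, snd z)) = merge S (-S)"
    by (rule ext) simp
  ultimately show ?thesis by simp
qed

text \<open>A function of \<open>x_S\<close> is read on \<open>\<real>^S\<close> through the section that fills in zeros.\<close>

lemma depends_on_measurable_leb:
  assumes "\<phi> \<in> borel_measurable (leb UNIV)" "depends_on S \<phi>"
  shows "\<phi> \<in> borel_measurable (leb S)"
proof -
  let ?e = "\<lambda>x i. if i \<in> S then x i else (0::real)"
  have "?e \<in> leb S \<rightarrow>\<^sub>M leb UNIV"
  proof (rule measurable_PiM_single')
    show "(\<lambda>x. ?e x i) \<in> leb S \<rightarrow>\<^sub>M lborel" for i
      by (cases "i \<in> S") (auto intro: measurable_component_singleton)
  qed auto
  then have "(\<lambda>x. \<phi> (?e x)) \<in> borel_measurable (leb S)"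
    using assms(1) by measurable
  moreover have "\<phi> (?e x) = \<phi> x" for x
    by (rule depends_onD[OF assms(2)]) simp
  ultimately show ?thesis by simp
qed

interpretation lborel_product: product_sigma_finite "\<lambda>_. lborel :: real measure"
  by unfold_locales

lemma sigma_finite_leb: "sigma_finite_measure (leb S)"
  by (rule lborel_product.sigma_finite) simp

lemma nn_integral_leb_split:
  fixes \<phi> :: "('d::finite \<Rightarrow> real) \<Rightarrow> ennreal"
  assumes "\<phi> \<in> borel_measurable (leb UNIV)"
  shows "(\<integral>\<^sup>+x. \<phi> x \<partial>leb UNIV) = (\<integral>\<^sup>+x. \<integral>\<^sup>+y. \<phi> (merge S (-S) (x, y)) \<partial>leb (-S) \<partial>leb S)"
  using lborel_product.product_nn_integral_fold[of S "-S" \<phi>] assms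
  by (simp add: Compl_partition)

lemma sets_law [simp, measurable_cong]: "sets (law g) = sets (leb UNIV)"
  by (simp add: law_def)

lemma space_law [simp]: "space (law g) = UNIV"
  by (simp add: law_def)

lemma prob_space_law: "prob_density g \<Longrightarrow> prob_space (law g)"
  unfolding law_def prob_density_def
  by (intro prob_spaceI) (auto simp: emeasure_density)

lemma measurable_prob_density: "prob_density g \<Longrightarrow> g \<in> borel_measurable (leb UNIV)"
  unfolding prob_density_def by simp

lemma integral_law:
  "prob_density g \<Longrightarrow> \<phi> \<in> borel_measurable (leb UNIV) \<Longrightarrow>
    (\<integral>x. \<phi> x \<partial>law g) = (\<integral>x. \<phi> x * g x \<partial>leb UNIV)"
  unfolding law_def prob_density_def by (subst integral_density) (auto simp: mult.commute)

lemma integrable_law: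
  "prob_density g \<Longrightarrow> \<phi> \<in> borel_measurable (leb UNIV) \<Longrightarrow>
    integrable (law g) \<phi> \<longleftrightarrow> integrable (leb UNIV) (\<lambda>x. \<phi> x * g x)"
  unfolding law_def prob_density_def
  by (subst integrable_density) (auto simp: mult.commute[of _ "g _"])

lemma theta_law:
  "prob_density g \<Longrightarrow> a \<in> borel_measurable (leb UNIV) \<Longrightarrow> theta a g = (\<integral>x. a x \<partial>law g)"
  by (simp add: theta_def integral_law)

section \<open>Marginal and biased laws of a density\<close>

context
  fixes g :: "('d::finite \<Rightarrow> real) \<Rightarrow> real"
  assumes g: "prob_density g"
begin

lemma measurable_marginal: "marginal g S \<in> borel_measurable (leb S)"
proof -
  interpret sigma_finite_measure "leb (-S) :: ('d \<Rightarrow> real) measure" by (rule sigma_finite_leb)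
  show ?thesis
    unfolding marginal_def using measurable_prob_density[OF g] by measurable
qed

lemma marginal_nonneg: "0 \<le> marginal g S x"
  using g by (auto simp: marginal_def prob_density_def)

text \<open>\<open>marginal\<close> is a Bochner integral and returns 0 on a slice of infinite mass;
  such slices form a null set because the total mass is 1.\<close>

lemma AE_marginal:
  "AE x in leb S. ennreal (marginal g S x) = (\<integral>\<^sup>+y. ennreal (g (merge S (-S) (x, y))) \<partial>leb (-S))"
proof -
  interpret sigma_finite_measure "leb (-S) :: ('d \<Rightarrow> real) measure" by (rule sigma_finite_leb)
  note [measurable] = measurable_prob_density[OF g]
  let ?F = "\<lambda>x. \<integral>\<^sup>+y. ennreal (g (merge S (-S) (x, y))) \<partial>leb (-S)"
  have "(\<integral>\<^sup>+x. ?F x \<partial>leb S) = 1"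
    using nn_integral_leb_split[of "\<lambda>x. ennreal (g x)" S] g by (simp add: prob_density_def)
  then have "AE x in leb S. ?F x \<noteq> \<infinity>"
    by (intro nn_integral_PInf_AE) auto
  then show ?thesis
  proof (rule AE_mp, intro AE_I2 impI)
    fix x assume x: "x \<in> space (leb S)" and fin: "?F x \<noteq> \<infinity>"
    have "(\<lambda>y. g (merge S (-S) (x, y))) \<in> borel_measurable (leb (-S))"
      using x by measurable
    then show "ennreal (marginal g S x) = ?F x"
      unfolding marginal_def using fin g
      by (subst integral_eq_nn_integral) (auto simp: prob_density_def top.not_eq_extremum)
  qed
qed

lemma distr_law_restrict:
  "distr (law g) (leb S) (\<lambda>x. restrict x S) = density (leb S) (\<lambda>x. ennreal (marginal g S x))"
proof (rule measure_eqI)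
  note [measurable] = measurable_prob_density[OF g] measurable_marginal
  interpret sigma_finite_measure "leb (-S) :: ('d \<Rightarrow> real) measure" by (rule sigma_finite_leb)
  fix A assume "A \<in> sets (distr (law g) (leb S) (\<lambda>x. restrict x S))"
  then have [measurable]: "A \<in> sets (leb S)" by simp
  have "emeasure (distr (law g) (leb S) (\<lambda>x. restrict x S)) A =
      (\<integral>\<^sup>+x. indicator A x \<partial>distr (law g) (leb S) (\<lambda>x. restrict x S))"
    by (subst nn_integral_indicator) auto
  also have "\<dots> = (\<integral>\<^sup>+x. indicator A (restrict x S) \<partial>law g)"
    by (subst nn_integral_distr) (auto simp: law_def)
  also have "\<dots> = (\<integral>\<^sup>+x. ennreal (g x) * indicator A (restrict x S) \<partial>leb UNIV)"
    unfolding law_def by (subst nn_integral_density) auto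
  also have "\<dots> = (\<integral>\<^sup>+x. \<integral>\<^sup>+y. ennreal (g (merge S (-S) (x, y))) * indicator A (restrict x S)
      \<partial>leb (-S) \<partial>leb S)"
    by (subst nn_integral_leb_split[where S=S]) auto
  also have "\<dots> = (\<integral>\<^sup>+x. (\<integral>\<^sup>+y. ennreal (g (merge S (-S) (x, y))) \<partial>leb (-S)) * indicator A x
      \<partial>leb S)"
  proof (rule nn_integral_cong)
    fix x :: "'d \<Rightarrow> real" assume x: "x \<in> space (leb S)"
    then have [simp]: "restrict x S = x" by (auto simp: space_PiM)
    have "(\<lambda>y. g (merge S (-S) (x, y))) \<in> borel_measurable (leb (-S))"
      using x by measurable
    then show "(\<integral>\<^sup>+y. ennreal (g (merge S (-S) (x, y))) * indicator A (restrict x S) \<partial>leb (-S)) =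
      (\<integral>\<^sup>+y. ennreal (g (merge S (-S) (x, y))) \<partial>leb (-S)) * indicator A x"
      by (simp add: nn_integral_multc)
  qed
  also have "\<dots> = (\<integral>\<^sup>+x. ennreal (marginal g S x) * indicator A x \<partial>leb S)"
    by (rule nn_integral_cong_AE) (use AE_marginal[of S] in eventually_elim, simp)
  also have "\<dots> = emeasure (density (leb S) (\<lambda>x. ennreal (marginal g S x))) A"
    by (subst emeasure_density) auto
  finally show "emeasure (distr (law g) (leb S) (\<lambda>x. restrict x S)) A =
    emeasure (density (leb S) (\<lambda>x. ennreal (marginal g S x))) A" .
qed simp

lemma integral_marginal:
  assumes [measurable]: "\<phi> \<in> borel_measurable (leb UNIV)" and d: "depends_on S \<phi>"
  shows "(\<integral>x. \<phi> x * marginal g S x \<partial>leb S) = (\<integral>x. \<phi> x \<partial>law g)"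
proof -
  have [measurable]: "\<phi> \<in> borel_measurable (leb S)"
    by (rule depends_on_measurable_leb) fact+
  have "(\<integral>x. \<phi> x \<partial>law g) = (\<integral>x. \<phi> (restrict x S) \<partial>law g)"
    using d by (simp add: depends_on_restrict)
  also have "\<dots> = (\<integral>x. \<phi> x \<partial>distr (law g) (leb S) (\<lambda>x. restrict x S))"
    by (subst integral_distr) auto
  also have "\<dots> = (\<integral>x. \<phi> x * marginal g S x \<partial>leb S)"
    unfolding distr_law_restrict
    by (subst integral_density) (auto simp: measurable_marginal marginal_nonneg mult.commute)
  finally show ?thesis ..
qed

text \<open>The normaliser is an integral over R^S; as an expectation under the full law it no
  longer refers to the marginal density.\<close>

lemma r_bar_eq:
  assumes "r S \<in> borel_measurable (leb UNIV)" "depends_on S (r S)"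
  shows "r_bar r g S x = r S x / (\<integral>x. r S x \<partial>law g)"
  unfolding r_bar_def using integral_marginal[OF assms] by simp

text \<open>Biased sampling is realised on the full space: tilt the law of X by the weight, then
  forget the coordinates outside \<open>S\<close>. Expectations over a sample on \<open>S\<close>
  thereby become weighted expectations under the law of X.\<close>

lemma biased_law_eq:
  assumes [measurable]: "r S \<in> borel_measurable (leb UNIV)" and d: "depends_on S (r S)"
    and nn: "\<And>x. 0 \<le> r S x"
  shows "biased_law r g S =
    distr (density (law g) (\<lambda>x. ennreal (r_bar r g S x))) (leb S) (\<lambda>x. restrict x S)"
proof -
  have [measurable]: "r S \<in> borel_measurable (leb S)"
    by (rule depends_on_measurable_leb) fact+
  have n: "0 \<le> r_bar r g S x" for x
    using r_bar_eq[of r S x, OF assms(1,2)] nn by simp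
  have [measurable]: "r_bar r g S \<in> borel_measurable (leb S)"
    using r_bar_eq[of r S, OF assms(1,2)] by (simp add: measurable_cong[of _ "r_bar r g S"])
  have "r_bar r g S (restrict x S) = r_bar r g S x" for x
    unfolding r_bar_def using d by (simp add: depends_on_restrict)
  then have "distr (density (law g) (\<lambda>x. ennreal (r_bar r g S x))) (leb S) (\<lambda>x. restrict x S) =
     density (distr (law g) (leb S) (\<lambda>x. restrict x S)) (\<lambda>x. ennreal (r_bar r g S x))"
    by (subst density_distr) auto
  also have "\<dots> = biased_law r g S"
    unfolding distr_law_restrict biased_law_def
    by (subst density_density_eq)
      (auto simp: measurable_marginal marginal_nonneg n ennreal_mult' mult.commute)
  finally show ?thesis ..
qed

end

text \<open>One version \<kappa> of the conditional distributions is fixed, since continuity in the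
  conditioning value refers to a version. That continuity is added by the extension
  \<open>regular_missing_data\<close>.\<close>

locale missing_data =
  fixes f a :: "('d::finite \<Rightarrow> real) \<Rightarrow> real"
    and \<S> :: "'d set set"
    and r :: "'d set \<Rightarrow> ('d \<Rightarrow> real) \<Rightarrow> real"
    and lam :: "'d set \<Rightarrow> real"
    and \<kappa> :: "'d set \<Rightarrow> ('d \<Rightarrow> real) \<Rightarrow> ('d \<Rightarrow> real) measure"
    and c C A :: real
  assumes f: "prob_density f"
    and \<S>: "\<S> \<noteq> {}"
    and r_meas: "\<And>S. S \<in> \<S> \<Longrightarrow> r S \<in> borel_measurable (leb UNIV)"
    and r_dep: "\<And>S. S \<in> \<S> \<Longrightarrow> depends_on S (r S)"
    and r_pos: "\<And>S x. S \<in> \<S> \<Longrightarrow> 0 < r S x"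
    and a_meas: "a \<in> borel_measurable (leb UNIV)"
    and a_bound: "\<And>x. \<bar>a x\<bar> \<le> A"
    and cC: "0 < c" "c \<le> C"
    and r_bar: "\<And>S x. S \<in> \<S> \<Longrightarrow> c \<le> r_bar r f S x \<and> r_bar r f S x \<le> C"
    and lam_pos: "\<And>S. S \<in> \<S> \<Longrightarrow> 0 < lam S"
    and \<kappa>: "\<And>S. S \<in> \<S> \<Longrightarrow> cond_dist f S (\<kappa> S)"
begin

abbreviation "P \<equiv> law f"
abbreviation "cond S x \<equiv> \<kappa> S (restrict x S)"
abbreviation "\<rho> \<equiv> r_bar r f"

sublocale P: prob_space P by (rule prob_space_law[OF f])

definition R :: "'d set \<Rightarrow> real" where "R S = (\<integral>x. r S x \<partial>P)"

lemma prob_UNIV [simp]: "P.prob UNIV = 1"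
  using P.prob_space by simp

lemma bfun_P: "bfun P \<phi> = bfun (leb UNIV) \<phi>"
  by (rule bfun_cong_sets) simp

lemma rho_eq: "S \<in> \<S> \<Longrightarrow> \<rho> S x = r S x / R S"
  unfolding R_def by (rule r_bar_eq[OF f r_meas r_dep])

text \<open>If \<open>r S\<close> were not integrable, \<open>R S\<close> would be 0 and division by
  zero would make the normalised weight vanish; its lower bound \<open>c > 0\<close> excludes
  this.\<close>

lemma R_pos: assumes "S \<in> \<S>" shows "0 < R S"
proof -
  have "0 < r S undefined / R S"
    using rho_eq[OF assms, of undefined] r_bar[OF assms, of undefined] cC by linarith
  then show ?thesis using r_pos[OF assms, of undefined] by (simp add: zero_less_divide_iff)
qed

lemma r_eq: "S \<in> \<S> \<Longrightarrow> r S x = R S * \<rho> S x"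
  using R_pos[of S] by (simp add: rho_eq)

lemma rho_ge: "S \<in> \<S> \<Longrightarrow> c \<le> \<rho> S x" and rho_le: "S \<in> \<S> \<Longrightarrow> \<rho> S x \<le> C"
  and rho_pos: "S \<in> \<S> \<Longrightarrow> 0 < \<rho> S x"
  using r_bar[of S x] cC by auto

lemma rho_dep: "S \<in> \<S> \<Longrightarrow> depends_on S (\<rho> S)"
  using r_dep[of S] unfolding depends_on_def by (metis rho_eq)

lemma bfun_rho: assumes "S \<in> \<S>" shows "bfun (leb UNIV) (\<rho> S)"
proof (rule bfunI[where B=C])
  have "(\<lambda>x. r S x / R S) \<in> borel_measurable (leb UNIV)" using r_meas[OF assms] by simp
  then show "\<rho> S \<in> borel_measurable (leb UNIV)"
    using rho_eq[OF assms] by (metis (no_types, lifting) measurable_cong)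
  show "\<bar>\<rho> S x\<bar> \<le> C" for x using rho_pos[OF assms, of x] rho_le[OF assms, of x] by simp
qed

lemma bfun_a: "bfun (leb UNIV) a"
  by (rule bfunI[OF a_meas a_bound])

lemma integral_rho: assumes "S \<in> \<S>" shows "(\<integral>x. \<rho> S x \<partial>P) = 1"
proof -
  have "(\<integral>x. \<rho> S x \<partial>P) = (\<integral>x. r S x / R S \<partial>P)" using rho_eq[OF assms] by simp
  also have "\<dots> = 1" using R_pos[OF assms] by (simp add: R_def)
  finally show ?thesis .
qed

lemma finite_S: "finite \<S>" by simp

text \<open>A version of the conditional expectation of \<phi> given X_S, defined at every point
  through the fixed kernel and read as a function on the full space. Being defined pointwise, it can
  be asked to be uniformly continuous.\<close>

definition E :: "'d set \<Rightarrow> (('d \<Rightarrow> real) \<Rightarrow> real) \<Rightarrow> ('d \<Rightarrow> real) \<Rightarrow> real" where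
  "E S \<phi> x = (\<integral>y. \<phi> (merge S (-S) (x, y)) \<partial>cond S x)"

lemma kappa_meas: "S \<in> \<S> \<Longrightarrow> (\<lambda>x. cond S x) \<in> leb UNIV \<rightarrow>\<^sub>M prob_algebra (leb (-S))"
  using \<kappa>[of S] unfolding cond_dist_def
  by (intro measurable_compose[OF measurable_restrict_leb]) auto

lemma kappa_meas_sub: "S \<in> \<S> \<Longrightarrow> (\<lambda>x. cond S x) \<in> leb UNIV \<rightarrow>\<^sub>M subprob_algebra (leb (-S))"
  by (rule measurable_prob_algebraD[OF kappa_meas])

lemma kappa_prob: assumes "S \<in> \<S>" shows "prob_space (cond S x)"
  "sets (cond S x) = sets (leb (-S))"
  using measurable_space[OF kappa_meas[OF assms], of x] by (auto simp: space_prob_algebra)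

lemma measurable_section:
  assumes "S \<in> \<S>" "\<phi> \<in> borel_measurable (leb UNIV)"
  shows "(\<lambda>y. \<phi> (merge S (-S) (x, y))) \<in> borel_measurable (cond S x)"
proof -
  have "(\<lambda>y. \<phi> (merge S (-S) (x, y))) \<in> borel_measurable (leb (-S))"
    by (intro measurable_compose[OF _ assms(2)]
        measurable_compose[OF measurable_Pair1' measurable_merge_leb_UNIV]) simp
  then show ?thesis using kappa_prob(2)[OF assms(1)] measurable_cong_sets by blast
qed

lemma bfun_section:
  assumes "S \<in> \<S>" "bfun (leb UNIV) \<phi>"
  shows "bfun (cond S x) (\<lambda>y. \<phi> (merge S (-S) (x, y)))"
  using measurable_section[OF assms(1) bfun_measurable[OF assms(2)]] assms(2)
  unfolding bfun_def by blast

lemma E_abs_le: assumes "S \<in> \<S>" "bfun (leb UNIV) \<phi>" "\<And>x. \<bar>\<phi> x\<bar> \<le> B" shows "\<bar>E S \<phi> x\<bar> \<le> B"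
proof -
  interpret K: prob_space "cond S x" by (rule kappa_prob[OF assms(1)])
  show ?thesis unfolding E_def
    by (rule K.integral_abs_le_const_bfun[OF bfun_section[OF assms(1,2)] assms(3)])
qed

text \<open>Pushing the kernel forward along \<open>merge\<close> moves the dependence on x from the
  integrand into the measure; integration of a fixed function is measurable in the measure.\<close>

lemma bfun_E: assumes S: "S \<in> \<S>" and "bfun (leb UNIV) \<phi>" shows "bfun (leb UNIV) (E S \<phi>)"
proof -
  obtain B where B: "\<And>x. \<bar>\<phi> x\<bar> \<le> B" using bfun_bound[OF assms(2)] by blast
  have [measurable]: "\<phi> \<in> borel_measurable (leb UNIV)" using assms(2) by auto
  note [measurable] = kappa_meas_sub[OF S]
  let ?D = "\<lambda>x. distr (cond S x) (leb UNIV) (\<lambda>y. merge S (-S) (x, y))"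
  have D: "?D \<in> leb UNIV \<rightarrow>\<^sub>M subprob_algebra (leb UNIV)"
    by (rule measurable_distr2[where M="leb (-S)"]) (auto simp: case_prod_eta)
  have "E S \<phi> x = (\<integral>z. \<phi> z \<partial>?D x)" for x
    unfolding E_def
    by (subst integral_distr) (use kappa_prob(2)[OF S] in \<open>auto cong: measurable_cong_sets\<close>)
  moreover have "(\<lambda>x. \<integral>z. \<phi> z \<partial>?D x) \<in> borel_measurable (leb UNIV)"
    by (rule measurable_compose[OF D integral_measurable_subprob_algebra]) fact
  ultimately have "E S \<phi> \<in> borel_measurable (leb UNIV)" by (simp cong: measurable_cong)
  then show ?thesis by (rule bfunI) (rule E_abs_le[OF assms B])
qed

lemma E_dep: "depends_on S (E S \<phi>)"
proof (rule depends_onI)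
  fix x y :: "'d \<Rightarrow> real" assume e: "\<And>i. i \<in> S \<Longrightarrow> x i = y i"
  then have r: "restrict x S = restrict y S" by (rule restrict_ext)
  have "merge S (-S) (x, z) = merge S (-S) (y, z)" for z
    by (metis merge_restrict(1) r)
  then show "E S \<phi> x = E S \<phi> y" by (simp add: E_def r)
qed

lemma E_add:
  assumes "S \<in> \<S>" "bfun (leb UNIV) \<phi>" "bfun (leb UNIV) \<psi>"
  shows "E S (\<lambda>x. \<phi> x + \<psi> x) x = E S \<phi> x + E S \<psi> x"
proof -
  interpret K: prob_space "cond S x" by (rule kappa_prob[OF assms(1)])
  show ?thesis unfolding E_def
    by (intro Bochner_Integration.integral_add K.bfun_integrable bfun_section assms)
qed

lemma E_mult_dep:
  assumes "S \<in> \<S>" "depends_on S \<psi>"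
  shows "E S (\<lambda>x. \<psi> x * \<phi> x) x = \<psi> x * E S \<phi> x"
proof -
  have "\<psi> (merge S (-S) (x, y)) = \<psi> x" for y
    by (rule depends_onD[OF assms(2)]) simp
  then show ?thesis unfolding E_def by simp
qed

lemma E_dep_eq:
  assumes "S \<in> \<S>" "depends_on S \<psi>" shows "E S \<psi> x = \<psi> x"
proof -
  interpret K: prob_space "cond S x" by (rule kappa_prob[OF assms(1)])
  show ?thesis using E_mult_dep[OF assms, of "\<lambda>_. 1" x] by (simp add: E_def K.prob_space)
qed

text \<open>\<open>cond_dist\<close> speaks only of rectangles. These generate the product sets, so
  the law of X equals the law obtained by drawing X_S and then the other coordinates from the
  kernel, and any nonnegative integral follows.\<close>

lemma nn_integral_disintegrate:
  assumes S: "S \<in> \<S>" and \<phi>: "\<phi> \<in> borel_measurable (leb UNIV)"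
  shows "(\<integral>\<^sup>+x. \<phi> x \<partial>P) = (\<integral>\<^sup>+x. \<integral>\<^sup>+y. \<phi> (merge S (-S) (x, y)) \<partial>cond S x \<partial>P)"
proof -
  note [measurable] = kappa_meas_sub[OF S]
  let ?D = "\<lambda>x. distr (cond S x) (leb UNIV) (\<lambda>y. merge S (-S) (x, y))"
  have D[measurable]: "?D \<in> P \<rightarrow>\<^sub>M subprob_algebra (leb UNIV)"
    by (rule measurable_distr2[where M="leb (-S)"]) (auto simp: case_prod_eta)
  have eD: "emeasure (?D x) B = emeasure (cond S x) {y\<in>space (leb (-S)). merge S (-S) (x, y) \<in> B}"
    if "B \<in> sets (leb UNIV)" for x B
    using kappa_prob(2)[OF S, of x] that sets_eq_imp_space_eq[OF kappa_prob(2)[OF S, of x]]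
    by (subst emeasure_distr) (auto cong: measurable_cong_sets simp: vimage_def Int_def conj_commute)
  have eq: "P = P \<bind> ?D"
  proof (rule measure_eqI_PiM_finite[where I=UNIV and M="\<lambda>_. lborel" and A="\<lambda>_. UNIV"])
    show sb: "sets (P \<bind> ?D) = sets (leb UNIV)"
      by (rule sets_bind[where N="leb UNIV"]) auto
    fix B :: "'d \<Rightarrow> real set" assume "\<And>i. i \<in> UNIV \<Longrightarrow> B i \<in> sets lborel"
    then have B: "\<And>i. B i \<in> sets lborel" by simp
    then have Bm[measurable]: "Pi\<^sub>E UNIV B \<in> sets (leb UNIV)"
      by (intro sets_PiM_I_finite) auto
    let ?B1 = "Pi\<^sub>E S B" and ?B2 = "Pi\<^sub>E (-S) B"
    have B12: "?B1 \<in> sets (leb S)" "?B2 \<in> sets (leb (-S))"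
      using B by (auto intro!: sets_PiM_I_finite)
    have "emeasure (P \<bind> ?D) (Pi\<^sub>E UNIV B) = (\<integral>\<^sup>+x. emeasure (?D x) (Pi\<^sub>E UNIV B) \<partial>P)"
      by (rule emeasure_bind[OF _ D Bm]) simp
    also have "\<dots> = (\<integral>\<^sup>+x. indicator ?B1 (restrict x S) * emeasure (cond S x) ?B2 \<partial>P)"
    proof (rule nn_integral_cong)
      fix x
      have "merge S (-S) (x, y) \<in> Pi\<^sub>E UNIV B \<longleftrightarrow> restrict x S \<in> ?B1 \<and> y \<in> ?B2"
        if "y \<in> space (leb (-S))" for y
      proof -
        have "merge S (-S) (x, y) i = (if i \<in> S then x i else y i)" for i
          by (simp add: merge_def)
        then show ?thesis using that by (auto simp: PiE_iff space_PiM)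
      qed
      then have "{y\<in>space (leb (-S)). merge S (-S) (x, y) \<in> Pi\<^sub>E UNIV B} =
          (if restrict x S \<in> ?B1 then ?B2 else {})"
        using sets.sets_into_space[OF B12(2)] by auto
      then show "emeasure (?D x) (Pi\<^sub>E UNIV B) =
          indicator ?B1 (restrict x S) * emeasure (cond S x) ?B2"
        using eD[OF Bm, of x] by simp
    qed
    also have "\<dots> = emeasure P {x. restrict x S \<in> ?B1 \<and> restrict x (-S) \<in> ?B2}"
    proof -
      have "emeasure P {x. restrict x S \<in> ?B1 \<and> restrict x (-S) \<in> ?B2} =
          (\<integral>\<^sup>+x. indicator ?B1 (restrict x S) * emeasure (cond S x) ?B2 \<partial>P)"
        using \<kappa>[OF S] B12 unfolding cond_dist_def by blast
      then show ?thesis by (rule sym)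
    qed
    also have "{x. restrict x S \<in> ?B1 \<and> restrict x (-S) \<in> ?B2} = Pi\<^sub>E UNIV B"
      by (auto simp: PiE_iff)
    finally show "emeasure P (Pi\<^sub>E UNIV B) = emeasure (P \<bind> ?D) (Pi\<^sub>E UNIV B)" ..
  next
    show "range (\<lambda>_::nat. UNIV) \<subseteq> prod_algebra (UNIV :: 'd set) (\<lambda>_. lborel :: real measure)"
      using prod_algebraI_finite[of "UNIV :: 'd set" "\<lambda>_. UNIV" "\<lambda>_. lborel :: real measure"]
      by (auto simp: PiE_UNIV_domain)
  qed (auto simp: P.emeasure_eq_measure)
  have "(\<integral>\<^sup>+x. \<phi> x \<partial>P) = (\<integral>\<^sup>+x. \<phi> x \<partial>(P \<bind> ?D))"
    by (rule arg_cong2[where f=nn_integral, OF eq refl])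
  also have "\<dots> = (\<integral>\<^sup>+x. \<integral>\<^sup>+z. \<phi> z \<partial>?D x \<partial>P)"
    by (rule nn_integral_bind[OF \<phi> D])
  also have "\<dots> = (\<integral>\<^sup>+x. \<integral>\<^sup>+y. \<phi> (merge S (-S) (x, y)) \<partial>cond S x \<partial>P)"
    by (intro nn_integral_cong, subst nn_integral_distr)
      (use \<phi> kappa_prob(2)[OF S] in \<open>auto cong: measurable_cong_sets\<close>)
  finally show ?thesis .
qed

text \<open>The tower property. Adding the bound \<open>B\<close> makes the integrand nonnegative,
  which brings it within reach of \<open>nn_integral_disintegrate\<close>.\<close>

lemma integral_E:
  assumes S: "S \<in> \<S>" and \<phi>: "bfun (leb UNIV) \<phi>"
  shows "(\<integral>x. E S \<phi> x \<partial>P) = (\<integral>x. \<phi> x \<partial>P)"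
proof -
  obtain B where B: "\<And>x. \<bar>\<phi> x\<bar> \<le> B" using bfun_bound[OF \<phi>] by blast
  let ?\<psi> = "\<lambda>x. \<phi> x + B"
  have b\<psi>: "bfun (leb UNIV) ?\<psi>" by (intro bfun_intros \<phi>)
  have nn: "0 \<le> ?\<psi> x" for x using B[of x] by (simp add: abs_le_iff)
  have Enn: "0 \<le> E S ?\<psi> x" for x
    unfolding E_def by (intro Bochner_Integration.integral_nonneg nn)
  have E\<psi>: "E S ?\<psi> x = E S \<phi> x + B" for x
    using E_add[OF S \<phi> bfun_const[of _ B]] E_dep_eq[OF S, of "\<lambda>_. B" x] by (simp add: depends_on_def)
  have "ennreal (\<integral>x. ?\<psi> x \<partial>P) = (\<integral>\<^sup>+x. ?\<psi> x \<partial>P)"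
    by (rule nn_integral_eq_integral[symmetric]) (use b\<psi> nn P.bfun_integrable bfun_P in auto)
  also have "\<dots> = (\<integral>\<^sup>+x. \<integral>\<^sup>+y. ?\<psi> (merge S (-S) (x, y)) \<partial>cond S x \<partial>P)"
    by (rule nn_integral_disintegrate[OF S]) (use b\<psi> in auto)
  also have "\<dots> = (\<integral>\<^sup>+x. E S ?\<psi> x \<partial>P)"
  proof (rule nn_integral_cong)
    fix x
    interpret K: prob_space "cond S x" by (rule kappa_prob[OF S])
    show "(\<integral>\<^sup>+y. ?\<psi> (merge S (-S) (x, y)) \<partial>cond S x) = E S ?\<psi> x"
      unfolding E_def
      by (rule nn_integral_eq_integral) (use nn K.bfun_integrable[OF bfun_section[OF S b\<psi>]] in auto)
  qed
  also have "\<dots> = ennreal (\<integral>x. E S ?\<psi> x \<partial>P)"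
    by (rule nn_integral_eq_integral)
      (use bfun_E[OF S b\<psi>] P.bfun_integrable bfun_P Enn in auto)
  finally have "(\<integral>x. ?\<psi> x \<partial>P) = (\<integral>x. E S ?\<psi> x \<partial>P)"
    by (subst (asm) ennreal_inj)
      (auto intro!: Bochner_Integration.integral_nonneg simp: nn Enn)
  moreover have "(\<integral>x. ?\<psi> x \<partial>P) = (\<integral>x. \<phi> x \<partial>P) + B"
    using P.bfun_integrable \<phi> bfun_P by (auto simp: P.prob_space)
  moreover have "(\<integral>x. E S ?\<psi> x \<partial>P) = (\<integral>x. E S \<phi> x \<partial>P) + B"
    unfolding E\<psi> using P.bfun_integrable bfun_E[OF S \<phi>] bfun_P by (auto simp: P.prob_space)
  ultimately show ?thesis by simp
qed

lemma integral_mult_E_bfun: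
  assumes "S \<in> \<S>" "bfun (leb UNIV) \<phi>" "bfun (leb UNIV) \<psi>" "depends_on S \<psi>"
  shows "(\<integral>x. \<psi> x * E S \<phi> x \<partial>P) = (\<integral>x. \<psi> x * \<phi> x \<partial>P)"
  using integral_E[OF assms(1) bfun_mult[OF assms(3,2)]] E_mult_dep[OF assms(1,4)] by simp

lemma integrable_mult_bfun:
  assumes "integrable P \<psi>" "bfun (leb UNIV) \<phi>" shows "integrable P (\<lambda>x. \<psi> x * \<phi> x)"
proof -
  obtain B where B: "\<And>x. \<bar>\<phi> x\<bar> \<le> B" "0 \<le> B" using bfun_bound[OF assms(2)] by blast
  show ?thesis
  proof (rule Bochner_Integration.integrable_bound)
    show "integrable P (\<lambda>x. B * \<bar>\<psi> x\<bar>)" using assms(1) by simp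
    show "(\<lambda>x. \<psi> x * \<phi> x) \<in> borel_measurable P"
      using assms bfun_P by (intro borel_measurable_times) auto
    show "AE x in P. norm (\<psi> x * \<phi> x) \<le> norm (B * \<bar>\<psi> x\<bar>)"
      using B by (intro AE_I2) (auto simp: abs_mult mult.commute intro!: mult_mono)
  qed
qed

text \<open>Needed for the competitors in \<open>H_prod\<close>, which are unbounded: truncate
  \<psi> at level n, which keeps it a function of x_S, and pass to the limit by dominated
  convergence.\<close>

lemma integral_mult_E:
  assumes S: "S \<in> \<S>" and \<phi>: "bfun (leb UNIV) \<phi>" and \<psi>: "integrable P \<psi>" "depends_on S \<psi>"
  shows "(\<integral>x. \<psi> x * E S \<phi> x \<partial>P) = (\<integral>x. \<psi> x * \<phi> x \<partial>P)"
proof -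
  have m: "\<psi> \<in> borel_measurable (leb UNIV)" using \<psi>(1) by auto
  define t where "t n x = (if \<bar>\<psi> x\<bar> \<le> real n then \<psi> x else 0)" for n x
  have bt: "bfun (leb UNIV) (t n)" for n
    by (rule bfunI[where B="real n"]) (use m in \<open>auto simp: t_def[abs_def]\<close>)
  have dt: "depends_on S (t n)" for n
    using \<psi>(2) unfolding depends_on_def t_def by metis
  have lim: "(\<lambda>n. \<integral>x. t n x * q x \<partial>P) \<longlonglongrightarrow> (\<integral>x. \<psi> x * q x \<partial>P)"
    if q: "bfun (leb UNIV) q" for q
  proof (rule integral_dominated_convergence[where w="\<lambda>x. \<bar>\<psi> x * q x\<bar>"])
    show "AE x in P. (\<lambda>n. t n x * q x) \<longlonglongrightarrow> \<psi> x * q x"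
    proof (rule AE_I2)
      fix x
      have "\<forall>\<^sub>F n in sequentially. t n x * q x = \<psi> x * q x"
        using eventually_ge_at_top[of "nat \<lceil>\<bar>\<psi> x\<bar>\<rceil>"]
        by eventually_elim (auto simp: t_def nat_le_iff ceiling_le_iff)
      then show "(\<lambda>n. t n x * q x) \<longlonglongrightarrow> \<psi> x * q x" by (rule tendsto_eventually)
    qed
    show "AE x in P. norm (t n x * q x) \<le> \<bar>\<psi> x * q x\<bar>" for n
      by (intro AE_I2) (auto simp: t_def)
    show "integrable P (\<lambda>x. \<bar>\<psi> x * q x\<bar>)" using integrable_mult_bfun[OF \<psi>(1) q] by simp
    show "(\<lambda>x. t n x * q x) \<in> borel_measurable P" for n
      using bt[of n] q bfun_P by (intro borel_measurable_times) auto
    show "(\<lambda>x. \<psi> x * q x) \<in> borel_measurable P"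
      using integrable_mult_bfun[OF \<psi>(1) q] by auto
  qed
  have "(\<integral>x. t n x * E S \<phi> x \<partial>P) = (\<integral>x. t n x * \<phi> x \<partial>P)" for n
    by (rule integral_mult_E_bfun[OF S \<phi> bt dt])
  then show ?thesis
    using LIMSEQ_unique[OF lim[OF bfun_E[OF S \<phi>]]] lim[OF \<phi>] by simp
qed

end

section \<open>Population backfitting\<close>

context missing_data
begin

text \<open>\<open>iw\<close> is the reciprocal of the weight \<open>w\<close>, the curvature of the objective in direction \<open>S\<close>.\<close>

definition w :: "'d set \<Rightarrow> ('d \<Rightarrow> real) \<Rightarrow> real" where
  "w S x = lam S * \<rho> S x / (1 + lam S * \<rho> S x)"

definition il :: "'d set \<Rightarrow> ('d \<Rightarrow> real) \<Rightarrow> real" where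
  "il S x = 1 / (lam S * \<rho> S x)"

definition iw :: "'d set \<Rightarrow> ('d \<Rightarrow> real) \<Rightarrow> real" where
  "iw S x = 1 + il S x"

definition partial_residual :: "('d set \<Rightarrow> ('d \<Rightarrow> real) \<Rightarrow> real) \<Rightarrow> 'd set \<Rightarrow> ('d \<Rightarrow> real) \<Rightarrow> real" where
  "partial_residual \<alpha> S x = a x - (\<Sum>S'\<in>\<S> - {S}. \<alpha> S' x)"

definition update :: "('d set \<Rightarrow> ('d \<Rightarrow> real) \<Rightarrow> real) \<Rightarrow> 'd set \<Rightarrow> ('d \<Rightarrow> real) \<Rightarrow> real" where
  "update \<alpha> S x = w S x * (E S (partial_residual \<alpha> S) x -
     (\<integral>y. w S y * partial_residual \<alpha> S y \<partial>P) / (\<integral>y. w S y \<partial>P))"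

definition residual :: "('d set \<Rightarrow> ('d \<Rightarrow> real) \<Rightarrow> real) \<Rightarrow> ('d \<Rightarrow> real) \<Rightarrow> real" where
  "residual \<alpha> x = a x - (\<Sum>S\<in>\<S>. \<alpha> S x) - theta a f"

definition admissible :: "('d set \<Rightarrow> ('d \<Rightarrow> real) \<Rightarrow> real) \<Rightarrow> bool" where
  "admissible \<alpha> \<longleftrightarrow> (\<forall>S\<in>\<S>. bfun (leb UNIV) (\<alpha> S) \<and> depends_on S (\<alpha> S) \<and> (\<integral>x. \<alpha> S x \<partial>P) = 0)"

definition \<eta> :: real where "\<eta> = 1 / real (card \<S>)"

primrec pop :: "nat \<Rightarrow> 'd set \<Rightarrow> ('d \<Rightarrow> real) \<Rightarrow> real" where
  "pop 0 = (\<lambda>S x. 0)"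
| "pop (Suc m) = (\<lambda>S x. (1 - \<eta>) * pop m S x + \<eta> * update (pop m) S x)"

definition gap :: "('d set \<Rightarrow> ('d \<Rightarrow> real) \<Rightarrow> real) \<Rightarrow> real" where
  "gap \<alpha> = (\<Sum>S\<in>\<S>. \<integral>x. (update \<alpha> S x - \<alpha> S x)^2 * iw S x \<partial>P)"

abbreviation "obj \<equiv> objective f \<S> a r lam"

lemma card_S_pos: "0 < real (card \<S>)"
  using \<S> by (simp add: card_gt_0_iff)

lemma eta_bounds: "0 < \<eta>" "\<eta> \<le> 1"
  using card_S_pos by (auto simp: \<eta>_def)

lemma lam_rho_pos: "S \<in> \<S> \<Longrightarrow> 0 < lam S * \<rho> S x"
  using lam_pos rho_pos by simp

lemma il_pos: "S \<in> \<S> \<Longrightarrow> 0 < il S x"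
  using lam_rho_pos[of S x] by (simp add: il_def)

lemma w_pos: "S \<in> \<S> \<Longrightarrow> 0 < w S x" and w_le_1: "S \<in> \<S> \<Longrightarrow> w S x \<le> 1"
  using lam_rho_pos[of S x] by (auto simp: w_def field_simps)

lemma w_iw: "S \<in> \<S> \<Longrightarrow> w S x * iw S x = 1"
proof -
  have "l / (1 + l) * (1 + 1 / l) = 1" if "0 < l" for l :: real
    using that by (auto simp: divide_simps)
  then show ?thesis if "S \<in> \<S>"
    using lam_rho_pos[OF that] unfolding w_def iw_def il_def by blast
qed

lemma w_ge: assumes "S \<in> \<S>" shows "lam S * c / (1 + lam S * c) \<le> w S x"
proof -
  have "lam S * c \<le> lam S * \<rho> S x" using lam_pos[OF assms] rho_ge[OF assms] by simp
  moreover have "0 < lam S * c" using lam_pos[OF assms] cC by simp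
  ultimately show ?thesis unfolding w_def by (simp add: divide_simps) (simp add: algebra_simps)
qed

lemma iw_ge_1: "S \<in> \<S> \<Longrightarrow> 1 \<le> iw S x"
  using il_pos[of S x] by (simp add: iw_def)

lemma w_dep: "S \<in> \<S> \<Longrightarrow> depends_on S (w S)" and iw_dep: "S \<in> \<S> \<Longrightarrow> depends_on S (iw S)"
  using rho_dep[of S] unfolding depends_on_def w_def iw_def il_def by metis+

lemma bfun_inverse_lam_rho: assumes "S \<in> \<S>" shows "bfun (leb UNIV) (il S)"
  unfolding il_def[abs_def]
proof (rule bfun_divide_ge[where e="lam S * c"])
  show "lam S * c \<le> lam S * \<rho> S x" for x using lam_pos[OF assms] rho_ge[OF assms] by simp
qed (use assms lam_pos cC in \<open>auto intro: bfun_intros bfun_rho\<close>)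

lemma bfun_w: assumes "S \<in> \<S>" shows "bfun (leb UNIV) (w S)"
proof (rule bfunI[where B=1])
  show "w S \<in> borel_measurable (leb UNIV)"
    using bfun_measurable[OF bfun_rho[OF assms]] unfolding w_def[abs_def] by measurable
  show "\<bar>w S x\<bar> \<le> 1" for x using w_pos[OF assms, of x] w_le_1[OF assms, of x] by simp
qed

lemma bfun_iw: "S \<in> \<S> \<Longrightarrow> bfun (leb UNIV) (iw S)"
  unfolding iw_def[abs_def] by (intro bfun_intros bfun_inverse_lam_rho)

lemma integral_w_ge: assumes "S \<in> \<S>" shows "lam S * c / (1 + lam S * c) \<le> (\<integral>x. w S x \<partial>P)"
proof -
  have "(\<integral>x. lam S * c / (1 + lam S * c) \<partial>P) \<le> (\<integral>x. w S x \<partial>P)"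
    by (rule P.bfun_integral_mono) (use bfun_w[OF assms] w_ge[OF assms] bfun_P in \<open>auto intro: bfun_const\<close>)
  then show ?thesis by simp
qed

lemma integral_w_pos: assumes "S \<in> \<S>" shows "0 < (\<integral>x. w S x \<partial>P)"
proof -
  have "0 < lam S * c / (1 + lam S * c)"
    using lam_pos[OF assms] cC by (intro divide_pos_pos add_pos_pos mult_pos_pos) auto
  then show ?thesis using integral_w_ge[OF assms] by linarith
qed

lemma admissibleD:
  assumes "admissible \<alpha>" "S \<in> \<S>"
  shows "bfun (leb UNIV) (\<alpha> S)" "depends_on S (\<alpha> S)" "(\<integral>x. \<alpha> S x \<partial>P) = 0"
  using assms unfolding admissible_def by auto

lemma integrable_bfun: "bfun (leb UNIV) \<phi> \<Longrightarrow> integrable P \<phi>"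
  using P.bfun_integrable bfun_P by blast

lemma bfun_partial_residual: "admissible \<alpha> \<Longrightarrow> bfun (leb UNIV) (partial_residual \<alpha> S)"
  unfolding partial_residual_def[abs_def] by (intro bfun_intros bfun_a admissibleD(1)) auto

lemma bfun_residual: "admissible \<alpha> \<Longrightarrow> bfun (leb UNIV) (residual \<alpha>)"
  unfolding residual_def[abs_def] by (intro bfun_intros bfun_a admissibleD(1)) auto

lemma update_admissible:
  assumes \<alpha>: "admissible \<alpha>" and S: "S \<in> \<S>"
  shows "bfun (leb UNIV) (update \<alpha> S)" "depends_on S (update \<alpha> S)" "(\<integral>x. update \<alpha> S x \<partial>P) = 0"
proof -
  note b = bfun_partial_residual[OF \<alpha>, of S] bfun_w[OF S]
  note bE = bfun_E[OF S b(1)]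
  show "bfun (leb UNIV) (update \<alpha> S)"
    unfolding update_def[abs_def] by (intro bfun_intros b bE)
  show "depends_on S (update \<alpha> S)"
    using w_dep[OF S] E_dep unfolding update_def depends_on_def by metis
  have "(\<integral>x. w S x * E S (partial_residual \<alpha> S) x \<partial>P) = (\<integral>x. w S x * partial_residual \<alpha> S x \<partial>P)"
    by (rule integral_mult_E_bfun[OF S b w_dep[OF S]])
  moreover have "(\<integral>x. update \<alpha> S x \<partial>P) = (\<integral>x. w S x * E S (partial_residual \<alpha> S) x -
      w S x * ((\<integral>y. w S y * partial_residual \<alpha> S y \<partial>P) / (\<integral>y. w S y \<partial>P)) \<partial>P)"
    unfolding update_def by (simp add: algebra_simps)
  moreover have "\<dots> = (\<integral>x. w S x * E S (partial_residual \<alpha> S) x \<partial>P) -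
      (\<integral>x. w S x \<partial>P) * ((\<integral>y. w S y * partial_residual \<alpha> S y \<partial>P) / (\<integral>y. w S y \<partial>P))"
    by (subst Bochner_Integration.integral_diff)
      (use integrable_bfun[OF bfun_mult[OF b(2) bE]] integrable_bfun[OF b(2)] in auto)
  ultimately show "(\<integral>x. update \<alpha> S x \<partial>P) = 0"
    using integral_w_pos[OF S] by simp
qed

lemma pop_admissible: "admissible (pop m)"
proof (induction m)
  case 0
  show ?case by (auto simp: admissible_def depends_on_def intro: bfun_const)
next
  case (Suc m)
  show ?case unfolding admissible_def
  proof (intro ballI conjI)
    fix S assume S: "S \<in> \<S>"
    note p = admissibleD[OF Suc S] and u = update_admissible[OF Suc S]
    show "bfun (leb UNIV) (pop (Suc m) S)" by (simp, intro bfun_intros p u)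
    show "depends_on S (pop (Suc m) S)" using p(2) u(2) by (auto simp: depends_on_def)
    show "(\<integral>x. pop (Suc m) S x \<partial>P) = 0"
      using integrable_bfun[OF p(1)] integrable_bfun[OF u(1)] p(3) u(3) by simp
  qed
qed

lemma integral_residual: assumes "admissible \<alpha>" shows "(\<integral>x. residual \<alpha> x \<partial>P) = 0"
proof -
  have "(\<integral>x. residual \<alpha> x \<partial>P) = (\<integral>x. a x \<partial>P) - (\<Sum>S\<in>\<S>. \<integral>x. \<alpha> S x \<partial>P) - theta a f"
    unfolding residual_def using admissibleD(1)[OF assms] integrable_bfun bfun_a
    by (simp add: Bochner_Integration.integral_diff Bochner_Integration.integral_sum)
  then show ?thesis using admissibleD(3)[OF assms] theta_law[OF f a_meas] by simp
qed

text \<open>Approximate first-order condition: the gradient of the objective at \<open>\<alpha>\<close> is expressed by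
  the update step.\<close>

lemma E_residual:
  assumes \<alpha>: "admissible \<alpha>" and S: "S \<in> \<S>"
  obtains q where "\<And>x. E S (residual \<alpha>) x =
    \<alpha> S x * il S x + (update \<alpha> S x - \<alpha> S x) * iw S x + q"
proof
  fix x
  let ?q = "(\<integral>y. w S y * partial_residual \<alpha> S y \<partial>P) / (\<integral>y. w S y \<partial>P)"
  have dec: "partial_residual \<alpha> S y = residual \<alpha> y + (theta a f + \<alpha> S y)" for y
    unfolding partial_residual_def residual_def using S by (simp add: sum.remove[OF finite_S S])
  have "E S (partial_residual \<alpha> S) x = E S (residual \<alpha>) x + E S (\<lambda>y. theta a f + \<alpha> S y) x"
    unfolding dec[abs_def]
    by (rule E_add[OF S]) (intro bfun_intros bfun_residual[OF \<alpha>] admissibleD(1)[OF \<alpha> S])+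
  moreover have "E S (\<lambda>y. theta a f + \<alpha> S y) x = theta a f + \<alpha> S x"
    by (rule E_dep_eq[OF S]) (use admissibleD(2)[OF \<alpha> S] in \<open>simp add: depends_on_def\<close>)
  moreover have "E S (partial_residual \<alpha> S) x - ?q = update \<alpha> S x * iw S x"
    unfolding update_def using w_iw[OF S, of x] by (simp add: mult.assoc mult.left_commute)
  ultimately have "E S (residual \<alpha>) x = update \<alpha> S x * iw S x + ?q - theta a f - \<alpha> S x"
    by simp
  moreover have "\<alpha> S x * iw S x = \<alpha> S x + \<alpha> S x * il S x"
    by (simp add: iw_def algebra_simps)
  ultimately show "E S (residual \<alpha>) x =
    \<alpha> S x * il S x + (update \<alpha> S x - \<alpha> S x) * iw S x + (?q - theta a f)"
    by (simp add: left_diff_distrib)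
qed

text \<open>The unspecified constant of \<open>E_residual\<close> disappears because \<gamma> is
  centred. At a fixed point of all updates the last integral vanishes and the normal equations of
  the objective remain.\<close>

lemma integral_mult_residual:
  assumes \<alpha>: "admissible \<alpha>" and S: "S \<in> \<S>"
    and \<gamma>: "integrable P \<gamma>" "depends_on S \<gamma>" "(\<integral>x. \<gamma> x \<partial>P) = 0"
  shows "(\<integral>x. \<gamma> x * residual \<alpha> x \<partial>P) = (\<integral>x. \<gamma> x * (\<alpha> S x * il S x) \<partial>P) +
    (\<integral>x. \<gamma> x * ((update \<alpha> S x - \<alpha> S x) * iw S x) \<partial>P)"
proof -
  obtain q where q: "\<And>x. E S (residual \<alpha>) x =
    \<alpha> S x * il S x + (update \<alpha> S x - \<alpha> S x) * iw S x + q"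
    using E_residual[OF \<alpha> S] by blast
  have b1: "bfun (leb UNIV) (\<lambda>x. \<alpha> S x * il S x)"
    using bfun_mult[OF admissibleD(1)[OF \<alpha> S] bfun_inverse_lam_rho[OF S]] by simp
  have b2: "bfun (leb UNIV) (\<lambda>x. (update \<alpha> S x - \<alpha> S x) * iw S x)"
    by (intro bfun_intros admissibleD[OF \<alpha> S] update_admissible[OF \<alpha> S] bfun_iw[OF S])
  have "(\<integral>x. \<gamma> x * residual \<alpha> x \<partial>P) = (\<integral>x. \<gamma> x * E S (residual \<alpha>) x \<partial>P)"
    by (rule integral_mult_E[OF S bfun_residual[OF \<alpha>] \<gamma>(1,2), symmetric])
  also have "\<dots> = (\<integral>x. \<gamma> x * (\<alpha> S x * il S x) +
      \<gamma> x * ((update \<alpha> S x - \<alpha> S x) * iw S x) + \<gamma> x * q \<partial>P)"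
    unfolding q by (simp only: distrib_left)
  also have "\<dots> = (\<integral>x. \<gamma> x * (\<alpha> S x * il S x) \<partial>P) +
      (\<integral>x. \<gamma> x * ((update \<alpha> S x - \<alpha> S x) * iw S x) \<partial>P) + (\<integral>x. \<gamma> x * q \<partial>P)"
    using integrable_mult_bfun[OF \<gamma>(1) b1] integrable_mult_bfun[OF \<gamma>(1) b2] \<gamma>(1) by simp
  finally show ?thesis using \<gamma>(3) by simp
qed

lemma objective_eq:
  assumes "\<And>S. S \<in> \<S> \<Longrightarrow> integrable P (\<beta> S)" "\<And>S. S \<in> \<S> \<Longrightarrow> (\<integral>x. \<beta> S x \<partial>P) = 0"
  shows "obj \<beta> = (\<integral>x. (residual \<beta> x)^2 \<partial>P) + (\<Sum>S\<in>\<S>. \<integral>x. (\<beta> S x)^2 * il S x \<partial>P)"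
proof -
  have "(\<integral>x. a x - (\<Sum>S\<in>\<S>. \<beta> S x) \<partial>P) = theta a f"
    using assms integrable_bfun[OF bfun_a] theta_law[OF f a_meas]
    by (simp add: Bochner_Integration.integral_diff Bochner_Integration.integral_sum)
  then show ?thesis by (simp add: objective_def residual_def il_def)
qed

lemma objective_admissible:
  "admissible \<alpha> \<Longrightarrow>
    obj \<alpha> = (\<integral>x. (residual \<alpha> x)^2 \<partial>P) + (\<Sum>S\<in>\<S>. \<integral>x. (\<alpha> S x)^2 * il S x \<partial>P)"
  by (rule objective_eq) (auto dest: admissibleD intro: integrable_bfun)

lemma objective_terms_le:
  assumes "admissible \<alpha>"
  shows "0 \<le> obj \<alpha>" "(\<integral>x. (residual \<alpha> x)^2 \<partial>P) \<le> obj \<alpha>"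
    "S \<in> \<S> \<Longrightarrow> (\<integral>x. (\<alpha> S x)^2 * il S x \<partial>P) \<le> obj \<alpha>"
proof -
  have nn: "0 \<le> (\<integral>x. (\<alpha> S x)^2 * il S x \<partial>P)" if "S \<in> \<S>" for S
    by (intro Bochner_Integration.integral_nonneg mult_nonneg_nonneg less_imp_le[OF il_pos[OF that]]) simp
  then have s: "0 \<le> (\<Sum>S\<in>\<S>. \<integral>x. (\<alpha> S x)^2 * il S x \<partial>P)"
    by (rule sum_nonneg)
  show "(\<integral>x. (residual \<alpha> x)^2 \<partial>P) \<le> obj \<alpha>" using s objective_admissible[OF assms] by simp
  moreover have "0 \<le> (\<integral>x. (residual \<alpha> x)^2 \<partial>P)" by simp
  ultimately show "0 \<le> obj \<alpha>" by linarith
  show "(\<integral>x. (\<alpha> S x)^2 * il S x \<partial>P) \<le> obj \<alpha>" if "S \<in> \<S>"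
    using member_le_sum[OF that, of "\<lambda>S. \<integral>x. (\<alpha> S x)^2 * il S x \<partial>P"] nn
      objective_admissible[OF assms] \<open>0 \<le> (\<integral>x. (residual \<alpha> x)^2 \<partial>P)\<close>
    by (smt (verit) DiffD1 finite_S)
qed

text \<open>As the normalised weight is at most C, \<open>il S\<close> is at least 1 / (lam S C).
  Hence \<open>iw S = 1 + il S\<close> is at most (1 + lam S C) times \<open>il S\<close>, and the
  penalty in the objective controls the stronger weight.\<close>

lemma integral_square_iw_le:
  assumes \<alpha>: "admissible \<alpha>" and S: "S \<in> \<S>"
  shows "(\<integral>x. (\<alpha> S x)^2 * iw S x \<partial>P) \<le> (1 + lam S * C) * obj \<alpha>"
proof -
  have "(\<integral>x. (\<alpha> S x)^2 * iw S x \<partial>P) \<le>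
    (\<integral>x. (1 + lam S * C) * ((\<alpha> S x)^2 * il S x) \<partial>P)"
  proof (rule P.bfun_integral_mono)
    show "bfun P (\<lambda>x. (\<alpha> S x)^2 * iw S x)"
      "bfun P (\<lambda>x. (1 + lam S * C) * ((\<alpha> S x)^2 * il S x))"
      unfolding bfun_P by (intro bfun_intros admissibleD[OF \<alpha> S] bfun_iw[OF S] bfun_inverse_lam_rho[OF S])+
    fix x
    have "lam S * \<rho> S x \<le> lam S * C" using rho_le[OF S] lam_pos[OF S] by simp
    then have "iw S x \<le> (1 + lam S * C) * il S x"
      using lam_rho_pos[OF S, of x] by (simp add: iw_def il_def field_simps)
    then show "(\<alpha> S x)^2 * iw S x \<le> (1 + lam S * C) * ((\<alpha> S x)^2 * il S x)"
      using mult_left_mono[of "iw S x" "(1 + lam S * C) * il S x" "(\<alpha> S x)^2"]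
      by (simp only: mult.left_commute[of _ "(\<alpha> S x)^2"] zero_le_power2)
  qed
  also have "\<dots> = (1 + lam S * C) * (\<integral>x. (\<alpha> S x)^2 * il S x \<partial>P)"
    by (rule integral_mult_right_zero)
  also have "\<dots> \<le> (1 + lam S * C) * obj \<alpha>"
    by (intro mult_left_mono objective_terms_le(3)[OF \<alpha> S]) (use lam_pos[OF S] cC in auto)
  finally show ?thesis .
qed

section \<open>Descent of the objective along the damped updates\<close>

lemma gap_nonneg: "0 \<le> gap \<alpha>"
  unfolding gap_def
  by (intro sum_nonneg Bochner_Integration.integral_nonneg mult_nonneg_nonneg)
    (auto intro: order_trans[OF _ iw_ge_1])

text \<open>Cross terms between coordinates are paid by Cauchy-Schwarz over \<S>: since \<eta>^2
  |\<S>| = \<eta>, the simultaneous step costs no more than \<eta> times the sum of the separate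
  full coordinate steps. Along each of these, the objective falls by the weighted squared length of
  the step.\<close>

lemma descent: "obj (pop (Suc m)) \<le> obj (pop m) - \<eta> * gap (pop m)"
proof -
  let ?\<alpha> = "pop m"
  define u where "u S x = update ?\<alpha> S x - ?\<alpha> S x" for S x
  have \<alpha>: "admissible ?\<alpha>" by (rule pop_admissible)
  have bu: "bfun (leb UNIV) (u S)" and du: "depends_on S (u S)" and iu: "(\<integral>x. u S x \<partial>P) = 0"
    if S: "S \<in> \<S>" for S
  proof -
    note p = admissibleD[OF \<alpha> S] and v = update_admissible[OF \<alpha> S]
    show "bfun (leb UNIV) (u S)" unfolding u_def[abs_def] by (intro bfun_intros p v)
    show "depends_on S (u S)" using p(2) v(2) by (auto simp: depends_on_def u_def)
    show "(\<integral>x. u S x \<partial>P) = 0"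
      unfolding u_def using integrable_bfun[OF p(1)] integrable_bfun[OF v(1)] p(3) v(3) by simp
  qed
  have new: "pop (Suc m) S x = ?\<alpha> S x + \<eta> * u S x" for S x
    by (simp add: u_def left_diff_distrib right_diff_distrib)
  have res: "residual (pop (Suc m)) x = residual ?\<alpha> x - \<eta> * (\<Sum>S\<in>\<S>. u S x)" for x
    unfolding residual_def new sum.distrib sum_distrib_left by simp
  have br: "bfun (leb UNIV) (residual ?\<alpha>)" by (rule bfun_residual[OF \<alpha>])
  note I = integrable_bfun bfun_intros br bu bfun_inverse_lam_rho admissibleD(1)[OF \<alpha>] bfun_iw
  let ?F = "\<lambda>S x. \<eta> * ((u S x)^2 - 2 * (u S x * residual ?\<alpha> x))"
  let ?U = "\<lambda>x. (residual (pop (Suc m)) x)^2"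
  have "(\<integral>x. ?U x \<partial>P) \<le>
     (\<integral>x. (residual ?\<alpha> x)^2 + (\<Sum>S\<in>\<S>. ?F S x) \<partial>P)"
  proof (rule P.bfun_integral_mono)
    show "bfun P (\<lambda>x. ?U x)"
      unfolding bfun_P by (intro bfun_power bfun_residual pop_admissible)
    show "bfun P (\<lambda>x. (residual ?\<alpha> x)^2 + (\<Sum>S\<in>\<S>. ?F S x))"
      unfolding bfun_P by (intro bfun_intros br bu)
    fix x
    have "\<eta>^2 * (\<Sum>S\<in>\<S>. u S x)^2 \<le> \<eta>^2 * (real (card \<S>) * (\<Sum>S\<in>\<S>. (u S x)^2))"
      by (intro mult_left_mono sum_square_le) simp
    also have "\<dots> = \<eta> * (\<Sum>S\<in>\<S>. (u S x)^2)"
      using card_S_pos by (simp add: power2_eq_square \<eta>_def)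
    finally have "\<eta>^2 * (\<Sum>S\<in>\<S>. u S x)^2 \<le> \<eta> * (\<Sum>S\<in>\<S>. (u S x)^2)" .
    moreover have "?U x = (residual ?\<alpha> x)^2 -
        2 * (\<eta> * (\<Sum>S\<in>\<S>. u S x * residual ?\<alpha> x)) + \<eta>^2 * (\<Sum>S\<in>\<S>. u S x)^2"
      unfolding res sum_distrib_right[symmetric] by (simp add: power2_eq_square algebra_simps)
    moreover have "(\<Sum>S\<in>\<S>. ?F S x) =
        \<eta> * (\<Sum>S\<in>\<S>. (u S x)^2) - 2 * (\<eta> * (\<Sum>S\<in>\<S>. u S x * residual ?\<alpha> x))"
      by (simp only: right_diff_distrib sum_subtractf sum_distrib_left mult.left_commute)
    ultimately show "?U x \<le>
      (residual ?\<alpha> x)^2 + (\<Sum>S\<in>\<S>. ?F S x)" by linarith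
  qed
  also have "\<dots> = (\<integral>x. (residual ?\<alpha> x)^2 \<partial>P) +
      (\<Sum>S\<in>\<S>. \<integral>x. ?F S x \<partial>P)"
  proof -
    have i1: "integrable P (\<lambda>x. (residual ?\<alpha> x)^2)" by (intro I)
    have i2: "integrable P (\<lambda>x. ?F S x)" if "S \<in> \<S>" for S
      by (intro I that)
    show ?thesis
      by (subst Bochner_Integration.integral_add[OF i1 Bochner_Integration.integrable_sum[OF i2]], assumption)
        (subst Bochner_Integration.integral_sum[OF i2], assumption, rule refl)
  qed
  finally have 1: "(\<integral>x. ?U x \<partial>P) \<le> (\<integral>x. (residual ?\<alpha> x)^2 \<partial>P) +
      (\<Sum>S\<in>\<S>. \<integral>x. ?F S x \<partial>P)" .
  let ?H = "\<lambda>S x. (pop (Suc m) S x)^2 * il S x"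
  have 2: "(\<integral>x. ?F S x \<partial>P) +
      (\<integral>x. ?H S x \<partial>P) \<le>
      (\<integral>x. (?\<alpha> S x)^2 * il S x \<partial>P) - \<eta> * (\<integral>x. (u S x)^2 * iw S x \<partial>P)"
    if S: "S \<in> \<S>" for S
  proof -
    note J = integrable_bfun bfun_intros br bu[OF S] bfun_inverse_lam_rho[OF S] admissibleD(1)[OF \<alpha> S] bfun_iw[OF S]
    have ur: "(\<integral>x. u S x * residual ?\<alpha> x \<partial>P) = (\<integral>x. u S x * (?\<alpha> S x * il S x) \<partial>P) +
        (\<integral>x. u S x * (u S x * iw S x) \<partial>P)"
      using integral_mult_residual[OF \<alpha> S integrable_bfun[OF bu[OF S]] du[OF S] iu[OF S]]
      by (simp add: u_def)
    let ?G = "\<lambda>S. (\<integral>x. (?\<alpha> S x)^2 * il S x \<partial>P) + 2 * \<eta> * (\<integral>x. u S x * (?\<alpha> S x * il S x) \<partial>P) + \<eta> * (\<integral>x. (u S x)^2 * il S x \<partial>P)"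
    have "(\<integral>x. ?H S x \<partial>P) \<le>
      (\<integral>x. (?\<alpha> S x)^2 * il S x + 2 * \<eta> * (u S x * (?\<alpha> S x * il S x)) + \<eta> * ((u S x)^2 * il S x) \<partial>P)"
    proof (rule P.bfun_integral_mono)
      show "bfun P (\<lambda>x. ?H S x)"
        unfolding bfun_P by (intro bfun_mult bfun_power bfun_inverse_lam_rho[OF S]
            admissibleD(1)[OF pop_admissible S])
      show "bfun P (\<lambda>x. (?\<alpha> S x)^2 * il S x + 2 * \<eta> * (u S x * (?\<alpha> S x * il S x)) + \<eta> * ((u S x)^2 * il S x))"
        unfolding bfun_P by (intro J)
      fix x
      have "\<eta>^2 \<le> \<eta>" using eta_bounds by (simp add: power2_eq_square mult_left_le)
      then have "\<eta>^2 * ((u S x)^2 * il S x) \<le> \<eta> * ((u S x)^2 * il S x)"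
        using less_imp_le[OF il_pos[OF S, of x]] by (intro mult_right_mono mult_nonneg_nonneg) auto
      moreover have "(pop (Suc m) S x)^2 * l = (?\<alpha> S x)^2 * l + 2 * \<eta> * (u S x * (?\<alpha> S x * l)) + \<eta>^2 * ((u S x)^2 * l)" for l
        unfolding new by (simp add: power2_eq_square algebra_simps)
      ultimately show "?H S x \<le>
        (?\<alpha> S x)^2 * il S x + 2 * \<eta> * (u S x * (?\<alpha> S x * il S x)) + \<eta> * ((u S x)^2 * il S x)" by simp
    qed
    also have "\<dots> = ?G S"
      by (subst Bochner_Integration.integral_add, (intro J)+)+ simp
    finally have p: "(\<integral>x. ?H S x \<partial>P) \<le> ?G S" .
    have q: "(\<integral>x. ?F S x \<partial>P) =
        \<eta> * ((\<integral>x. (u S x)^2 \<partial>P) - 2 * (\<integral>x. u S x * residual ?\<alpha> x \<partial>P))"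
      by (subst integral_mult_right_zero, subst Bochner_Integration.integral_diff, (intro J)+) simp
    have "(\<integral>x. (u S x)^2 * iw S x \<partial>P) = (\<integral>x. (u S x)^2 + (u S x)^2 * il S x \<partial>P)"
      by (simp add: iw_def distrib_left)
    also have "\<dots> = (\<integral>x. (u S x)^2 \<partial>P) + (\<integral>x. (u S x)^2 * il S x \<partial>P)"
      by (intro Bochner_Integration.integral_add J)
    finally have i: "(\<integral>x. (u S x)^2 * iw S x \<partial>P) = (\<integral>x. (u S x)^2 \<partial>P) + (\<integral>x. (u S x)^2 * il S x \<partial>P)" .
    have i2: "(\<integral>x. u S x * (u S x * iw S x) \<partial>P) = (\<integral>x. (u S x)^2 * iw S x \<partial>P)"
      by (simp add: power2_eq_square mult.assoc)
    \<comment> \<open>\<open>U\<close>, \<open>L\<close> and \<open>W\<close> are the squared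
      lengths of \<open>u S\<close> with weights 1, \<open>il S\<close> and \<open>iw S\<close>. The
      first-order gain 2 \<eta> W exceeds the second-order cost \<eta> (U + L) = \<eta> W by \<eta>
      W; the terms with V cancel.\<close>
    have alg: "\<eta> * (U - 2 * (V + W)) + N \<le> Z - \<eta> * W" if "N \<le> Z + 2 * \<eta> * V + \<eta> * L" "W = U + L" for U V W N Z L :: real
      using that by (simp add: algebra_simps)
    show ?thesis unfolding q ur i2 by (rule alg[OF p i])
  qed
  have "obj (pop (Suc m)) = (\<integral>x. ?U x \<partial>P) +
      (\<Sum>S\<in>\<S>. \<integral>x. ?H S x \<partial>P)"
    by (rule objective_admissible[OF pop_admissible])
  also have "\<dots> \<le> (\<integral>x. (residual ?\<alpha> x)^2 \<partial>P) +
      (\<Sum>S\<in>\<S>. (\<integral>x. ?F S x \<partial>P) +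
      (\<integral>x. ?H S x \<partial>P))"
    using 1 unfolding sum.distrib by linarith
  also have "\<dots> \<le> (\<integral>x. (residual ?\<alpha> x)^2 \<partial>P) + (\<Sum>S\<in>\<S>.
      (\<integral>x. (?\<alpha> S x)^2 * il S x \<partial>P) - \<eta> * (\<integral>x. (u S x)^2 * iw S x \<partial>P))"
    by (intro add_left_mono sum_mono 2)
  also have "\<dots> = obj ?\<alpha> - \<eta> * gap ?\<alpha>"
    unfolding objective_admissible[OF \<alpha>] gap_def sum_subtractf sum_distrib_left u_def by simp
  finally show ?thesis .
qed

lemma obj_pop_le: "obj (pop m) \<le> obj (pop 0)"
proof (induction m)
  case (Suc m)
  have "0 \<le> \<eta> * gap (pop m)" using gap_nonneg eta_bounds by simp
  then show ?case using descent[of m] Suc by linarith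
qed simp

text \<open>The descent inequality telescopes and the objective is nonnegative, so the gaps are
  summable.\<close>

lemma gap_tendsto: "(\<lambda>m. gap (pop m)) \<longlonglongrightarrow> 0"
proof -
  have "(\<Sum>m<n. \<eta> * gap (pop m)) \<le> obj (pop 0) - obj (pop n)" for n
  proof (induction n)
    case (Suc n)
    then show ?case using descent[of n] by simp
  qed simp
  then have "(\<Sum>m<n. \<eta> * gap (pop m)) \<le> obj (pop 0)" for n
    using objective_terms_le(1)[OF pop_admissible, of n] by (smt (verit))
  then have "summable (\<lambda>m. \<eta> * gap (pop m))"
    by (intro bounded_imp_summable[where B="obj (pop 0)"])
      (use gap_nonneg eta_bounds in \<open>auto simp: lessThan_Suc_atMost[symmetric] simp del: sum.lessThan_Suc\<close>)
  from summable_LIMSEQ_zero[OF this] show ?thesis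
    using eta_bounds tendsto_mult_left[of "\<lambda>m. \<eta> * gap (pop m)" 0 sequentially "1 / \<eta>"] by simp
qed

section \<open>Comparison with arbitrary competitors\<close>

lemma HS_D:
  assumes "\<beta> \<in> H_prod f \<S>" "S \<in> \<S>"
  shows "integrable P (\<lambda>x. (\<beta> S x)^2)" "integrable P (\<beta> S)" "depends_on S (\<beta> S)"
    "(\<integral>x. \<beta> S x \<partial>P) = 0" "\<beta> S \<in> borel_measurable (leb UNIV)"
proof -
  have "\<beta> S \<in> HS f S" using assms by (auto simp: H_prod_def PiE_iff)
  then have m: "\<beta> S \<in> borel_measurable (leb UNIV)"
    and i: "integrable (leb UNIV) (\<lambda>x. (\<beta> S x)^2 * f x)"
    and d: "depends_on S (\<beta> S)" and z: "(\<integral>x. \<beta> S x * f x \<partial>leb UNIV) = 0"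
    by (auto simp: HS_def Lsq_def)
  show "\<beta> S \<in> borel_measurable (leb UNIV)" "depends_on S (\<beta> S)" by fact+
  show "(\<integral>x. \<beta> S x \<partial>P) = 0" using integral_law[OF f m] z by simp
  show sq: "integrable P (\<lambda>x. (\<beta> S x)^2)"
    using integrable_law[OF f, of "\<lambda>x. (\<beta> S x)^2"] m i by simp
  show "integrable P (\<beta> S)"
    by (rule P.square_integrable_imp_integrable[OF _ sq]) (use m in auto)
qed

text \<open>The first-order lower bound of a convex functional at \<alpha>. Its gradient is
  expressed by \<open>update \<alpha> - \<alpha>\<close>, and the pairing with \<beta> - \<alpha> is
  split by Young's inequality with a free parameter t, since only the length of the update will be
  small.\<close>

lemma convexity:
  assumes \<alpha>: "admissible \<alpha>" and \<beta>: "\<beta> \<in> H_prod f \<S>" and t: "0 < t"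
  shows "obj \<alpha> \<le> obj \<beta> + t * (\<Sum>S\<in>\<S>. \<integral>x. (\<beta> S x - \<alpha> S x)^2 * iw S x \<partial>P) + gap \<alpha> / t"
proof -
  let ?e = "residual \<alpha>"
  define \<gamma> where "\<gamma> S x = \<beta> S x - \<alpha> S x" for S x
  define u where "u S x = update \<alpha> S x - \<alpha> S x" for S x
  have be: "bfun (leb UNIV) ?e" by (rule bfun_residual[OF \<alpha>])
  have i\<gamma>: "integrable P (\<gamma> S)" and d\<gamma>: "depends_on S (\<gamma> S)" and z\<gamma>: "(\<integral>x. \<gamma> S x \<partial>P) = 0"
    and s\<gamma>: "integrable P (\<lambda>x. (\<gamma> S x)^2)" and bu: "bfun (leb UNIV) (u S)"
    if S: "S \<in> \<S>" for S
  proof -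
    note b = HS_D[OF \<beta> S] and p = admissibleD[OF \<alpha> S]
    show "integrable P (\<gamma> S)" unfolding \<gamma>_def using b(2) integrable_bfun[OF p(1)] by simp
    show "depends_on S (\<gamma> S)" using b(3) p(2) by (auto simp: depends_on_def \<gamma>_def)
    show "(\<integral>x. \<gamma> S x \<partial>P) = 0" unfolding \<gamma>_def using b(2,4) p(3) integrable_bfun[OF p(1)] by simp
    have "(\<gamma> S x)^2 = (\<beta> S x)^2 - 2 * (\<beta> S x * \<alpha> S x) + (\<alpha> S x)^2" for x
      by (simp add: \<gamma>_def power2_eq_square algebra_simps)
    then show "integrable P (\<lambda>x. (\<gamma> S x)^2)"
      using b(1) integrable_mult_bfun[OF b(2) p(1)] integrable_bfun[OF bfun_power[OF p(1)]] by simp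
    show "bfun (leb UNIV) (u S)"
      unfolding u_def[abs_def] by (intro bfun_intros p update_admissible[OF \<alpha> S])
  qed
  have m\<gamma>: "\<gamma> S \<in> borel_measurable P" if "S \<in> \<S>" for S using i\<gamma>[OF that] by auto
  have res: "residual \<beta> x = ?e x - (\<Sum>S\<in>\<S>. \<gamma> S x)" for x
    unfolding residual_def \<gamma>_def sum_subtractf by simp
  have i\<gamma>e: "integrable P (\<lambda>x. \<gamma> S x * ?e x)" if "S \<in> \<S>" for S
    by (rule integrable_mult_bfun[OF i\<gamma>[OF that] be])
  have ires: "integrable P (\<lambda>x. (residual \<beta> x)^2)"
  proof (rule Bochner_Integration.integrable_bound)
    let ?G = "\<lambda>x. 2 * (?e x)^2 + 2 * (real (card \<S>) * (\<Sum>S\<in>\<S>. (\<gamma> S x)^2))"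
    show "integrable P (\<lambda>x. ?G x)"
      using s\<gamma> integrable_bfun[OF bfun_power[OF be]] by auto
    show "(\<lambda>x. (residual \<beta> x)^2) \<in> borel_measurable P"
      unfolding res using be m\<gamma> bfun_measurable[OF be] by (auto intro!: borel_measurable_power borel_measurable_diff borel_measurable_sum)
    show "AE x in P. norm ((residual \<beta> x)^2) \<le> norm (?G x)"
    proof (rule AE_I2)
      fix x
      have "(residual \<beta> x)^2 \<le> 2 * (?e x)^2 + 2 * (\<Sum>S\<in>\<S>. \<gamma> S x)^2"
        unfolding res using zero_le_power2[of "?e x + (\<Sum>S\<in>\<S>. \<gamma> S x)"]
        by (simp add: power2_eq_square algebra_simps)
      also have "\<dots> \<le> ?G x"
        using sum_square_le[of "\<lambda>S. \<gamma> S x" \<S>] by simp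
      finally show "norm ((residual \<beta> x)^2) \<le> norm (?G x)"
        by simp
    qed
  qed
  \<comment> \<open>Only the square of the sum of the \<gamma> is dropped here.\<close>
  have 1: "(\<integral>x. (?e x)^2 \<partial>P) - 2 * (\<Sum>S\<in>\<S>. \<integral>x. \<gamma> S x * ?e x \<partial>P) \<le> (\<integral>x. (residual \<beta> x)^2 \<partial>P)"
  proof -
    have "(\<integral>x. (?e x)^2 \<partial>P) - 2 * (\<Sum>S\<in>\<S>. \<integral>x. \<gamma> S x * ?e x \<partial>P) =
        (\<integral>x. (?e x)^2 - 2 * (\<Sum>S\<in>\<S>. \<gamma> S x * ?e x) \<partial>P)"
      using i\<gamma>e integrable_bfun[OF bfun_power[OF be]]
      by (simp add: Bochner_Integration.integral_diff Bochner_Integration.integral_sum)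
    also have "\<dots> \<le> (\<integral>x. (residual \<beta> x)^2 \<partial>P)"
    proof (rule integral_mono)
      show "integrable P (\<lambda>x. (?e x)^2 - 2 * (\<Sum>S\<in>\<S>. \<gamma> S x * ?e x))"
        using i\<gamma>e integrable_bfun[OF bfun_power[OF be]] by auto
      fix x
      show "(?e x)^2 - 2 * (\<Sum>S\<in>\<S>. \<gamma> S x * ?e x) \<le> (residual \<beta> x)^2"
        unfolding res sum_distrib_right[symmetric] using zero_le_power2[of "\<Sum>S\<in>\<S>. \<gamma> S x"]
        by (simp add: power2_eq_square algebra_simps)
    qed (rule ires)
    finally show ?thesis .
  qed
  let ?F = "\<lambda>S. (\<integral>x. (\<beta> S x)^2 * il S x \<partial>P) + t * (\<integral>x. (\<gamma> S x)^2 * iw S x \<partial>P) + (\<integral>x. (u S x)^2 * iw S x \<partial>P) / t"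
  let ?H = "\<lambda>S. (\<integral>x. (\<alpha> S x)^2 * il S x \<partial>P) + 2 * (\<integral>x. \<gamma> S x * ?e x \<partial>P)"
  have 3: "?H S \<le> ?F S" if S: "S \<in> \<S>" for S
  proof -
    note bl = bfun_inverse_lam_rho[OF S] and p = admissibleD[OF \<alpha> S] and biw = bfun_iw[OF S]
    have e: "(\<integral>x. \<gamma> S x * ?e x \<partial>P) = (\<integral>x. \<gamma> S x * (\<alpha> S x * il S x) \<partial>P) +
        (\<integral>x. \<gamma> S x * (u S x * iw S x) \<partial>P)"
      using integral_mult_residual[OF \<alpha> S i\<gamma>[OF S] d\<gamma>[OF S] z\<gamma>[OF S]] by (simp add: u_def)
    have ia: "integrable P (\<lambda>x. (\<alpha> S x)^2 * il S x)" "integrable P (\<lambda>x. \<gamma> S x * (\<alpha> S x * il S x))"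
      "integrable P (\<lambda>x. \<gamma> S x * (u S x * iw S x))"
      "integrable P (\<lambda>x. (\<beta> S x)^2 * il S x)" "integrable P (\<lambda>x. (\<gamma> S x)^2 * iw S x)"
      "integrable P (\<lambda>x. (u S x)^2 * iw S x)"
          apply (intro integrable_bfun bfun_intros p bl)
         apply (intro integrable_mult_bfun i\<gamma>[OF S] bfun_intros p bl)
        apply (intro integrable_mult_bfun i\<gamma>[OF S] bfun_intros bu[OF S] biw)
       apply (intro integrable_mult_bfun HS_D[OF \<beta> S] bl)
      apply (intro integrable_mult_bfun s\<gamma>[OF S] biw)
      apply (intro integrable_bfun bfun_intros bu[OF S] biw)
      done
    have "?H S =
      (\<integral>x. (\<alpha> S x)^2 * il S x + 2 * (\<gamma> S x * (\<alpha> S x * il S x)) + 2 * (\<gamma> S x * (u S x * iw S x)) \<partial>P)"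
      unfolding e using ia by simp
    also have "\<dots> \<le> (\<integral>x. (\<beta> S x)^2 * il S x + t * ((\<gamma> S x)^2 * iw S x) + ((u S x)^2 * iw S x) / t \<partial>P)"
    proof (rule integral_mono)
      fix x
      have l: "0 \<le> il S x" using il_pos[OF S, of x] by simp
      have i: "0 \<le> iw S x" using iw_ge_1[OF S, of x] by linarith
      have "(\<beta> S x)^2 * l = (\<alpha> S x)^2 * l + 2 * (\<gamma> S x * (\<alpha> S x * l)) + (\<gamma> S x)^2 * l" for l
        by (simp add: \<gamma>_def power2_eq_square algebra_simps)
      moreover have "0 \<le> (\<gamma> S x)^2 * il S x" using l by simp
      ultimately have A: "(\<alpha> S x)^2 * il S x + 2 * (\<gamma> S x * (\<alpha> S x * il S x)) \<le> (\<beta> S x)^2 * il S x"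
        by (smt (verit))
      \<comment> \<open>Young's inequality; integrated and summed over \<S>, its last term becomes
        \<open>gap \<alpha> / t\<close>.\<close>
      have "2 * (\<gamma> S x * u S x) \<le> t * (\<gamma> S x)^2 + (u S x)^2 / t"
      proof -
        have "0 \<le> (t * \<gamma> S x - u S x)^2 / t" using t by simp
        also have "\<dots> = t * (\<gamma> S x)^2 + (u S x)^2 / t - 2 * (\<gamma> S x * u S x)"
          using t by (simp add: power2_eq_square field_simps)
        finally show ?thesis by simp
      qed
      from mult_right_mono[OF this i]
      have B: "2 * (\<gamma> S x * (u S x * iw S x)) \<le> t * ((\<gamma> S x)^2 * iw S x) + ((u S x)^2 * iw S x) / t"
        by (simp add: algebra_simps)
      show "(\<alpha> S x)^2 * il S x + 2 * (\<gamma> S x * (\<alpha> S x * il S x)) + 2 * (\<gamma> S x * (u S x * iw S x)) \<le>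
        (\<beta> S x)^2 * il S x + t * ((\<gamma> S x)^2 * iw S x) + ((u S x)^2 * iw S x) / t"
        using A B by linarith
    qed (use ia in auto)
    also have "\<dots> = ?F S"
      using ia by simp
    finally show ?thesis .
  qed
  have "obj \<alpha> = (\<integral>x. (?e x)^2 \<partial>P) + (\<Sum>S\<in>\<S>. \<integral>x. (\<alpha> S x)^2 * il S x \<partial>P)"
    by (rule objective_admissible[OF \<alpha>])
  also have "\<dots> \<le> (\<integral>x. (residual \<beta> x)^2 \<partial>P) +
      (\<Sum>S\<in>\<S>. ?H S)"
    using 1 unfolding sum.distrib sum_distrib_left by linarith
  also have "\<dots> \<le> (\<integral>x. (residual \<beta> x)^2 \<partial>P) + (\<Sum>S\<in>\<S>. ?F S)"
    by (intro add_left_mono sum_mono 3)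
  also have "\<dots> = obj \<beta> + t * (\<Sum>S\<in>\<S>. \<integral>x. (\<gamma> S x)^2 * iw S x \<partial>P) + gap \<alpha> / t"
    using objective_eq[of \<beta>] HS_D[OF \<beta>]
    by (simp add: gap_def u_def sum.distrib sum_distrib_left sum_divide_distrib)
  finally show ?thesis unfolding \<gamma>_def .
qed

abbreviation "efficiency_bound \<equiv> (INF \<alpha>\<in>H_prod f \<S>. obj \<alpha>)"

lemma H_prod_nonempty: "(\<lambda>S\<in>\<S>. \<lambda>x. 0) \<in> H_prod f \<S>"
  by (auto simp: H_prod_def HS_def Lsq_def depends_on_def)

lemma objective_nonneg: "0 \<le> obj \<beta>"
  unfolding objective_def
  by (intro add_nonneg_nonneg sum_nonneg Bochner_Integration.integral_nonneg divide_nonneg_nonneg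
      less_imp_le[OF lam_rho_pos]) auto

lemma bdd_below_obj: "bdd_below (obj ` H_prod f \<S>)"
  by (rule bdd_belowI2[where m=0]) (rule objective_nonneg)

lemma efficiency_bound_le_pop: "efficiency_bound \<le> obj (pop m)"
proof -
  \<comment> \<open>\<open>H_prod\<close> contains only extensional families; the objective does not
    see the values outside \<S>.\<close>
  let ?\<alpha> = "restrict (pop m) \<S>"
  have "?\<alpha> \<in> H_prod f \<S>"
    unfolding H_prod_def
  proof (intro PiE_I)
    fix S assume S: "S \<in> \<S>"
    note p = admissibleD[OF pop_admissible S, of m]
    have "pop m S \<in> borel_measurable (leb UNIV)" using p(1) by auto
    then show "?\<alpha> S \<in> HS f S"
      using S p integrable_bfun[OF bfun_power[OF p(1), of 2]] integral_law[OF f, of "pop m S"]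
        integrable_law[OF f, of "\<lambda>x. (pop m S x)^2"]
      by (simp add: HS_def Lsq_def)
  qed auto
  moreover have "obj ?\<alpha> = obj (pop m)" by (simp add: objective_def)
  ultimately show ?thesis using cINF_lower[OF bdd_below_obj] by metis
qed

text \<open>Fix a competitor within \<epsilon>/3 of the infimum. Its weighted distance to the
  iterates has a bound K that does not depend on m, because the objective, which controls the
  iterates, never rises above its initial value. So t can be chosen from K first, and then m so
  large that \<open>gap (pop m) / t\<close> is small too.\<close>

lemma pop_nearly_optimal:
  assumes \<epsilon>: "0 < \<epsilon>"
  shows "\<exists>m. obj (pop m) \<le> efficiency_bound + \<epsilon> \<and> gap (pop m) \<le> \<epsilon>"
proof -
  have "\<exists>\<beta>\<in>H_prod f \<S>. obj \<beta> < efficiency_bound + \<epsilon> / 3"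
    using cINF_less_iff[OF _ bdd_below_obj, of "efficiency_bound + \<epsilon> / 3"] H_prod_nonempty \<epsilon> by auto
  then obtain \<beta> where \<beta>: "\<beta> \<in> H_prod f \<S>" "obj \<beta> < efficiency_bound + \<epsilon> / 3" by blast
  define K where "K = (\<Sum>S\<in>\<S>. 2 * (\<integral>x. (\<beta> S x)^2 * iw S x \<partial>P) + 2 * ((1 + lam S * C) * obj (pop 0)))"
  let ?F = "\<lambda>S x m. (\<beta> S x - pop m S x)^2 * iw S x"
  have K: "(\<Sum>S\<in>\<S>. \<integral>x. ?F S x m \<partial>P) \<le> K" for m
    unfolding K_def
  proof (intro sum_mono)
    fix S assume S: "S \<in> \<S>"
    note b = HS_D[OF \<beta>(1) S] and p = admissibleD[OF pop_admissible S, of m]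
    have i: "integrable P (\<lambda>x. (\<beta> S x)^2 * iw S x)" "integrable P (\<lambda>x. (pop m S x)^2 * iw S x)"
      by (intro integrable_mult_bfun b bfun_iw[OF S] integrable_bfun bfun_intros p)+
    let ?G = "\<lambda>S x m. 2 * ((\<beta> S x)^2 * iw S x) + 2 * ((pop m S x)^2 * iw S x)"
    have "(\<integral>x. ?F S x m \<partial>P) \<le>
        (\<integral>x. ?G S x m \<partial>P)"
    proof (rule integral_mono_AE')
      show "AE x in P. ?F S x m \<le> ?G S x m"
      proof (rule AE_I2)
        fix x
        have "(\<beta> S x - pop m S x)^2 \<le> 2 * (\<beta> S x)^2 + 2 * (pop m S x)^2"
          using zero_le_power2[of "\<beta> S x + pop m S x"] by (simp add: power2_eq_square algebra_simps)
        then have "?F S x m \<le> (2 * (\<beta> S x)^2 + 2 * (pop m S x)^2) * iw S x"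
          using iw_ge_1[OF S, of x] by (intro mult_right_mono) auto
        then show "?F S x m \<le> ?G S x m"
          by (simp add: algebra_simps)
      qed
      show "AE x in P. 0 \<le> ?G S x m"
        by (intro AE_I2 add_nonneg_nonneg mult_nonneg_nonneg) (auto intro: order_trans[OF _ iw_ge_1[OF S]])
    qed (use i in simp)
    also have "\<dots> = 2 * (\<integral>x. (\<beta> S x)^2 * iw S x \<partial>P) + 2 * (\<integral>x. (pop m S x)^2 * iw S x \<partial>P)"
      using i by simp
    also have "(\<integral>x. (pop m S x)^2 * iw S x \<partial>P) \<le> (1 + lam S * C) * obj (pop m)"
      by (rule integral_square_iw_le[OF pop_admissible S])
    also have "\<dots> \<le> (1 + lam S * C) * obj (pop 0)"
      by (intro mult_left_mono obj_pop_le) (use lam_pos[OF S] cC in auto)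
    finally show "(\<integral>x. ?F S x m \<partial>P) \<le>
      2 * (\<integral>x. (\<beta> S x)^2 * iw S x \<partial>P) + 2 * ((1 + lam S * C) * obj (pop 0))" by simp
  qed
  define t where "t = \<epsilon> / (3 * (\<bar>K\<bar> + 1))"
  have t: "0 < t" using \<epsilon> by (auto simp: t_def)
  have tK: "t * K \<le> \<epsilon> / 3"
  proof -
    have "t * K \<le> t * (\<bar>K\<bar> + 1)" using t by (intro mult_left_mono) auto
    also have "\<dots> = \<epsilon> / 3" by (simp add: t_def field_simps)
    finally show ?thesis .
  qed
  have "\<forall>\<^sub>F m in sequentially. gap (pop m) < min \<epsilon> (t * \<epsilon> / 3)"
    by (rule order_tendstoD[OF gap_tendsto]) (use \<epsilon> t in auto)
  then obtain m where m: "gap (pop m) < \<epsilon>" "gap (pop m) < t * \<epsilon> / 3"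
    using eventually_happens by force
  have "obj (pop m) \<le> obj \<beta> + t * (\<Sum>S\<in>\<S>. \<integral>x. ?F S x m \<partial>P) + gap (pop m) / t"
    by (rule convexity[OF pop_admissible \<beta>(1) t])
  also have "\<dots> \<le> obj \<beta> + t * K + \<epsilon> / 3"
    using t m(2) K[of m] by (intro add_mono mult_left_mono) (auto simp: field_simps)
  finally show ?thesis using \<beta>(2) tK m(1) by (intro exI[of _ m]) auto
qed

end

section \<open>Chi-square distances of local perturbations\<close>

lemma k_fun_bounds: "1 / 2 \<le> k_fun u" "k_fun u \<le> 3 / 2"
  unfolding k_fun_def by (auto simp: inverse_eq_divide field_simps add_pos_pos)

lemma k_fun_0: "k_fun 0 = 1"
  by (simp add: k_fun_def)

lemma k_fun_deriv: "(k_fun has_real_derivative 4 * exp (- 4 * u) / (1 + exp (- 4 * u))^2) (at u)"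
proof -
  have nz: "1 + exp (- 4 * u) \<noteq> 0" using exp_gt_zero[of "- 4 * u"] by linarith
  have d: "((\<lambda>u. 1 + exp (- 4 * u)) has_real_derivative - 4 * exp (- 4 * u)) (at u)"
    by (auto intro!: derivative_eq_intros)
  have "((\<lambda>u. 1 / 2 + inverse (1 + exp (- 4 * u))) has_real_derivative
      0 + - (inverse (1 + exp (- 4 * u)) * (- 4 * exp (- 4 * u)) * inverse (1 + exp (- 4 * u)))) (at u)"
    by (rule DERIV_add[OF DERIV_const DERIV_inverse'[OF d nz]])
  moreover have "0 + - (inverse X * (- 4 * e) * inverse X) = 4 * e / X^2" for X e :: real
    by (simp add: divide_inverse power2_eq_square)
  ultimately show ?thesis
    unfolding k_fun_def[abs_def] by (simp only:)
qed

lemma k_fun_measurable [measurable]: "k_fun \<in> borel_measurable borel"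
  unfolding k_fun_def[abs_def] by measurable

text \<open>With e = exp (-4 z) the derivative is 4 e / (1 + e)^2, which is at most 1 because (1 -
  e)^2 is nonnegative.\<close>

lemma k_fun_lipschitz: "\<bar>k_fun u - 1\<bar> \<le> \<bar>u\<bar>"
proof (rule ccontr)
  assume n: "\<not> ?thesis"
  then have "u \<noteq> 0" by (auto simp: k_fun_0)
  have "\<exists>z. k_fun u - k_fun 0 = u * (4 * exp (- 4 * z) / (1 + exp (- 4 * z))^2)"
  proof (cases "0 < u")
    case True
    then show ?thesis using MVT2[of 0 u k_fun] k_fun_deriv by fastforce
  next
    case False
    with \<open>u \<noteq> 0\<close> have "u < 0" by simp
    then obtain z where "k_fun 0 - k_fun u = (0 - u) * (4 * exp (- 4 * z) / (1 + exp (- 4 * z))^2)"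
      using MVT2[of u 0 k_fun "\<lambda>z. 4 * exp (- 4 * z) / (1 + exp (- 4 * z))^2"] k_fun_deriv by blast
    then show ?thesis by (intro exI[of _ z]) simp
  qed
  then obtain z where z: "k_fun u - 1 = u * (4 * exp (- 4 * z) / (1 + exp (- 4 * z))^2)"
    by (auto simp: k_fun_0)
  define e where "e = exp (- 4 * z)"
  have e: "0 < e" by (simp add: e_def)
  have "4 * e \<le> (1 + e)^2" using zero_le_power2[of "1 - e"] by (simp add: power2_eq_square algebra_simps)
  then have "4 * e / (1 + e)^2 \<le> 1" using e by (simp add: divide_le_eq)
  then have "\<bar>u\<bar> * (4 * e / (1 + e)^2) \<le> \<bar>u\<bar> * 1" by (intro mult_left_mono) auto
  moreover have "\<bar>k_fun u - 1\<bar> = \<bar>u\<bar> * (4 * e / (1 + e)^2)"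
    unfolding z e_def[symmetric] using e by (simp add: abs_mult)
  ultimately show False using n by simp
qed

text \<open>\<open>k_fun\<close> has value 1 and derivative 1 at 0, so to first order it acts like 1
  + u and the perturbing function is the score.\<close>

lemma k_fun_limit: "(\<lambda>n. sqrt (real n) * (k_fun (s / sqrt (real n)) - 1)) \<longlonglongrightarrow> s"
proof (cases "s = 0")
  case True
  then show ?thesis by (simp add: k_fun_0)
next
  case False
  have "(k_fun has_real_derivative 1) (at 0)"
    using k_fun_deriv[of 0] by (simp add: power2_eq_square)
  then have d: "((\<lambda>h. (k_fun h - 1) / h) \<longlongrightarrow> 1) (at 0)"
    unfolding DERIV_def by (simp add: k_fun_0)
  have "(\<lambda>n. s / sqrt (real n)) \<longlonglongrightarrow> 0"
    by real_asymp
  moreover have ev: "\<forall>\<^sub>F n in sequentially. s / sqrt (real n) \<noteq> 0"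
    using eventually_gt_at_top[of 0] by eventually_elim (use False in auto)
  ultimately have "filterlim (\<lambda>n. s / sqrt (real n)) (at 0) sequentially"
    by (simp add: filterlim_at)
  from filterlim_compose[OF d this]
  have "(\<lambda>n. s * ((k_fun (s / sqrt (real n)) - 1) / (s / sqrt (real n)))) \<longlonglongrightarrow> s * 1"
    by (intro tendsto_mult_left)
  moreover have "s * ((k_fun (s / sqrt (real n)) - 1) / (s / sqrt (real n))) =
      sqrt (real n) * (k_fun (s / sqrt (real n)) - 1)" for n
    using False by simp
  ultimately show ?thesis by simp
qed

text \<open>Dividing by the normaliser subtracts the mean of the first-order term. The kernel is
  left general because it will be \<open>k_fun\<close> of the perturbation for complete observations
  and its conditional expectation for observations on \<open>S\<close>.\<close>

lemma (in prob_space) normalised_kernel_limit: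
  assumes K: "\<And>n. K n \<in> borel_measurable M" "\<And>n x. 1 / 2 \<le> K n x"
    and G: "\<And>n x. \<bar>sqrt (real n) * (K n x - 1)\<bar> \<le> G"
    and lim: "\<And>x. (\<lambda>n. sqrt (real n) * (K n x - 1)) \<longlonglongrightarrow> \<psi> x"
    and \<psi>: "bfun M \<psi>" and bK: "\<And>n. bfun M (K n)"
  defines "Z \<equiv> \<lambda>n. \<integral>x. K n x \<partial>M"
  shows "1 / 2 \<le> Z n" "\<bar>sqrt (real n) * (K n x / Z n - 1)\<bar> \<le> 4 * G"
    "(\<lambda>n. sqrt (real n) * (K n x / Z n - 1)) \<longlonglongrightarrow> \<psi> x - (\<integral>x. \<psi> x \<partial>M)"
proof -
  have bK1: "bfun M (\<lambda>x. sqrt (real n) * (K n x - 1))" for n by (intro bfun_intros bK)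
  have Zi: "sqrt (real n) * (Z n - 1) = (\<integral>x. sqrt (real n) * (K n x - 1) \<partial>M)" for n
    using bfun_integrable[OF bK, of n] by (simp add: Z_def prob_space)
  have Zge: "1 / 2 \<le> Z n" for n
  proof -
    have "(\<integral>x. 1 / 2 \<partial>M) \<le> Z n"
      unfolding Z_def using K(2) by (intro bfun_integral_mono bfun_const bK)
    then show ?thesis by (simp add: prob_space)
  qed
  then show "1 / 2 \<le> Z n" .
  have ZG: "\<bar>sqrt (real n) * (Z n - 1)\<bar> \<le> G" for n
    unfolding Zi by (rule integral_abs_le_const_bfun[OF bK1 G])
  have Zlim: "(\<lambda>n. sqrt (real n) * (Z n - 1)) \<longlonglongrightarrow> (\<integral>x. \<psi> x \<partial>M)"
    unfolding Zi
    by (rule integral_dominated_convergence[where w="\<lambda>x. G"])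
      (use G lim \<psi> bK1 in \<open>auto simp: bfun_measurable\<close>)
  have id: "sqrt (real n) * (K n x / Z n - 1) =
      (sqrt (real n) * (K n x - 1) - sqrt (real n) * (Z n - 1)) / Z n" for n x
    using Zge[of n] by (simp add: field_simps)
  \<comment> \<open>The numerator in \<open>id\<close> is at most 2 G in absolute value and
    \<open>Z n\<close> is at least 1/2, hence the 4.\<close>
  show "\<bar>sqrt (real n) * (K n x / Z n - 1)\<bar> \<le> 4 * G"
  proof -
    have "\<bar>sqrt (real n) * (K n x - 1) - sqrt (real n) * (Z n - 1)\<bar> \<le> 2 * G"
      using G[of n x] ZG[of n] by linarith
    moreover have "0 \<le> G" using G[of n x] by linarith
    moreover from this have "4 * G * (1 / 2) \<le> 4 * G * Z n"
      using Zge[of n] by (intro mult_left_mono) auto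
    ultimately show ?thesis
      unfolding id abs_divide using Zge[of n] by (simp add: divide_le_eq)
  qed
  have "(\<lambda>n. Z n - 1) \<longlonglongrightarrow> 0"
  proof (rule Lim_null_comparison[where g="\<lambda>n. G / sqrt (real n)"])
    show "\<forall>\<^sub>F n in sequentially. norm (Z n - 1) \<le> G / sqrt (real n)"
      using eventually_gt_at_top[of 0]
    proof eventually_elim
      case (elim n)
      have "sqrt (real n) * \<bar>Z n - 1\<bar> \<le> G"
        using ZG[of n] by (metis abs_mult abs_of_nonneg of_nat_0_le_iff real_sqrt_ge_zero)
      then show ?case using elim by (simp add: pos_le_divide_eq mult.commute)
    qed
    show "(\<lambda>n. G / sqrt (real n)) \<longlonglongrightarrow> 0" by real_asymp
  qed
  then have Z1: "Z \<longlonglongrightarrow> 1" using LIM_zero_iff by blast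
  show "(\<lambda>n. sqrt (real n) * (K n x / Z n - 1)) \<longlonglongrightarrow> \<psi> x - (\<integral>x. \<psi> x \<partial>M)"
    unfolding id using tendsto_divide[OF tendsto_diff[OF lim Zlim] Z1] by simp
qed

text \<open>As p and q integrate to one, the integral of p^2/q exceeds 1 by the integral of (p -
  q)^2/q. Scaled by n this is the square of a difference of first-order terms, which have centred
  limits and are dominated since q stays away from 0.\<close>

lemma (in prob_space) chi_square_limit:
  assumes K: "\<And>n x. 1 / 2 \<le> K n x" and bK: "\<And>n. bfun M (K n)"
    and G: "\<And>n x. \<bar>sqrt (real n) * (K n x - 1)\<bar> \<le> G"
    and lim: "\<And>x. (\<lambda>n. sqrt (real n) * (K n x - 1)) \<longlonglongrightarrow> \<tau> * \<psi> x"
    and K': "\<And>n x. 1 / 2 \<le> K' n x" "\<And>n x. K' n x \<le> 3 / 2" and bK': "\<And>n. bfun M (K' n)"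
    and G': "\<And>n x. \<bar>sqrt (real n) * (K' n x - 1)\<bar> \<le> G'"
    and lim': "\<And>x. (\<lambda>n. sqrt (real n) * (K' n x - 1)) \<longlonglongrightarrow> \<sigma> * \<psi> x"
    and \<psi>: "bfun M \<psi>"
  defines "p \<equiv> \<lambda>n x. K n x / (\<integral>x. K n x \<partial>M)" and "q \<equiv> \<lambda>n x. K' n x / (\<integral>x. K' n x \<partial>M)"
  shows "(\<lambda>n. real n * ((\<integral>x. (p n x)^2 / q n x \<partial>M) - 1)) \<longlonglongrightarrow> (\<tau> - \<sigma>)^2 * variance \<psi>"
proof -
  have b: "bfun M (\<lambda>x. \<tau> * \<psi> x)" "bfun M (\<lambda>x. \<sigma> * \<psi> x)" by (intro bfun_intros \<psi>)+
  note P0 = normalised_kernel_limit[OF bfun_measurable[OF bK] K G lim b(1) bK]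
  note Q0 = normalised_kernel_limit[OF bfun_measurable[OF bK'] K'(1) G' lim' b(2) bK']
  have P: "1 / 2 \<le> (\<integral>x. K n x \<partial>M)" "\<bar>sqrt (real n) * (p n x - 1)\<bar> \<le> 4 * G"
    "(\<lambda>n. sqrt (real n) * (p n x - 1)) \<longlonglongrightarrow> \<tau> * \<psi> x - (\<integral>x. \<tau> * \<psi> x \<partial>M)" for n x
    unfolding p_def by (rule P0)+
  have Q: "1 / 2 \<le> (\<integral>x. K' n x \<partial>M)" "\<bar>sqrt (real n) * (q n x - 1)\<bar> \<le> 4 * G'"
    "(\<lambda>n. sqrt (real n) * (q n x - 1)) \<longlonglongrightarrow> \<sigma> * \<psi> x - (\<integral>x. \<sigma> * \<psi> x \<partial>M)" for n x
    unfolding q_def by (rule Q0)+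
  let ?Z = "\<lambda>n. \<integral>x. K n x \<partial>M" and ?Z' = "\<lambda>n. \<integral>x. K' n x \<partial>M"
  have pos: "0 < ?Z n" "0 < ?Z' n" for n using P(1)[of n] Q(1)[of n] by linarith+
  have Z'le: "?Z' n \<le> 3 / 2" for n
    by (rule integral_le_const_bfun[OF bK' K'(2)])
  \<comment> \<open>The lower bound 1/2 of the kernel divided by the upper bound 3/2 of its
    mean.\<close>
  have qge: "1 / 3 \<le> q n x" for n x
    unfolding q_def using K'(1)[of n x] Z'le[of n] pos[of n] by (simp add: field_simps)
  have bp: "bfun M (p n)" and bq: "bfun M (q n)" for n
    unfolding p_def q_def by (intro bfun_intros bK bK')+
  have ip: "(\<integral>x. p n x \<partial>M) = 1" and iq: "(\<integral>x. q n x \<partial>M) = 1" for n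
    unfolding p_def q_def using pos[of n] by auto
  have bpq: "bfun M (\<lambda>x. (p n x)^2 / q n x)" "bfun M (\<lambda>x. (p n x - q n x)^2 / q n x)" for n
    by (intro bfun_divide_ge[OF _ bq qge] bfun_intros bp bq, simp)+
  let ?D = "\<lambda>n x. sqrt (real n) * (p n x - 1) - sqrt (real n) * (q n x - 1)"
  have eq: "real n * ((\<integral>x. (p n x)^2 / q n x \<partial>M) - 1) = (\<integral>x. (?D n x)^2 / q n x \<partial>M)" for n
  proof -
    have "(p n x)^2 / q n x - 2 * p n x + q n x = (p n x - q n x)^2 / q n x" for x
      using qge[of n x] by (simp add: power2_eq_square field_simps)
    then have "(\<integral>x. (p n x - q n x)^2 / q n x \<partial>M) = (\<integral>x. (p n x)^2 / q n x - 2 * p n x + q n x \<partial>M)"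
      by simp
    also have "\<dots> = (\<integral>x. (p n x)^2 / q n x \<partial>M) - 1"
      using bfun_integrable[OF bpq(1)] bfun_integrable[OF bp] bfun_integrable[OF bq] ip iq by simp
    finally have "real n * ((\<integral>x. (p n x)^2 / q n x \<partial>M) - 1) = real n * (\<integral>x. (p n x - q n x)^2 / q n x \<partial>M)"
      by simp
    also have "\<dots> = (\<integral>x. real n * ((p n x - q n x)^2 / q n x) \<partial>M)"
      by (rule integral_mult_right_zero[symmetric])
    also have "\<dots> = (\<integral>x. (?D n x)^2 / q n x \<partial>M)"
      by (simp add: power_mult_distrib flip: right_diff_distrib)
    finally show ?thesis .
  qed
  let ?F = "\<lambda>x. (\<tau> * \<psi> x - (\<integral>x. \<tau> * \<psi> x \<partial>M)) - (\<sigma> * \<psi> x - (\<integral>x. \<sigma> * \<psi> x \<partial>M))"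
  have "(\<lambda>n. \<integral>x. (?D n x)^2 / q n x \<partial>M) \<longlonglongrightarrow>
     (\<integral>x. (?F x)^2 / 1 \<partial>M)"
  proof (rule integral_dominated_convergence[where w="\<lambda>x. 3 * (4 * G + 4 * G')^2"])
    have lq: "(\<lambda>n. q n x) \<longlonglongrightarrow> 1" for x
    proof -
      have "(\<lambda>n. q n x - 1) \<longlonglongrightarrow> 0"
      proof (rule Lim_null_comparison[where g="\<lambda>n. 4 * G' / sqrt (real n)"])
        show "\<forall>\<^sub>F n in sequentially. norm (q n x - 1) \<le> 4 * G' / sqrt (real n)"
          using eventually_gt_at_top[of 0]
        proof eventually_elim
          case (elim n)
          have "sqrt (real n) * \<bar>q n x - 1\<bar> \<le> 4 * G'"
            using Q(2)[of n x] by (metis abs_mult abs_of_nonneg of_nat_0_le_iff real_sqrt_ge_zero)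
          then show ?case using elim by (simp add: pos_le_divide_eq mult.commute)
        qed
        show "(\<lambda>n. 4 * G' / sqrt (real n)) \<longlonglongrightarrow> 0" by real_asymp
      qed
      then show ?thesis using LIM_zero_iff by blast
    qed
    show "AE x in M. (\<lambda>n. (?D n x)^2 / q n x) \<longlonglongrightarrow>
        (?F x)^2 / 1"
      by (intro AE_I2 tendsto_divide tendsto_power tendsto_diff P(3) Q(3) lq) simp
    show "AE x in M. norm ((?D n x)^2 / q n x) \<le> 3 * (4 * G + 4 * G')^2" for n
    proof (rule AE_I2)
      fix x
      have "\<bar>?D n x\<bar> \<le> 4 * G + 4 * G'" using P(2)[of n x] Q(2)[of n x] by linarith
      then have "(?D n x)^2 \<le> (4 * G + 4 * G')^2" by (metis abs_ge_zero power2_abs power_mono)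
      then have "(?D n x)^2 / q n x \<le> (4 * G + 4 * G')^2 / (1 / 3)"
        using qge[of n x] by (intro frac_le) auto
      moreover have "0 \<le> (?D n x)^2 / q n x" using qge[of n x] by (intro divide_nonneg_nonneg) auto
      ultimately show "norm ((?D n x)^2 / q n x) \<le> 3 * (4 * G + 4 * G')^2" by simp
    qed
    show "(\<lambda>x. (?D n x)^2 / q n x) \<in> borel_measurable M" for n
      using bfun_measurable[OF bp[of n]] bfun_measurable[OF bq[of n]] by measurable
    show "(\<lambda>x. (?F x)^2 / 1) \<in> borel_measurable M"
      using bfun_measurable[OF \<psi>] by measurable
  qed simp
  moreover have "(\<integral>x. (?F x)^2 / 1 \<partial>M) =
      (\<tau> - \<sigma>)^2 * variance \<psi>"
  proof -
    have "((\<tau> * \<psi> x - \<tau> * E) - (\<sigma> * \<psi> x - \<sigma> * E))^2 / 1 = (\<tau> - \<sigma>)^2 * (\<psi> x - E)^2" for x and E :: real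
    proof -
      have "(\<tau> * \<psi> x - \<tau> * E) - (\<sigma> * \<psi> x - \<sigma> * E) = (\<tau> - \<sigma>) * (\<psi> x - E)"
        by (simp add: algebra_simps)
      then show ?thesis by (simp add: power_mult_distrib)
    qed
    then show ?thesis by simp
  qed
  ultimately show ?thesis unfolding eq by simp
qed

text \<open>A discrete form of the van Trees inequality for finitely many models: consecutive means
  of the estimator differ by at most the root of risk times chi-square distance.\<close>

lemma (in prob_space) chained_chapman_robbins:
  assumes L: "\<And>k. bfun M (L k)" "\<And>k x. e k \<le> L k x" "\<And>k. 0 < e k" "\<And>k. (\<integral>x. L k x \<partial>M) = 1"
    and T: "T \<in> borel_measurable M"
    and risk: "\<And>k. k \<le> K \<Longrightarrow> integrable M (\<lambda>x. (T x - t k)^2 * L k x)"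
      "\<And>k. k \<le> K \<Longrightarrow> (\<integral>x. (T x - t k)^2 * L k x \<partial>M) \<le> R"
    and chi: "\<And>k. k < K \<Longrightarrow> (\<integral>x. (L (Suc k) x)^2 / L k x \<partial>M) \<le> 1 + \<chi>'"
    and pos: "0 < R" "0 < \<chi>'"
  shows "t K - t 0 \<le> sqrt R * (2 + real K * sqrt \<chi>')"
proof -
  have Lpos: "0 < L k x" for k x using L(2)[of k x] L(3)[of k] by linarith
  \<comment> \<open>Since \<open>L k\<close> is bounded below by \<open>e k > 0\<close>, a finite
    risk in one model makes T square integrable under M, and then integrable under every model of
    the chain.\<close>
  have i2: "integrable M (\<lambda>x. (T x - t k)^2)" if "k \<le> K" for k
  proof (rule Bochner_Integration.integrable_bound)
    show "integrable M (\<lambda>x. 1 / e k * ((T x - t k)^2 * L k x))" using risk(1)[OF that] by simp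
    show "AE x in M. norm ((T x - t k)^2) \<le> norm (1 / e k * ((T x - t k)^2 * L k x))"
    proof (rule AE_I2)
      fix x
      have "(T x - t k)^2 * e k \<le> (T x - t k)^2 * L k x" using L(2) by (intro mult_left_mono) auto
      then have "(T x - t k)^2 \<le> 1 / e k * ((T x - t k)^2 * L k x)" using L(3)[of k] by (simp add: field_simps)
      then show "norm ((T x - t k)^2) \<le> norm (1 / e k * ((T x - t k)^2 * L k x))"
        using order_trans[OF zero_le_power2] by (metis abs_of_nonneg real_norm_def zero_le_power2)
    qed
  qed (use T in measurable)
  have i1: "integrable M (\<lambda>x. T x - t k)" if "k \<le> K" for k
    by (rule square_integrable_imp_integrable[OF _ i2[OF that]]) (use T in measurable)
  have iTL: "integrable M (\<lambda>x. (T x - t k) * L j x)" if "k \<le> K" for j k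
  proof -
    obtain B where B: "\<And>x. \<bar>L j x\<bar> \<le> B" "0 \<le> B" using bfun_bound[OF L(1)] by blast
    show ?thesis
    proof (rule Bochner_Integration.integrable_bound)
      show "integrable M (\<lambda>x. B * \<bar>T x - t k\<bar>)" using i1[OF that] by simp
      show "AE x in M. norm ((T x - t k) * L j x) \<le> norm (B * \<bar>T x - t k\<bar>)"
        using B by (intro AE_I2) (auto simp: abs_mult mult.commute intro!: mult_mono)
    qed (use T bfun_measurable[OF L(1)] in measurable)
  qed
  \<comment> \<open>The mean of T in the k-th model, computed from \<open>T - t 0\<close>, whose
    integrability is at hand.\<close>
  define m where "m k = (\<integral>x. (T x - t 0) * L k x \<partial>M) + t 0" for k
  have m_eq: "m j - t k = (\<integral>x. (T x - t k) * L j x \<partial>M)" if "k \<le> K" for j k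
  proof -
    have "(\<integral>x. (T x - t k) * L j x \<partial>M) = (\<integral>x. (T x - t 0) * L j x + (t 0 - t k) * L j x \<partial>M)"
      by (rule Bochner_Integration.integral_cong) (auto simp: algebra_simps)
    also have "\<dots> = (\<integral>x. (T x - t 0) * L j x \<partial>M) + (t 0 - t k)"
      using iTL[of 0 j] bfun_integrable[OF L(1)] L(4) by simp
    finally show ?thesis by (simp add: m_def)
  qed
  define \<rho> \<xi> where "\<rho> = sqrt R" and "\<xi> = sqrt \<chi>'"
  have pr: "0 < \<rho>" "0 < \<xi>" "R = \<rho>^2" "\<chi>' = \<xi>^2" using pos by (auto simp: \<rho>_def \<xi>_def)
  have bias: "\<bar>m k - t k\<bar> \<le> \<rho>" if k: "k \<le> K" for k
  proof -
    have one: "\<sigma> * (m k - t k) \<le> \<rho>" if \<sigma>: "\<sigma> = 1 \<or> \<sigma> = -1" for \<sigma> :: real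
    proof -
      have "\<sigma> * (m k - t k) = (\<integral>x. \<sigma> * ((T x - t k) * L k x) \<partial>M)"
        unfolding m_eq[OF k] by simp
      \<comment> \<open>Young's inequality with weights adapted to the risk bound takes the place of
        Cauchy-Schwarz, as T may be unbounded.\<close>
      also have "\<dots> \<le> (\<integral>x. 1 / (2 * \<rho>) * ((T x - t k)^2 * L k x) + \<rho> / 2 * L k x \<partial>M)"
      proof (rule integral_mono)
        show "integrable M (\<lambda>x. \<sigma> * ((T x - t k) * L k x))" using iTL[OF k] by simp
        show "integrable M (\<lambda>x. 1 / (2 * \<rho>) * ((T x - t k)^2 * L k x) + \<rho> / 2 * L k x)"
          using risk(1)[OF k] bfun_integrable[OF L(1)] by simp
        fix x
        have "0 \<le> (\<sigma> * (T x - t k) - \<rho>)^2" by simp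
        then have "2 * \<rho> * (\<sigma> * (T x - t k)) \<le> (T x - t k)^2 + \<rho>^2"
          using \<sigma> by (auto simp: power2_eq_square algebra_simps)
        then have "\<sigma> * (T x - t k) \<le> 1 / (2 * \<rho>) * (T x - t k)^2 + \<rho> / 2"
          using pr by (simp add: field_simps power2_eq_square)
        from mult_right_mono[OF this less_imp_le[OF Lpos[of k x]]]
        show "\<sigma> * ((T x - t k) * L k x) \<le> 1 / (2 * \<rho>) * ((T x - t k)^2 * L k x) + \<rho> / 2 * L k x"
          by (simp add: algebra_simps)
      qed
      also have "\<dots> = 1 / (2 * \<rho>) * (\<integral>x. (T x - t k)^2 * L k x \<partial>M) + \<rho> / 2"
        using risk(1)[OF k] bfun_integrable[OF L(1)] L(4) by simp
      also have "\<dots> \<le> 1 / (2 * \<rho>) * \<rho>^2 + \<rho> / 2"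
        using risk(2)[OF k] pr by (intro add_right_mono mult_left_mono) auto
      also have "\<dots> = \<rho>" using pr by (simp add: power2_eq_square field_simps)
      finally show ?thesis .
    qed
    show ?thesis using one[of 1] one[of "-1"] by (simp add: abs_le_iff)
  qed
  have step: "m (Suc k) - m k \<le> \<rho> * \<xi>" if k: "k < K" for k
  proof -
    define Q where "Q x = (L (Suc k) x - L k x)^2 / L k x" for x
    have bD: "bfun M (\<lambda>x. (L (Suc k) x - L k x)^2 / L k x)" "bfun M (\<lambda>x. (L (Suc k) x)^2 / L k x)"
      by (intro bfun_divide_ge[OF _ L(1) L(2) L(3)] bfun_intros L(1))+
    have bQ: "bfun M Q" using bD(1) by (simp add: Q_def[abs_def])
    have D: "(\<integral>x. Q x \<partial>M) \<le> \<xi>^2"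
    proof -
      have "(L (Suc k) x - L k x)^2 / L k x = (L (Suc k) x)^2 / L k x - 2 * L (Suc k) x + L k x" for x
        using Lpos[of k x] by (simp add: power2_eq_square field_simps)
      then have "(\<integral>x. (L (Suc k) x - L k x)^2 / L k x \<partial>M) = (\<integral>x. (L (Suc k) x)^2 / L k x \<partial>M) - 1"
        using bfun_integrable[OF bD(2)] bfun_integrable[OF L(1)] L(4) by simp
      then show ?thesis using chi[OF k] pr unfolding Q_def by simp
    qed
    have kK: "k \<le> K" using k by simp
    have "m (Suc k) - m k = (m (Suc k) - t k) - (m k - t k)" by simp
    also have "\<dots> = (\<integral>x. (T x - t k) * L (Suc k) x - (T x - t k) * L k x \<partial>M)"
      unfolding m_eq[OF kK] using iTL[OF kK] by simp
    also have "\<dots> \<le> (\<integral>x. \<xi> / (2 * \<rho>) * ((T x - t k)^2 * L k x) +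
        \<rho> / (2 * \<xi>) * Q x \<partial>M)"
    proof (rule integral_mono)
      show "integrable M (\<lambda>x. (T x - t k) * L (Suc k) x - (T x - t k) * L k x)"
        using iTL[OF kK] by simp
      show "integrable M (\<lambda>x. \<xi> / (2 * \<rho>) * ((T x - t k)^2 * L k x) +
        \<rho> / (2 * \<xi>) * Q x)"
        using risk(1)[OF kK] bfun_integrable[OF bQ] by simp
      fix x
      define U W l where "U = T x - t k" and "W = L (Suc k) x - L k x" and "l = L k x"
      have l: "0 < l" using Lpos by (simp add: l_def)
      have "0 \<le> (\<xi> * l * U - \<rho> * W)^2 / (2 * \<rho> * \<xi> * l)" using pr l by simp
      also have "\<dots> = \<xi> / (2 * \<rho>) * (U^2 * l) + \<rho> / (2 * \<xi>) * (W^2 / l) - U * W"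
        using pr l by (simp add: power2_eq_square field_simps)
      finally have "U * W \<le> \<xi> / (2 * \<rho>) * (U^2 * l) + \<rho> / (2 * \<xi>) * (W^2 / l)" by simp
      moreover have "(T x - t k) * L (Suc k) x - (T x - t k) * L k x = U * W"
        by (simp add: U_def W_def algebra_simps)
      ultimately show "(T x - t k) * L (Suc k) x - (T x - t k) * L k x \<le>
        \<xi> / (2 * \<rho>) * ((T x - t k)^2 * L k x) + \<rho> / (2 * \<xi>) * Q x"
        by (simp add: U_def W_def l_def Q_def)
    qed
    also have "\<dots> = \<xi> / (2 * \<rho>) * (\<integral>x. (T x - t k)^2 * L k x \<partial>M) +
        \<rho> / (2 * \<xi>) * (\<integral>x. Q x \<partial>M)"
      using risk(1)[OF kK] bfun_integrable[OF bQ] by simp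
    also have "\<dots> \<le> \<xi> / (2 * \<rho>) * \<rho>^2 + \<rho> / (2 * \<xi>) * \<xi>^2"
      using risk(2)[OF kK] D pr by (intro add_mono mult_left_mono) auto
    also have "\<dots> = \<rho> * \<xi>" using pr by (simp add: power2_eq_square field_simps)
    finally show ?thesis .
  qed
  have "m k - m 0 \<le> real k * (\<rho> * \<xi>)" if "k \<le> K" for k
    using that
  proof (induction k)
    case (Suc k)
    then show ?case using step[of k] by (simp add: algebra_simps)
  qed simp
  \<comment> \<open>The two summands \<rho> are the biases at the ends of the chain; they give the 2
    in the claim.\<close>
  from this[of K] bias[of K] bias[of 0] have "t K - t 0 \<le> \<rho> + \<rho> + real K * (\<rho> * \<xi>)" by simp
  then show ?thesis by (simp add: \<rho>_def \<xi>_def algebra_simps)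
qed

text \<open>For small \<delta> the chi-square term is about \<delta>^2 I, so the left side is about
  2 sqrt v + K \<delta> sqrt (v I). The strict inequality v I < D^2 leaves room for the
  approximation, and a large K absorbs the constant 2 sqrt v.\<close>

lemma exists_grid_for_bound:
  fixes D I v :: real
  assumes D: "0 < D" and I: "0 \<le> I" and v: "0 \<le> v" and gap: "v * I < D^2"
  shows "\<exists>\<delta>>0. \<exists>\<iota>>0. \<exists>K::nat. sqrt v * (2 + real K * sqrt (exp (\<delta>^2 * I) - 1 + \<iota>)) < real K * (\<delta> * D)"
proof -
  obtain I' where I': "I < I'" "v * I' < D^2"
  proof (cases "v = 0")
    case True
    then show ?thesis using that[of "I + 1"] D by simp
  next
    case False
    with v have vp: "0 < v" by simp
    with gap have "I < D^2 / v" by (simp add: field_simps)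
    then obtain z where "I < z" "z < D^2 / v" using dense by blast
    then show ?thesis using that[of z] vp by (simp add: field_simps)
  qed
  have "((\<lambda>y. (exp y - 1) / y) \<longlongrightarrow> 1) (at (0::real))"
    using DERIV_exp[of "0::real"] unfolding DERIV_def by simp
  have "\<exists>\<delta>>0. exp (\<delta>^2 * I) - 1 < \<delta>^2 * I'"
  proof -
    \<comment> \<open>The first entry of the minimum gives y \<le> 1, so that exp y \<le> 1 + y +
      y^2; the second makes y^2 smaller than \<delta>^2 (I' - I).\<close>
    define \<delta> where "\<delta> = sqrt (min (1 / (I + 1)) ((I' - I) / (2 * (I + 1)^2)))"
    have sq: "\<delta>^2 = min (1 / (I + 1)) ((I' - I) / (2 * (I + 1)^2))"
      unfolding \<delta>_def using I I'(1) by (subst real_sqrt_pow2) auto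
    have \<delta>: "0 < \<delta>" unfolding \<delta>_def using I I'(1) by auto
    define y where "y = \<delta>^2 * I"
    have y0: "0 \<le> y" using I by (simp add: y_def)
    have "y \<le> 1 / (I + 1) * I" unfolding y_def sq using I by (intro mult_right_mono) auto
    also have "\<dots> \<le> 1" using I by (simp add: field_simps)
    finally have y1: "y \<le> 1" .
    have "exp y \<le> 1 + y + y^2" by (rule exp_bound[OF y0 y1])
    moreover have "y^2 < \<delta>^2 * (I' - I)"
    proof -
      have "y^2 = \<delta>^2 * (\<delta>^2 * I^2)" by (simp add: y_def power2_eq_square)
      also have "\<delta>^2 * I^2 \<le> (I' - I) / (2 * (I + 1)^2) * (I + 1)^2"
        unfolding sq using I I'(1) by (intro mult_mono power_mono) auto
      also have "\<dots> = (I' - I) / 2" using I by simp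
      also have "\<dots> < I' - I" using I'(1) by simp
      finally show ?thesis using \<delta> by simp
    qed
    ultimately have "exp (\<delta>^2 * I) - 1 < \<delta>^2 * I'" by (simp add: y_def algebra_simps)
    with \<delta> show ?thesis by blast
  qed
  then obtain \<delta> where \<delta>: "0 < \<delta>" "exp (\<delta>^2 * I) - 1 < \<delta>^2 * I'" by blast
  define \<iota> where "\<iota> = \<delta>^2 * I' - (exp (\<delta>^2 * I) - 1)"
  have \<iota>: "0 < \<iota>" using \<delta> by (simp add: \<iota>_def)
  have sq: "sqrt (exp (\<delta>^2 * I) - 1 + \<iota>) = \<delta> * sqrt I'"
    using \<delta>(1) by (simp add: \<iota>_def real_sqrt_mult)
  have "sqrt v * sqrt I' < D"
  proof -
    have "sqrt (v * I') < sqrt (D^2)" using I'(2) by (rule real_sqrt_less_mono)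
    then show ?thesis using D by (simp add: real_sqrt_mult)
  qed
  then have "0 < \<delta> * (D - sqrt v * sqrt I')" using \<delta>(1) by simp
  then obtain K :: nat where "sqrt v * 2 < real K * (\<delta> * (D - sqrt v * sqrt I'))"
    using reals_Archimedean3 by blast
  then have "sqrt v * (2 + real K * sqrt (exp (\<delta>^2 * I) - 1 + \<iota>)) < real K * (\<delta> * D)"
    unfolding sq by (simp add: algebra_simps)
  then show ?thesis using \<delta>(1) \<iota> by blast
qed

section \<open>Densities and integrals on product spaces\<close>

lemma PiM_density:
  fixes p :: "'i \<Rightarrow> 'a \<Rightarrow> real"
  assumes I: "finite I" and M: "\<And>i. i \<in> I \<Longrightarrow> prob_space (M i)"
    and p: "\<And>i. i \<in> I \<Longrightarrow> p i \<in> borel_measurable (M i)" "\<And>i x. i \<in> I \<Longrightarrow> 0 \<le> p i x"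
    and D: "\<And>i. i \<in> I \<Longrightarrow> prob_space (density (M i) (\<lambda>x. ennreal (p i x)))"
  shows "PiM I (\<lambda>i. density (M i) (\<lambda>x. ennreal (p i x))) =
    density (PiM I M) (\<lambda>x. ennreal (\<Prod>i\<in>I. p i (x i)))"
proof -
  obtain M' where M': "product_prob_space M'" "PiM I M = PiM I M'" "\<And>i. i \<in> I \<Longrightarrow> M' i = M i"
    using PiM_as_product_prob_space[of I M] M by blast
  interpret M': product_prob_space M' by fact
  let ?D = "\<lambda>i. density (M i) (\<lambda>x. ennreal (p i x))"
  obtain N where N: "product_prob_space N" "PiM I ?D = PiM I N" "\<And>i. i \<in> I \<Longrightarrow> N i = ?D i"
    using PiM_as_product_prob_space[of I ?D] D by blast
  interpret N: product_prob_space N by fact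
  have sets: "sets (PiM I N) = sets (PiM I M')"
    using N(3) M'(3) by (intro sets_PiM_cong) auto
  have [measurable]: "(\<lambda>x. \<Prod>i\<in>I. p i (x i)) \<in> borel_measurable (PiM I M')"
    using p(1) M'(3) by (intro borel_measurable_prod) (auto intro!: measurable_PiM_component_rev)
  let ?F = "density (PiM I M') (\<lambda>x. ennreal (\<Prod>i\<in>I. p i (x i)))"
  have "?F = PiM I N"
  proof (rule N.PiM_eqI[OF I])
    show "sets (?F) = PiM I N"
      using sets by simp
    fix A assume "\<And>i. i \<in> I \<Longrightarrow> A i \<in> sets (N i)"
    then have A: "\<And>i. i \<in> I \<Longrightarrow> A i \<in> sets (M' i)" using N(3) M'(3) by auto
    have Am: "Pi\<^sub>E I A \<in> sets (PiM I M')" using A I by (intro sets_PiM_I_finite) auto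
    have "emeasure (?F) (Pi\<^sub>E I A) =
        (\<integral>\<^sup>+x. ennreal (\<Prod>i\<in>I. p i (x i)) * indicator (Pi\<^sub>E I A) x \<partial>PiM I M')"
      by (rule emeasure_density) (use Am in auto)
    also have "\<dots> = (\<integral>\<^sup>+x. (\<Prod>i\<in>I. ennreal (p i (x i)) * indicator (A i) (x i)) \<partial>PiM I M')"
    proof (rule nn_integral_cong)
      fix x assume x: "x \<in> space (PiM I M')"
      have "(indicator (Pi\<^sub>E I A) x :: ennreal) = (\<Prod>i\<in>I. indicator (A i) (x i))"
      proof (cases "x \<in> Pi\<^sub>E I A")
        case True
        then have "(\<Prod>i\<in>I. indicator (A i) (x i) :: ennreal) = (\<Prod>i\<in>I. 1)"
          by (intro prod.cong) (auto simp: PiE_iff)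
        then show ?thesis using True by simp
      next
        case False
        then obtain i where "i \<in> I" "x i \<notin> A i" using x by (auto simp: PiE_iff space_PiM)
        then show ?thesis using False I by (auto intro!: prod_zero[symmetric] bexI[of _ i])
      qed
      then show "ennreal (\<Prod>i\<in>I. p i (x i)) * indicator (Pi\<^sub>E I A) x =
        (\<Prod>i\<in>I. ennreal (p i (x i)) * indicator (A i) (x i))"
        using p(2) by (simp add: prod.distrib prod_ennreal)
    qed
    also have "\<dots> = (\<Prod>i\<in>I. \<integral>\<^sup>+x. ennreal (p i x) * indicator (A i) x \<partial>M' i)"
      by (rule M'.product_nn_integral_prod[OF I])
        (use p(1) M'(3) A in \<open>auto intro!: borel_measurable_times_ennreal\<close>)
    also have "\<dots> = (\<Prod>i\<in>I. emeasure (N i) (A i))"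
      using p(1) M'(3) A N(3) by (intro prod.cong refl) (simp add: emeasure_density)
    finally show "emeasure (?F) (Pi\<^sub>E I A) =
      (\<Prod>i\<in>I. emeasure (N i) (A i))" .
  qed
  then show ?thesis using M'(2) N(2) by simp
qed

lemma integral_pair_mult:
  assumes "prob_space M1" "prob_space M2" "bfun M1 f" "bfun M2 g"
  shows "(\<integral>z. f (fst z) * g (snd z) \<partial>(M1 \<Otimes>\<^sub>M M2)) = (\<integral>x. f x \<partial>M1) * (\<integral>y. g y \<partial>M2)"
proof -
  interpret M1: prob_space M1 by fact
  interpret M2: prob_space M2 by fact
  interpret pair_prob_space M1 M2 ..
  have "bfun (M1 \<Otimes>\<^sub>M M2) (\<lambda>z. f (fst z) * g (snd z))"
    by (intro bfun_intros bfun_comp[OF assms(3)] bfun_comp[OF assms(4)]) auto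
  then have "integrable (M1 \<Otimes>\<^sub>M M2) (\<lambda>(x, y). f x * g y)"
    using P.bfun_integrable by (simp add: case_prod_unfold)
  from integral_fst'[OF this[unfolded case_prod_unfold]]
  have "(\<integral>z. f (fst z) * g (snd z) \<partial>(M1 \<Otimes>\<^sub>M M2)) = (\<integral>x. \<integral>y. f x * g y \<partial>M2 \<partial>M1)"
    by simp
  then show ?thesis by simp
qed

section \<open>The likelihood of perturbed data\<close>

lemma (in prob_space) prob_space_density_bfun:
  assumes "bfun M p" "\<And>x. 0 \<le> p x" "(\<integral>x. p x \<partial>M) = 1"
  shows "prob_space (density M (\<lambda>x. ennreal (p x)))"
proof (rule prob_spaceI)
  have "(\<integral>\<^sup>+x. ennreal (p x) \<partial>M) = ennreal (\<integral>x. p x \<partial>M)"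
    by (rule nn_integral_eq_integral[OF bfun_integrable[OF assms(1)]]) (use assms(2) in simp)
  then show "emeasure (density M (\<lambda>x. ennreal (p x))) (space (density M (\<lambda>x. ennreal (p x)))) = 1"
    using assms bfun_measurable[OF assms(1)]
    by (simp add: emeasure_density cong: nn_integral_cong)
qed

lemma prob_space_pair:
  assumes "prob_space M1" "prob_space M2" shows "prob_space (M1 \<Otimes>\<^sub>M M2)"
proof -
  interpret M1: prob_space M1 by fact
  interpret M2: prob_space M2 by fact
  interpret pair_prob_space M1 M2 ..
  show ?thesis by unfold_locales
qed

context missing_data
begin

abbreviation "Q \<equiv> biased_law r f"

lemma Q_eq: "S \<in> \<S> \<Longrightarrow> Q S = distr (density P (\<lambda>x. ennreal (\<rho> S x))) (leb S) (\<lambda>x. restrict x S)"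
  by (rule biased_law_eq[OF f r_meas r_dep less_imp_le[OF r_pos]])

lemma sets_biased_law [simp, measurable_cong]: "sets (biased_law r g S) = sets (leb S)"
  by (simp add: biased_law_def)

lemma integral_Q:
  assumes S: "S \<in> \<S>" and \<phi>[measurable]: "\<phi> \<in> borel_measurable (leb UNIV)" and d: "depends_on S \<phi>"
  shows "(\<integral>x. \<phi> x \<partial>Q S) = (\<integral>x. \<rho> S x * \<phi> x \<partial>P)"
proof -
  have [measurable]: "\<phi> \<in> borel_measurable (leb S)"
    by (rule depends_on_measurable_leb[OF \<phi> d])
  have "(\<integral>x. \<phi> x \<partial>Q S) = (\<integral>x. \<phi> (restrict x S) \<partial>density P (\<lambda>x. ennreal (\<rho> S x)))"
    unfolding Q_eq[OF S] by (rule integral_distr) auto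
  also have "\<dots> = (\<integral>x. \<rho> S x * \<phi> (restrict x S) \<partial>P)"
    by (subst integral_density)
      (use bfun_measurable[OF bfun_rho[OF S]] less_imp_le[OF rho_pos[OF S]] in auto)
  finally show ?thesis using d by (simp add: depends_on_restrict)
qed

lemma prob_space_Q: assumes S: "S \<in> \<S>" shows "prob_space (Q S)"
proof -
  have "prob_space (density P (\<lambda>x. ennreal (\<rho> S x)))"
    by (rule P.prob_space_density_bfun)
      (use bfun_rho[OF S] bfun_P less_imp_le[OF rho_pos[OF S]] integral_rho[OF S] in auto)
  then show ?thesis unfolding Q_eq[OF S] by (rule prob_space.prob_space_distr) simp
qed

lemma bfun_Q:
  assumes "bfun (leb UNIV) \<phi>" "depends_on S \<phi>" shows "bfun (Q S) \<phi>"
proof -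
  obtain B where B: "\<And>x. \<bar>\<phi> x\<bar> \<le> B" using bfun_bound[OF assms(1)] by blast
  have "bfun (leb S) \<phi>"
    by (rule bfunI[OF depends_on_measurable_leb[OF bfun_measurable[OF assms(1)] assms(2)] B])
  then show ?thesis using bfun_cong_sets[OF sets_biased_law] by blast
qed

section \<open>Perturbed laws of a single observation\<close>

definition tilt :: "(('d \<Rightarrow> real) \<Rightarrow> real) \<Rightarrow> real" where
  "tilt g = (\<integral>x. k_fun (g x) \<partial>P)"

definition tiltS :: "(('d \<Rightarrow> real) \<Rightarrow> real) \<Rightarrow> 'd set \<Rightarrow> real" where
  "tiltS g S = (\<integral>x. \<rho> S x * k_fun (g x) \<partial>P)"

definition pX :: "(('d \<Rightarrow> real) \<Rightarrow> real) \<Rightarrow> ('d \<Rightarrow> real) \<Rightarrow> real" where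
  "pX g x = k_fun (g x) / tilt g"

text \<open>Density ratio of one observation on \<open>S\<close> between the perturbed and the
  original model: only X_S is seen, so the tilt enters through its conditional mean.
  \<open>tiltS\<close> is the normaliser, the mean of the tilt under the biased law.\<close>

definition pY :: "(('d \<Rightarrow> real) \<Rightarrow> real) \<Rightarrow> 'd set \<Rightarrow> ('d \<Rightarrow> real) \<Rightarrow> real" where
  "pY g S x = E S (\<lambda>x. k_fun (g x)) x / tiltS g S"

definition lik :: "nat \<Rightarrow> ('d set \<Rightarrow> nat) \<Rightarrow> (('d \<Rightarrow> real) \<Rightarrow> real) \<Rightarrow> 'd data \<Rightarrow> real" where
  "lik n N g z = (\<Prod>i\<in>{1..n}. pX g (fst z i)) * (\<Prod>S\<in>\<S>. \<Prod>j\<in>{1..N S}. pY g S (snd z S j))"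

context
  fixes g :: "('d \<Rightarrow> real) \<Rightarrow> real"
  assumes g: "g \<in> borel_measurable (leb UNIV)"
begin

lemma bfun_k: "bfun (leb UNIV) (\<lambda>x. k_fun (g x))"
proof (rule bfunI[where B="3/2"])
  show "\<bar>k_fun (g x)\<bar> \<le> 3 / 2" for x using k_fun_bounds[of "g x"] by simp
qed (use g in measurable)

lemma tilt_bounds: "1 / 2 \<le> tilt g" "tilt g \<le> 3 / 2"
proof -
  show "tilt g \<le> 3 / 2" unfolding tilt_def
    by (rule P.integral_le_const_bfun) (use bfun_k bfun_P k_fun_bounds in auto)
  have "(\<integral>x. 1 / 2 \<partial>P) \<le> tilt g" unfolding tilt_def
    by (rule P.bfun_integral_mono) (use bfun_k bfun_P k_fun_bounds bfun_const in auto)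
  then show "1 / 2 \<le> tilt g" by simp
qed

lemma E_k_bounds: assumes S: "S \<in> \<S>"
  shows "1 / 2 \<le> E S (\<lambda>x. k_fun (g x)) x" "E S (\<lambda>x. k_fun (g x)) x \<le> 3 / 2"
proof -
  interpret K: prob_space "cond S x" by (rule kappa_prob[OF S])
  note b = bfun_section[OF S bfun_k, of x]
  show "E S (\<lambda>x. k_fun (g x)) x \<le> 3 / 2" unfolding E_def
    by (rule K.integral_le_const_bfun[OF b k_fun_bounds(2)])
  have "(\<integral>y. 1 / 2 \<partial>cond S x) \<le> E S (\<lambda>x. k_fun (g x)) x" unfolding E_def
    by (rule K.bfun_integral_mono[OF bfun_const b k_fun_bounds(1)])
  then show "1 / 2 \<le> E S (\<lambda>x. k_fun (g x)) x" by (simp add: K.prob_space)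
qed

lemma tiltS_eq: "S \<in> \<S> \<Longrightarrow> tiltS g S = (\<integral>x. E S (\<lambda>x. k_fun (g x)) x \<partial>Q S)"
  unfolding tiltS_def
  using integral_Q[OF _ bfun_measurable[OF bfun_E[OF _ bfun_k]] E_dep]
    integral_mult_E_bfun[OF _ bfun_k bfun_rho rho_dep] by simp

lemma tiltS_bounds: assumes S: "S \<in> \<S>" shows "1 / 2 \<le> tiltS g S" "tiltS g S \<le> 3 / 2"
proof -
  interpret QS: prob_space "Q S" by (rule prob_space_Q[OF S])
  have b: "bfun (Q S) (E S (\<lambda>x. k_fun (g x)))" by (rule bfun_Q[OF bfun_E[OF S bfun_k] E_dep])
  show "tiltS g S \<le> 3 / 2" unfolding tiltS_eq[OF S]
    by (rule QS.integral_le_const_bfun[OF b E_k_bounds(2)[OF S]])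
  have "(\<integral>x. 1 / 2 \<partial>Q S) \<le> tiltS g S" unfolding tiltS_eq[OF S]
    by (rule QS.bfun_integral_mono[OF bfun_const b E_k_bounds(1)[OF S]])
  then show "1 / 2 \<le> tiltS g S" by (simp add: QS.prob_space)
qed

lemma bfun_pX: "bfun (leb UNIV) (pX g)" and pX_ge: "1 / 3 \<le> pX g x" and integral_pX: "(\<integral>x. pX g x \<partial>P) = 1"
proof -
  show "bfun (leb UNIV) (pX g)" unfolding pX_def[abs_def] by (intro bfun_intros bfun_k)
  show "1 / 3 \<le> pX g x" unfolding pX_def using tilt_bounds k_fun_bounds(1)[of "g x"]
    by (simp add: field_simps)
  show "(\<integral>x. pX g x \<partial>P) = 1" unfolding pX_def using tilt_bounds(1) by (simp flip: tilt_def)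
qed

lemma pY_dep: "depends_on S (pY g S)"
  using E_dep[of S "\<lambda>x. k_fun (g x)"] unfolding pY_def depends_on_def by metis

lemma bfun_pY: "S \<in> \<S> \<Longrightarrow> bfun (leb UNIV) (pY g S)"
  unfolding pY_def[abs_def] by (intro bfun_intros bfun_E bfun_k)

lemma bfun_Q_pY: "S \<in> \<S> \<Longrightarrow> bfun (Q S) (pY g S)"
  by (rule bfun_Q[OF bfun_pY pY_dep])

lemma pY_ge: "S \<in> \<S> \<Longrightarrow> 1 / 3 \<le> pY g S x"
  unfolding pY_def using tiltS_bounds[of S] E_k_bounds[of S x] by (simp add: field_simps)

lemma integral_pY: "S \<in> \<S> \<Longrightarrow> (\<integral>x. pY g S x \<partial>Q S) = 1"
  unfolding pY_def using tiltS_bounds(1)[of S] by (simp flip: tiltS_eq)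

lemma perturb_eq: "perturb f g x = pX g x * f x"
  unfolding perturb_def pX_def tilt_def
  using integral_law[OF f bfun_measurable[OF bfun_k]] by simp

lemma prob_density_perturb: "prob_density (perturb f g)"
  unfolding prob_density_def
proof (intro conjI allI)
  note m = bfun_measurable[OF bfun_pX] measurable_prob_density[OF f]
  have nnf: "0 \<le> f x" for x using f by (simp add: prob_density_def)
  have nnp: "0 \<le> pX g x" for x using pX_ge[of x] by linarith
  show "perturb f g \<in> borel_measurable (leb UNIV)"
    unfolding perturb_eq[abs_def] using m by measurable
  show "0 \<le> perturb f g x" for x unfolding perturb_eq using nnf nnp by simp
  have "(\<integral>\<^sup>+x. ennreal (perturb f g x) \<partial>leb UNIV) = (\<integral>\<^sup>+x. ennreal (pX g x) \<partial>P)"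
    unfolding law_def perturb_eq using m nnf nnp
    by (subst nn_integral_density) (auto simp: ennreal_mult' mult.commute)
  also have "\<dots> = ennreal (\<integral>x. pX g x \<partial>P)"
    by (rule nn_integral_eq_integral[OF integrable_bfun[OF bfun_pX]]) (use nnp in simp)
  finally show "(\<integral>\<^sup>+x. ennreal (perturb f g x) \<partial>leb UNIV) = 1" using integral_pX by simp
qed

lemma law_perturb: "law (perturb f g) = density P (\<lambda>x. ennreal (pX g x))"
proof -
  note m = bfun_measurable[OF bfun_pX] measurable_prob_density[OF f]
  have nnf: "0 \<le> f x" for x using f by (simp add: prob_density_def)
  show ?thesis unfolding law_def perturb_eq using m nnf
    by (subst density_density_eq) (auto simp: ennreal_mult' mult.commute)
qed

lemma integral_law_perturb:
  assumes "\<phi> \<in> borel_measurable (leb UNIV)"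
  shows "(\<integral>x. \<phi> x \<partial>law (perturb f g)) = (\<integral>x. pX g x * \<phi> x \<partial>P)"
proof -
  have nnp: "0 \<le> pX g x" for x using pX_ge[of x] by linarith
  show ?thesis unfolding law_perturb
    using bfun_measurable[OF bfun_pX] nnp assms by (subst integral_density) auto
qed

text \<open>The weight r_S is kept while its normalising integral moves with the density; this
  produces the quotient of the two normalisers.\<close>

lemma r_bar_perturb: assumes S: "S \<in> \<S>"
  shows "r_bar r (perturb f g) S x = \<rho> S x * tilt g / tiltS g S"
proof -
  have "(\<integral>x. r S x \<partial>law (perturb f g)) = (\<integral>x. R S / tilt g * (\<rho> S x * k_fun (g x)) \<partial>P)"
    unfolding integral_law_perturb[OF r_meas[OF S]]
    by (intro Bochner_Integration.integral_cong refl) (simp add: pX_def r_eq[OF S] mult_ac)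
  also have "\<dots> = R S / tilt g * tiltS g S" unfolding tiltS_def by (rule integral_mult_right_zero)
  finally have "r_bar r (perturb f g) S x = r S x / (R S / tilt g * tiltS g S)"
    using r_bar_eq[of "perturb f g" r S, OF prob_density_perturb r_meas[OF S] r_dep[OF S]] by simp
  then show ?thesis unfolding r_eq[OF S] using R_pos[OF S] by simp
qed

text \<open>On the full space, perturbing and then biasing multiplies the law of X by the normalised
  weight times \<open>k_fun (g x) / tiltS g S\<close>. Testing against sets of x_S replaces
  \<open>k_fun (g x)\<close> by its conditional expectation, because all other factors depend on x_S
  only.\<close>

lemma biased_law_perturb: assumes S: "S \<in> \<S>"
  shows "biased_law r (perturb f g) S = density (Q S) (\<lambda>x. ennreal (pY g S x))"
proof (rule measure_eqI)
  fix A assume "A \<in> sets (biased_law r (perturb f g) S)"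
  then have A[measurable]: "A \<in> sets (leb S)" by simp
  have nnp: "0 \<le> pX g x" for x using pX_ge[of x] by linarith
  have nnr: "0 \<le> \<rho> S x" for x using rho_pos[OF S, of x] by linarith
  have t: "0 < tilt g" "0 < tiltS g S" using tilt_bounds tiltS_bounds[OF S] by linarith+
  note [measurable] = bfun_measurable[OF bfun_pX] bfun_measurable[OF bfun_rho[OF S]]
    bfun_measurable[OF bfun_pY[OF S]] g
  have [measurable]: "pY g S \<in> borel_measurable (leb S)"
    by (rule depends_on_measurable_leb[OF _ pY_dep]) measurable
  let ?i = "\<lambda>x. indicator A (restrict x S) :: real"
  have bi: "bfun (leb UNIV) ?i" by (rule bfunI[where B=1]) (auto simp: indicator_def)
  have di: "depends_on S (\<lambda>x. ?i x * \<rho> S x)"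
    using rho_dep[OF S] unfolding depends_on_def by (metis restrict_restrict Int_absorb)
  let ?F = "\<lambda>x. ?i x * \<rho> S x * k_fun (g x) / tiltS g S"
  have "emeasure (biased_law r (perturb f g) S) A =
      (\<integral>\<^sup>+x. ennreal (?F x) \<partial>P)"
  proof -
    have "emeasure (biased_law r (perturb f g) S) A = (\<integral>\<^sup>+x. indicator A x \<partial>biased_law r (perturb f g) S)"
      by simp
    also have "\<dots> = (\<integral>\<^sup>+x. ennreal (r_bar r (perturb f g) S x) * indicator A (restrict x S) \<partial>law (perturb f g))"
      unfolding biased_law_eq[of "perturb f g" r S, OF prob_density_perturb r_meas[OF S] r_dep[OF S] less_imp_le[OF r_pos[OF S]]]
      by (subst nn_integral_distr, simp_all, subst nn_integral_density)
        (auto simp: r_bar_perturb[OF S])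
    also have "\<dots> = (\<integral>\<^sup>+x. ennreal (pX g x) * (ennreal (r_bar r (perturb f g) S x) * indicator A (restrict x S)) \<partial>P)"
      unfolding law_perturb by (subst nn_integral_density) (auto simp: r_bar_perturb[OF S])
    also have "\<dots> = (\<integral>\<^sup>+x. ennreal (?F x) \<partial>P)"
    proof (rule nn_integral_cong)
      fix x
      have "pX g x * r_bar r (perturb f g) S x = \<rho> S x * k_fun (g x) / tiltS g S"
        unfolding r_bar_perturb[OF S] pX_def using t by (simp add: field_simps)
      then show "ennreal (pX g x) * (ennreal (r_bar r (perturb f g) S x) * indicator A (restrict x S)) =
        ennreal (?F x)"
        using nnp[of x] by (auto simp: indicator_def ennreal_mult'[symmetric])
    qed
    finally show ?thesis .
  qed
  also have "\<dots> = ennreal (\<integral>x. ?F x \<partial>P)"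
    by (rule nn_integral_eq_integral, intro integrable_bfun bfun_intros bi bfun_rho[OF S] bfun_k, rule AE_I2)
      (use t nnr k_fun_bounds(1) in \<open>auto simp: indicator_def intro!: divide_nonneg_nonneg mult_nonneg_nonneg order_trans[OF _ k_fun_bounds(1)]\<close>)
  also have "(\<integral>x. ?F x \<partial>P) =
      (\<integral>x. ?i x * \<rho> S x * E S (\<lambda>x. k_fun (g x)) x / tiltS g S \<partial>P)"
    using integral_mult_E_bfun[OF S bfun_k bfun_mult[OF bi bfun_rho[OF S]] di] by simp
  also have "ennreal \<dots> = (\<integral>\<^sup>+x. ennreal (?i x * \<rho> S x * pY g S x) \<partial>P)"
    unfolding pY_def times_divide_eq_right
    by (rule nn_integral_eq_integral[symmetric], intro integrable_bfun bfun_intros bi bfun_rho[OF S] bfun_E[OF S] bfun_k, rule AE_I2)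
      (use t nnr in \<open>auto simp: indicator_def intro!: divide_nonneg_nonneg mult_nonneg_nonneg order_trans[OF _ E_k_bounds(1)[OF S]]\<close>)
  also have "\<dots> = (\<integral>\<^sup>+x. ennreal (\<rho> S x) * (ennreal (pY g S (restrict x S)) * indicator A (restrict x S)) \<partial>P)"
    by (intro nn_integral_cong)
      (use nnr in \<open>auto simp: indicator_def ennreal_mult'[symmetric] depends_on_restrict[OF pY_dep]\<close>)
  also have "\<dots> = (\<integral>\<^sup>+x. ennreal (pY g S x) * indicator A x \<partial>Q S)"
    unfolding Q_eq[OF S] by (subst nn_integral_distr, simp_all, subst nn_integral_density) auto
  also have "\<dots> = emeasure (density (Q S) (\<lambda>x. ennreal (pY g S x))) A"
    by (subst emeasure_density) auto
  finally show "emeasure (biased_law r (perturb f g) S) A = emeasure (density (Q S) (\<lambda>x. ennreal (pY g S x))) A" .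
qed simp

end

section \<open>The joint law of the data and its likelihood ratios\<close>

lemma prob_space_data_X: "prob_space (\<Pi>\<^sub>M i\<in>I. P)"
  by (intro prob_space_PiM P.prob_space_axioms)

lemma prob_space_data_Y: "S \<in> \<S> \<Longrightarrow> prob_space (\<Pi>\<^sub>M j\<in>J. Q S)"
  by (intro prob_space_PiM prob_space_Q)

lemma prob_space_data_YY: "prob_space (\<Pi>\<^sub>M S\<in>\<S>. \<Pi>\<^sub>M j\<in>J S. Q S)"
  by (intro prob_space_PiM prob_space_Q)

lemma prob_space_data: "prob_space (data_law \<S> r n N f)"
  unfolding data_law_def by (intro prob_space_pair prob_space_data_X prob_space_data_YY)

lemma sets_data_law: "sets (data_law \<S> r n N g) = sets (data_space \<S> n N)"
  unfolding data_law_def data_space_def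
  by (intro sets_pair_measure_cong sets_PiM_cong) auto

lemma bfun_X_prod:
  assumes "bfun (leb UNIV) p" shows "bfun (\<Pi>\<^sub>M i\<in>I. P) (\<lambda>x. \<Prod>i\<in>I. p (x i))"
  by (intro bfun_prod P.bfun_PiM_component) (use assms bfun_P in auto)

lemma bfun_Y_prod:
  assumes "\<And>S. S \<in> \<S> \<Longrightarrow> bfun (Q S) (q S)"
  shows "bfun (\<Pi>\<^sub>M S\<in>\<S>. \<Pi>\<^sub>M j\<in>J S. Q S) (\<lambda>y. \<Prod>S\<in>\<S>. \<Prod>j\<in>J S. q S (y S j))"
proof (intro bfun_prod)
  fix S j assume Sj: "S \<in> \<S>" "j \<in> J S"
  have "(\<lambda>y. y S j) \<in> (\<Pi>\<^sub>M S\<in>\<S>. \<Pi>\<^sub>M j\<in>J S. Q S) \<rightarrow>\<^sub>M Q S"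
    by (rule measurable_compose[where f="\<lambda>y. y S" and g="\<lambda>z. z j"])
      (use Sj in \<open>auto intro: measurable_component_singleton\<close>)
  then show "bfun (\<Pi>\<^sub>M S\<in>\<S>. \<Pi>\<^sub>M j\<in>J S. Q S) (\<lambda>y. q S (y S j))"
    by (rule bfun_comp[OF assms[OF Sj(1)]])
qed

lemma integral_data_prod:
  assumes p: "bfun (leb UNIV) p" and q: "\<And>S. S \<in> \<S> \<Longrightarrow> bfun (Q S) (q S)"
  shows "(\<integral>z. (\<Prod>i\<in>{1..n}. p (fst z i)) * (\<Prod>S\<in>\<S>. \<Prod>j\<in>{1..N S}. q S (snd z S j)) \<partial>data_law \<S> r n N f) =
    (\<integral>x. p x \<partial>P) ^ n * (\<Prod>S\<in>\<S>. (\<integral>x. q S x \<partial>Q S) ^ N S)"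
proof -
  let ?F = "\<lambda>S. \<Pi>\<^sub>M j\<in>{1..N S}. Q S"
  have "(\<integral>z. (\<Prod>i\<in>{1..n}. p (fst z i)) * (\<Prod>S\<in>\<S>. \<Prod>j\<in>{1..N S}. q S (snd z S j)) \<partial>data_law \<S> r n N f) =
    (\<integral>x. (\<Prod>i\<in>{1..n}. p (x i)) \<partial>(\<Pi>\<^sub>M i\<in>{1..n}. P)) *
    (\<integral>y. (\<Prod>S\<in>\<S>. \<Prod>j\<in>{1..N S}. q S (y S j)) \<partial>(\<Pi>\<^sub>M S\<in>\<S>. ?F S))"
    unfolding data_law_def
  proof (rule integral_pair_mult)
    show "prob_space (\<Pi>\<^sub>M i\<in>{1..n}. P)" by (rule prob_space_data_X)
    show "prob_space (\<Pi>\<^sub>M S\<in>\<S>. ?F S)" by (rule prob_space_data_YY)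
    show "bfun (\<Pi>\<^sub>M i\<in>{1..n}. P) (\<lambda>x. \<Prod>i\<in>{1..n}. p (x i))" by (rule bfun_X_prod[OF p])
    show "bfun (\<Pi>\<^sub>M S\<in>\<S>. ?F S) (\<lambda>y. \<Prod>S\<in>\<S>. \<Prod>j\<in>{1..N S}. q S (y S j))"
      by (rule bfun_Y_prod[OF q])
  qed
  also have "(\<integral>x. (\<Prod>i\<in>{1..n}. p (x i)) \<partial>(\<Pi>\<^sub>M i\<in>{1..n}. P)) = (\<integral>x. p x \<partial>P) ^ n"
    using integral_PiM_prod[of "{1..n}" "\<lambda>_. P" "\<lambda>_. p"] p bfun_P P.prob_space_axioms by simp
  also have "(\<integral>y. (\<Prod>S\<in>\<S>. \<Prod>j\<in>{1..N S}. q S (y S j)) \<partial>(\<Pi>\<^sub>M S\<in>\<S>. ?F S)) =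
     (\<Prod>S\<in>\<S>. \<integral>y. (\<Prod>j\<in>{1..N S}. q S (y j)) \<partial>(?F S))"
  proof (rule integral_PiM_prod[OF finite_S prob_space_data_Y])
    fix S assume S: "S \<in> \<S>"
    show "bfun (?F S) (\<lambda>y. \<Prod>j\<in>{1..N S}. q S (y j))"
      by (intro bfun_prod bfun_comp[OF q[OF S]]) auto
  qed
  also have "\<dots> = (\<Prod>S\<in>\<S>. (\<integral>x. q S x \<partial>Q S) ^ N S)"
  proof (rule prod.cong[OF refl])
    fix S assume S: "S \<in> \<S>"
    show "(\<integral>y. (\<Prod>j\<in>{1..N S}. q S (y j)) \<partial>(?F S)) = (\<integral>x. q S x \<partial>Q S) ^ N S"
      using integral_PiM_prod[of "{1..N S}" "\<lambda>_. Q S" "\<lambda>_. q S"] q[OF S] prob_space_Q[OF S] by simp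
  qed
  finally show ?thesis .
qed

text \<open>\<open>PiM_density\<close> is used on both levels of the nested product, within each
  sample on \<open>S\<close> and then across \<S>, before the independent complete sample is paired
  with it.\<close>

lemma data_law_perturb:
  assumes g: "g \<in> borel_measurable (leb UNIV)"
  shows "data_law \<S> r n N (perturb f g) = density (data_law \<S> r n N f) (\<lambda>z. ennreal (lik n N g z))"
proof -
  have nnX: "0 \<le> pX g x" for x using pX_ge[OF g, of x] by linarith
  have nnY: "0 \<le> pY g S x" if "S \<in> \<S>" for S x using pY_ge[OF g that, of x] by linarith
  have pdX: "prob_space (density P (\<lambda>x. ennreal (pX g x)))"
    using prob_space_law[OF prob_density_perturb[OF g]] by (simp add: law_perturb[OF g])
  have pdY: "prob_space (density (Q S) (\<lambda>x. ennreal (pY g S x)))" if S: "S \<in> \<S>" for S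
    by (rule prob_space.prob_space_density_bfun[OF prob_space_Q[OF S] bfun_Q_pY[OF g S] nnY[OF S] integral_pY[OF g S]])
  let ?X = "\<Pi>\<^sub>M i\<in>{1..n}. P" and ?Y = "\<Pi>\<^sub>M S\<in>\<S>. \<Pi>\<^sub>M j\<in>{1..N S}. Q S"
  let ?fX = "\<lambda>x. ennreal (\<Prod>i\<in>{1..n}. pX g (x i))"
  let ?fS = "\<lambda>S y. \<Prod>j\<in>{1..N S}. pY g S (y j)"
  let ?fY = "\<lambda>y. ennreal (\<Prod>S\<in>\<S>. \<Prod>j\<in>{1..N S}. pY g S (y S j))"
  have X: "(\<Pi>\<^sub>M i\<in>{1..n}. law (perturb f g)) = density ?X ?fX"
    unfolding law_perturb[OF g]
    by (rule PiM_density) (use nnX pdX P.prob_space_axioms bfun_pX[OF g] bfun_P in auto)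
  let ?F = "\<lambda>S. \<Pi>\<^sub>M j\<in>{1..N S}. biased_law r (perturb f g) S"
  let ?G = "\<lambda>S. density (\<Pi>\<^sub>M j\<in>{1..N S}. Q S) (\<lambda>y. ennreal (?fS S y))"
  have Y1: "(?F S) = ?G S"
    if S: "S \<in> \<S>" for S
    unfolding biased_law_perturb[OF g S]
    by (rule PiM_density) (use nnY[OF S] pdY[OF S] prob_space_Q[OF S] bfun_Q_pY[OF g S] in auto)
  have p1: "prob_space (?G S)" if S: "S \<in> \<S>" for S
    unfolding Y1[OF S, symmetric]
    by (intro prob_space_PiM) (use pdY[OF S] in \<open>simp add: biased_law_perturb[OF g S]\<close>)
  have "(\<Pi>\<^sub>M S\<in>\<S>. ?F S) =
      (\<Pi>\<^sub>M S\<in>\<S>. ?G S)"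
    by (rule PiM_cong) (use Y1 in auto)
  also have "\<dots> = density ?Y ?fY"
  proof (rule PiM_density[OF finite_S prob_space_data_Y])
    fix S assume S: "S \<in> \<S>"
    show "?fS S \<in> borel_measurable (\<Pi>\<^sub>M j\<in>{1..N S}. Q S)"
      by (intro bfun_measurable bfun_prod bfun_comp[OF bfun_Q_pY[OF g S]]) auto
    show "0 \<le> ?fS S y" for y by (intro prod_nonneg) (use nnY[OF S] in auto)
  qed (use p1 in auto)
  finally have Y: "(\<Pi>\<^sub>M S\<in>\<S>. ?F S) = density ?Y ?fY" .
  have mX: "?fX \<in> borel_measurable ?X"
    by (rule measurable_compose[OF bfun_measurable[OF bfun_X_prod[OF bfun_pX[OF g]]] measurable_ennreal])
  have mY: "?fY \<in> borel_measurable ?Y"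
    by (rule measurable_compose[OF bfun_measurable[OF bfun_Y_prod[OF bfun_Q_pY[OF g]]] measurable_ennreal])
  have sY: "sigma_finite_measure (density ?Y ?fY)"
  proof -
    have "prob_space (\<Pi>\<^sub>M S\<in>\<S>. ?F S)"
      by (intro prob_space_PiM) (use pdY in \<open>simp add: biased_law_perturb[OF g]\<close>)
    then show ?thesis unfolding Y by (rule prob_space_imp_sigma_finite)
  qed
  show ?thesis
    unfolding data_law_def X Y
    by (subst pair_measure_density[OF mX mY prob_space_imp_sigma_finite[OF prob_space_data_YY] sY])
      (auto simp: lik_def case_prod_unfold ennreal_mult' prod_nonneg nnX intro!: arg_cong2[where f=density])
qed

lemma bfun_data_prod:
  assumes p: "bfun (leb UNIV) p" and q: "\<And>S. S \<in> \<S> \<Longrightarrow> bfun (Q S) (q S)"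
  shows "bfun (data_law \<S> r n N f) (\<lambda>z. (\<Prod>i\<in>{1..n}. p (fst z i)) * (\<Prod>S\<in>\<S>. \<Prod>j\<in>{1..N S}. q S (snd z S j)))"
  unfolding data_law_def
  by (intro bfun_mult bfun_comp[OF bfun_X_prod[OF p]] bfun_comp[OF bfun_Y_prod[OF q]]) auto

lemma bfun_lik: "g \<in> borel_measurable (leb UNIV) \<Longrightarrow> bfun (data_law \<S> r n N f) (lik n N g)"
  unfolding lik_def[abs_def] by (intro bfun_data_prod bfun_pX bfun_Q_pY)

lemma integral_lik: "g \<in> borel_measurable (leb UNIV) \<Longrightarrow> (\<integral>z. lik n N g z \<partial>data_law \<S> r n N f) = 1"
  unfolding lik_def
  by (subst integral_data_prod) (auto intro: bfun_pX bfun_Q_pY simp: integral_pX integral_pY)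

text \<open>The bound is exponentially small in the sample sizes; what counts is that it is positive
  and uniform in the data, as \<open>chained_chapman_robbins\<close> requires.\<close>

lemma lik_ge:
  assumes "g \<in> borel_measurable (leb UNIV)"
  shows "(\<Prod>i\<in>{1..n}. 1 / 3) * (\<Prod>S\<in>\<S>. \<Prod>j\<in>{1..N S}. 1 / 3) \<le> lik n N g z"
  unfolding lik_def
  by (intro mult_mono prod_mono prod_nonneg conjI)
    (use pX_ge[OF assms] pY_ge[OF assms] in \<open>auto intro!: prod_nonneg order_trans[OF _ pX_ge[OF assms]]\<close>)

text \<open>One plus the chi-square divergence is multiplicative over independent
  observations.\<close>

lemma integral_lik_ratio:
  assumes g: "g \<in> borel_measurable (leb UNIV)" "g' \<in> borel_measurable (leb UNIV)"
  shows "(\<integral>z. (lik n N g' z)^2 / lik n N g z \<partial>data_law \<S> r n N f) =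
    (\<integral>x. (pX g' x)^2 / pX g x \<partial>P) ^ n * (\<Prod>S\<in>\<S>. (\<integral>x. (pY g' S x)^2 / pY g S x \<partial>Q S) ^ N S)"
proof -
  have "(lik n N g' z)^2 / lik n N g z = (\<Prod>i\<in>{1..n}. (pX g' (fst z i))^2 / pX g (fst z i)) *
     (\<Prod>S\<in>\<S>. \<Prod>j\<in>{1..N S}. (pY g' S (snd z S j))^2 / pY g S (snd z S j))" for z
    unfolding lik_def by (simp add: power_mult_distrib prod_dividef flip: prod_power_distrib)
  then show ?thesis
    by (simp only:) (intro integral_data_prod bfun_divide_ge[OF _ bfun_pX[OF g(1)] pX_ge[OF g(1)]]
      bfun_divide_ge[OF _ bfun_Q_pY[OF g(1)] pY_ge[OF g(1)]] bfun_power bfun_pX bfun_Q_pY g; simp)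
qed

lemma scaled_risk_perturb:
  assumes g: "g \<in> borel_measurable (leb UNIV)" and est: "est \<in> estimators \<S> n N"
  shows "scaled_risk \<S> a r n N (perturb f g) est =
    (\<integral>\<^sup>+z. ennreal (real n * ((est z - theta a (perturb f g))^2 * lik n N g z)) \<partial>data_law \<S> r n N f)"
proof -
  have e: "est \<in> borel_measurable (data_law \<S> r n N f)"
    using est unfolding estimators_def by (simp add: measurable_cong_sets[OF sets_data_law refl])
  have "0 < (\<Prod>i\<in>{1..n}. 1 / 3 :: real) * (\<Prod>S\<in>\<S>. \<Prod>j\<in>{1..N S}. 1 / 3)"
    by (intro mult_pos_pos prod_pos) auto
  then have nn: "0 \<le> lik n N g z" for z using lik_ge[OF g, of n N z] by linarith
  show ?thesis
    unfolding scaled_risk_def data_law_perturb[OF g]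
    using e bfun_measurable[OF bfun_lik[OF g]] nn
    by (subst nn_integral_density) (auto simp: ennreal_mult'[symmetric] mult_ac)
qed

end

section \<open>The local minimax lower bound\<close>

text \<open>Turns a power of one plus a chi-square divergence of order 1/n into the exponential of
  their sum.\<close>

lemma power_le_exp:
  fixes x :: real assumes "0 \<le> x" shows "x ^ m \<le> exp (real m * (x - 1))"
proof -
  have "x \<le> exp (x - 1)" using exp_ge_add_one_self[of "x - 1"] by simp
  then have "x ^ m \<le> exp (x - 1) ^ m" using assms by (intro power_mono)
  then show ?thesis by (simp add: exp_of_nat_mult)
qed

context missing_data
begin

text \<open>Written in the form in which the theorem perturbs f, so that \<tau> times h can be taken
  as a member of the finite set of directions.\<close>

definition path :: "(('d \<Rightarrow> real) \<Rightarrow> real) \<Rightarrow> real \<Rightarrow> nat \<Rightarrow> ('d \<Rightarrow> real) \<Rightarrow> real" where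
  "path h \<tau> n x = real n powr (- 1 / 2) * (\<tau> * h x)"

text \<open>The Fisher information of the whole data along h, per complete observation: a complete
  observation contributes the variance of h, and the sample on \<open>S\<close>, with about
  \<open>lam S\<close> observations per complete one, the variance of the projected score
  \<open>E S h\<close> under its own law.\<close>

definition information :: "(('d \<Rightarrow> real) \<Rightarrow> real) \<Rightarrow> real" where
  "information h = P.variance h + (\<Sum>S\<in>\<S>. lam S * prob_space.variance (Q S) (E S h))"

text \<open>The derivative at 0 of the parameter along the path, by
  \<open>theta_perturb_limit\<close>; the centring of h comes from the normalisation of the
  perturbed density.\<close>

definition sensitivity :: "(('d \<Rightarrow> real) \<Rightarrow> real) \<Rightarrow> real" where
  "sensitivity h = (\<integral>x. a x * (h x - (\<integral>x. h x \<partial>P)) \<partial>P)"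

lemma path_eq: "path h \<tau> n x = \<tau> * h x / sqrt (real n)"
  unfolding path_def by (simp add: powr_minus_divide powr_half_sqrt)

context
  fixes h :: "('d \<Rightarrow> real) \<Rightarrow> real"
  assumes h: "bfun (leb UNIV) h"
begin

lemma path_measurable: "path h \<tau> n \<in> borel_measurable (leb UNIV)"
  unfolding path_def[abs_def] using bfun_measurable[OF h] by measurable

lemma kernel_bound:
  assumes "\<And>x. \<bar>h x\<bar> \<le> B"
  shows "\<bar>sqrt (real n) * (k_fun (path h \<tau> n x) - 1)\<bar> \<le> \<bar>\<tau>\<bar> * B"
proof (cases "n = 0")
  case True
  have "0 \<le> B" using assms[of undefined] by linarith
  then show ?thesis using True by simp
next
  case False
  have "\<bar>sqrt (real n) * (k_fun (path h \<tau> n x) - 1)\<bar> \<le> sqrt (real n) * \<bar>path h \<tau> n x\<bar>"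
    using k_fun_lipschitz[of "path h \<tau> n x"] by (simp add: abs_mult mult_left_mono)
  also have "\<dots> = \<bar>\<tau>\<bar> * \<bar>h x\<bar>" using False by (simp add: path_eq abs_mult)
  also have "\<dots> \<le> \<bar>\<tau>\<bar> * B" using assms by (intro mult_left_mono) auto
  finally show ?thesis .
qed

lemma kernel_limit: "(\<lambda>n. sqrt (real n) * (k_fun (path h \<tau> n x) - 1)) \<longlonglongrightarrow> \<tau> * h x"
  unfolding path_eq by (rule k_fun_limit)

text \<open>The limit is taken inside the conditional law at each fixed x, so it holds at every
  point and feeds \<open>chi_square_limit\<close> without exceptional sets.\<close>

lemma E_kernel_bound:
  assumes S: "S \<in> \<S>" and B: "\<And>x. \<bar>h x\<bar> \<le> B"
  shows "\<bar>sqrt (real n) * (E S (\<lambda>x. k_fun (path h \<tau> n x)) x - 1)\<bar> \<le> \<bar>\<tau>\<bar> * B"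
    and "(\<lambda>n. sqrt (real n) * (E S (\<lambda>x. k_fun (path h \<tau> n x)) x - 1)) \<longlonglongrightarrow> \<tau> * E S h x"
proof -
  interpret K: prob_space "cond S x" by (rule kappa_prob[OF S])
  let ?f = "\<lambda>n y. sqrt (real n) * (k_fun (path h \<tau> n (merge S (-S) (x, y))) - 1)"
  have b: "bfun (cond S x) (\<lambda>y. k_fun (path h \<tau> n (merge S (-S) (x, y))))" for n
    by (rule bfun_section[OF S bfun_k[OF path_measurable]])
  have bf: "bfun (cond S x) (?f n)" for n by (intro bfun_intros b)
  have e: "sqrt (real n) * (E S (\<lambda>x. k_fun (path h \<tau> n x)) x - 1) = (\<integral>y. ?f n y \<partial>cond S x)" for n
    unfolding E_def using K.bfun_integrable[OF b] by (simp add: K.prob_space)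
  show "\<bar>sqrt (real n) * (E S (\<lambda>x. k_fun (path h \<tau> n x)) x - 1)\<bar> \<le> \<bar>\<tau>\<bar> * B"
    unfolding e by (rule K.integral_abs_le_const_bfun[OF bf kernel_bound[OF B]])
  have "(\<lambda>n. \<integral>y. ?f n y \<partial>cond S x) \<longlonglongrightarrow> (\<integral>y. \<tau> * h (merge S (-S) (x, y)) \<partial>cond S x)"
  proof (rule integral_dominated_convergence[where w="\<lambda>_. \<bar>\<tau>\<bar> * B"])
    show "AE y in cond S x. (\<lambda>n. ?f n y) \<longlonglongrightarrow> \<tau> * h (merge S (-S) (x, y))"
      by (intro AE_I2 kernel_limit)
    show "AE y in cond S x. norm (?f n y) \<le> \<bar>\<tau>\<bar> * B" for n
      unfolding real_norm_def by (intro AE_I2 kernel_bound B)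
    show "?f n \<in> borel_measurable (cond S x)" for n by (rule bfun_measurable[OF bf])
    show "(\<lambda>y. \<tau> * h (merge S (-S) (x, y))) \<in> borel_measurable (cond S x)"
      by (intro bfun_measurable bfun_mult bfun_const bfun_section[OF S h])
  qed simp
  then show "(\<lambda>n. sqrt (real n) * (E S (\<lambda>x. k_fun (path h \<tau> n x)) x - 1)) \<longlonglongrightarrow> \<tau> * E S h x"
    unfolding e by (simp add: E_def)
qed

lemma theta_perturb_limit:
  "(\<lambda>n. sqrt (real n) * (theta a (perturb f (path h \<tau> n)) - theta a f)) \<longlonglongrightarrow> \<tau> * sensitivity h"
proof -
  obtain B where B: "\<And>x. \<bar>h x\<bar> \<le> B" using bfun_bound[OF h] by blast
  note bk = bfun_k[OF path_measurable]
  have bkP: "bfun P (\<lambda>x. k_fun (path h \<tau> n x))" for n using bk bfun_P by blast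
  have b\<tau>: "bfun P (\<lambda>x. \<tau> * h x)" using h bfun_P by (intro bfun_mult bfun_const) auto
  note L = P.normalised_kernel_limit[OF bfun_measurable[OF bkP] k_fun_bounds(1) kernel_bound[OF B]
      kernel_limit b\<tau> bkP, folded tilt_def, folded pX_def]
  let ?F = "\<lambda>x n. a x * (sqrt (real n) * (pX (path h \<tau> n) x - 1))"
  have bp: "bfun (leb UNIV) (\<lambda>x. ?F x n)" for n
    by (intro bfun_intros bfun_a bfun_pX path_measurable)
  have e: "sqrt (real n) * (theta a (perturb f (path h \<tau> n)) - theta a f) =
      (\<integral>x. ?F x n \<partial>P)" for n
  proof -
    have i: "integrable P (\<lambda>x. pX (path h \<tau> n) x * a x)" "integrable P a"
      by (intro integrable_bfun bfun_intros bfun_pX path_measurable bfun_a)+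
    have "theta a (perturb f (path h \<tau> n)) - theta a f = (\<integral>x. pX (path h \<tau> n) x * a x - a x \<partial>P)"
      using theta_law[OF prob_density_perturb[OF path_measurable] a_meas] theta_law[OF f a_meas]
        integral_law_perturb[OF path_measurable a_meas] i by simp
    then show ?thesis
      by (subst integral_mult_right_zero[symmetric, of "sqrt (real n)"] | simp add: algebra_simps)+
  qed
  let ?G = "\<lambda>x. \<tau> * h x - (\<integral>x. \<tau> * h x \<partial>P)"
  have "(\<lambda>n. \<integral>x. ?F x n \<partial>P) \<longlonglongrightarrow>
      (\<integral>x. a x * (?G x) \<partial>P)"
  proof (rule integral_dominated_convergence[where w="\<lambda>x. A * (4 * (\<bar>\<tau>\<bar> * B))"])
    show "AE x in P. (\<lambda>n. ?F x n) \<longlonglongrightarrow>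
        a x * (?G x)"
      by (intro AE_I2 tendsto_mult_left L(3))
    show "AE x in P. norm (?F x n) \<le> A * (4 * (\<bar>\<tau>\<bar> * B))" for n
      unfolding real_norm_def abs_mult[of "a _"]
      by (intro AE_I2 mult_mono a_bound L(2)) (use a_bound order_trans[OF abs_ge_zero] in auto)
    show "(\<lambda>x. ?F x n) \<in> borel_measurable P" for n
      using bfun_measurable[OF bp] by simp
    show "(\<lambda>x. a x * (?G x)) \<in> borel_measurable P"
      using a_meas bfun_measurable[OF h] by simp
  qed simp
  moreover have "(\<integral>x. a x * (?G x) \<partial>P) = \<tau> * sensitivity h"
    unfolding sensitivity_def integral_mult_right_zero[symmetric, of \<tau>]
    by (simp add: algebra_simps)
  ultimately show ?thesis unfolding e by simp
qed

lemma chi_square_X_limit: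
  "(\<lambda>n. real n * ((\<integral>x. (pX (path h \<tau> n) x)^2 / pX (path h \<sigma> n) x \<partial>P) - 1))
    \<longlonglongrightarrow> (\<tau> - \<sigma>)^2 * P.variance h"
proof -
  obtain B where B: "\<And>x. \<bar>h x\<bar> \<le> B" using bfun_bound[OF h] by blast
  have bkP: "bfun P (\<lambda>x. k_fun (path h \<tau> n x))" for \<tau> n using bfun_k[OF path_measurable] bfun_P by blast
  have hP: "bfun P h" using h bfun_P by blast
  show ?thesis
    using P.chi_square_limit[OF k_fun_bounds(1) bkP kernel_bound[OF B] kernel_limit
        k_fun_bounds bkP kernel_bound[OF B] kernel_limit hP, of \<tau> \<sigma>]
    unfolding pX_def tilt_def .
qed

lemma chi_square_Y_limit:
  assumes S: "S \<in> \<S>"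
  shows "(\<lambda>n. real n * ((\<integral>x. (pY (path h \<tau> n) S x)^2 / pY (path h \<sigma> n) S x \<partial>Q S) - 1))
    \<longlonglongrightarrow> (\<tau> - \<sigma>)^2 * prob_space.variance (Q S) (E S h)"
proof -
  interpret QS: prob_space "Q S" by (rule prob_space_Q[OF S])
  obtain B where B: "\<And>x. \<bar>h x\<bar> \<le> B" using bfun_bound[OF h] by blast
  have bk: "bfun (Q S) (E S (\<lambda>x. k_fun (path h \<tau> n x)))" for \<tau> n
    by (rule bfun_Q[OF bfun_E[OF S bfun_k[OF path_measurable]] E_dep])
  have hQ: "bfun (Q S) (E S h)" by (rule bfun_Q[OF bfun_E[OF S h] E_dep])
  note Eb = E_k_bounds[OF path_measurable S]
  show ?thesis
    using QS.chi_square_limit[OF Eb(1) bk E_kernel_bound[OF S B] Eb bk E_kernel_bound[OF S B] hQ, of \<tau> \<sigma>]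
    unfolding pY_def tiltS_eq[OF path_measurable S] .
qed

text \<open>If the maximal risk were below v for a large n, the estimator would have risk at most v
  on the whole grid, and \<open>chained_chapman_robbins\<close> would limit the change of the
  parameter along it. The grid from \<open>exists_grid_for_bound\<close> makes the parameter change
  by more.\<close>

lemma local_minimax_path:
  assumes D: "0 < sensitivity h" and v: "0 \<le> v" "v * information h < (sensitivity h)^2"
    and nS: "\<And>S. S \<in> \<S> \<Longrightarrow> (\<lambda>n. real (nS n S) / real n) \<longlonglongrightarrow> lam S"
    and est: "\<And>n. 1 \<le> n \<Longrightarrow> est n \<in> estimators \<S> n (nS n)"
  shows "\<exists>I. finite I \<and> I \<noteq> {} \<and> I \<subseteq> Lsq f \<and>
    (\<forall>\<^sub>F n in sequentially. ennreal v \<le>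
      (MAX h\<in>I. scaled_risk \<S> a r n (nS n) (perturb f (\<lambda>x. real n powr (- 1 / 2) * h x)) (est n)))"
proof -
  have I0: "0 \<le> information h"
    unfolding information_def using lam_pos
    by (intro add_nonneg_nonneg sum_nonneg mult_nonneg_nonneg Bochner_Integration.integral_nonneg)
      (auto intro: less_imp_le)
  obtain \<delta> \<iota> K where \<delta>: "0 < \<delta>" and \<iota>: "0 < \<iota>" and K: "sqrt v * (2 + real K * sqrt (exp (\<delta>^2 * information h) - 1 + \<iota>)) <
      real K * (\<delta> * sensitivity h)"
    using exists_grid_for_bound[OF D I0 v] by blast
  define chi0 where "chi0 = exp (\<delta>^2 * information h) - 1 + \<iota>"
  have chi0: "0 < chi0" using \<iota> I0 by (simp add: chi0_def add_nonneg_pos)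
  define t where "t k = real k * \<delta>" for k
  define g where "g n k = path h (t k) n" for n k
  note gm = path_measurable
  define I where "I = (\<lambda>k x. t k * h x) ` {..K}"
  have I: "finite I" "I \<noteq> {}" by (auto simp: I_def)
  have ISq: "I \<subseteq> Lsq f"
  proof
    fix q assume "q \<in> I"
    then obtain k where q: "q = (\<lambda>x. t k * h x)" by (auto simp: I_def)
    have "bfun (leb UNIV) q" unfolding q by (intro bfun_intros h)
    then show "q \<in> Lsq f"
      using integrable_law[OF f, of "\<lambda>x. (q x)^2"] integrable_bfun[OF bfun_power, of q 2]
        bfun_measurable[of _ q] by (simp add: Lsq_def)
  qed
  let ?chi = "\<lambda>n k. (\<integral>z. (lik n (nS n) (g n (Suc k)) z)^2 / lik n (nS n) (g n k) z \<partial>data_law \<S> r n (nS n) f)"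
  have chi_ev: "\<forall>\<^sub>F n in sequentially. ?chi n k \<le> 1 + chi0" for k
  proof -
    let ?cX = "\<lambda>n. (\<integral>x. (pX (g n (Suc k)) x)^2 / pX (g n k) x \<partial>P)"
    let ?cY = "\<lambda>n S. (\<integral>x. (pY (g n (Suc k)) S x)^2 / pY (g n k) S x \<partial>Q S)"
    have d: "t (Suc k) - t k = \<delta>" by (simp add: t_def algebra_simps)
    have lX: "(\<lambda>n. real n * (?cX n - 1)) \<longlonglongrightarrow> \<delta>^2 * P.variance h"
      using chi_square_X_limit[of "t (Suc k)" "t k"] unfolding d g_def .
    have lY: "(\<lambda>n. real (nS n S) / real n * (real n * (?cY n S - 1))) \<longlonglongrightarrow>
        lam S * (\<delta>^2 * prob_space.variance (Q S) (E S h))" if S: "S \<in> \<S>" for S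
      using tendsto_mult[OF nS[OF S] chi_square_Y_limit[OF S, of "t (Suc k)" "t k"]]
      unfolding d g_def .
    let ?H = "\<lambda>n. exp (real n * (?cX n - 1) + (\<Sum>S\<in>\<S>. real (nS n S) / real n * (real n * (?cY n S - 1))))"
    have "(\<lambda>n. ?H n) \<longlonglongrightarrow>
      exp (\<delta>^2 * P.variance h + (\<Sum>S\<in>\<S>. lam S * (\<delta>^2 * prob_space.variance (Q S) (E S h))))"
      by (intro tendsto_exp tendsto_add tendsto_sum lX lY)
    moreover have "\<delta>^2 * P.variance h + (\<Sum>S\<in>\<S>. lam S * (\<delta>^2 * prob_space.variance (Q S) (E S h))) =
        \<delta>^2 * information h"
      unfolding information_def distrib_left sum_distrib_left by (simp add: mult_ac)
    moreover have "exp (\<delta>^2 * information h) < 1 + chi0" using \<iota> by (simp add: chi0_def)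
    ultimately have "\<forall>\<^sub>F n in sequentially. ?H n < 1 + chi0"
      using order_tendstoD(2) by fastforce
    then show ?thesis using eventually_gt_at_top[of 0]
    proof eventually_elim
      case (elim n)
      have cX: "0 \<le> ?cX n"
        by (intro Bochner_Integration.integral_nonneg divide_nonneg_nonneg)
          (auto simp: g_def intro: order_trans[OF _ pX_ge[OF gm]])
      have cY: "0 \<le> ?cY n S" if "S \<in> \<S>" for S
        by (intro Bochner_Integration.integral_nonneg divide_nonneg_nonneg)
          (auto simp: g_def intro: order_trans[OF _ pY_ge[OF gm that]])
      have "?chi n k = ?cX n ^ n * (\<Prod>S\<in>\<S>. ?cY n S ^ nS n S)"
        unfolding g_def by (rule integral_lik_ratio[OF gm gm])
      \<comment> \<open>The factors are of size 1 + O(1/n); passing to exponentials turns the powers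
        into a sum whose limit is \<delta>^2 times the information.\<close>
      also have "\<dots> \<le> exp (real n * (?cX n - 1)) * (\<Prod>S\<in>\<S>. exp (real (nS n S) * (?cY n S - 1)))"
        by (intro mult_mono prod_mono conjI power_le_exp cX cY prod_nonneg zero_le_power exp_ge_zero)
      also have "\<dots> = ?H n"
        using elim(2) by (simp add: exp_add exp_sum)
      finally show "?chi n k \<le> 1 + chi0" using elim(1) by linarith
    qed
  qed
  have th_ev: "\<forall>\<^sub>F n in sequentially. sqrt v * (2 + real K * sqrt chi0) <
      sqrt (real n) * (theta a (perturb f (g n K)) - theta a (perturb f (g n 0)))"
  proof (rule order_tendstoD(1))
    show "(\<lambda>n. sqrt (real n) * (theta a (perturb f (g n K)) - theta a (perturb f (g n 0)))) \<longlonglongrightarrow>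
      t K * sensitivity h - t 0 * sensitivity h"
      using tendsto_diff[OF theta_perturb_limit[of "t K"] theta_perturb_limit[of "t 0"]]
      unfolding g_def by (simp add: algebra_simps)
    show "sqrt v * (2 + real K * sqrt chi0) < t K * sensitivity h - t 0 * sensitivity h"
      using K by (simp add: t_def chi0_def mult.assoc)
  qed
  let ?G = "\<lambda>h n. scaled_risk \<S> a r n (nS n) (perturb f (\<lambda>x. real n powr (- 1 / 2) * h x)) (est n)"
  have "\<forall>\<^sub>F n in sequentially. \<forall>k<K. ?chi n k \<le> 1 + chi0"
    using chi_ev by (simp add: eventually_all_finite eventually_ball_finite flip: Ball_def lessThan_iff)
  then have "\<forall>\<^sub>F n in sequentially. ennreal v \<le> (MAX h\<in>I. ?G h n)"
    using th_ev eventually_gt_at_top[of 0]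
  proof eventually_elim
    case (elim n)
    note e = est[of n] elim(3)
    have en: "est n \<in> estimators \<S> n (nS n)" using est elim(3) by simp
    interpret data: prob_space "data_law \<S> r n (nS n) f" by (rule prob_space_data)
    let ?risk = "\<lambda>k. scaled_risk \<S> a r n (nS n) (perturb f (g n k)) (est n)"
    show ?case
    proof (rule ccontr)
      assume "\<not> ?case"
      then have less: "Max ((\<lambda>h. ?G h n) ` I) < ennreal v" by simp
      have v0: "0 < v" using le_less_trans[OF zero_le less] by simp
      have risk: "?risk k \<le> ennreal v" if k: "k \<le> K" for k
      proof -
        have "?risk k \<in> (\<lambda>h. ?G h n) ` I"
          unfolding I_def image_image using k by (auto simp: g_def path_def[abs_def] intro!: image_eqI[of _ _ k])
        then have "?risk k \<le> Max ((\<lambda>h. ?G h n) ` I)"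
          using I by (intro Max_ge) auto
        then show ?thesis using less by simp
      qed
      let ?th = "\<lambda>k. theta a (perturb f (g n k))" and ?L = "\<lambda>k. lik n (nS n) (g n k)"
      let ?e = "(\<Prod>i\<in>{1..n}. 1 / 3 :: real) * (\<Prod>S\<in>\<S>. \<Prod>j\<in>{1..nS n S}. 1 / 3)"
      have epos: "0 < ?e" by (intro mult_pos_pos prod_pos) auto
      have Lge: "?e \<le> ?L k z" for k z unfolding g_def by (rule lik_ge[OF gm])
      have Lnn: "0 \<le> ?L k z" for k z using Lge[of k z] epos by linarith
      have estm: "est n \<in> borel_measurable (data_law \<S> r n (nS n) f)"
        using en unfolding estimators_def by (simp add: measurable_cong_sets[OF sets_data_law refl])
      have bL: "bfun (data_law \<S> r n (nS n) f) (?L k)" for k unfolding g_def by (rule bfun_lik[OF gm])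
      let ?F = "\<lambda>z k. (est n z - ?th k)^2 * ?L k z"
      have R: "integrable (data_law \<S> r n (nS n) f) (\<lambda>z. ?F z k) \<and>
          (\<integral>z. ?F z k \<partial>data_law \<S> r n (nS n) f) \<le> v / real n" if k: "k \<le> K" for k
      proof -
        have m: "(\<lambda>z. ?F z k) \<in> borel_measurable (data_law \<S> r n (nS n) f)"
          using estm bfun_measurable[OF bL] by measurable
        have nn: "0 \<le> ?F z k" for z using Lnn by simp
        have "(\<integral>\<^sup>+z. ennreal (real n * (?F z k)) \<partial>data_law \<S> r n (nS n) f) \<le> ennreal v"
          using risk[OF k] unfolding g_def scaled_risk_perturb[OF gm en] .
        moreover have "(\<integral>\<^sup>+z. ennreal (real n * (?F z k)) \<partial>data_law \<S> r n (nS n) f) =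
            ennreal (real n) * (\<integral>\<^sup>+z. ennreal (?F z k) \<partial>data_law \<S> r n (nS n) f)"
        proof -
          have "(\<lambda>z. ennreal (?F z k)) \<in> borel_measurable (data_law \<S> r n (nS n) f)"
            using m by (rule measurable_compose[OF _ measurable_ennreal])
          then show ?thesis
            by (subst nn_integral_cmult[symmetric]) (auto simp only: ennreal_mult'[OF of_nat_0_le_iff])
        qed
        ultimately have "ennreal (real n) * (\<integral>\<^sup>+z. ennreal (?F z k) \<partial>data_law \<S> r n (nS n) f) \<le> ennreal v"
          by simp
        then have le: "(\<integral>\<^sup>+z. ennreal (?F z k) \<partial>data_law \<S> r n (nS n) f) \<le> ennreal (v / real n)"
        proof -
          assume A: "ennreal (real n) * (\<integral>\<^sup>+z. ennreal (?F z k) \<partial>data_law \<S> r n (nS n) f) \<le> ennreal v"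
          have "ennreal (1 / real n) * (ennreal (real n) * (\<integral>\<^sup>+z. ennreal (?F z k) \<partial>data_law \<S> r n (nS n) f)) \<le>
            ennreal (1 / real n) * ennreal v"
            by (rule mult_left_mono[OF A]) simp
          moreover have "ennreal (1 / real n) * ennreal (real n) = 1"
            using elim(3) by (simp flip: ennreal_mult')
          ultimately show ?thesis using v0
            by (simp add: mult.assoc[symmetric] ennreal_mult'[symmetric])
        qed
        have int: "integrable (data_law \<S> r n (nS n) f) (\<lambda>z. ?F z k)"
          using le_less_trans[OF le ennreal_less_top] m nn by (intro integrableI_nonneg) auto
        moreover have "(\<integral>z. ?F z k \<partial>data_law \<S> r n (nS n) f) \<le> v / real n"
          using le nn_integral_eq_integral[OF int] nn v0 elim(3) by (simp add: ennreal_le_iff)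
        ultimately show ?thesis by blast
      qed
      \<comment> \<open>A scaled risk of at most v is a mean squared error of at most v/n;
        multiplication by sqrt n afterwards returns to the scale of the grid.\<close>
      have "?th K - ?th 0 \<le> sqrt (v / real n) * (2 + real K * sqrt chi0)"
      proof (rule data.chained_chapman_robbins[where L="?L" and e="\<lambda>k. ?e" and T="est n"])
        show "(\<integral>z. ?L k z \<partial>data_law \<S> r n (nS n) f) = 1" for k unfolding g_def by (rule integral_lik[OF gm])
      qed (use bL Lge epos estm R elim(1,3) v0 chi0 in auto)
      then have "sqrt (real n) * (?th K - ?th 0) \<le> sqrt (real n) * (sqrt (v / real n) * (2 + real K * sqrt chi0))"
        by (rule mult_left_mono) simp
      also have "\<dots> = sqrt v * (2 + real K * sqrt chi0)"
        using elim(3) by (simp add: real_sqrt_divide)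
      finally show False using elim(2) by linarith
    qed
  qed
  with I ISq show ?thesis by blast
qed

end

text \<open>At an exact minimiser the conditional mean of the residual is \<alpha>_S times
  \<open>il S\<close> up to a constant, and both quantities equal the objective. Otherwise the
  unfinished updates \<open>update \<alpha> S - \<alpha> S\<close> leave cross terms; Cauchy-Schwarz
  with weight \<open>iw S\<close> bounds each by the root of a multiple of objective times gap, and
  \<Delta> is the sum of these bounds.\<close>

lemma residual_information:
  assumes \<alpha>: "admissible \<alpha>"
  defines "\<Delta> \<equiv> \<Sum>S\<in>\<S>. sqrt ((1 + lam S * C) * obj \<alpha> * gap \<alpha>)"
  shows "obj \<alpha> - \<Delta> \<le> sensitivity (residual \<alpha>)"
    and "information (residual \<alpha>) \<le> obj \<alpha> + 2 * \<Delta> + (\<Sum>S\<in>\<S>. (1 + lam S * C) * gap \<alpha>)"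
proof -
  let ?e = "residual \<alpha>"
  define u where "u S x = update \<alpha> S x - \<alpha> S x" for S x
  have be: "bfun (leb UNIV) ?e" by (rule bfun_residual[OF \<alpha>])
  have bu: "bfun (leb UNIV) (u S)" if S: "S \<in> \<S>" for S
    unfolding u_def[abs_def] by (intro bfun_intros admissibleD[OF \<alpha> S] update_admissible[OF \<alpha> S])
  have gapS: "(\<integral>x. (u S x)^2 * iw S x \<partial>P) \<le> gap \<alpha>" if S: "S \<in> \<S>" for S
    unfolding gap_def u_def
    by (rule member_le_sum[OF S _ finite_S])
      (intro Bochner_Integration.integral_nonneg mult_nonneg_nonneg, auto intro: order_trans[OF _ iw_ge_1])
  let ?F = "\<lambda>S x. \<alpha> S x * (u S x * iw S x)"
  have cross: "\<bar>\<integral>x. ?F S x \<partial>P\<bar> \<le> sqrt ((1 + lam S * C) * obj \<alpha> * gap \<alpha>)"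
    if S: "S \<in> \<S>" for S
  proof -
    have s: "(\<lambda>x. sqrt (iw S x)) \<in> borel_measurable (leb UNIV)"
      using bfun_measurable[OF bfun_iw[OF S]] by measurable
    obtain B where B: "\<And>x. \<bar>iw S x\<bar> \<le> B" using bfun_bound[OF bfun_iw[OF S]] by blast
    have nn: "0 \<le> iw S x" for x using iw_ge_1[OF S, of x] by linarith
    have bs: "bfun (leb UNIV) (\<lambda>x. sqrt (iw S x))"
      by (rule bfunI[OF s, where B="sqrt B"]) (use B nn in auto)
    have b: "bfun P (\<lambda>x. \<alpha> S x * sqrt (iw S x))" "bfun P (\<lambda>x. u S x * sqrt (iw S x))"
      unfolding bfun_P by (intro bfun_mult bs bu[OF S] admissibleD(1)[OF \<alpha> S])+
    have "(\<integral>x. ?F S x \<partial>P) = (\<integral>x. (\<alpha> S x * sqrt (iw S x)) * (u S x * sqrt (iw S x)) \<partial>P)"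
      using nn by (intro Bochner_Integration.integral_cong) (auto simp: mult_ac)
    then have "(\<integral>x. ?F S x \<partial>P)^2 \<le>
        (\<integral>x. (\<alpha> S x)^2 * iw S x \<partial>P) * (\<integral>x. (u S x)^2 * iw S x \<partial>P)"
      using P.integral_mult_square_le[OF b] nn by (simp add: power_mult_distrib)
    also have "\<dots> \<le> ((1 + lam S * C) * obj \<alpha>) * gap \<alpha>"
      using integral_square_iw_le[OF \<alpha> S] gapS[OF S] nn objective_nonneg[of \<alpha>] lam_pos[OF S] cC
      by (intro mult_mono Bochner_Integration.integral_nonneg) auto
    finally show ?thesis by (metis real_sqrt_abs real_sqrt_le_mono)
  qed
  have sumcross: "\<bar>\<Sum>S\<in>\<S>. \<integral>x. ?F S x \<partial>P\<bar> \<le> \<Delta>"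
    unfolding \<Delta>_def by (rule order_trans[OF sum_abs sum_mono]) (rule cross)
  have m0: "(\<integral>x. ?e x \<partial>P) = 0" by (rule integral_residual[OF \<alpha>])
  have "sensitivity ?e = (\<integral>x. (?e x)^2 + (\<Sum>S\<in>\<S>. \<alpha> S x * ?e x) + theta a f * ?e x \<partial>P)"
  proof -
    have ax: "a x = ?e x + (\<Sum>S\<in>\<S>. \<alpha> S x) + theta a f" for x by (simp add: residual_def)
    have "a x * (?e x - 0) = (?e x)^2 + (\<Sum>S\<in>\<S>. \<alpha> S x * ?e x) + theta a f * ?e x" for x
      unfolding sum_distrib_right[symmetric] by (subst ax) (simp add: power2_eq_square algebra_simps)
    then show ?thesis unfolding sensitivity_def m0 by (simp only:)
  qed
  also have "\<dots> = (\<integral>x. (?e x)^2 \<partial>P) + (\<Sum>S\<in>\<S>. \<integral>x. \<alpha> S x * ?e x \<partial>P)"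
    using integrable_bfun[OF bfun_power[OF be]] integrable_bfun[OF be] m0
      integrable_bfun[OF bfun_mult[OF admissibleD(1)[OF \<alpha>] be]]
    by (simp add: Bochner_Integration.integral_add Bochner_Integration.integral_sum)
  also have "\<dots> = (\<integral>x. (?e x)^2 \<partial>P) + (\<Sum>S\<in>\<S>. (\<integral>x. (\<alpha> S x)^2 * il S x \<partial>P) + (\<integral>x. ?F S x \<partial>P))"
    using integral_mult_residual[OF \<alpha> _ integrable_bfun[OF admissibleD(1)[OF \<alpha>]] admissibleD(2,3)[OF \<alpha>]]
    by (intro arg_cong2[where f="(+)"] sum.cong refl) (simp add: u_def power2_eq_square mult.assoc)
  also have "\<dots> = obj \<alpha> + (\<Sum>S\<in>\<S>. \<integral>x. ?F S x \<partial>P)"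
    unfolding objective_admissible[OF \<alpha>] sum.distrib by simp
  finally show "obj \<alpha> - \<Delta> \<le> sensitivity ?e" using sumcross by linarith
  have var: "lam S * prob_space.variance (Q S) (E S ?e) \<le> (\<integral>x. (\<alpha> S x)^2 * il S x \<partial>P) +
      2 * (\<integral>x. ?F S x \<partial>P) + (1 + lam S * C) * gap \<alpha>" if S: "S \<in> \<S>" for S
  proof -
    interpret QS: prob_space "Q S" by (rule prob_space_Q[OF S])
    obtain q where q: "\<And>x. E S ?e x = \<alpha> S x * il S x + (update \<alpha> S x - \<alpha> S x) * iw S x + q"
      using E_residual[OF \<alpha> S] by blast
    \<comment> \<open>The conditional mean of the residual up to an additive constant, to which the
      variance is blind.\<close>
    define z where "z x = \<alpha> S x * il S x + u S x * iw S x" for x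
    have bz: "bfun (leb UNIV) z"
      unfolding z_def[abs_def] by (intro bfun_intros admissibleD(1)[OF \<alpha> S] bu[OF S] bfun_iw[OF S] bfun_inverse_lam_rho[OF S])
    have dz: "depends_on S z"
    proof -
      have "z = (\<lambda>x. E S ?e x - q)" using q by (auto simp: z_def u_def)
      then show ?thesis using E_dep[of S ?e] by (simp add: depends_on_def)
    qed
    have bzQ: "bfun (Q S) z" by (rule bfun_Q[OF bz dz])
    have "prob_space.variance (Q S) (E S ?e) = QS.variance z"
    proof -
      have "E S ?e = (\<lambda>x. z x + q)" using q by (auto simp: z_def u_def)
      then show ?thesis using QS.bfun_integrable[OF bzQ] by (simp add: QS.prob_space)
    qed
    also have "\<dots> = (\<integral>x. (z x)^2 \<partial>Q S) - (\<integral>x. z x \<partial>Q S)^2"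
      by (intro QS.variance_eq QS.bfun_integrable bfun_power bzQ)
    also have "\<dots> \<le> (\<integral>x. (z x)^2 \<partial>Q S)" by simp
    also have "\<dots> = (\<integral>x. \<rho> S x * (z x)^2 \<partial>P)"
      using dz by (intro integral_Q[OF S bfun_measurable[OF bfun_power[OF bz]]]) (simp add: depends_on_def)
    finally have "lam S * prob_space.variance (Q S) (E S ?e) \<le> lam S * (\<integral>x. \<rho> S x * (z x)^2 \<partial>P)"
      using lam_pos[OF S] by simp
    also have "\<dots> = (\<integral>x. lam S * (\<rho> S x * (z x)^2) \<partial>P)" by simp
    also have "\<dots> \<le> (\<integral>x. (\<alpha> S x)^2 * il S x + 2 * (?F S x) + (1 + lam S * C) * ((u S x)^2 * iw S x) \<partial>P)"
    proof (rule P.bfun_integral_mono)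
      note bb = admissibleD(1)[OF \<alpha> S] bu[OF S] bfun_iw[OF S] bfun_inverse_lam_rho[OF S] bfun_rho[OF S] bz
      show "bfun P (\<lambda>x. lam S * (\<rho> S x * (z x)^2))" unfolding bfun_P by (intro bfun_intros bb)
      show "bfun P (\<lambda>x. (\<alpha> S x)^2 * il S x + 2 * (?F S x) + (1 + lam S * C) * ((u S x)^2 * iw S x))"
        unfolding bfun_P by (intro bfun_intros bb)
      fix x
      \<comment> \<open>Multiplying by l = lam S * \<rho> S x turns the terms of z^2 into those of
        the bound: l il = 1, and l iw = l + 1 is at most 1 + lam S C.\<close>
      define l where "l = lam S * \<rho> S x"
      have l: "0 < l" using lam_rho_pos[OF S] by (simp add: l_def)
      have li: "l * il S x = 1" using l by (simp add: il_def flip: l_def)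
      have lw: "l * iw S x = l + 1" using li by (simp add: iw_def distrib_left)
      have "l * (z x)^2 = (\<alpha> S x)^2 * il S x * (l * il S x) + 2 * (?F S x) * (l * il S x) +
          (u S x)^2 * iw S x * (l * iw S x)"
        by (simp add: z_def power2_eq_square algebra_simps)
      also have "\<dots> = (\<alpha> S x)^2 * il S x + 2 * (?F S x) + (u S x)^2 * iw S x * (l + 1)"
        unfolding li lw by simp
      also have "(u S x)^2 * iw S x * (l + 1) \<le> (u S x)^2 * iw S x * (1 + lam S * C)"
        using rho_le[OF S, of x] lam_pos[OF S] iw_ge_1[OF S, of x] by (intro mult_left_mono) (auto simp: l_def)
      finally show "lam S * (\<rho> S x * (z x)^2) \<le>
        (\<alpha> S x)^2 * il S x + 2 * (?F S x) + (1 + lam S * C) * ((u S x)^2 * iw S x)"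
        by (simp add: l_def mult_ac)
    qed
    also have "\<dots> = (\<integral>x. (\<alpha> S x)^2 * il S x \<partial>P) + 2 * (\<integral>x. ?F S x \<partial>P) +
        (1 + lam S * C) * (\<integral>x. (u S x)^2 * iw S x \<partial>P)"
    proof -
      note bb = admissibleD(1)[OF \<alpha> S] bu[OF S] bfun_iw[OF S] bfun_inverse_lam_rho[OF S]
      have "integrable P (\<lambda>x. (\<alpha> S x)^2 * il S x)" "integrable P (\<lambda>x. ?F S x)"
        "integrable P (\<lambda>x. (u S x)^2 * iw S x)"
        by (intro integrable_bfun bfun_intros bb)+
      then show ?thesis by simp
    qed
    also have "(1 + lam S * C) * (\<integral>x. (u S x)^2 * iw S x \<partial>P) \<le> (1 + lam S * C) * gap \<alpha>"
      by (intro mult_left_mono gapS[OF S]) (use lam_pos[OF S] cC in auto)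
    finally show ?thesis by simp
  qed
  have "information ?e \<le> (\<integral>x. (?e x)^2 \<partial>P) + (\<Sum>S\<in>\<S>. (\<integral>x. (\<alpha> S x)^2 * il S x \<partial>P) +
      2 * (\<integral>x. ?F S x \<partial>P) + (1 + lam S * C) * gap \<alpha>)"
    unfolding information_def m0 by (intro add_mono sum_mono var) auto
  also have "\<dots> = obj \<alpha> + 2 * (\<Sum>S\<in>\<S>. \<integral>x. ?F S x \<partial>P) + (\<Sum>S\<in>\<S>. (1 + lam S * C) * gap \<alpha>)"
    unfolding objective_admissible[OF \<alpha>] sum.distrib sum_distrib_left by simp
  finally show "information ?e \<le> obj \<alpha> + 2 * \<Delta> + (\<Sum>S\<in>\<S>. (1 + lam S * C) * gap \<alpha>)"
    using sumcross by linarith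
qed

text \<open>A value v strictly between the supremum and V would leave the margin v * information <
  sensitivity^2 for the residual of a sufficiently late iterate; \<open>local_minimax_path\<close>
  then exhibits a finite set on which the liminf is at least v.\<close>

lemma local_minimax_lower_bound:
  assumes nS: "\<And>S. S \<in> \<S> \<Longrightarrow> (\<lambda>n. real (nS n S) / real n) \<longlonglongrightarrow> lam S"
    and est: "\<And>n. 1 \<le> n \<Longrightarrow> est n \<in> estimators \<S> n (nS n)"
  shows "ennreal efficiency_bound \<le> (SUP I\<in>{I. finite I \<and> I \<noteq> {} \<and> I \<subseteq> Lsq f}.
    liminf (\<lambda>n. MAX h\<in>I. scaled_risk \<S> a r n (nS n) (perturb f (\<lambda>x. real n powr (- 1 / 2) * h x)) (est n)))"
    (is "_ \<le> ?SUP")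
proof (rule ccontr)
  assume "\<not> ?thesis"
  then have less: "?SUP < ennreal efficiency_bound" by simp
  let ?V = efficiency_bound
  obtain v where v: "0 \<le> v" "?SUP < ennreal v" "v < ?V"
  proof -
    obtain y where y: "?SUP < y" "y < ennreal ?V" using dense[OF less] by blast
    obtain z where z: "y = ennreal z" "0 \<le> z" using y(2) by (cases y) auto
    show ?thesis
      by (rule that[OF z(2)]) (use y z(2) in \<open>auto simp: z(1) ennreal_less_iff\<close>)
  qed
  then have Vpos: "0 < ?V" by linarith
  define L where "L = (\<Sum>S\<in>\<S>. 1 + lam S * C)"
  have "\<exists>m. 0 < sensitivity (residual (pop m)) \<and>
      v * information (residual (pop m)) < (sensitivity (residual (pop m)))^2"
  proof -
    \<comment> \<open>\<open>D e\<close> and \<open>F e\<close> are the worst cases of the bounds in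
      \<open>residual_information\<close> when the objective is at most V + e and the gap at most e.
      As e tends to 0, \<open>F e\<close> tends to V^2 - v V, which is positive.\<close>
    define D where "D e = (\<Sum>S\<in>\<S>. sqrt ((1 + lam S * C) * (?V + e) * e))" for e
    define F where "F e = (?V - D e)^2 - v * (?V + e + 2 * D e + L * e)" for e
    have "(F \<longlongrightarrow> (?V - (\<Sum>S\<in>\<S>. sqrt ((1 + lam S * C) * (?V + 0) * 0)))^2 -
        v * (?V + 0 + 2 * (\<Sum>S\<in>\<S>. sqrt ((1 + lam S * C) * (?V + 0) * 0)) + L * 0)) (at_right 0)"
      unfolding F_def D_def by (intro tendsto_intros)
    then have F: "(F \<longlongrightarrow> ?V^2 - v * ?V) (at_right 0)" by simp
    have "0 < ?V^2 - v * ?V" using v(3) Vpos by (simp add: power2_eq_square)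
    then have ev1: "\<forall>\<^sub>F e in at_right 0. 0 < F e" using order_tendstoD(1)[OF F] by simp
    have "((\<lambda>e. ?V - D e) \<longlongrightarrow> ?V - (\<Sum>S\<in>\<S>. sqrt ((1 + lam S * C) * (?V + 0) * 0))) (at_right 0)"
      unfolding D_def by (intro tendsto_intros)
    then have "((\<lambda>e. ?V - D e) \<longlongrightarrow> ?V) (at_right 0)" by simp
    from order_tendstoD(1)[OF this Vpos] have ev2: "\<forall>\<^sub>F e in at_right 0. 0 < ?V - D e" .
    have ev: "\<forall>\<^sub>F e in at_right 0. 0 < F e \<and> 0 < ?V - D e \<and> 0 < e"
      using ev1 ev2 eventually_at_right_less[of 0] by eventually_elim auto
    then obtain e where e: "0 < F e" "0 < ?V - D e" "0 < e"
      using eventually_happens'[OF trivial_limit_at_right_real ev] by blast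
    obtain m where m: "obj (pop m) \<le> ?V + e" "gap (pop m) \<le> e"
      using pop_nearly_optimal[OF e(3)] by blast
    define \<Delta> where "\<Delta> = (\<Sum>S\<in>\<S>. sqrt ((1 + lam S * C) * obj (pop m) * gap (pop m)))"
    note ri = residual_information[OF pop_admissible, of m, folded \<Delta>_def]
    have pos: "0 \<le> 1 + lam S * C" if "S \<in> \<S>" for S using lam_pos[OF that] cC by simp
    have \<Delta>: "\<Delta> \<le> D e"
      unfolding \<Delta>_def D_def using m gap_nonneg[of "pop m"] objective_nonneg[of "pop m"] Vpos e(3)
      by (intro sum_mono real_sqrt_le_mono mult_mono mult_left_mono pos) (auto intro!: mult_nonneg_nonneg pos)
    have L: "(\<Sum>S\<in>\<S>. (1 + lam S * C) * gap (pop m)) \<le> L * e"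
      unfolding L_def sum_distrib_right by (intro sum_mono mult_left_mono m(2) pos)
    have s: "?V - D e \<le> sensitivity (residual (pop m))"
      using ri(1) \<Delta> efficiency_bound_le_pop[of m] by linarith
    have "information (residual (pop m)) \<le> ?V + e + 2 * D e + L * e"
      using ri(2) \<Delta> L m(1) by linarith
    then have "v * information (residual (pop m)) \<le> v * (?V + e + 2 * D e + L * e)"
      using v(1) by (rule mult_left_mono)
    also have "\<dots> < (?V - D e)^2" using e(1) by (simp add: F_def)
    also have "\<dots> \<le> (sensitivity (residual (pop m)))^2" using s e(2) by (intro power_mono) auto
    finally show ?thesis using s e(2) by (intro exI[of _ m]) auto
  qed
  then obtain m where m: "0 < sensitivity (residual (pop m))"
    "v * information (residual (pop m)) < (sensitivity (residual (pop m)))^2" by blast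
  obtain I where I: "finite I" "I \<noteq> {}" "I \<subseteq> Lsq f"
    "\<forall>\<^sub>F n in sequentially. ennreal v \<le>
      (MAX h\<in>I. scaled_risk \<S> a r n (nS n) (perturb f (\<lambda>x. real n powr (- 1 / 2) * h x)) (est n))"
    using local_minimax_path[OF bfun_residual[OF pop_admissible] m(1) v(1) m(2) nS est] by blast
  have "ennreal v \<le> liminf (\<lambda>n. MAX h\<in>I. scaled_risk \<S> a r n (nS n) (perturb f (\<lambda>x. real n powr (- 1 / 2) * h x)) (est n))"
    by (rule Liminf_bounded[OF I(4)])
  also have "\<dots> \<le> ?SUP" by (rule SUP_upper) (use I in auto)
  finally show False using v(2) by simp
qed

end

section \<open>Kernel smoothing\<close>

definition ucont :: "(('d::finite \<Rightarrow> real) \<Rightarrow> real) \<Rightarrow> bool" where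
  "ucont \<phi> \<longleftrightarrow> (\<forall>\<epsilon>>0. \<exists>\<delta>>0. \<forall>x y. (\<forall>i. \<bar>x i - y i\<bar> \<le> \<delta>) \<longrightarrow> \<bar>\<phi> x - \<phi> y\<bar> \<le> \<epsilon>)"

lemma ucontD:
  assumes "ucont \<phi>" "0 < \<epsilon>"
  obtains \<delta> where "0 < \<delta>" "\<And>x y. (\<And>i. \<bar>x i - y i\<bar> \<le> \<delta>) \<Longrightarrow> \<bar>\<phi> x - \<phi> y\<bar> \<le> \<epsilon>"
  using assms unfolding ucont_def by blast

lemma ucont_const: "ucont (\<lambda>x. c)"
  unfolding ucont_def by (auto intro: exI[of _ 1])

lemma ucont_add:
  assumes "ucont \<phi>" "ucont \<psi>" shows "ucont (\<lambda>x. \<phi> x + \<psi> x)"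
  unfolding ucont_def
proof (intro allI impI)
  fix \<epsilon> :: real assume \<epsilon>: "0 < \<epsilon>"
  obtain \<delta>1 where 1: "0 < \<delta>1" "\<And>x y. (\<And>i. \<bar>x i - y i\<bar> \<le> \<delta>1) \<Longrightarrow> \<bar>\<phi> x - \<phi> y\<bar> \<le> \<epsilon> / 2"
    using ucontD[OF assms(1), of "\<epsilon> / 2"] \<epsilon> by (metis half_gt_zero)
  obtain \<delta>2 where 2: "0 < \<delta>2" "\<And>x y. (\<And>i. \<bar>x i - y i\<bar> \<le> \<delta>2) \<Longrightarrow> \<bar>\<psi> x - \<psi> y\<bar> \<le> \<epsilon> / 2"
    using ucontD[OF assms(2), of "\<epsilon> / 2"] \<epsilon> by (metis half_gt_zero)
  show "\<exists>\<delta>>0. \<forall>x y. (\<forall>i. \<bar>x i - y i\<bar> \<le> \<delta>) \<longrightarrow> \<bar>\<phi> x + \<psi> x - (\<phi> y + \<psi> y)\<bar> \<le> \<epsilon>"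
  proof (intro exI[of _ "min \<delta>1 \<delta>2"] conjI allI impI)
    fix x y :: "'a \<Rightarrow> real" assume "\<forall>i. \<bar>x i - y i\<bar> \<le> min \<delta>1 \<delta>2"
    then have "\<bar>\<phi> x - \<phi> y\<bar> \<le> \<epsilon> / 2" "\<bar>\<psi> x - \<psi> y\<bar> \<le> \<epsilon> / 2" using 1(2) 2(2) by auto
    then show "\<bar>\<phi> x + \<psi> x - (\<phi> y + \<psi> y)\<bar> \<le> \<epsilon>" by linarith
  qed (use 1 2 in simp)
qed

lemma ucont_mult:
  assumes u: "ucont \<phi>" "ucont \<psi>" and b: "bfun M \<phi>" "bfun M' \<psi>"
  shows "ucont (\<lambda>x. \<phi> x * \<psi> x)"
  unfolding ucont_def
proof (intro allI impI)
  fix \<epsilon> :: real assume \<epsilon>: "0 < \<epsilon>"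
  obtain B1 where B1: "0 \<le> B1" "\<And>x. \<bar>\<phi> x\<bar> \<le> B1" using bfun_bound[OF b(1)] by blast
  obtain B2 where B2: "0 \<le> B2" "\<And>x. \<bar>\<psi> x\<bar> \<le> B2" using bfun_bound[OF b(2)] by blast
  let ?e = "\<epsilon> / (B1 + B2 + 1)"
  have e: "0 < ?e" using \<epsilon> B1 B2 by (intro divide_pos_pos) auto
  have alg: "B1 * e + e * B2 \<le> (B1 + B2 + 1) * e" if "0 < e" for e :: real
    using that by (simp add: algebra_simps)
  obtain \<delta>1 where 1: "0 < \<delta>1" "\<And>x y. (\<And>i. \<bar>x i - y i\<bar> \<le> \<delta>1) \<Longrightarrow> \<bar>\<phi> x - \<phi> y\<bar> \<le> ?e"
    using ucontD[OF u(1) e] by blast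
  obtain \<delta>2 where 2: "0 < \<delta>2" "\<And>x y. (\<And>i. \<bar>x i - y i\<bar> \<le> \<delta>2) \<Longrightarrow> \<bar>\<psi> x - \<psi> y\<bar> \<le> ?e"
    using ucontD[OF u(2) e] by blast
  show "\<exists>\<delta>>0. \<forall>x y. (\<forall>i. \<bar>x i - y i\<bar> \<le> \<delta>) \<longrightarrow> \<bar>\<phi> x * \<psi> x - \<phi> y * \<psi> y\<bar> \<le> \<epsilon>"
  proof (intro exI[of _ "min \<delta>1 \<delta>2"] conjI allI impI)
    fix x y :: "'a \<Rightarrow> real" assume "\<forall>i. \<bar>x i - y i\<bar> \<le> min \<delta>1 \<delta>2"
    then have d: "\<bar>\<phi> x - \<phi> y\<bar> \<le> ?e" "\<bar>\<psi> x - \<psi> y\<bar> \<le> ?e" using 1(2) 2(2) by auto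
    have "\<bar>\<phi> x * \<psi> x - \<phi> y * \<psi> y\<bar> = \<bar>\<phi> x * (\<psi> x - \<psi> y) + (\<phi> x - \<phi> y) * \<psi> y\<bar>"
      by (simp add: algebra_simps)
    also have "\<dots> \<le> B1 * ?e + ?e * B2"
      by (intro order_trans[OF abs_triangle_ineq] add_mono)
        (unfold abs_mult, (intro mult_mono d B1 B2; use e in simp)+)
    also have "\<dots> \<le> (B1 + B2 + 1) * ?e" by (rule alg[OF e])
    also have "\<dots> = \<epsilon>" using B1(1) B2(1) by simp
    finally show "\<bar>\<phi> x * \<psi> x - \<phi> y * \<psi> y\<bar> \<le> \<epsilon>" .
  qed (use 1 2 in simp)
qed

lemma ucont_cmult: assumes "ucont \<phi>" shows "ucont (\<lambda>x. c * \<phi> x)"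
  unfolding ucont_def
proof (intro allI impI)
  fix \<epsilon> :: real assume \<epsilon>: "0 < \<epsilon>"
  let ?F = "\<epsilon> / (\<bar>c\<bar> + 1)"
  have e: "0 < ?F" using \<epsilon> by (intro divide_pos_pos) auto
  obtain \<delta> where \<delta>: "0 < \<delta>" "\<And>x y. (\<And>i. \<bar>x i - y i\<bar> \<le> \<delta>) \<Longrightarrow> \<bar>\<phi> x - \<phi> y\<bar> \<le> ?F"
    using ucontD[OF assms e] by blast
  show "\<exists>\<delta>>0. \<forall>x y. (\<forall>i. \<bar>x i - y i\<bar> \<le> \<delta>) \<longrightarrow> \<bar>c * \<phi> x - c * \<phi> y\<bar> \<le> \<epsilon>"
  proof (intro exI[of _ \<delta>] conjI allI impI)
    fix x y :: "'a \<Rightarrow> real" assume "\<forall>i. \<bar>x i - y i\<bar> \<le> \<delta>"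
    then have "\<bar>\<phi> x - \<phi> y\<bar> \<le> ?F" using \<delta>(2) by auto
    then have "\<bar>c\<bar> * \<bar>\<phi> x - \<phi> y\<bar> \<le> \<bar>c\<bar> * (?F)" by (intro mult_left_mono) auto
    also have "\<dots> \<le> (\<bar>c\<bar> + 1) * (?F)" using e by (intro mult_right_mono) auto
    also have "\<dots> = \<epsilon>" by simp
    finally show "\<bar>c * \<phi> x - c * \<phi> y\<bar> \<le> \<epsilon>" by (simp add: abs_mult flip: right_diff_distrib)
  qed (rule \<delta>(1))
qed

lemma ucont_diff: "ucont \<phi> \<Longrightarrow> ucont \<psi> \<Longrightarrow> ucont (\<lambda>x. \<phi> x - \<psi> x)"
  using ucont_add[of \<phi> "\<lambda>x. -1 * \<psi> x"] ucont_cmult[of \<psi> "-1"] by simp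

lemma ucont_sum: "(\<And>i. i \<in> I \<Longrightarrow> ucont (f i)) \<Longrightarrow> ucont (\<lambda>x. \<Sum>i\<in>I. f i x)"
  by (induction I rule: infinite_finite_induct) (auto intro: ucont_const ucont_add)

lemma ucont_inverse:
  assumes "ucont \<phi>" "\<And>x. 1 \<le> \<phi> x" shows "ucont (\<lambda>x. 1 / \<phi> x)"
  unfolding ucont_def
proof (intro allI impI)
  fix \<epsilon> :: real assume "0 < \<epsilon>"
  then obtain \<delta> where \<delta>: "0 < \<delta>" "\<And>x y. (\<And>i. \<bar>x i - y i\<bar> \<le> \<delta>) \<Longrightarrow> \<bar>\<phi> x - \<phi> y\<bar> \<le> \<epsilon>"
    using ucontD[OF assms(1)] by blast
  show "\<exists>\<delta>>0. \<forall>x y. (\<forall>i. \<bar>x i - y i\<bar> \<le> \<delta>) \<longrightarrow> \<bar>1 / \<phi> x - 1 / \<phi> y\<bar> \<le> \<epsilon>"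
  proof (intro exI[of _ \<delta>] conjI allI impI)
    fix x y :: "'a \<Rightarrow> real" assume "\<forall>i. \<bar>x i - y i\<bar> \<le> \<delta>"
    then have d: "\<bar>\<phi> x - \<phi> y\<bar> \<le> \<epsilon>" using \<delta>(2) by auto
    have p: "0 < \<phi> x" "0 < \<phi> y" using assms(2)[of x] assms(2)[of y] by linarith+
    have one: "1 \<le> \<phi> x * \<phi> y" using mult_mono[OF assms(2)[of x] assms(2)[of y]] p by simp
    have "\<bar>1 / \<phi> x - 1 / \<phi> y\<bar> = \<bar>\<phi> x - \<phi> y\<bar> / (\<phi> x * \<phi> y)"
      using p by (simp add: diff_frac_eq abs_minus_commute)
    also have "\<dots> \<le> \<bar>\<phi> x - \<phi> y\<bar> / 1" using one by (intro divide_left_mono) auto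
    finally show "\<bar>1 / \<phi> x - 1 / \<phi> y\<bar> \<le> \<epsilon>" using d by simp
  qed (rule \<delta>(1))
qed

text \<open>Outside \<open>S\<close> the point x may be altered freely: the intermediate point
  agrees with y on \<open>S\<close> and with x elsewhere.\<close>

lemma ucont_dependsD:
  assumes "ucont \<phi>" "depends_on S \<phi>" "0 < \<epsilon>"
  obtains \<delta> where "0 < \<delta>" "\<And>x y. (\<And>i. i \<in> S \<Longrightarrow> \<bar>x i - y i\<bar> \<le> \<delta>) \<Longrightarrow> \<bar>\<phi> x - \<phi> y\<bar> \<le> \<epsilon>"
proof -
  obtain \<delta> where \<delta>: "0 < \<delta>" "\<And>x y. (\<And>i. \<bar>x i - y i\<bar> \<le> \<delta>) \<Longrightarrow> \<bar>\<phi> x - \<phi> y\<bar> \<le> \<epsilon>"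
    using ucontD[OF assms(1,3)] by blast
  show ?thesis
  proof (rule that[OF \<delta>(1)])
    fix x y :: "'a \<Rightarrow> real" assume xy: "\<And>i. i \<in> S \<Longrightarrow> \<bar>x i - y i\<bar> \<le> \<delta>"
    let ?z = "\<lambda>i. if i \<in> S then y i else x i"
    have "\<bar>\<phi> x - \<phi> ?z\<bar> \<le> \<epsilon>" by (rule \<delta>(2)) (use xy \<delta>(1) in auto)
    moreover have "\<phi> ?z = \<phi> y" by (rule depends_onD[OF assms(2)]) simp
    ultimately show "\<bar>\<phi> x - \<phi> y\<bar> \<le> \<epsilon>" by simp
  qed
qed

lemma tail_tendsto_0:
  fixes M :: "('d::finite \<Rightarrow> real) measure"
  assumes "prob_space M" "sets M = sets (leb UNIV)"
  shows "(\<lambda>n. measure M {x. \<not> sup_norm UNIV x \<le> real n}) \<longlonglongrightarrow> 0"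
proof -
  interpret prob_space M by fact
  let ?F = "\<lambda>n. {x. \<exists>i. real n < \<bar>x i\<bar>}"
  have eq: "{x. \<not> sup_norm UNIV x \<le> real n} = ?F n" for n :: nat
    by (subst sup_norm_le_iff) (auto simp: not_le)
  have "(\<lambda>n. measure M {x. \<exists>i. real n < \<bar>x i\<bar>}) \<longlonglongrightarrow> measure M (\<Inter>n. ?F n)"
  proof (rule finite_Lim_measure_decseq)
    have m: "{x::'d \<Rightarrow> real. \<exists>i. real n < \<bar>x i\<bar>} \<in> sets (leb UNIV)" for n
    proof -
      have "{x \<in> space (leb UNIV). \<exists>i. real n < \<bar>(x :: 'd \<Rightarrow> real) i\<bar>} \<in> sets (leb UNIV)" by measurable
      then show ?thesis by simp
    qed
    then show "range (\<lambda>n. ?F n) \<subseteq> events" using assms(2) by auto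
    show "decseq (\<lambda>n. {x::'d \<Rightarrow> real. \<exists>i. real n < \<bar>x i\<bar>})"
      unfolding decseq_def by (auto intro: le_less_trans[OF of_nat_mono])
  qed
  moreover have "(\<Inter>n. ?F n) = ({} :: ('d \<Rightarrow> real) set)"
  proof -
    have "x \<notin> (\<Inter>n. ?F n)" for x :: "'d \<Rightarrow> real"
    proof
      assume "x \<in> (\<Inter>n. ?F n)"
      then have all: "\<exists>i. real n < \<bar>x i\<bar>" for n by auto
      obtain n :: nat where "Max (range (\<lambda>i. \<bar>x i\<bar>)) \<le> real n" using real_arch_simple by blast
      moreover obtain i where "real n < \<bar>x i\<bar>" using all by blast
      ultimately show False by (metis Max_ge finite finite_imageI linorder_not_le order_trans rangeI)
    qed
    then show ?thesis by blast
  qed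
  ultimately show ?thesis unfolding eq by simp
qed

text \<open>Grid cells of side \<open>h\<close>: two points of the same cell are \<open>h\<close>-close in the coordinates \<open>S\<close>, and
  the \<open>h\<close>-neighbours of a point lie in at most \<open>3 ^ d\<close> cells. Consequently the reciprocal mass of the
  boxes integrates to at most one over every cell.\<close>

definition nbox :: "real \<Rightarrow> 'd set \<Rightarrow> ('d \<Rightarrow> real) \<Rightarrow> ('d \<Rightarrow> real) set" where
  "nbox h S x = {y. \<forall>i\<in>S. \<bar>x i - y i\<bar> \<le> h}"

definition cell :: "real \<Rightarrow> 'd set \<Rightarrow> ('d \<Rightarrow> real) \<Rightarrow> 'd \<Rightarrow> int" where
  "cell h S x i = (if i \<in> S then \<lfloor>x i / h\<rfloor> else 0)"

lemma cell_eq_imp_box: assumes "0 < h" "cell h S x = cell h S y" shows "y \<in> nbox h S x"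
  unfolding nbox_def
proof (intro CollectI ballI)
  fix i assume i: "i \<in> S"
  have "\<lfloor>x i / h\<rfloor> = \<lfloor>y i / h\<rfloor>" using fun_cong[OF assms(2), of i] i by (simp add: cell_def)
  then have "\<bar>x i / h - y i / h\<bar> \<le> 1" by linarith
  then have "\<bar>x i - y i\<bar> / h \<le> 1" using assms(1) by (simp flip: diff_divide_distrib)
  then show "\<bar>x i - y i\<bar> \<le> h" using assms(1) by simp
qed

lemma box_imp_cell_near: assumes "0 < h" "y \<in> nbox h S x" shows "cell h S x i \<in> {cell h S y i - 1..cell h S y i + 1}"
proof (cases "i \<in> S")
  case True
  then have "\<bar>x i - y i\<bar> \<le> h" using assms(2) by (simp add: nbox_def)
  then have "\<bar>x i / h - y i / h\<bar> \<le> 1" using assms(1) by (simp flip: diff_divide_distrib)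
  then have "\<bar>\<lfloor>x i / h\<rfloor> - \<lfloor>y i / h\<rfloor>\<bar> \<le> 1" by linarith
  then show ?thesis using True by (auto simp: cell_def)
qed (simp add: cell_def)

lemma box_sym: "y \<in> nbox h S x \<longleftrightarrow> x \<in> nbox h S y"
  by (auto simp: nbox_def abs_minus_commute)

lemma finite_box_cells: "finite (Pi\<^sub>E (UNIV :: 'd::finite set) (\<lambda>i. {l i..u i :: int}))"
  by (intro finite_PiE) auto

lemma measurable_cell [measurable]: "{x. cell h S x = z} \<in> sets (leb (UNIV :: 'd::finite set))"
proof -
  have "{x \<in> space (leb (UNIV :: 'd set)). \<forall>i. (if i \<in> S then \<lfloor>x i / h\<rfloor> else 0) = z i} \<in> sets (leb UNIV)"
    by measurable
  then show ?thesis by (simp add: fun_eq_iff cell_def)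
qed

lemma pred_box [measurable]:
  assumes [measurable]: "f \<in> M \<rightarrow>\<^sub>M leb (UNIV :: 'd::finite set)" "g \<in> M \<rightarrow>\<^sub>M leb (UNIV :: 'd set)"
  shows "Measurable.pred M (\<lambda>z. g z \<in> nbox h S (f z))"
proof -
  have [measurable]: "(\<lambda>z. f z i) \<in> borel_measurable M" "(\<lambda>z. g z i) \<in> borel_measurable M" for i
    using measurable_compose[OF assms(1) measurable_component_singleton[of i UNIV "\<lambda>_. lborel"]]
      measurable_compose[OF assms(2) measurable_component_singleton[of i UNIV "\<lambda>_. lborel"]] by simp_all
  show ?thesis unfolding nbox_def by simp measurable
qed

lemma box_measurable [measurable]: "nbox h S x \<in> sets (leb (UNIV :: 'd::finite set))"
proof -
  have "{y \<in> space (leb (UNIV :: 'd set)). y \<in> nbox h S x} \<in> sets (leb UNIV)"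
    by (rule measurable_sets_Collect[OF _ ], rule pred_box) auto
  then show ?thesis by simp
qed

text \<open>Size of a box of integer vectors that contains the index of every cell meeting the cube
  of radius T. It is fixed once h and T are, so it disappears when divided by the sample
  size.\<close>

definition cell_count :: "real \<Rightarrow> real \<Rightarrow> 'd::finite itself \<Rightarrow> nat" where
  "cell_count h T _ = card (Pi\<^sub>E (UNIV :: 'd set) (\<lambda>i. {- \<lceil>T / h\<rceil> - 1..\<lceil>T / h\<rceil> + 1}))"

lemma ennreal_comb:
  assumes "0 \<le> a" "0 \<le> q" "0 \<le> b" "0 \<le> d"
  shows "ennreal (a * q + b + 8 * (d * q)) = ennreal a * ennreal q + ennreal b + 8 * (ennreal d * ennreal q)"
  using assms by (simp add: ennreal_mult)

text \<open>Here the masses of boxes have no lower bound; they are merely positive almost surely, by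
  \<open>AE_prob_box_pos\<close>.\<close>

locale law_on_space = prob_space L for L :: "('d::finite \<Rightarrow> real) measure" +
  assumes sets_L [measurable_cong]: "sets L = sets (leb UNIV)"
begin

lemma space_L [simp]: "space L = UNIV"
  using sets_eq_imp_space_eq[OF sets_L] by simp

lemma measurable_prob_box [measurable]: "(\<lambda>x. prob (nbox h S x)) \<in> borel_measurable L"
proof -
  have "(\<lambda>x. \<integral>y. of_bool (y \<in> nbox h S x) \<partial>L :: real) \<in> borel_measurable L"
  proof (rule borel_measurable_lebesgue_integral)
    have "(\<lambda>z. of_bool (snd z \<in> nbox h S (fst z)) :: real) \<in> borel_measurable (L \<Otimes>\<^sub>M L)"
      by measurable
    then show "(\<lambda>(x, y). of_bool (y \<in> nbox h S x) :: real) \<in> borel_measurable (L \<Otimes>\<^sub>M L)"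
      by (simp add: case_prod_unfold)
  qed
  moreover have "(\<integral>y. of_bool (y \<in> nbox h S x) \<partial>L :: real) = prob (nbox h S x)" for x
  proof -
    have "(\<integral>y. of_bool (y \<in> nbox h S x) \<partial>L :: real) = (\<integral>y. indicator (nbox h S x) y \<partial>L)"
      by (simp add: indicator_def of_bool_def)
    then show ?thesis by simp
  qed
  ultimately show ?thesis by simp
qed

lemma prob_cell_le_box: "0 < h \<Longrightarrow> prob {y. cell h S y = cell h S x} \<le> prob (nbox h S x)"
  by (rule finite_measure_mono) (auto intro: cell_eq_imp_box)

text \<open>There are countably many cells, so almost surely no cell of mass zero is hit; and the
  box around a point contains the cell of the point.\<close>

lemma AE_prob_box_pos: assumes "0 < h" shows "AE x in L. 0 < prob (nbox h S x)"
proof -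
  have "AE x in L. \<forall>z. prob {y. cell h S y = z} = 0 \<longrightarrow> cell h S x \<noteq> z"
  proof (rule AE_all_countable[THEN iffD2], intro allI)
    fix z
    show "AE x in L. prob {y. cell h S y = z} = 0 \<longrightarrow> cell h S x \<noteq> z"
    proof (cases "prob {y. cell h S y = z} = 0")
      case True
      then have "emeasure L {y. cell h S y = z} = 0" by (simp add: emeasure_eq_measure)
      then have "AE x in L. x \<notin> {y. cell h S y = z}"
        by (intro AE_not_in null_setsI) (auto simp: sets_L)
      then show ?thesis by simp
    qed simp
  qed
  then show ?thesis
  proof eventually_elim
    case (elim x)
    then have "prob {y. cell h S y = cell h S x} \<noteq> 0" by blast
    then show ?case using prob_cell_le_box[OF assms, of S x] measure_nonneg[of L "{y. cell h S y = cell h S x}"]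
      by linarith
  qed
qed

text \<open>This replaces a lower bound on the box mass: on a given cell the reciprocal box mass is
  at most the reciprocal cell mass, which the mass of the cell cancels.\<close>

lemma nn_integral_inverse_box:
  assumes h: "0 < h" and Z: "finite Z"
  shows "(\<integral>\<^sup>+x. indicator {x. cell h S x \<in> Z} x * ennreal (1 / prob (nbox h S x)) \<partial>L) \<le> of_nat (card Z)"
proof -
  let ?F = "\<lambda>x z. indicator {x. cell h S x = z} x * ennreal (1 / prob (nbox h S x))"
  have one: "(\<integral>\<^sup>+x. ?F x z \<partial>L) \<le> 1" for z
  proof (cases "prob {y. cell h S y = z} = 0")
    case True
    then have "emeasure L {y. cell h S y = z} = 0" by (simp add: emeasure_eq_measure)
    then have "AE x in L. x \<notin> {y. cell h S y = z}"
      by (intro AE_not_in null_setsI) (auto simp: sets_L)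
    then have "(\<integral>\<^sup>+x. ?F x z \<partial>L) = (\<integral>\<^sup>+x. 0 \<partial>L)"
      by (intro nn_integral_cong_AE) (auto elim!: AE_mp)
    then show ?thesis by simp
  next
    case False
    let ?p = "prob {y. cell h S y = z}"
    have p: "0 < ?p" using False measure_nonneg[of L] by (metis less_eq_real_def)
    have "(\<integral>\<^sup>+x. ?F x z \<partial>L) \<le>
        (\<integral>\<^sup>+x. ennreal (1 / ?p) * indicator {x. cell h S x = z} x \<partial>L)"
    proof (rule nn_integral_mono)
      fix x
      show "?F x z \<le>
          ennreal (1 / ?p) * indicator {x. cell h S x = z} x"
      proof (cases "cell h S x = z")
        case True
        then have "?p \<le> prob (nbox h S x)" using prob_cell_le_box[OF h, of S x] by simp
        then have "1 / prob (nbox h S x) \<le> 1 / ?p" using p by (intro divide_left_mono) auto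
        then show ?thesis using True by (simp add: ennreal_leI)
      qed simp
    qed
    also have "\<dots> = ennreal (1 / ?p) * emeasure L {x. cell h S x = z}"
      by (subst nn_integral_cmult_indicator) (auto simp: sets_L)
    also have "\<dots> = 1" using p by (simp add: emeasure_eq_measure flip: ennreal_mult')
    finally show ?thesis .
  qed
  have "(\<integral>\<^sup>+x. indicator {x. cell h S x \<in> Z} x * ennreal (1 / prob (nbox h S x)) \<partial>L) =
      (\<integral>\<^sup>+x. (\<Sum>z\<in>Z. ?F x z) \<partial>L)"
  proof (rule nn_integral_cong)
    fix x
    have "(\<Sum>z\<in>Z. indicator {x. cell h S x = z} x) = (indicator {x. cell h S x \<in> Z} x :: ennreal)"
      using Z by (simp add: indicator_def sum.delta')
    then show "indicator {x. cell h S x \<in> Z} x * ennreal (1 / prob (nbox h S x)) =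
        (\<Sum>z\<in>Z. ?F x z)"
      by (simp flip: sum_distrib_right)
  qed
  also have "\<dots> = (\<Sum>z\<in>Z. \<integral>\<^sup>+x. ?F x z \<partial>L)"
    by (rule nn_integral_sum) (auto intro!: borel_measurable_times_ennreal borel_measurable_indicator simp: sets_L)
  also have "\<dots> \<le> (\<Sum>z\<in>Z. 1)" by (rule sum_mono) (rule one)
  finally show ?thesis by simp
qed

lemma nn_integral_inverse_box_sup_norm:
  assumes h: "0 < h"
  shows "(\<integral>\<^sup>+x. indicator {x. sup_norm S x \<le> T} x * ennreal (1 / prob (nbox h S x)) \<partial>L) \<le>
    of_nat (cell_count h T TYPE('d))"
proof (cases "0 \<le> T")
  case True
  let ?Z = "Pi\<^sub>E (UNIV :: 'd set) (\<lambda>i. {- \<lceil>T / h\<rceil> - 1..\<lceil>T / h\<rceil> + 1})"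
  have "{x. sup_norm S x \<le> T} \<subseteq> {x. cell h S x \<in> ?Z}"
  proof clarify
    fix x assume "sup_norm S x \<le> T"
    then have x: "\<bar>x i\<bar> \<le> T" if "i \<in> S" for i using sup_norm_le_iff[OF True] that by blast
    have "cell h S x i \<in> {- \<lceil>T / h\<rceil> - 1..\<lceil>T / h\<rceil> + 1}" for i
    proof (cases "i \<in> S")
      case True
      have "\<bar>x i / h\<bar> \<le> T / h" using x[OF True] h by (simp add: divide_right_mono)
      then have "- \<lceil>T / h\<rceil> - 1 \<le> \<lfloor>x i / h\<rfloor>" "\<lfloor>x i / h\<rfloor> \<le> \<lceil>T / h\<rceil> + 1" by linarith+
      then show ?thesis using True by (simp add: cell_def)
    next
      case False
      have "0 \<le> T / h" using \<open>0 \<le> T\<close> h by simp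
      then have "- \<lceil>T / h\<rceil> - 1 \<le> 0" "0 \<le> \<lceil>T / h\<rceil> + 1" by linarith+
      then show ?thesis using False unfolding cell_def by (simp only: if_False atLeastAtMost_iff)
    qed
    then show "cell h S x \<in> ?Z" by (auto simp: PiE_iff)
  qed
  then have "(\<integral>\<^sup>+x. indicator {x. sup_norm S x \<le> T} x * ennreal (1 / prob (nbox h S x)) \<partial>L) \<le>
      (\<integral>\<^sup>+x. indicator {x. cell h S x \<in> ?Z} x * ennreal (1 / prob (nbox h S x)) \<partial>L)"
    by (intro nn_integral_mono mult_right_mono) (auto simp: indicator_def)
  also have "\<dots> \<le> of_nat (card ?Z)" by (rule nn_integral_inverse_box[OF h finite_box_cells])
  finally show ?thesis by (simp add: cell_count_def)
next
  case False
  then have "{x. sup_norm S x \<le> T} = {}" using sup_norm_nonneg[of S] by (auto intro: order_trans)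
  then show ?thesis by simp
qed

text \<open>Here the data point y is fixed and the centre x varies, as happens after the order of
  integration is exchanged. All centres whose box holds y lie in the 3^d cells around that of
  y.\<close>

lemma nn_integral_inverse_box_near:
  assumes h: "0 < h"
  shows "(\<integral>\<^sup>+x. indicator (nbox h S x) y * ennreal (1 / prob (nbox h S x)) \<partial>L) \<le> 3 ^ CARD('d)"
proof -
  let ?Z = "Pi\<^sub>E (UNIV :: 'd set) (\<lambda>i. {cell h S y i - 1..cell h S y i + 1})"
  have "card ?Z = (\<Prod>i\<in>(UNIV :: 'd set). card {cell h S y i - 1..cell h S y i + 1})"
    by (rule card_PiE) simp
  also have "\<dots> = 3 ^ CARD('d)" by simp
  finally have c: "card ?Z = 3 ^ CARD('d)" .
  have "cell h S x \<in> ?Z" if "y \<in> nbox h S x" for x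
    using box_imp_cell_near[OF h that] by (auto simp: PiE_iff)
  then have "(\<integral>\<^sup>+x. indicator (nbox h S x) y * ennreal (1 / prob (nbox h S x)) \<partial>L) \<le>
      (\<integral>\<^sup>+x. indicator {x. cell h S x \<in> ?Z} x * ennreal (1 / prob (nbox h S x)) \<partial>L)"
    by (intro nn_integral_mono mult_right_mono) (auto simp: indicator_def)
  also have "\<dots> \<le> of_nat (card ?Z)" by (rule nn_integral_inverse_box[OF h finite_box_cells])
  finally show ?thesis by (simp add: c)
qed

text \<open>The Nadaraya-Watson estimator with box kernel, after the kernel height has cancelled; an
  empty box yields 0.\<close>

definition smoother :: "real \<Rightarrow> 'd set \<Rightarrow> nat set \<Rightarrow> (('d \<Rightarrow> real) \<Rightarrow> real) \<Rightarrow> (nat \<Rightarrow> 'd \<Rightarrow> real) \<Rightarrow> ('d \<Rightarrow> real) \<Rightarrow> real" where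
  "smoother h S I G X x = (\<Sum>i\<in>I. G (X i) * indicator (nbox h S x) (X i)) / (\<Sum>i\<in>I. indicator (nbox h S x) (X i))"

lemma smoother_abs_le: assumes "\<And>x. \<bar>G x\<bar> \<le> B" shows "\<bar>smoother h S I G X x\<bar> \<le> B"
proof (cases "(\<Sum>i\<in>I. indicator (nbox h S x) (X i) :: real) = 0")
  case True
  have "0 \<le> B" using assms[of undefined] by linarith
  then show ?thesis using True by (simp add: smoother_def)
next
  case False
  then have pos: "0 < (\<Sum>i\<in>I. indicator (nbox h S x) (X i) :: real)"
    by (metis indicator_pos_le less_eq_real_def sum_nonneg)
  have "\<bar>\<Sum>i\<in>I. G (X i) * indicator (nbox h S x) (X i)\<bar> \<le> (\<Sum>i\<in>I. B * indicator (nbox h S x) (X i))"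
    by (rule order_trans[OF sum_abs]) (intro sum_mono, use assms in \<open>auto simp: abs_mult indicator_def\<close>)
  then show ?thesis using pos by (simp add: smoother_def abs_divide field_simps sum_distrib_left)
qed

lemma smoother_measurable:
  assumes [measurable]: "G \<in> borel_measurable L"
  shows "(\<lambda>z. smoother h S I G (fst z) (snd z)) \<in> borel_measurable (PiM I (\<lambda>_. L) \<Otimes>\<^sub>M L)"
proof -
  have c[measurable]: "(\<lambda>z. fst z i) \<in> PiM I (\<lambda>_. L) \<Otimes>\<^sub>M L \<rightarrow>\<^sub>M L" if "i \<in> I" for i
    using that by measurable
  have [measurable]: "(\<lambda>z. indicator (nbox h S (snd z)) (fst z i) :: real) \<in> borel_measurable (PiM I (\<lambda>_. L) \<Otimes>\<^sub>M L)"
    if i: "i \<in> I" for i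
  proof -
    have "Measurable.pred (PiM I (\<lambda>_. L) \<Otimes>\<^sub>M L) (\<lambda>z. fst z i \<in> nbox h S (snd z))"
      by (rule pred_box) (use c[OF i] sets_L in \<open>auto cong: measurable_cong_sets\<close>)
    then have "(\<lambda>z. of_bool (fst z i \<in> nbox h S (snd z)) :: real) \<in> borel_measurable (PiM I (\<lambda>_. L) \<Otimes>\<^sub>M L)"
      by measurable
    then show ?thesis by (simp add: indicator_def of_bool_def)
  qed
  show ?thesis unfolding smoother_def
    by (intro borel_measurable_divide borel_measurable_sum borel_measurable_times) (use c in measurable)
qed

text \<open>Integrates \<open>local_average_error\<close> over the centre x. The factor 1/p(x) there
  is never bounded pointwise: in the variance term it integrates to at most the cell count, and in
  the misfit term, after Tonelli, to at most 3^d for each data point. The bias term carries no such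
  factor.\<close>

lemma smoother_error:
  assumes h: "0 < h" and I: "finite I" "I \<noteq> {}"
    and G: "G \<in> borel_measurable L" "\<And>x. \<bar>G x\<bar> \<le> B" and g: "bfun L g"
    and m: "m \<in> borel_measurable L" "\<And>x. \<bar>m x\<bar> \<le> B"
    and loc: "\<And>x. \<bar>\<integral>y. (g y - m x) * indicator (nbox h S x) y \<partial>L\<bar> \<le> \<epsilon> * prob (nbox h S x)"
  shows "(\<integral>x. \<integral>X. of_bool (sup_norm S x \<le> T) * (smoother h S I G X x - m x)^2 \<partial>PiM I (\<lambda>_. L) \<partial>L) \<le>
    32 * B^2 * real (cell_count h T TYPE('d)) / real (card I) + 8 * \<epsilon>^2 +
    8 * 3 ^ CARD('d) * (\<integral>x. (G x - g x)^2 \<partial>L)"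
proof -
  interpret PI: prob_space "PiM I (\<lambda>_. L)" by (rule prob_space_PiM_const)
  let ?in = "\<lambda>x. of_bool (sup_norm S x \<le> T) :: real" and ?p = "\<lambda>x. prob (nbox h S x)"
  have N: "0 < real (card I)" using I by (simp add: card_gt_0_iff)
  have B: "0 \<le> B" using m(2)[of undefined] by linarith
  have bG: "bfun L G" by (rule bfunI[OF G])
  have bD: "bfun L (\<lambda>x. (G x - g x)^2)" by (intro bfun_intros bG g)
  note [measurable] = m(1) bfun_measurable[OF bD]
  let ?J = "\<lambda>x. \<integral>X. ?in x * (smoother h S I G X x - m x)^2 \<partial>PiM I (\<lambda>_. L)"
  have sm: "(\<lambda>X. smoother h S I G X x) \<in> borel_measurable (PiM I (\<lambda>_. L))" for x
    using measurable_compose[OF measurable_Pair2'[of x L "PiM I (\<lambda>_. L)"] smoother_measurable[OF G(1), where h=h and S=S and I=I]] by simp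
  have bs: "bfun (PiM I (\<lambda>_. L)) (\<lambda>X. ?in x * (smoother h S I G X x - m x)^2)" for x
    by (intro bfun_intros bfunI[OF sm smoother_abs_le[OF G(2)]])
  have Jm: "?J \<in> borel_measurable L"
  proof (rule PI.borel_measurable_lebesgue_integral)
    have "(\<lambda>z. smoother h S I G (snd z) (fst z)) \<in> borel_measurable (L \<Otimes>\<^sub>M PiM I (\<lambda>_. L))"
      using measurable_compose[OF measurable_Pair[OF measurable_snd measurable_fst] smoother_measurable[OF G(1), where h=h and S=S and I=I]] by simp
    moreover have "Measurable.pred L (\<lambda>x. sup_norm S x \<le> T)"
      by (rule pred_sup_norm) (simp add: sets_L cong: measurable_cong_sets)
    ultimately show "(\<lambda>(x, X). ?in x * (smoother h S I G X x - m x)^2) \<in> borel_measurable (L \<Otimes>\<^sub>M PiM I (\<lambda>_. L))"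
      unfolding case_prod_unfold by measurable
  qed
  have Jb: "\<bar>?J x\<bar> \<le> (2 * B)^2" for x
  proof (rule PI.integral_abs_le_const_bfun[OF bs])
    fix X
    have "\<bar>smoother h S I G X x - m x\<bar> \<le> 2 * B"
      using smoother_abs_le[where G=G and B=B, OF G(2), of h S I X x] m(2)[of x] by linarith
    then have "(smoother h S I G X x - m x)^2 \<le> (2 * B)^2"
      by (metis B abs_le_square_iff abs_of_nonneg mult_nonneg_nonneg zero_le_numeral)
    then show "\<bar>?in x * (smoother h S I G X x - m x)^2\<bar> \<le> (2 * B)^2" by auto
  qed
  have Jnn: "0 \<le> ?J x" for x by (intro Bochner_Integration.integral_nonneg) auto
  have bJ: "bfun L ?J" by (rule bfunI[OF Jm Jb])
  let ?D = "\<lambda>x. \<integral>\<^sup>+y. ennreal ((G y - g y)^2) * indicator (nbox h S x) y \<partial>L"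
  let ?ip = "\<lambda>x. ennreal (1 / ?p x)"
  let ?F = "\<lambda>x. ennreal (32 * B^2 / real (card I)) * (indicator {x. sup_norm S x \<le> T} x * ?ip x) + ennreal (8 * \<epsilon>^2) + 8 * (?D x * ?ip x)"
  have pt: "ennreal (?J x) \<le> ?F x" if p: "0 < ?p x" for x
  proof (cases "sup_norm S x \<le> T")
    case True
    let ?d = "\<integral>y. (G y - g y)^2 * indicator (nbox h S x) y \<partial>L"
    have d: "?D x = ennreal ?d"
    proof -
      have "bfun L (\<lambda>y. (G y - g y)^2 * indicator (nbox h S x) y)"
        by (intro bfun_mult bD bfunI[where B=1]) (auto simp: indicator_def sets_L)
      from nn_integral_eq_integral[OF bfun_integrable[OF this]]
      have "(\<integral>\<^sup>+y. ennreal ((G y - g y)^2 * indicator (nbox h S x) y) \<partial>L) = ennreal ?d" by simp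
      moreover have "ennreal ((G y - g y)^2 * indicator (nbox h S x) y) = ennreal ((G y - g y)^2) * indicator (nbox h S x) y" for y
        by (auto simp: indicator_def)
      ultimately show ?thesis by simp
    qed
    have dn: "0 \<le> ?d" by (intro Bochner_Integration.integral_nonneg) auto
    have "?J x \<le> 32 * B^2 / (real (card I) * ?p x) + 8 * \<epsilon>^2 + 8 * ?d / ?p x"
      using local_average_error[OF I _ p G m(2) g loc] True sets_L by (simp add: smoother_def)
    also have "\<dots> = 32 * B^2 / real (card I) * (1 / ?p x) + 8 * \<epsilon>^2 + 8 * (?d * (1 / ?p x))" by simp
    finally have "ennreal (?J x) \<le> ennreal (32 * B^2 / real (card I) * (1 / ?p x) + 8 * \<epsilon>^2 + 8 * (?d * (1 / ?p x)))"
      by (rule ennreal_leI)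
    also have "\<dots> = ennreal (32 * B^2 / real (card I)) * ?ip x + ennreal (8 * \<epsilon>^2) + 8 * (ennreal ?d * ?ip x)"
      by (rule ennreal_comb) (use p N dn in auto)
    finally show ?thesis using True unfolding d by simp
  next
    case False
    then show ?thesis by simp
  qed
  have m1: "(\<lambda>x. indicator {x. sup_norm S x \<le> T} x * ?ip x) \<in> borel_measurable L"
  proof -
    have "{x. sup_norm S x \<le> T} \<in> sets L"
      using pred_sup_norm[of "\<lambda>x. x" L S T] by (simp add: pred_def sets_L cong: measurable_cong_sets)
    then show ?thesis by measurable
  qed
  have ibox[measurable]: "(\<lambda>z. indicator (nbox h S (fst z)) (snd z) :: ennreal) \<in> borel_measurable (L \<Otimes>\<^sub>M L)"
  proof -
    have "Measurable.pred (L \<Otimes>\<^sub>M L) (\<lambda>z. snd z \<in> nbox h S (fst z))" by measurable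
    then have "(\<lambda>z. of_bool (snd z \<in> nbox h S (fst z)) :: ennreal) \<in> borel_measurable (L \<Otimes>\<^sub>M L)" by measurable
    then show ?thesis by (simp add: indicator_def of_bool_def)
  qed
  have m2: "?D \<in> borel_measurable L"
    by (rule borel_measurable_nn_integral) (unfold case_prod_unfold, measurable)
  have "(\<integral>\<^sup>+x. ?D x * ?ip x \<partial>L) = (\<integral>\<^sup>+x. \<integral>\<^sup>+y. ennreal ((G y - g y)^2) * indicator (nbox h S x) y * ?ip x \<partial>L \<partial>L)"
  proof (rule nn_integral_cong, rule nn_integral_multc[symmetric])
    fix x
    have "(\<lambda>y. indicator (nbox h S x) y :: ennreal) \<in> borel_measurable L"
      by (intro borel_measurable_indicator) (simp add: sets_L)
    then show "(\<lambda>y. ennreal ((G y - g y)^2) * indicator (nbox h S x) y) \<in> borel_measurable L" by measurable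
  qed
  \<comment> \<open>Tonelli: from here on the inner integral runs over the centres whose box
    contains the fixed point y.\<close>
  also have "\<dots> = (\<integral>\<^sup>+y. \<integral>\<^sup>+x. ennreal ((G y - g y)^2) * indicator (nbox h S x) y * ?ip x \<partial>L \<partial>L)"
  proof -
    interpret pair_sigma_finite L L by unfold_locales
    show ?thesis by (rule Fubini'[symmetric]) (unfold case_prod_unfold, measurable)
  qed
  also have "\<dots> = (\<integral>\<^sup>+y. ennreal ((G y - g y)^2) * (\<integral>\<^sup>+x. indicator (nbox h S x) y * ?ip x \<partial>L) \<partial>L)"
  proof (rule nn_integral_cong)
    fix y
    have "(\<lambda>x. indicator (nbox h S x) y :: ennreal) \<in> borel_measurable L"
    proof -
      have "(\<lambda>x. indicator (nbox h S x) y :: ennreal) = indicator (nbox h S y)"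
        by (auto simp: fun_eq_iff indicator_def box_sym[of y])
      then show ?thesis by (simp add: sets_L)
    qed
    then show "(\<integral>\<^sup>+x. ennreal ((G y - g y)^2) * indicator (nbox h S x) y * ?ip x \<partial>L) =
        ennreal ((G y - g y)^2) * (\<integral>\<^sup>+x. indicator (nbox h S x) y * ?ip x \<partial>L)"
      unfolding mult.assoc by (intro nn_integral_cmult) measurable
  qed
  also have "\<dots> \<le> (\<integral>\<^sup>+y. ennreal ((G y - g y)^2) * 3 ^ CARD('d) \<partial>L)"
    by (intro nn_integral_mono mult_left_mono nn_integral_inverse_box_near h) simp
  also have "\<dots> = (\<integral>\<^sup>+y. ennreal ((G y - g y)^2) \<partial>L) * 3 ^ CARD('d)"
    by (rule nn_integral_multc) simp
  also have "(\<integral>\<^sup>+y. ennreal ((G y - g y)^2) \<partial>L) = ennreal (\<integral>y. (G y - g y)^2 \<partial>L)"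
    by (rule nn_integral_eq_integral[OF bfun_integrable[OF bD]]) simp
  finally have Dle: "(\<integral>\<^sup>+x. ?D x * ?ip x \<partial>L) \<le> ennreal (\<integral>y. (G y - g y)^2 \<partial>L) * 3 ^ CARD('d)" .
  have "ennreal (\<integral>x. ?J x \<partial>L) = (\<integral>\<^sup>+x. ennreal (?J x) \<partial>L)"
    by (rule nn_integral_eq_integral[OF bfun_integrable[OF bJ], symmetric]) (use Jnn in simp)
  also have "\<dots> \<le> (\<integral>\<^sup>+x. ?F x \<partial>L)"
    by (rule nn_integral_mono_AE) (use AE_prob_box_pos[OF h, of S] in eventually_elim, rule pt)
  also have "\<dots> = ennreal (32 * B^2 / real (card I)) * (\<integral>\<^sup>+x. indicator {x. sup_norm S x \<le> T} x * ?ip x \<partial>L) +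
      ennreal (8 * \<epsilon>^2) + 8 * (\<integral>\<^sup>+x. ?D x * ?ip x \<partial>L)"
  proof -
    note [measurable] = m1 m2
    have "(\<lambda>x. ?D x * ?ip x) \<in> borel_measurable L"
      by (intro borel_measurable_times_ennreal m2) measurable
    then show ?thesis
      using m1 by (subst nn_integral_add, measurable)+ (simp add: nn_integral_cmult emeasure_space_1[simplified])
  qed
  also have "\<dots> \<le> ennreal (32 * B^2 / real (card I)) * of_nat (cell_count h T TYPE('d)) +
      ennreal (8 * \<epsilon>^2) + 8 * (ennreal (\<integral>y. (G y - g y)^2 \<partial>L) * 3 ^ CARD('d))"
    by (intro add_mono mult_left_mono nn_integral_inverse_box_sup_norm h Dle) auto
  also have "\<dots> = ennreal (32 * B^2 * real (cell_count h T TYPE('d)) / real (card I) + 8 * \<epsilon>^2 +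
    8 * 3 ^ CARD('d) * (\<integral>x. (G x - g x)^2 \<partial>L))"
  proof -
    have i: "0 \<le> (\<integral>y. (G y - g y)^2 \<partial>L)" by simp
    have "of_nat (cell_count h T TYPE('d)) = ennreal (real (cell_count h T TYPE('d)))"
      by (simp add: ennreal_of_nat_eq_real_of_nat)
    moreover have "(3::ennreal) ^ CARD('d) = ennreal (3 ^ CARD('d))" by (simp flip: ennreal_power ennreal_numeral)
    moreover have "(8::ennreal) = ennreal 8" by simp
    ultimately show ?thesis using i
      by (simp only: ennreal_mult'[symmetric] ennreal_plus[symmetric] zero_le_power2 zero_le_mult_iff
          zero_le_divide_iff zero_le_numeral of_nat_0_le_iff zero_le_power add_nonneg_nonneg mult_nonneg_nonneg simp_thms)
        (simp add: mult_ac)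
  qed
  finally show ?thesis
    by (subst (asm) ennreal_le_iff) auto
qed

end

section \<open>One backfitting step on a subsample\<close>

text \<open>The bound has to hold even for x outside the space, where the section may fail to be
  integrable; its integral is then 0 by convention.\<close>

lemma bfun_integral_pair:
  assumes "prob_space L" "bfun (M \<Otimes>\<^sub>M L) F"
  shows "bfun M (\<lambda>x. \<integral>y. F (x, y) \<partial>L)"
proof -
  interpret L: prob_space L by fact
  obtain B where B: "\<And>z. \<bar>F z\<bar> \<le> B" "0 \<le> B" using bfun_bound[OF assms(2)] by blast
  show ?thesis
  proof (rule bfunI)
    show "(\<lambda>x. \<integral>y. F (x, y) \<partial>L) \<in> borel_measurable M"
      using bfun_measurable[OF assms(2)] by (intro L.borel_measurable_lebesgue_integral) simp
    show "\<bar>\<integral>y. F (x, y) \<partial>L\<bar> \<le> B" for x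
    proof (cases "integrable L (\<lambda>y. F (x, y))")
      case True
      then show ?thesis
        by (rule L.integral_abs_le_const_bfun[OF bfunI[OF borel_measurable_integrable B(1)] B(1)])
    next
      case False
      then show ?thesis using B(2) by (simp add: not_integrable_integral_eq)
    qed
  qed
qed

lemma bfun_section_pair:
  assumes "bfun (M \<Otimes>\<^sub>M L) F" "x \<in> space M" shows "bfun L (\<lambda>y. F (x, y))"
  by (rule bfun_comp[OF assms(1)]) (rule measurable_Pair1'[OF assms(2)])

lemma pair_Fubini_bfun:
  assumes "prob_space M" "prob_space L" "bfun (M \<Otimes>\<^sub>M L) F"
  shows "(\<integral>x. \<integral>y. F (x, y) \<partial>L \<partial>M) = (\<integral>y. \<integral>x. F (x, y) \<partial>M \<partial>L)"
proof -
  interpret M: prob_space M by fact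
  interpret L: prob_space L by fact
  interpret pair_prob_space M L ..
  have "integrable (M \<Otimes>\<^sub>M L) (case_prod (\<lambda>x y. F (x, y)))"
    using P.bfun_integrable[OF assms(3)] by (simp add: case_prod_eta)
  from Fubini_integral[OF this] show ?thesis by simp
qed

lemma kern_eq:
  assumes "0 < h"
  shows "kern h S (\<lambda>j. x j - y j) = inverse ((2 * h) ^ card S) * indicator (nbox h S x) y"
  unfolding kern_def using sup_norm_le_iff[of h S "\<lambda>j. x j - y j"] assms
  by (auto simp: nbox_def indicator_def)

text \<open>Kernel height and sample size cancel between the kernel and the density estimate; if no
  observation falls into the box, both sides are 0 because x/0 = 0.\<close>

lemma (in law_on_space) nadaraya_watson_eq:
  assumes "0 < h" "finite I"
  shows "avg I (\<lambda>i. G (X i) * (kern h S (\<lambda>j. x j - X i j) / f_hat h X I S x)) = smoother h S I G X x"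
proof (cases "I = {}")
  case True
  then show ?thesis by (simp add: avg_def smoother_def)
next
  case False
  let ?k = "inverse ((2 * h) ^ card S)" and ?b = "\<lambda>i. indicator (nbox h S x) (X i) :: real"
  have N: "real (card I) \<noteq> 0" and k: "?k \<noteq> 0" using assms False by auto
  have f: "f_hat h X I S x = ?k * (\<Sum>i\<in>I. ?b i) / real (card I)"
    unfolding f_hat_def avg_def kern_eq[OF assms(1)] by (simp add: sum_distrib_left)
  have "avg I (\<lambda>i. G (X i) * (kern h S (\<lambda>j. x j - X i j) / f_hat h X I S x)) =
      (\<Sum>i\<in>I. G (X i) * ?b i) * (?k / f_hat h X I S x) / real (card I)"
    unfolding avg_def kern_eq[OF assms(1)] sum_distrib_right
    by (intro arg_cong2[where f="(/)"] sum.cong refl) simp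
  also have "\<dots> = smoother h S I G X x"
  proof (cases "(\<Sum>i\<in>I. ?b i) = 0")
    case True
    then show ?thesis unfolding f smoother_def by simp
  next
    case nz: False
    have "?k / f_hat h X I S x = real (card I) / (\<Sum>i\<in>I. ?b i)"
      unfolding f using N k nz by (simp add: field_simps)
    then show ?thesis unfolding smoother_def using N by simp
  qed
  finally show ?thesis .
qed

lemma measurable_indicator_nbox:
  assumes "f \<in> M \<rightarrow>\<^sub>M leb (UNIV :: 'd::finite set)" "g \<in> M \<rightarrow>\<^sub>M leb (UNIV :: 'd set)"
  shows "(\<lambda>z. indicator (nbox h S (f z)) (g z) :: real) \<in> borel_measurable M"
proof -
  have "(\<lambda>z. of_bool (g z \<in> nbox h S (f z)) :: real) \<in> borel_measurable M"
    using pred_box[OF assms] by measurable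
  then show ?thesis by (simp add: indicator_def of_bool_def)
qed

context missing_data
begin

sublocale P: law_on_space P
  by unfold_locales simp

abbreviation (input) "s \<equiv> real (card \<S>)"
abbreviation "PX I \<equiv> PiM I (\<lambda>_. P)"

definition cut_residual :: "real \<Rightarrow> ('d set \<Rightarrow> ('d \<Rightarrow> real) \<Rightarrow> real) \<Rightarrow> 'd set \<Rightarrow> ('d \<Rightarrow> real) \<Rightarrow> real" where
  "cut_residual T \<alpha> S y = partial_residual \<alpha> S y * of_bool (sup_norm UNIV y \<le> T)"

text \<open>The ratio of \<open>r_hat\<close> to its expectation \<open>R S\<close>, hence an
  average with mean 1. The unknown constant \<open>R S\<close> cancels from all fitted
  quantities.\<close>

definition rho_hat :: "(nat \<Rightarrow> 'd \<Rightarrow> real) \<Rightarrow> nat set \<Rightarrow> 'd set \<Rightarrow> real" where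
  "rho_hat X I S = avg I (\<lambda>i. \<rho> S (X i))"

definition centre_hat :: "real \<Rightarrow> ('d set \<Rightarrow> ('d \<Rightarrow> real) \<Rightarrow> real) \<Rightarrow> 'd set \<Rightarrow> nat set \<Rightarrow> (nat \<Rightarrow> 'd \<Rightarrow> real) \<Rightarrow> real" where
  "centre_hat T \<alpha> S I X = (\<Sum>i\<in>I. w_hat r lam X I S (X i) * cut_residual T \<alpha> S (X i)) /
     (\<Sum>i\<in>I. w_hat r lam X I S (X i))"

lemma r_hat_eq: "S \<in> \<S> \<Longrightarrow> r_hat r X I S = R S * rho_hat X I S"
  unfolding r_hat_def rho_hat_def by (simp add: r_eq avg_cmult)

lemma rho_hat_nonneg: "S \<in> \<S> \<Longrightarrow> 0 \<le> rho_hat X I S"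
  unfolding rho_hat_def by (intro avg_nonneg less_imp_le[OF rho_pos])

lemma w_hat_eq: "S \<in> \<S> \<Longrightarrow> w_hat r lam X I S x = lam S * \<rho> S x / (rho_hat X I S + lam S * \<rho> S x)"
proof -
  assume S: "S \<in> \<S>"
  have "w_hat r lam X I S x = (R S * (lam S * \<rho> S x)) / (R S * (rho_hat X I S + lam S * \<rho> S x))"
    unfolding w_hat_def r_hat_eq[OF S] r_eq[OF S] by (simp add: algebra_simps)
  then show ?thesis using R_pos[OF S] by simp
qed

text \<open>The difference of the two weights factors as (1 - rho_hat) times \<open>w_hat\<close>
  times 1 / (1 + lam S * \<rho> S x), and the last two factors lie in [0, 1]. The error is thus
  uniform in x.\<close>

lemma w_hat_bounds:
  assumes S: "S \<in> \<S>"
  shows "0 < w_hat r lam X I S x" "w_hat r lam X I S x \<le> 1"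
    "\<bar>w_hat r lam X I S x - w S x\<bar> \<le> \<bar>rho_hat X I S - 1\<bar>"
proof -
  let ?l = "lam S * \<rho> S x" and ?R = "rho_hat X I S"
  have l: "0 < ?l" by (rule lam_rho_pos[OF S])
  have R: "0 \<le> ?R" by (rule rho_hat_nonneg[OF S])
  show w1: "0 < w_hat r lam X I S x" and w2: "w_hat r lam X I S x \<le> 1"
    unfolding w_hat_eq[OF S] using l R by (auto simp: add_nonneg_pos)
  have gen: "\<bar>l / (R + l) - l / (1 + l)\<bar> = \<bar>1 - R\<bar> * (l / (R + l)) * (1 / (1 + l))" if "0 < l" "0 \<le> R" for l R :: real
  proof -
    have "l / (R + l) - l / (1 + l) = (1 - R) * (l / (R + l)) * (1 / (1 + l))"
      using that by (simp add: divide_simps add_nonneg_pos) (simp add: algebra_simps)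
    moreover have "0 \<le> l / (R + l)" "0 \<le> 1 / (1 + l)" using that by auto
    ultimately show ?thesis by (simp only: abs_mult abs_of_nonneg)
  qed
  have "\<bar>w_hat r lam X I S x - w S x\<bar> = \<bar>1 - ?R\<bar> * w_hat r lam X I S x * (1 / (1 + ?l))"
    using gen[OF l R] unfolding w_hat_eq[OF S] w_def .
  also have "\<dots> \<le> \<bar>1 - ?R\<bar> * 1 * 1"
    using w1 w2 l by (intro mult_mono) auto
  finally show "\<bar>w_hat r lam X I S x - w S x\<bar> \<le> \<bar>?R - 1\<bar>" by (simp add: abs_minus_commute)
qed

text \<open>Expresses the step through smoother, weight and centre, each of which has a population
  counterpart in \<open>update\<close>.\<close>

lemma backfit_eq:
  assumes h: "0 < h" and I: "finite I"
  shows "backfit_step \<S> a r lam h T X I \<alpha> S x = (if sup_norm S x \<le> T then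
    (1 - \<eta>) * \<alpha> S x + \<eta> * w_hat r lam X I S x * (P.smoother h S I (cut_residual T \<alpha> S) X x - centre_hat T \<alpha> S I X) else 0)"
proof -
  have "avg I (\<lambda>i. (a (X i) - (\<Sum>S'\<in>\<S> - {S}. \<alpha> S' (X i))) * of_bool (sup_norm UNIV (X i) \<le> T) *
      (kern h S (\<lambda>j. x j - X i j) / f_hat h X I S x)) = P.smoother h S I (cut_residual T \<alpha> S) X x"
    using P.nadaraya_watson_eq[OF h I, of "cut_residual T \<alpha> S" X S x]
    by (simp add: cut_residual_def partial_residual_def)
  moreover have "(\<Sum>i\<in>I. w_hat r lam X I S (X i) * (a (X i) - (\<Sum>S'\<in>\<S> - {S}. \<alpha> S' (X i))) * of_bool (sup_norm UNIV (X i) \<le> T)) =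
      (\<Sum>i\<in>I. w_hat r lam X I S (X i) * cut_residual T \<alpha> S (X i))"
    by (simp only: cut_residual_def partial_residual_def mult.assoc)
  ultimately show ?thesis
    unfolding backfit_step_def Let_def centre_hat_def \<eta>_def by simp
qed

lemma partial_residual_abs_le:
  assumes b: "0 \<le> b" and \<alpha>: "\<And>S' x. S' \<in> \<S> \<Longrightarrow> \<bar>\<alpha> S' x\<bar> \<le> b"
  shows "\<bar>partial_residual \<alpha> S x\<bar> \<le> A + s * b" "\<bar>cut_residual T \<alpha> S x\<bar> \<le> A + s * b"
proof -
  have A: "0 \<le> A" using a_bound[of undefined] by linarith
  have "\<bar>\<Sum>S'\<in>\<S> - {S}. \<alpha> S' x\<bar> \<le> (\<Sum>S'\<in>\<S> - {S}. b)"
    by (rule order_trans[OF sum_abs sum_mono]) (use \<alpha> in auto)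
  also have "\<dots> = real (card (\<S> - {S})) * b" by simp
  also have "\<dots> \<le> s * b" using b by (intro mult_right_mono) (auto intro!: card_mono)
  finally show 1: "\<bar>partial_residual \<alpha> S x\<bar> \<le> A + s * b"
    unfolding partial_residual_def using a_bound[of x] by linarith
  then show "\<bar>cut_residual T \<alpha> S x\<bar> \<le> A + s * b" using A b by (auto simp: cut_residual_def)
qed

lemma weighted_average_abs_le:
  fixes v G :: "'i \<Rightarrow> real"
  assumes "\<And>i. i \<in> I \<Longrightarrow> 0 \<le> v i" "\<And>i. i \<in> I \<Longrightarrow> \<bar>G i\<bar> \<le> B" "0 \<le> B"
  shows "\<bar>(\<Sum>i\<in>I. v i * G i) / (\<Sum>i\<in>I. v i)\<bar> \<le> B"
proof (cases "(\<Sum>i\<in>I. v i) = 0")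
  case False
  then have pos: "0 < (\<Sum>i\<in>I. v i)" using sum_nonneg[of I v] assms(1) by force
  have "\<bar>\<Sum>i\<in>I. v i * G i\<bar> \<le> (\<Sum>i\<in>I. v i * B)"
    by (rule order_trans[OF sum_abs]) (intro sum_mono, use assms in \<open>auto simp: abs_mult intro: mult_left_mono\<close>)
  then show ?thesis using pos by (simp add: abs_divide divide_le_eq sum_distrib_left mult.commute)
qed (use assms in simp)

lemma centre_hat_abs_le:
  assumes S: "S \<in> \<S>" and b: "0 \<le> b" and \<alpha>: "\<And>S' x. S' \<in> \<S> \<Longrightarrow> \<bar>\<alpha> S' x\<bar> \<le> b"
  shows "\<bar>centre_hat T \<alpha> S I X\<bar> \<le> A + s * b"
proof -
  have A: "0 \<le> A" using a_bound[of undefined] by linarith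
  show ?thesis unfolding centre_hat_def
    by (rule weighted_average_abs_le)
      (use w_hat_bounds(1)[OF S] partial_residual_abs_le[OF b \<alpha>] A b in \<open>auto intro: less_imp_le\<close>)
qed

lemma backfit_abs_le:
  assumes S: "S \<in> \<S>" and h: "0 < h" and I: "finite I" and b: "0 \<le> b" and \<alpha>: "\<And>S' x. S' \<in> \<S> \<Longrightarrow> \<bar>\<alpha> S' x\<bar> \<le> b"
  shows "\<bar>backfit_step \<S> a r lam h T X I \<alpha> S x\<bar> \<le> b + 2 * (A + s * b)"
proof -
  let ?B = "A + s * b"
  have A: "0 \<le> A" using a_bound[of undefined] by linarith
  have sm: "\<bar>P.smoother h S I (cut_residual T \<alpha> S) X x\<bar> \<le> ?B"
    by (rule P.smoother_abs_le) (rule partial_residual_abs_le[OF b \<alpha>])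
  have ce: "\<bar>centre_hat T \<alpha> S I X\<bar> \<le> ?B" by (rule centre_hat_abs_le[OF S b \<alpha>])
  have "\<bar>(1 - \<eta>) * \<alpha> S x + \<eta> * w_hat r lam X I S x * (P.smoother h S I (cut_residual T \<alpha> S) X x - centre_hat T \<alpha> S I X)\<bar> \<le>
     1 * b + 1 * 1 * (2 * ?B)"
    by (intro order_trans[OF abs_triangle_ineq] add_mono; unfold abs_mult; intro mult_mono)
      (use eta_bounds w_hat_bounds(1,2)[OF S, of X I x] \<alpha>[OF S] sm ce A b in auto)
  then show ?thesis unfolding backfit_eq[OF h I] using A b by auto
qed

lemma update_abs_le:
  assumes \<alpha>: "admissible \<alpha>" and S: "S \<in> \<S>" and b: "0 \<le> b" and \<alpha>b: "\<And>S' x. S' \<in> \<S> \<Longrightarrow> \<bar>\<alpha> S' x\<bar> \<le> b"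
  shows "\<bar>E S (partial_residual \<alpha> S) x\<bar> \<le> A + s * b"
    "\<bar>(\<integral>y. w S y * partial_residual \<alpha> S y \<partial>P) / (\<integral>y. w S y \<partial>P)\<bar> \<le> A + s * b"
    "\<bar>(1 - \<eta>) * \<alpha> S x + \<eta> * update \<alpha> S x\<bar> \<le> b + 2 * (A + s * b)"
proof -
  let ?B = "A + s * b"
  have A: "0 \<le> A" using a_bound[of undefined] by linarith
  have pr: "\<bar>partial_residual \<alpha> S x\<bar> \<le> ?B" for x by (rule partial_residual_abs_le[OF b \<alpha>b])
  show 1: "\<bar>E S (partial_residual \<alpha> S) x\<bar> \<le> ?B"
    by (rule E_abs_le[OF S bfun_partial_residual[OF \<alpha>] pr])
  have bw: "bfun P (w S)" "bfun P (\<lambda>y. w S y * partial_residual \<alpha> S y)"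
    unfolding bfun_P by (intro bfun_mult bfun_w[OF S] bfun_partial_residual[OF \<alpha>])+
  have "\<bar>\<integral>y. w S y * partial_residual \<alpha> S y \<partial>P\<bar> \<le> (\<integral>y. \<bar>w S y * partial_residual \<alpha> S y\<bar> \<partial>P)"
    by (rule integral_abs_bound)
  also have "\<dots> \<le> (\<integral>y. ?B * w S y \<partial>P)"
  proof (rule P.bfun_integral_mono)
    show "\<bar>w S y * partial_residual \<alpha> S y\<bar> \<le> ?B * w S y" for y
      using pr[of y] w_pos[OF S, of y] by (simp add: abs_mult mult.commute mult_left_mono)
  qed (intro bfun_intros bw)+
  also have "\<dots> = ?B * (\<integral>y. w S y \<partial>P)" by simp
  finally show 2: "\<bar>(\<integral>y. w S y * partial_residual \<alpha> S y \<partial>P) / (\<integral>y. w S y \<partial>P)\<bar> \<le> ?B"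
    using integral_w_pos[OF S] by (simp add: abs_divide divide_le_eq)
  have aux: "\<bar>(1 - \<eta>) * p + \<eta> * (v * (e - q))\<bar> \<le> 1 * b + 1 * (1 * (2 * B))"
    if "\<bar>p\<bar> \<le> b" "\<bar>e\<bar> \<le> B" "\<bar>q\<bar> \<le> B" "0 < v" "v \<le> 1" for p e q v B
    by (intro order_trans[OF abs_triangle_ineq] add_mono; unfold abs_mult; intro mult_mono)
      (use eta_bounds that b in auto)
  have "\<bar>(1 - \<eta>) * \<alpha> S x + \<eta> * (w S x * (E S (partial_residual \<alpha> S) x -
      (\<integral>y. w S y * partial_residual \<alpha> S y \<partial>P) / (\<integral>y. w S y \<partial>P)))\<bar> \<le> 1 * b + 1 * (1 * (2 * ?B))"
    by (rule aux[OF \<alpha>b[OF S] 1 2 w_pos[OF S] w_le_1[OF S]])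
  then show "\<bar>(1 - \<eta>) * \<alpha> S x + \<eta> * update \<alpha> S x\<bar> \<le> b + 2 * ?B" by (simp add: update_def)
qed

section \<open>Joint measurability in data and evaluation point\<close>

lemma measurable_rho_hat:
  assumes S: "S \<in> \<S>" and X: "\<And>i. i \<in> I \<Longrightarrow> (\<lambda>z. X z i) \<in> M \<rightarrow>\<^sub>M leb UNIV"
  shows "(\<lambda>z. rho_hat (X z) I S) \<in> borel_measurable M"
  unfolding rho_hat_def avg_def
  by (intro borel_measurable_divide borel_measurable_sum measurable_compose[OF X bfun_measurable[OF bfun_rho[OF S]]]) auto

lemma measurable_w_hat:
  assumes S: "S \<in> \<S>" and X: "\<And>i. i \<in> I \<Longrightarrow> (\<lambda>z. X z i) \<in> M \<rightarrow>\<^sub>M leb UNIV" and x: "x \<in> M \<rightarrow>\<^sub>M leb UNIV"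
  shows "(\<lambda>z. w_hat r lam (X z) I S (x z)) \<in> borel_measurable M"
  unfolding w_hat_eq[OF S]
  using measurable_rho_hat[where X=X and M=M, OF S X] measurable_compose[OF x bfun_measurable[OF bfun_rho[OF S]]]
  by measurable

lemma measurable_cut_residual:
  assumes x: "x \<in> M \<rightarrow>\<^sub>M leb UNIV" and \<alpha>: "\<And>S'. S' \<in> \<S> \<Longrightarrow> (\<lambda>z. \<alpha> z S' (x z)) \<in> borel_measurable M"
  shows "(\<lambda>z. cut_residual T (\<alpha> z) S (x z)) \<in> borel_measurable M"
  unfolding cut_residual_def partial_residual_def
  using pred_sup_norm[OF x, of UNIV T] measurable_compose[OF x a_meas]
  by (intro borel_measurable_times borel_measurable_diff borel_measurable_sum \<alpha>) auto

lemma measurable_centre_hat: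
  assumes S: "S \<in> \<S>" and X: "\<And>i. i \<in> I \<Longrightarrow> (\<lambda>z. X z i) \<in> M \<rightarrow>\<^sub>M leb UNIV"
    and \<alpha>: "\<And>S' i. S' \<in> \<S> \<Longrightarrow> i \<in> I \<Longrightarrow> (\<lambda>z. \<alpha> z S' (X z i)) \<in> borel_measurable M"
  shows "(\<lambda>z. centre_hat T (\<alpha> z) S I (X z)) \<in> borel_measurable M"
  unfolding centre_hat_def
  by (intro borel_measurable_divide borel_measurable_sum borel_measurable_times
      measurable_w_hat[OF S X] measurable_cut_residual X \<alpha>) auto

lemma measurable_smoother:
  assumes X: "\<And>i. i \<in> I \<Longrightarrow> (\<lambda>z. X z i) \<in> M \<rightarrow>\<^sub>M leb UNIV" and x: "x \<in> M \<rightarrow>\<^sub>M leb UNIV"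
    and G: "\<And>i. i \<in> I \<Longrightarrow> (\<lambda>z. G z (X z i)) \<in> borel_measurable M"
  shows "(\<lambda>z. P.smoother h S I (G z) (X z) (x z)) \<in> borel_measurable M"
  unfolding P.smoother_def
  by (intro borel_measurable_divide borel_measurable_sum borel_measurable_times measurable_indicator_nbox G x X) auto

text \<open>Data, evaluation point and previous iterate may all depend on z: iterates are random
  functions, evaluated both at fresh points and at the observations themselves.\<close>

lemma measurable_backfit:
  assumes S: "S \<in> \<S>" and h: "0 < h" and I: "finite I"
    and X: "\<And>i. i \<in> I \<Longrightarrow> (\<lambda>z. X z i) \<in> M \<rightarrow>\<^sub>M leb UNIV" and x: "x \<in> M \<rightarrow>\<^sub>M leb UNIV"
    and \<alpha>x: "(\<lambda>z. \<alpha> z S (x z)) \<in> borel_measurable M"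
    and \<alpha>X: "\<And>S' i. S' \<in> \<S> \<Longrightarrow> i \<in> I \<Longrightarrow> (\<lambda>z. \<alpha> z S' (X z i)) \<in> borel_measurable M"
  shows "(\<lambda>z. backfit_step \<S> a r lam h T (X z) I (\<alpha> z) S (x z)) \<in> borel_measurable M"
proof -
  note [measurable] = pred_sup_norm[OF x, of S T] \<alpha>x measurable_w_hat[where X=X and M=M and x=x, OF S X x]
    measurable_centre_hat[where X=X and M=M and \<alpha>=\<alpha> and T=T, OF S X \<alpha>X]
  have [measurable]: "(\<lambda>z. P.smoother h S I (cut_residual T (\<alpha> z) S) (X z) (x z)) \<in> borel_measurable M"
    by (intro measurable_smoother X x measurable_cut_residual \<alpha>X) auto
  show ?thesis unfolding backfit_eq[OF h I] by measurable
qed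

definition tail :: "real \<Rightarrow> real" where
  "tail T = P.prob {x. \<not> sup_norm UNIV x \<le> T}"

lemma tail_nonneg: "0 \<le> tail T"
  by (simp add: tail_def)

lemma integral_tail: "(\<integral>x. of_bool (\<not> sup_norm UNIV x \<le> T) \<partial>P) = tail T"
proof -
  have "(\<integral>x. of_bool (\<not> sup_norm UNIV x \<le> T) \<partial>P :: real) = (\<integral>x. indicator {x. \<not> sup_norm UNIV x \<le> T} x \<partial>P)"
    by (simp add: indicator_def of_bool_def)
  then show ?thesis by (simp add: tail_def)
qed

definition total_error :: "('d set \<Rightarrow> ('d \<Rightarrow> real) \<Rightarrow> real) \<Rightarrow> ('d set \<Rightarrow> ('d \<Rightarrow> real) \<Rightarrow> real) \<Rightarrow> real" where
  "total_error \<alpha> \<beta> = (\<Sum>S\<in>\<S>. \<integral>x. (\<alpha> S x - \<beta> S x)^2 \<partial>P)"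

lemma total_error_nonneg: "0 \<le> total_error \<alpha> \<beta>"
  unfolding total_error_def by (intro sum_nonneg) simp

text \<open>The sum of the coefficients of the four error sources collected at the end of
  \<open>one_step_error\<close>: previous error, bias, tail, sampling. \<open>B\<close> bounds the
  residuals, \<open>v\<close> bounds the weight from below, and \<open>D\<close> counts neighbouring
  cells.\<close>

definition step_const :: "real \<Rightarrow> 'd set \<Rightarrow> real" where
  "step_const b S = (let B = A + s * b; v = lam S * c / (1 + lam S * c); D = 3 ^ CARD('d) in
     4 + 32 * D * s + 16 * s / v^2 + 9 * B^2 + 32 * D * B^2 + 16 * B^2 / v^2 + 32 +
     128 * B^2 + 16 / v^2 * (4 * B^2 * C^2 + 2 * B^2) + 16 * B^2 * C^2)"

lemma step_const_nonneg: "0 \<le> step_const b S"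
  unfolding step_const_def Let_def by (intro add_nonneg_nonneg) auto

lemma integral_rho_hat:
  assumes S: "S \<in> \<S>" and I: "finite I" "I \<noteq> {}"
  shows "(\<integral>X. (rho_hat X I S - 1)^2 \<partial>PX I) \<le> C^2 / real (card I)"
proof -
  have b: "bfun P (\<rho> S)" using bfun_rho[OF S] bfun_P by blast
  have "(\<integral>X. (rho_hat X I S - 1)^2 \<partial>PX I) \<le> (\<integral>x. (\<rho> S x)^2 \<partial>P) / real (card I)"
    using P.integral_avg_deviation_le[OF I b] unfolding rho_hat_def integral_rho[OF S] .
  also have "(\<integral>x. (\<rho> S x)^2 \<partial>P) \<le> C^2"
    by (rule P.integral_le_const_bfun[OF bfun_power[OF b]])
      (use rho_le[OF S] rho_pos[OF S] in \<open>auto intro: power_mono less_imp_le\<close>)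
  finally show ?thesis by (simp add: divide_right_mono)
qed

end

context missing_data
begin

text \<open>The previous fitted iterate \<beta> is a fixed function here; randomness enters only
  through the fresh piece. The error splits into the inherited error of \<beta>, the smoothing
  error, the error of the centring constant and that of the weight, plus the tail outside the
  cube.\<close>

lemma one_step_error:
  assumes S: "S \<in> \<S>" and h: "0 < h" and I: "finite I" "I \<noteq> {}"
    and \<alpha>: "admissible \<alpha>" and b: "0 \<le> b" and \<alpha>b: "\<And>S' x. S' \<in> \<S> \<Longrightarrow> \<bar>\<alpha> S' x\<bar> \<le> b"
    and \<beta>: "\<And>S'. S' \<in> \<S> \<Longrightarrow> \<beta> S' \<in> borel_measurable (leb UNIV)" and \<beta>b: "\<And>S' x. S' \<in> \<S> \<Longrightarrow> \<bar>\<beta> S' x\<bar> \<le> b"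
    and loc: "\<And>x y. y \<in> nbox h S x \<Longrightarrow> \<bar>E S (partial_residual \<alpha> S) y - E S (partial_residual \<alpha> S) x\<bar> \<le> \<epsilon>"
  shows "(\<integral>X. \<integral>x. (backfit_step \<S> a r lam h T X I \<beta> S x - ((1 - \<eta>) * \<alpha> S x + \<eta> * update \<alpha> S x))^2 \<partial>P \<partial>PX I) \<le>
    step_const b S * (total_error \<beta> \<alpha> + \<epsilon>^2 + tail T + (real (cell_count h T TYPE('d)) + 1) / real (card I))"
proof -
  interpret PI: prob_space "PX I" by (rule P.prob_space_PiM_const)
  define B where "B = A + s * b"
  define v where "v = lam S * c / (1 + lam S * c)"
  have A0: "0 \<le> A" using a_bound[of undefined] by linarith
  have "0 < card \<S>" using card_S_pos by simp
  then have s1: "1 \<le> s" by linarith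
  have B0: "0 \<le> B" using A0 b by (simp add: B_def)
  have bB: "b \<le> B" using mult_right_mono[OF s1 b] A0 by (simp add: B_def)
  have v0: "0 < v" unfolding v_def using lam_pos[OF S] cC by (intro divide_pos_pos add_pos_pos mult_pos_pos) auto
  define N where "N = real (card I)"
  have N0: "0 < N" using I by (simp add: N_def card_gt_0_iff)
  define g where "g = partial_residual \<alpha> S"
  define G where "G = cut_residual T \<beta> S"
  define m where "m = E S g"
  define W0 where "W0 = (\<integral>y. w S y \<partial>P)"
  define A1 where "A1 = (\<integral>y. w S y * g y \<partial>P)"
  define cb where "cb = A1 / W0"
  define new where "new x = (1 - \<eta>) * \<alpha> S x + \<eta> * update \<alpha> S x" for x
  have new_eq: "new x = (1 - \<eta>) * \<alpha> S x + \<eta> * (w S x * (m x - cb))" for x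
    by (simp add: new_def update_def m_def g_def cb_def A1_def W0_def)
  have b\<alpha>: "bfun (leb UNIV) (\<alpha> S')" if "S' \<in> \<S>" for S' by (rule admissibleD(1)[OF \<alpha> that])
  have b\<beta>: "bfun (leb UNIV) (\<beta> S')" if "S' \<in> \<S>" for S' by (rule bfunI[OF \<beta>[OF that] \<beta>b[OF that]])
  have bg: "bfun (leb UNIV) g" unfolding g_def by (rule bfun_partial_residual[OF \<alpha>])
  have gB: "\<bar>g x\<bar> \<le> B" for x unfolding g_def B_def by (rule partial_residual_abs_le[OF b \<alpha>b])
  have GB: "\<bar>G x\<bar> \<le> B" for x unfolding G_def B_def by (rule partial_residual_abs_le[OF b \<beta>b])
  have Gm: "G \<in> borel_measurable (leb UNIV)"
    unfolding G_def by (rule measurable_cut_residual[where x="\<lambda>x. x" and \<alpha>="\<lambda>_. \<beta>"]) (use \<beta> in auto)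
  have bG: "bfun (leb UNIV) G" by (rule bfunI[OF Gm GB])
  have bm: "bfun (leb UNIV) m" unfolding m_def by (rule bfun_E[OF S bg])
  have mB: "\<bar>m x\<bar> \<le> B" for x unfolding m_def g_def B_def by (rule update_abs_le(1)[OF \<alpha> S b \<alpha>b])
  have cB: "\<bar>cb\<bar> \<le> B" unfolding cb_def A1_def W0_def g_def B_def by (rule update_abs_le(2)[OF \<alpha> S b \<alpha>b])
  have bnew: "bfun (leb UNIV) new"
    unfolding new_eq[abs_def] by (intro bfun_intros b\<alpha>[OF S] bfun_w[OF S] bm)
  have newB: "(new x)^2 \<le> 9 * B^2" for x
  proof -
    have "\<bar>new x\<bar> \<le> 3 * B" using update_abs_le(3)[OF \<alpha> S b \<alpha>b, of x] bB by (simp add: new_def B_def)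
    then have "(new x)^2 \<le> (3 * B)^2" using B0 by (metis abs_le_square_iff abs_of_nonneg mult_nonneg_nonneg zero_le_numeral)
    then show ?thesis by (simp add: power_mult_distrib)
  qed
  let ?in = "\<lambda>x. of_bool (sup_norm S x \<le> T) :: real"
  let ?sm = "\<lambda>X x. P.smoother h S I G X x"
  define ch where "ch X = centre_hat T \<beta> S I X" for X
  define Rh where "Rh X = \<bar>rho_hat X I S - 1\<bar>" for X
  define bf where "bf X x = backfit_step \<S> a r lam h T X I \<beta> S x" for X x
  have XM: "(\<lambda>X. X i) \<in> PX I \<rightarrow>\<^sub>M leb UNIV" if "i \<in> I" for i
    using measurable_component_singleton[OF that, of "\<lambda>_. P"] by (simp cong: measurable_cong_sets)
  have XM2: "(\<lambda>z. fst z i) \<in> PX I \<Otimes>\<^sub>M P \<rightarrow>\<^sub>M leb UNIV" if "i \<in> I" for i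
    by (rule measurable_compose[OF measurable_fst XM[OF that]])
  have xM2: "snd \<in> PX I \<Otimes>\<^sub>M P \<rightarrow>\<^sub>M leb UNIV"
    using measurable_snd[of "PX I" P] by (simp cong: measurable_cong_sets)
  have bRh: "bfun (PX I) Rh"
  proof -
    have "bfun (PX I) (\<lambda>X. rho_hat X I S)" unfolding rho_hat_def
      by (intro bfun_avg P.bfun_PiM_component) (use bfun_rho[OF S] bfun_P in auto)
    then show ?thesis unfolding Rh_def[abs_def] by (intro bfun_intros)
  qed
  have bch: "bfun (PX I) ch"
    unfolding ch_def
  proof (rule bfunI)
    show "centre_hat T \<beta> S I \<in> borel_measurable (PX I)"
      by (rule measurable_centre_hat[where X="\<lambda>X. X" and \<alpha>="\<lambda>_. \<beta>", OF S XM])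
        (auto intro: measurable_compose[OF XM \<beta>])
    show "\<bar>centre_hat T \<beta> S I X\<bar> \<le> A + s * b" for X by (rule centre_hat_abs_le[OF S b \<beta>b])
  qed
  let ?H = "PX I \<Otimes>\<^sub>M P"
  have bbf: "bfun (?H) (\<lambda>z. bf (fst z) (snd z))"
    unfolding bf_def
  proof (rule bfunI)
    show "(\<lambda>z. backfit_step \<S> a r lam h T (fst z) I \<beta> S (snd z)) \<in> borel_measurable (?H)"
      by (rule measurable_backfit[where X=fst and x=snd and \<alpha>="\<lambda>_. \<beta>", OF S h I(1) XM2 xM2])
        (auto intro: measurable_compose[OF xM2 \<beta>[OF S]] measurable_compose[OF XM2 \<beta>])
    show "\<bar>backfit_step \<S> a r lam h T (fst z) I \<beta> S (snd z)\<bar> \<le> b + 2 * (A + s * b)" for z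
      by (rule backfit_abs_le[OF S h I(1) b \<beta>b])
  qed
  have bsm: "bfun (?H) (\<lambda>z. ?in (snd z) * (?sm (fst z) (snd z) - m (snd z))^2)"
  proof (intro bfun_mult bfun_power bfun_diff)
    show "bfun (?H) (\<lambda>z. ?in (snd z))"
      by (intro bfun_of_bool pred_sup_norm xM2)
    show "bfun (?H) (\<lambda>z. ?sm (fst z) (snd z))"
      by (rule bfunI[OF measurable_smoother[where X=fst and x=snd and G="\<lambda>_. G", OF XM2 xM2 measurable_compose[OF XM2 Gm]]
            P.smoother_abs_le[OF GB]])
    show "bfun (?H) (\<lambda>z. m (snd z))" by (rule bfun_comp[OF bm xM2])
  qed
  let ?F = "\<lambda>x X. ?in x * (?sm X x - m x)^2"
  \<comment> \<open>The 9 is the square of the bound 3 B on \<open>new\<close>, which is the whole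
    error where the fitted function is cut to 0; elsewhere \<open>four_square_le\<close> separates
    the four sources.\<close>
  have pw: "(bf X x - new x)^2 \<le> 9 * B^2 * of_bool (\<not> sup_norm UNIV x \<le> T) + 4 * (\<beta> S x - \<alpha> S x)^2 +
      4 * (?F x X) + 4 * (ch X - cb)^2 + 16 * B^2 * (Rh X)^2" for X x
  proof (cases "sup_norm S x \<le> T")
    case False
    then have "\<not> sup_norm UNIV x \<le> T" using sup_norm_mono[of S x] by linarith
    then have out: "of_bool (\<not> sup_norm UNIV x \<le> T) = (1 :: real)" by simp
    have "bf X x = 0" using False by (simp add: bf_def backfit_step_def Let_def)
    then have "(bf X x - new x)^2 = (new x)^2" by simp
    moreover have "0 \<le> 4 * (\<beta> S x - \<alpha> S x)^2 + 4 * (?F x X) + 4 * (ch X - cb)^2 + 16 * B^2 * (Rh X)^2"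
      by (intro add_nonneg_nonneg mult_nonneg_nonneg) auto
    ultimately show ?thesis unfolding out using newB[of x] by linarith
  next
    case True
    let ?wh = "w_hat r lam X I S x"
    have bfx: "bf X x = (1 - \<eta>) * \<beta> S x + \<eta> * ?wh * (?sm X x - ch X)"
      unfolding bf_def backfit_eq[OF h I(1)] G_def ch_def using True by simp
    have dec: "bf X x - new x = (1 - \<eta>) * (\<beta> S x - \<alpha> S x) + \<eta> * (?wh * (?sm X x - m x) + - (?wh * (ch X - cb)) + (?wh - w S x) * (m x - cb))"
      unfolding bfx new_eq by (simp add: algebra_simps)
    have "\<bar>bf X x - new x\<bar> \<le> 1 * \<bar>\<beta> S x - \<alpha> S x\<bar> + 1 * (1 * \<bar>?sm X x - m x\<bar> + 1 * \<bar>ch X - cb\<bar> + Rh X * (2 * B))"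
    proof -
      have t1: "\<bar>(1 - \<eta>) * (\<beta> S x - \<alpha> S x)\<bar> \<le> 1 * \<bar>\<beta> S x - \<alpha> S x\<bar>"
        unfolding abs_mult using eta_bounds by (intro mult_right_mono) auto
      have t2: "\<bar>?wh * (?sm X x - m x)\<bar> \<le> 1 * \<bar>?sm X x - m x\<bar>" "\<bar>- (?wh * (ch X - cb))\<bar> \<le> 1 * \<bar>ch X - cb\<bar>"
        unfolding abs_minus_cancel abs_mult using w_hat_bounds(1,2)[OF S, of X I x] by (intro mult_right_mono; simp)+
      have t3: "\<bar>(?wh - w S x) * (m x - cb)\<bar> \<le> Rh X * (2 * B)"
        unfolding abs_mult Rh_def using w_hat_bounds(3)[OF S, of X I x] mB[of x] cB by (intro mult_mono) auto
      have t4: "\<bar>\<eta> * (?wh * (?sm X x - m x) + - (?wh * (ch X - cb)) + (?wh - w S x) * (m x - cb))\<bar> \<le>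
          1 * (1 * \<bar>?sm X x - m x\<bar> + 1 * \<bar>ch X - cb\<bar> + Rh X * (2 * B))"
      proof -
        have "\<bar>?wh * (?sm X x - m x) + - (?wh * (ch X - cb)) + (?wh - w S x) * (m x - cb)\<bar> \<le>
            1 * \<bar>?sm X x - m x\<bar> + 1 * \<bar>ch X - cb\<bar> + Rh X * (2 * B)"
          by (rule order_trans[OF abs_triangle_ineq add_mono[OF order_trans[OF abs_triangle_ineq add_mono[OF t2]] t3]])
        then show ?thesis
          unfolding abs_mult[of \<eta>] using eta_bounds by (intro mult_mono) auto
      qed
      show ?thesis unfolding dec by (rule order_trans[OF abs_triangle_ineq add_mono[OF t1 t4]])
    qed
    then have "\<bar>bf X x - new x\<bar> \<le> \<bar>\<beta> S x - \<alpha> S x\<bar> + \<bar>?sm X x - m x\<bar> + \<bar>ch X - cb\<bar> + 2 * B * Rh X"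
      by (simp only: mult_1 mult.commute[of "Rh X"] add.assoc)
    then have "(bf X x - new x)^2 \<le> (\<bar>\<beta> S x - \<alpha> S x\<bar> + \<bar>?sm X x - m x\<bar> + \<bar>ch X - cb\<bar> + 2 * B * Rh X)^2"
      by (metis abs_ge_zero power2_abs power_mono)
    also have "\<dots> \<le> 4 * (\<bar>\<beta> S x - \<alpha> S x\<bar>^2 + \<bar>?sm X x - m x\<bar>^2 + \<bar>ch X - cb\<bar>^2 + (2 * B * Rh X)^2)"
      by (rule four_square_le)
    also have "\<dots> = 4 * (\<beta> S x - \<alpha> S x)^2 + 4 * (?F x X) + 4 * (ch X - cb)^2 + 16 * B^2 * (Rh X)^2"
      using True by (simp add: power_mult_distrib)
    also have "\<dots> \<le> 9 * B^2 * of_bool (\<not> sup_norm UNIV x \<le> T) + \<dots>" by simp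
    finally show ?thesis by (simp only: add.assoc)
  qed
  define DG where "DG = (\<integral>x. (G x - g x)^2 \<partial>P)"
  define \<Delta> where "\<Delta> = total_error \<beta> \<alpha>"
  \<comment> \<open>Inside the cube \<open>G - g\<close> is minus the sum of the inherited errors of
    the other coordinates; outside, \<open>G\<close> is cut to 0 and g itself remains.\<close>
  have DG: "DG \<le> s * \<Delta> + B^2 * tail T"
  proof -
    let ?G = "\<lambda>x. s * (\<Sum>S'\<in>\<S>. (\<beta> S' x - \<alpha> S' x)^2) + B^2 * of_bool (\<not> sup_norm UNIV x \<le> T)"
    have "DG \<le> (\<integral>x. ?G x \<partial>P)"
      unfolding DG_def
    proof (rule P.bfun_integral_mono)
      show "bfun P (\<lambda>x. (G x - g x)^2)" unfolding bfun_P by (intro bfun_intros bG bg)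
      show "bfun P (\<lambda>x. ?G x)"
        unfolding bfun_P by (intro bfun_intros b\<beta> b\<alpha>) measurable
      fix x
      show "(G x - g x)^2 \<le> ?G x"
      proof (cases "sup_norm UNIV x \<le> T")
        case True
        have "G x - g x = - (\<Sum>S'\<in>\<S> - {S}. \<beta> S' x - \<alpha> S' x)"
          using True by (simp add: G_def cut_residual_def g_def partial_residual_def sum_subtractf)
        then have "(G x - g x)^2 \<le> real (card (\<S> - {S})) * (\<Sum>S'\<in>\<S> - {S}. (\<beta> S' x - \<alpha> S' x)^2)"
          using sum_square_le[of "\<lambda>S'. \<beta> S' x - \<alpha> S' x" "\<S> - {S}"] by simp
        also have "\<dots> \<le> s * (\<Sum>S'\<in>\<S>. (\<beta> S' x - \<alpha> S' x)^2)"
          by (intro mult_mono sum_mono2 sum_nonneg) (auto intro!: card_mono)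
        finally show ?thesis using True by simp
      next
        case False
        then have "(G x - g x)^2 = \<bar>g x\<bar>^2" by (simp add: G_def cut_residual_def)
        also have "\<dots> \<le> B^2" using gB by (intro power_mono) auto
        finally show ?thesis using False by (simp add: add_increasing sum_nonneg)
      qed
    qed
    also have "\<dots> = s * \<Delta> + B^2 * tail T"
    proof -
      have "integrable P (\<lambda>x. (\<beta> S' x - \<alpha> S' x)^2)" if "S' \<in> \<S>" for S'
        by (intro integrable_bfun bfun_intros b\<beta>[OF that] b\<alpha>[OF that])
      moreover have "integrable P (\<lambda>x. of_bool (\<not> sup_norm UNIV x \<le> T) :: real)"
        by (intro integrable_bfun bfun_of_bool) measurable
      ultimately show ?thesis
        by (simp add: \<Delta>_def total_error_def integral_tail Bochner_Integration.integral_add Bochner_Integration.integral_sum)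
    qed
    finally show ?thesis .
  qed
  have ERh: "(\<integral>X. (Rh X)^2 \<partial>PX I) \<le> C^2 / N"
    using integral_rho_hat[OF S I] by (simp add: Rh_def N_def)
  have Ech: "(\<integral>X. (ch X - cb)^2 \<partial>PX I) \<le> 4 / v^2 * (4 * B^2 * (C^2 / N) + DG + B^2 / N + B^2 / N)"
  proof -
    define a1 where "a1 X = avg I (\<lambda>i. \<bar>G (X i) - g (X i)\<bar>)" for X
    define a2 where "a2 X = avg I (\<lambda>i. w S (X i) * g (X i)) - A1" for X
    define a3 where "a3 X = avg I (\<lambda>i. w S (X i)) - W0" for X
    have bP: "bfun P G" "bfun P g" "bfun P (w S)" using bG bg bfun_w[OF S] bfun_P by auto
    have b1: "bfun P (\<lambda>x. \<bar>G x - g x\<bar>)" "bfun P (\<lambda>x. w S x * g x)" by (intro bfun_intros bP)+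
    have ba: "bfun (PX I) a1" "bfun (PX I) a2" "bfun (PX I) a3"
      unfolding a1_def[abs_def] a2_def[abs_def] a3_def[abs_def]
      by (intro bfun_avg bfun_diff bfun_const P.bfun_PiM_component b1 bP; assumption?)+
    have e1: "(\<integral>X. (a1 X)^2 \<partial>PX I) \<le> DG"
      unfolding a1_def DG_def using P.integral_avg_square_le[OF I b1(1)] by simp
    have e2: "(\<integral>X. (a2 X)^2 \<partial>PX I) \<le> B^2 / N"
    proof -
      have "(\<integral>X. (a2 X)^2 \<partial>PX I) \<le> (\<integral>x. (w S x * g x)^2 \<partial>P) / N"
        unfolding a2_def A1_def N_def by (rule P.integral_avg_deviation_le[OF I b1(2)])
      also have "(\<integral>x. (w S x * g x)^2 \<partial>P) \<le> B^2"
      proof (rule P.integral_le_const_bfun[OF bfun_power[OF b1(2)]])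
        fix x
        have "\<bar>w S x * g x\<bar> \<le> 1 * B" unfolding abs_mult
          using w_pos[OF S, of x] w_le_1[OF S, of x] gB[of x] by (intro mult_mono) auto
        then show "(w S x * g x)^2 \<le> B^2" using B0 by (metis abs_le_square_iff abs_of_nonneg mult_1)
      qed
      finally show ?thesis using N0 by (simp add: divide_right_mono)
    qed
    have e3: "(\<integral>X. (a3 X)^2 \<partial>PX I) \<le> 1 / N"
    proof -
      have "(\<integral>X. (a3 X)^2 \<partial>PX I) \<le> (\<integral>x. (w S x)^2 \<partial>P) / N"
        unfolding a3_def W0_def N_def by (rule P.integral_avg_deviation_le[OF I bP(3)])
      also have "(\<integral>x. (w S x)^2 \<partial>P) \<le> 1"
        by (rule P.integral_le_const_bfun[OF bfun_power[OF bP(3)]])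
          (rule power_le_one[OF less_imp_le[OF w_pos[OF S]] w_le_1[OF S]])
      finally show ?thesis using N0 by (simp add: divide_right_mono)
    qed
    have W0v: "v \<le> W0" unfolding v_def W0_def by (rule integral_w_ge[OF S])
    let ?U = "\<lambda>X. 4 / v^2 * (4 * B^2 * (Rh X)^2 + (a1 X)^2 + (a2 X)^2 + B^2 * (a3 X)^2)"
    have pc: "(ch X - cb)^2 \<le> ?U X" for X
    proof -
      let ?wh = "\<lambda>i. w_hat r lam X I S (X i)"
      define AA where "AA = avg I (\<lambda>i. ?wh i * G (X i))"
      define WW where "WW = avg I ?wh"
      have WW0: "0 < WW" unfolding WW_def avg_def
        using I w_hat_bounds(1)[OF S] N0 by (intro divide_pos_pos sum_pos) (auto simp: N_def)
      have chX: "ch X = AA / WW"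
        unfolding ch_def centre_hat_def AA_def WW_def avg_def G_def using N0 by (simp add: N_def)
      have chB: "\<bar>ch X\<bar> \<le> B" unfolding ch_def B_def by (rule centre_hat_abs_le[OF S b \<beta>b])
      have "AA - A1 = avg I (\<lambda>i. (?wh i - w S (X i)) * G (X i)) + avg I (\<lambda>i. w S (X i) * (G (X i) - g (X i))) + a2 X"
        unfolding AA_def a2_def by (simp add: avg_add[symmetric] avg_diff[symmetric] algebra_simps)
      moreover have "\<bar>avg I (\<lambda>i. (?wh i - w S (X i)) * G (X i))\<bar> \<le> Rh X * B"
      proof -
        have "\<bar>avg I (\<lambda>i. (?wh i - w S (X i)) * G (X i))\<bar> \<le> avg I (\<lambda>i. Rh X * B)"
          by (rule order_trans[OF avg_abs_le avg_mono], unfold abs_mult, intro mult_mono)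
            (use w_hat_bounds(3)[OF S] GB in \<open>auto simp: Rh_def\<close>)
        then show ?thesis using avg_const[OF I] by simp
      qed
      moreover have "\<bar>avg I (\<lambda>i. w S (X i) * (G (X i) - g (X i)))\<bar> \<le> a1 X"
        unfolding a1_def
        by (rule order_trans[OF avg_abs_le avg_mono], unfold abs_mult)
          (use w_pos[OF S] w_le_1[OF S] in \<open>auto intro!: mult_left_le_one_le simp: less_imp_le\<close>)
      ultimately have dA: "\<bar>AA - A1\<bar> \<le> Rh X * B + a1 X + \<bar>a2 X\<bar>" by linarith
      have "WW - W0 = avg I (\<lambda>i. ?wh i - w S (X i)) + a3 X"
        unfolding WW_def a3_def by (simp add: avg_diff)
      moreover have "\<bar>avg I (\<lambda>i. ?wh i - w S (X i))\<bar> \<le> Rh X"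
      proof -
        have "\<bar>avg I (\<lambda>i. ?wh i - w S (X i))\<bar> \<le> avg I (\<lambda>i. Rh X)"
          by (rule order_trans[OF avg_abs_le avg_mono]) (use w_hat_bounds(3)[OF S] in \<open>auto simp: Rh_def\<close>)
        then show ?thesis using avg_const[OF I] by simp
      qed
      ultimately have dW: "\<bar>WW - W0\<bar> \<le> Rh X + \<bar>a3 X\<bar>" by linarith
      have W0p: "0 < W0" using v0 W0v by linarith
      \<comment> \<open>The difference of the two ratios is written over the population mean weight
        \<open>W0\<close>, so the random mean weight \<open>WW\<close> leaves the denominator;
        \<open>ch X\<close> itself is bounded by B.\<close>
      have "ch X - cb = ((AA - A1) - ch X * (WW - W0)) / W0"
        unfolding cb_def chX using WW0 W0p by (simp add: field_simps)
      then have "\<bar>ch X - cb\<bar> = \<bar>(AA - A1) - ch X * (WW - W0)\<bar> / W0" using W0p by (simp add: abs_divide)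
      also have "\<dots> \<le> (2 * B * Rh X + a1 X + \<bar>a2 X\<bar> + B * \<bar>a3 X\<bar>) / v"
      proof (rule frac_le)
        have "\<bar>ch X * (WW - W0)\<bar> \<le> B * (Rh X + \<bar>a3 X\<bar>)" unfolding abs_mult
          using chB dW B0 by (intro mult_mono) auto
        then show "\<bar>(AA - A1) - ch X * (WW - W0)\<bar> \<le> 2 * B * Rh X + a1 X + \<bar>a2 X\<bar> + B * \<bar>a3 X\<bar>"
          using dA by (simp add: algebra_simps)
        have "0 \<le> a1 X" unfolding a1_def by (rule avg_nonneg) simp
        moreover have "0 \<le> Rh X" by (simp add: Rh_def)
        ultimately show "0 \<le> 2 * B * Rh X + a1 X + \<bar>a2 X\<bar> + B * \<bar>a3 X\<bar>" using B0 by simp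
      qed (use v0 W0v in auto)
      finally have "(ch X - cb)^2 \<le> ((2 * B * Rh X + a1 X + \<bar>a2 X\<bar> + B * \<bar>a3 X\<bar>) / v)^2"
        by (metis abs_ge_zero power2_abs power_mono)
      also have "\<dots> \<le> 4 * ((2 * B * Rh X)^2 + (a1 X)^2 + \<bar>a2 X\<bar>^2 + (B * \<bar>a3 X\<bar>)^2) / v^2"
        unfolding power_divide by (rule divide_right_mono[OF four_square_le zero_le_power2])
      also have "\<dots> = ?U X"
        by (simp add: power_mult_distrib)
      finally show ?thesis .
    qed
    have "(\<integral>X. (ch X - cb)^2 \<partial>PX I) \<le>
        (\<integral>X. ?U X \<partial>PX I)"
      by (rule PI.bfun_integral_mono) (intro bfun_intros bch bRh ba, intro bfun_intros bch bRh ba, rule pc)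
    also have "\<dots> = 4 / v^2 * (4 * B^2 * (\<integral>X. (Rh X)^2 \<partial>PX I) + (\<integral>X. (a1 X)^2 \<partial>PX I) +
        (\<integral>X. (a2 X)^2 \<partial>PX I) + B^2 * (\<integral>X. (a3 X)^2 \<partial>PX I))"
      using PI.bfun_integrable[OF bfun_power[OF bRh]] PI.bfun_integrable[OF bfun_power[OF ba(1)]]
        PI.bfun_integrable[OF bfun_power[OF ba(2)]] PI.bfun_integrable[OF bfun_power[OF ba(3)]]
      by simp
    also have "\<dots> \<le> 4 / v^2 * (4 * B^2 * (C^2 / N) + DG + B^2 / N + B^2 * (1 / N))"
      by (intro mult_left_mono add_mono ERh e1 e2 e3) auto
    finally show ?thesis by simp
  qed
  define K where "K = real (cell_count h T TYPE('d))"
  have Esm: "(\<integral>x. \<integral>X. ?F x X \<partial>PX I \<partial>P) \<le>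
      32 * B^2 * K / N + 8 * \<epsilon>^2 + 8 * 3 ^ CARD('d) * DG"
    unfolding K_def N_def DG_def
  proof (rule P.smoother_error[OF h I])
    show "G \<in> borel_measurable P" "m \<in> borel_measurable P" "bfun P g"
      using Gm bfun_measurable[OF bm] bg bfun_P by auto
    fix x
    let ?i = "\<lambda>y. indicator (nbox h S x) y :: real"
    have bi: "bfun (leb UNIV) ?i" by (rule bfunI[where B=1]) (auto simp: indicator_def)
    have di: "depends_on S ?i"
      by (rule depends_onI) (auto simp: indicator_def nbox_def)
    have e0: "0 \<le> \<epsilon>" using loc[of x x] h by (simp add: nbox_def)
    have "(\<integral>y. (g y - m x) * ?i y \<partial>P) = (\<integral>y. ?i y * g y \<partial>P) - (\<integral>y. ?i y * m x \<partial>P)"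
      using integrable_bfun[OF bfun_mult[OF bi bg]] integrable_bfun[OF bi] by (simp add: algebra_simps)
    \<comment> \<open>The box constrains only coordinates in \<open>S\<close>, so its indicator is a
      function of x_S and g may be exchanged for its conditional mean m. The oscillation of m over
      the box is bounded by \<open>loc\<close>.\<close>
    also have "(\<integral>y. ?i y * g y \<partial>P) = (\<integral>y. ?i y * m y \<partial>P)"
      unfolding m_def by (rule integral_mult_E_bfun[OF S bg bi di, symmetric])
    also have "\<dots> - (\<integral>y. ?i y * m x \<partial>P) = (\<integral>y. ?i y * (m y - m x) \<partial>P)"
      using integrable_bfun[OF bfun_mult[OF bi bm]] integrable_bfun[OF bi] by (simp add: algebra_simps)
    finally have di2: "(\<integral>y. (g y - m x) * ?i y \<partial>P) = (\<integral>y. ?i y * (m y - m x) \<partial>P)" .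
    have "\<bar>\<integral>y. (g y - m x) * ?i y \<partial>P\<bar> \<le> (\<integral>y. \<bar>?i y * (m y - m x)\<bar> \<partial>P)" unfolding di2 by (rule integral_abs_bound)
    also have "\<dots> \<le> (\<integral>y. \<epsilon> * ?i y \<partial>P)"
    proof (rule P.bfun_integral_mono)
      show "bfun P (\<lambda>y. \<bar>?i y * (m y - m x)\<bar>)" "bfun P (\<lambda>y. \<epsilon> * ?i y)"
        unfolding bfun_P by (intro bfun_intros bi bm)+
      show "\<bar>?i y * (m y - m x)\<bar> \<le> \<epsilon> * ?i y" for y
        using loc[of y x] e0 by (auto simp: indicator_def m_def g_def)
    qed
    also have "\<dots> = \<epsilon> * P.prob (nbox h S x)" by simp
    finally show "\<bar>\<integral>y. (g y - m x) * ?i y \<partial>P\<bar> \<le> \<epsilon> * P.prob (nbox h S x)" .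
  qed (use GB mB in auto)
  define \<tau> where "\<tau> = tail T"
  have ib: "bfun P (\<lambda>x. (\<beta> S x - \<alpha> S x)^2)" "bfun P (\<lambda>x. of_bool (\<not> sup_norm UNIV x \<le> T) :: real)"
    unfolding bfun_P by (intro bfun_intros b\<beta>[OF S] b\<alpha>[OF S], intro bfun_of_bool, measurable)
  have inner: "(\<integral>x. (bf X x - new x)^2 \<partial>P) \<le> 9 * B^2 * \<tau> + 4 * \<Delta> +
      4 * (\<integral>x. ?F x X \<partial>P) + 4 * (ch X - cb)^2 + 16 * B^2 * (Rh X)^2"
    if X: "X \<in> space (PX I)" for X
  proof -
    have bX: "bfun P (\<lambda>x. bf X x)" using bfun_section_pair[OF bbf X] by simp
    have bY: "bfun P (\<lambda>x. ?F x X)" using bfun_section_pair[OF bsm X] by simp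
    have bn: "bfun P new" using bnew bfun_P by blast
    have "(\<integral>x. (bf X x - new x)^2 \<partial>P) \<le> (\<integral>x. 9 * B^2 * of_bool (\<not> sup_norm UNIV x \<le> T) + 4 * (\<beta> S x - \<alpha> S x)^2 +
      4 * (?F x X) + 4 * (ch X - cb)^2 + 16 * B^2 * (Rh X)^2 \<partial>P)"
      by (rule P.bfun_integral_mono)
        (intro bfun_add bfun_diff bfun_power bfun_const bX bn bfun_mult[OF bfun_const] ib bY | rule pw)+
    also have "\<dots> = 9 * B^2 * \<tau> + 4 * (\<integral>x. (\<beta> S x - \<alpha> S x)^2 \<partial>P) +
      4 * (\<integral>x. ?F x X \<partial>P) + 4 * (ch X - cb)^2 + 16 * B^2 * (Rh X)^2"
    proof -
      have i3: "integrable P (\<lambda>x. ?F x X)" by (rule P.bfun_integrable[OF bY])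
      have lin: "(\<integral>x. k1 * f1 x + k2 * f2 x + k3 * f3 x + k4 + k5 \<partial>P) =
          k1 * (\<integral>x. f1 x \<partial>P) + k2 * (\<integral>x. f2 x \<partial>P) + k3 * (\<integral>x. f3 x \<partial>P) + k4 + k5"
        if "integrable P f1" "integrable P f2" "integrable P f3"
        for k1 k2 k3 k4 k5 :: real and f1 f2 f3 :: "('d \<Rightarrow> real) \<Rightarrow> real"
        using that by simp
      show ?thesis unfolding \<tau>_def integral_tail[symmetric]
        by (rule lin[OF P.bfun_integrable[OF ib(2)] P.bfun_integrable[OF ib(1)] i3])
    qed
    also have "(\<integral>x. (\<beta> S x - \<alpha> S x)^2 \<partial>P) \<le> \<Delta>"
      unfolding \<Delta>_def total_error_def by (rule member_le_sum[OF S]) auto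
    finally show ?thesis by simp
  qed
  have bJ: "bfun (PX I) (\<lambda>X. \<integral>x. ?F x X \<partial>P)"
    using bfun_integral_pair[OF P.prob_space_axioms bsm] by simp
  have bI: "bfun (PX I) (\<lambda>X. \<integral>x. (bf X x - new x)^2 \<partial>P)"
  proof -
    have "bfun (?H) (\<lambda>z. (bf (fst z) (snd z) - new (snd z))^2)"
      by (intro bfun_power bfun_diff bbf bfun_comp[OF bnew xM2])
    from bfun_integral_pair[OF P.prob_space_axioms this] show ?thesis by simp
  qed
  have "(\<integral>X. \<integral>x. (bf X x - new x)^2 \<partial>P \<partial>PX I) \<le>
      (\<integral>X. 9 * B^2 * \<tau> + 4 * \<Delta> + 4 * (\<integral>x. ?F x X \<partial>P) + 4 * (ch X - cb)^2 + 16 * B^2 * (Rh X)^2 \<partial>PX I)"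
    by (rule integral_mono)
      (auto intro!: PI.bfun_integrable bfun_intros bI bJ bch bRh inner)
  also have "\<dots> = 9 * B^2 * \<tau> + 4 * \<Delta> + 4 * (\<integral>X. \<integral>x. ?F x X \<partial>P \<partial>PX I) +
      4 * (\<integral>X. (ch X - cb)^2 \<partial>PX I) + 16 * B^2 * (\<integral>X. (Rh X)^2 \<partial>PX I)"
  proof -
    have lin: "(\<integral>X. k1 + k2 + k3 * f1 X + k4 * f2 X + k5 * f3 X \<partial>PX I) =
        k1 + k2 + k3 * (\<integral>X. f1 X \<partial>PX I) + k4 * (\<integral>X. f2 X \<partial>PX I) + k5 * (\<integral>X. f3 X \<partial>PX I)"
      if "integrable (PX I) f1" "integrable (PX I) f2" "integrable (PX I) f3"
      for k1 k2 k3 k4 k5 :: real and f1 f2 f3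
      using that by (simp add: PI.prob_space)
    show ?thesis
      by (rule lin) (intro PI.bfun_integrable bfun_intros bJ bch bRh)+
  qed
  \<comment> \<open>\<open>smoother_error\<close> integrates the evaluation point last, so the order
    is exchanged before it is applied.\<close>
  also have "(\<integral>X. \<integral>x. ?F x X \<partial>P \<partial>PX I) = (\<integral>x. \<integral>X. ?F x X \<partial>PX I \<partial>P)"
    using pair_Fubini_bfun[OF PI.prob_space_axioms P.prob_space_axioms bsm] by simp
  also have "9 * B^2 * \<tau> + 4 * \<Delta> + 4 * \<dots> + 4 * (\<integral>X. (ch X - cb)^2 \<partial>PX I) +
      16 * B^2 * (\<integral>X. (Rh X)^2 \<partial>PX I) \<le>
      9 * B^2 * \<tau> + 4 * \<Delta> + 4 * (32 * B^2 * K / N + 8 * \<epsilon>^2 + 8 * 3 ^ CARD('d) * DG) +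
      4 * (4 / v^2 * (4 * B^2 * (C^2 / N) + DG + B^2 / N + B^2 / N)) + 16 * B^2 * (C^2 / N)"
    by (intro add_mono mult_left_mono order_refl Esm Ech ERh) auto
  also have "\<dots> \<le> step_const b S * (\<Delta> + \<epsilon>^2 + \<tau> + (K + 1) / N)"
  proof -
    define D where "D = (3::real) ^ CARD('d)"
    define u where "u = 1 / v^2"
    define n where "n = 1 / N"
    define c1 where "c1 = 4 + 32 * D * s + 16 * s * u"
    define c2 where "c2 = 9 * B^2 + 32 * D * B^2 + 16 * B^2 * u"
    define c4 where "c4 = 128 * B^2 + 16 * u * (4 * B^2 * C^2 + 2 * B^2) + 16 * B^2 * C^2"
    have nn: "0 \<le> D" "0 \<le> u" "0 \<le> n" "0 \<le> \<Delta>" "0 \<le> \<tau>" "0 \<le> K" "0 \<le> s"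
      using N0 total_error_nonneg tail_nonneg by (auto simp: D_def u_def n_def \<Delta>_def \<tau>_def K_def)
    have cn: "0 \<le> c1" "0 \<le> c2" "0 \<le> c4" unfolding c1_def c2_def c4_def using nn by auto
    have sc: "step_const b S = c1 + c2 + 32 + c4"
      unfolding step_const_def Let_def c1_def c2_def c4_def B_def[symmetric] v_def[symmetric] D_def[symmetric] u_def by simp
    have "9 * B^2 * \<tau> + 4 * \<Delta> + 4 * (32 * B^2 * K / N + 8 * \<epsilon>^2 + 8 * 3 ^ CARD('d) * DG) +
      4 * (4 / v^2 * (4 * B^2 * (C^2 / N) + DG + B^2 / N + B^2 / N)) + 16 * B^2 * (C^2 / N) =
      9 * B^2 * \<tau> + 4 * \<Delta> + 128 * B^2 * (K * n) + 32 * \<epsilon>^2 + (32 * D + 16 * u) * DG +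
      (16 * u * (4 * B^2 * C^2 + 2 * B^2) + 16 * B^2 * C^2) * n"
      unfolding D_def[symmetric] by (simp add: u_def n_def algebra_simps)
    also have "\<dots> \<le> 9 * B^2 * \<tau> + 4 * \<Delta> + 128 * B^2 * (K * n) + 32 * \<epsilon>^2 + (32 * D + 16 * u) * (s * \<Delta> + B^2 * \<tau>) +
      (16 * u * (4 * B^2 * C^2 + 2 * B^2) + 16 * B^2 * C^2) * n"
      using DG nn by (intro add_mono mult_left_mono order_refl) (auto simp: \<tau>_def)
    also have "\<dots> = c1 * \<Delta> + c2 * \<tau> + 32 * \<epsilon>^2 + (128 * B^2 * (K * n) + (c4 - 128 * B^2) * n)"
      unfolding c1_def c2_def c4_def by (simp add: algebra_simps)
    also have "\<dots> \<le> c1 * \<Delta> + c2 * \<tau> + 32 * \<epsilon>^2 + c4 * ((K + 1) * n)"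
    proof -
      have "128 * B^2 * (K * n) \<le> c4 * (K * n)"
        unfolding c4_def using nn by (intro mult_right_mono) auto
      moreover have "(c4 - 128 * B^2) * n \<le> c4 * n" using nn by (intro mult_right_mono) auto
      ultimately show ?thesis by (simp add: algebra_simps)
    qed
    also have "\<dots> \<le> step_const b S * \<Delta> + step_const b S * \<tau> + step_const b S * \<epsilon>^2 + step_const b S * ((K + 1) * n)"
      unfolding sc using cn nn by (intro add_mono mult_right_mono) auto
    finally show ?thesis by (simp add: n_def algebra_simps)
  qed
  finally show ?thesis
    unfolding bf_def new_def \<Delta>_def \<tau>_def K_def N_def .
qed

end

section \<open>Iterated backfitting\<close>

context missing_data
begin

text \<open>A sup bound shared by the population iterates and, for every sample, the fitted ones.
  Its growth in m is harmless because n tends to infinity while M is held fixed.\<close>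

primrec iterate_bound :: "nat \<Rightarrow> real" where
  "iterate_bound 0 = 0"
| "iterate_bound (Suc m) = iterate_bound m + 2 * (A + s * iterate_bound m)"

lemma iterate_bound_nonneg: "0 \<le> iterate_bound m"
proof (induction m)
  case (Suc m)
  have "0 \<le> A" using a_bound[of undefined] by linarith
  then show ?case using Suc by simp
qed simp

lemma pop_abs_le: "S \<in> \<S> \<Longrightarrow> \<bar>pop m S x\<bar> \<le> iterate_bound m"
proof (induction m arbitrary: S x)
  case (Suc m)
  show ?case
    using update_abs_le(3)[OF pop_admissible Suc.prems iterate_bound_nonneg Suc.IH] by simp
qed simp

context
  fixes h T :: real and piece :: "nat \<Rightarrow> nat set"
  assumes h: "0 < h" and piece: "\<And>m. finite (piece m)"
begin

abbreviation "hat X m \<equiv> alpha_hat \<S> a r lam h T piece X m"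

lemma alpha_hat_abs_le: "S \<in> \<S> \<Longrightarrow> \<bar>hat X m S x\<bar> \<le> iterate_bound m"
proof (induction m arbitrary: S x)
  case (Suc m)
  show ?case
    using backfit_abs_le[OF Suc.prems h piece iterate_bound_nonneg Suc.IH] by simp
qed simp

lemma measurable_alpha_hat:
  assumes "S \<in> \<S>" "x \<in> M \<rightarrow>\<^sub>M leb UNIV"
    and "\<And>i k. k \<in> {1..m} \<Longrightarrow> i \<in> piece k \<Longrightarrow> (\<lambda>z. X z i) \<in> M \<rightarrow>\<^sub>M leb UNIV"
  shows "(\<lambda>z. hat (X z) m S (x z)) \<in> borel_measurable M"
  using assms
proof (induction m arbitrary: S x)
  case (Suc m)
  have X: "(\<lambda>z. X z i) \<in> M \<rightarrow>\<^sub>M leb UNIV" if "i \<in> piece (Suc m)" for i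
    by (rule Suc.prems(3)[of "Suc m"]) (use that in auto)
  have IH: "(\<lambda>z. hat (X z) m S' (x' z)) \<in> borel_measurable M" if "S' \<in> \<S>" "x' \<in> M \<rightarrow>\<^sub>M leb UNIV" for S' x'
    by (rule Suc.IH[OF that]) (rule Suc.prems(3)[rotated], assumption, auto)
  show ?case unfolding alpha_hat.simps
    by (rule measurable_backfit[where \<alpha>="\<lambda>z. hat (X z) m", OF Suc.prems(1) h piece X Suc.prems(2)])
      (auto intro: IH Suc.prems X)
qed simp

lemma backfit_cong:
  assumes "\<And>i. i \<in> I \<Longrightarrow> X i = X' i"
  shows "backfit_step \<S> a r lam h T X I \<alpha> S x = backfit_step \<S> a r lam h T X' I \<alpha> S x"
proof -
  have avgc: "avg I (\<lambda>i. F (X i)) = avg I (\<lambda>i. F (X' i))" for F :: "('d \<Rightarrow> real) \<Rightarrow> real"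
    unfolding avg_def using assms by (intro arg_cong2[where f="(/)"] sum.cong) auto
  have w: "w_hat r lam X I = w_hat r lam X' I"
    unfolding w_hat_def r_hat_def by (intro ext) (simp add: avgc[of "r _"])
  have fh: "f_hat h X I = f_hat h X' I"
    unfolding f_hat_def by (intro ext avgc)
  have sc: "(\<Sum>i\<in>I. F (X i)) = (\<Sum>i\<in>I. F (X' i))" for F :: "('d \<Rightarrow> real) \<Rightarrow> real"
    using assms by (intro sum.cong) auto
  show ?thesis
    unfolding backfit_step_def Let_def w fh
    by (simp only: avgc[of "\<lambda>y. (a y - (\<Sum>S'\<in>\<S> - {S}. \<alpha> S' y)) * of_bool (sup_norm UNIV y \<le> T) * (kern h S (\<lambda>j. x j - y j) / f_hat h X' I S x)"]
        sc[of "\<lambda>y. w_hat r lam X' I S y * (a y - (\<Sum>S'\<in>\<S> - {S}. \<alpha> S' y)) * of_bool (sup_norm UNIV y \<le> T)"]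
        sc[of "w_hat r lam X' I S"])
qed

text \<open>Iterate m reads only the observations in its first m pieces; this is what makes it
  independent of the next piece.\<close>

lemma alpha_hat_cong:
  assumes "\<And>i k. k \<in> {1..m} \<Longrightarrow> i \<in> piece k \<Longrightarrow> X i = X' i"
  shows "hat X m = hat X' m"
  using assms
proof (induction m)
  case (Suc m)
  have IH: "hat X m = hat X' m" by (rule Suc.IH) (rule Suc.prems[rotated], assumption, auto)
  show ?case unfolding alpha_hat.simps IH
    by (intro ext backfit_cong) (use Suc.prems[of "Suc m"] in auto)
qed simp

lemma backfit_dep:
  assumes S: "S \<in> \<S>" and d: "depends_on S (\<alpha> S)"
  shows "depends_on S (backfit_step \<S> a r lam h T X I \<alpha> S)"
proof (rule depends_onI)
  fix x y :: "'d \<Rightarrow> real" assume xy: "\<And>i. i \<in> S \<Longrightarrow> x i = y i"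
  have sn: "sup_norm S x = sup_norm S y"
    unfolding sup_norm_def using xy by (intro arg_cong[where f=Max] arg_cong2[where f=insert] image_cong) auto
  have k: "kern h S (\<lambda>j. x j - z j) = kern h S (\<lambda>j. y j - z j)" for z :: "'d \<Rightarrow> real"
  proof -
    have "sup_norm S (\<lambda>j. x j - z j) = sup_norm S (\<lambda>j. y j - z j)"
      unfolding sup_norm_def using xy by (intro arg_cong[where f=Max] arg_cong2[where f=insert] image_cong) auto
    then show ?thesis by (simp add: kern_def)
  qed
  have w: "w_hat r lam X I S x = w_hat r lam X I S y"
    unfolding w_hat_def using depends_onD[OF r_dep[OF S] xy] by simp
  have dxy: "\<alpha> S x = \<alpha> S y" by (rule depends_onD[OF d]) (rule xy)
  have fh: "f_hat h X I S x = f_hat h X I S y" unfolding f_hat_def k ..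
  show "backfit_step \<S> a r lam h T X I \<alpha> S x = backfit_step \<S> a r lam h T X I \<alpha> S y"
    unfolding backfit_step_def Let_def sn w fh k dxy ..
qed

lemma alpha_hat_dep: "S \<in> \<S> \<Longrightarrow> depends_on S (hat X m S)"
proof (induction m arbitrary: S)
  case 0
  then show ?case by (simp add: depends_on_def)
next
  case (Suc m)
  then show ?case by (simp add: backfit_dep)
qed

lemma bfun_alpha_hat: "S \<in> \<S> \<Longrightarrow> bfun (leb UNIV) (hat X m S)"
  if "\<And>i k. k \<in> {1..m} \<Longrightarrow> i \<in> piece k \<Longrightarrow> X i \<in> space (leb UNIV)"
  by (rule bfunI[OF measurable_alpha_hat[where X="\<lambda>_. X" and x="\<lambda>x. x"] alpha_hat_abs_le])
    (use that in auto)

lemma bfun_alpha_hat_pair: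
  assumes S: "S \<in> \<S>" and U: "\<And>k. k \<in> {1..m} \<Longrightarrow> piece k \<subseteq> U"
  shows "bfun (PX U \<Otimes>\<^sub>M P) (\<lambda>z. hat (fst z) m S (snd z))"
proof (rule bfunI[OF _ alpha_hat_abs_le[OF S]])
  show "(\<lambda>z. hat (fst z) m S (snd z)) \<in> borel_measurable (PX U \<Otimes>\<^sub>M P)"
  proof (rule measurable_alpha_hat[OF S])
    show "snd \<in> PX U \<Otimes>\<^sub>M P \<rightarrow>\<^sub>M leb UNIV"
      using measurable_snd[of "PX U" P] by (simp cong: measurable_cong_sets)
    fix i k assume "k \<in> {1..m}" "i \<in> piece k"
    then have i: "i \<in> U" using U by blast
    have "(\<lambda>X. X i) \<in> PX U \<rightarrow>\<^sub>M leb UNIV"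
      using measurable_component_singleton[OF i, of "\<lambda>_. P"] by (simp cong: measurable_cong_sets)
    then show "(\<lambda>z. fst z i) \<in> PX U \<Otimes>\<^sub>M P \<rightarrow>\<^sub>M leb UNIV"
      by (rule measurable_compose[OF measurable_fst])
  qed
qed

lemma bfun_error_S:
  assumes S: "S \<in> \<S>" and U: "\<And>k. k \<in> {1..m} \<Longrightarrow> piece k \<subseteq> U"
  shows "bfun (PX U) (\<lambda>X. \<integral>x. (hat X m S x - pop k S x)^2 \<partial>P)"
proof -
  have x: "snd \<in> PX U \<Otimes>\<^sub>M P \<rightarrow>\<^sub>M leb UNIV"
    using measurable_snd[of "PX U" P] by (simp cong: measurable_cong_sets)
  have "bfun (PX U \<Otimes>\<^sub>M P) (\<lambda>z. (hat (fst z) m S (snd z) - pop k S (snd z))^2)"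
    by (intro bfun_power bfun_diff bfun_alpha_hat_pair[OF S U] bfun_comp[OF admissibleD(1)[OF pop_admissible S] x])
  from bfun_integral_pair[OF P.prob_space_axioms this] show ?thesis by simp
qed

lemma bfun_total_error:
  assumes "\<And>k. k \<in> {1..m} \<Longrightarrow> piece k \<subseteq> U"
  shows "bfun (PX U) (\<lambda>X. total_error (hat X m) (pop k))"
  unfolding total_error_def by (intro bfun_sum bfun_error_S assms)

end

text \<open>The bias requirement concerns population iterates only, so h can be chosen before any
  data are seen.\<close>

definition smooth_scale :: "real \<Rightarrow> nat \<Rightarrow> real \<Rightarrow> bool" where
  "smooth_scale h M \<epsilon> \<longleftrightarrow> (\<forall>k<M. \<forall>S\<in>\<S>. \<forall>x y. y \<in> nbox h S x \<longrightarrow>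
     \<bar>E S (partial_residual (pop k) S) y - E S (partial_residual (pop k) S) x\<bar> \<le> \<epsilon>)"

text \<open>Unrolls the recursion of \<open>one_step_error\<close>; the 1 stands for the error newly
  made in the step.\<close>

primrec iterate_const :: "nat \<Rightarrow> real" where
  "iterate_const 0 = 0"
| "iterate_const (Suc m) = (\<Sum>S\<in>\<S>. step_const (iterate_bound m) S) * (iterate_const m + 1)"

lemma iterate_const_nonneg: "0 \<le> iterate_const m"
  by (induction m) (auto intro!: mult_nonneg_nonneg sum_nonneg step_const_nonneg)

text \<open>Induction on m for every index set U that contains the pieces used so far. The data
  split into piece m + 1 and the rest; given the rest, the current iterate is a fixed function and
  \<open>one_step_error\<close> applies to the fresh piece.\<close>

lemma alpha_hat_error:
  assumes h: "0 < h" and piece: "\<And>m. finite (piece m)" and disj: "disjoint_family_on piece {1..M}"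
    and N: "0 < N" "\<And>m. m \<in> {1..M} \<Longrightarrow> N \<le> real (card (piece m))"
    and sm: "smooth_scale h M \<epsilon>" and m: "m \<le> M"
    and U: "finite U" "\<And>k. k \<in> {1..m} \<Longrightarrow> piece k \<subseteq> U"
  shows "(\<integral>X. total_error (alpha_hat \<S> a r lam h T piece X m) (pop m) \<partial>PX U) \<le>
    iterate_const m * (\<epsilon>^2 + tail T + (real (cell_count h T TYPE('d)) + 1) / N)"
  using m U
proof (induction m arbitrary: U)
  case 0
  show ?case by (simp add: total_error_def)
next
  case (Suc m)
  let ?hat = "\<lambda>X m. alpha_hat \<S> a r lam h T piece X m"
  let ?q = "\<epsilon>^2 + tail T + (real (cell_count h T TYPE('d)) + 1) / N"
  define J where "J = piece (Suc m)"
  define I where "I = U - J"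
  have JU: "J \<subseteq> U" using Suc.prems(3)[of "Suc m"] by (simp add: J_def)
  have UIJ: "U = I \<union> J" "I \<inter> J = {}" using JU by (auto simp: I_def)
  have fin: "finite I" "finite J" using Suc.prems(2) piece by (auto simp: I_def J_def)
  have cJ: "N \<le> real (card J)" unfolding J_def using N(2)[of "Suc m"] Suc.prems(1) by simp
  then have Jne: "J \<noteq> {}" using N(1) by auto
  have UI: "piece k \<subseteq> I" if k: "k \<in> {1..m}" for k
  proof -
    have "piece k \<inter> piece (Suc m) = {}"
      using disj k Suc.prems(1) unfolding disjoint_family_on_def by (metis Suc_n_not_le_n atLeastAtMost_iff le_SucI le_refl le_trans One_nat_def Suc_le_mono le0)
    then show ?thesis using Suc.prems(3)[of k] k by (auto simp: I_def J_def)
  qed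
  interpret PI: prob_space "PX I" by (rule P.prob_space_PiM_const)
  interpret PJ: prob_space "PX J" by (rule P.prob_space_PiM_const)
  let ?F = "\<lambda>S X. \<integral>x. (?hat X (Suc m) S x - pop (Suc m) S x)^2 \<partial>P"
  have bF: "bfun (PX U) (?F S)" if "S \<in> \<S>" for S
    by (rule bfun_error_S[OF h piece that Suc.prems(3)])
  have FS: "(\<integral>X. ?F S X \<partial>PX U) \<le> step_const (iterate_bound m) S * (iterate_const m * ?q + ?q)"
    if S: "S \<in> \<S>" for S
  proof -
    let ?c = "step_const (iterate_bound m) S"
    have "(\<integral>X. ?F S X \<partial>PX U) = (\<integral>x. \<integral>y. ?F S (merge I J (x, y)) \<partial>PX J \<partial>PX I)"
      unfolding UIJ(1) by (rule PiM_fold_bfun[OF UIJ(2) fin P.prob_space_axioms bF[OF S, unfolded UIJ(1)]])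
    also have "\<dots> \<le> (\<integral>x. ?c * (total_error (?hat x m) (pop m) + ?q) \<partial>PX I)"
    proof (rule integral_mono)
      have "bfun (PX I \<Otimes>\<^sub>M PX J) (\<lambda>z. ?F S (merge I J z))"
        by (rule bfun_comp[OF bF[OF S, unfolded UIJ(1)] measurable_merge])
      then show "integrable (PX I) (\<lambda>x. \<integral>y. ?F S (merge I J (x, y)) \<partial>PX J)"
        by (intro PI.bfun_integrable bfun_integral_pair[OF PJ.prob_space_axioms])
      show "integrable (PX I) (\<lambda>x. ?c * (total_error (?hat x m) (pop m) + ?q))"
        by (intro PI.bfun_integrable bfun_mult bfun_add bfun_const bfun_total_error[OF h piece UI])
      fix x assume "x \<in> space (PX I)"
      have hx: "?hat (merge I J (x, y)) m = ?hat x m" for y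
      proof (rule alpha_hat_cong[OF h piece])
        fix i k assume "k \<in> {1..m}" "i \<in> piece k"
        then have "i \<in> I" using UI by blast
        then show "merge I J (x, y) i = x i" using UIJ(2) by simp
      qed
      have bx: "?hat (merge I J (x, y)) (Suc m) S z = backfit_step \<S> a r lam h T y J (?hat x m) S z" for y z
        unfolding alpha_hat.simps hx J_def[symmetric]
        by (rule backfit_cong[OF h piece]) (use UIJ(2) in simp)
      have "(\<integral>y. ?F S (merge I J (x, y)) \<partial>PX J) =
          (\<integral>y. \<integral>z. (backfit_step \<S> a r lam h T y J (?hat x m) S z - ((1 - \<eta>) * pop m S z + \<eta> * update (pop m) S z))^2 \<partial>P \<partial>PX J)"
        unfolding bx by simp
      also have "\<dots> \<le> ?c * (total_error (?hat x m) (pop m) + \<epsilon>^2 + tail T + (real (cell_count h T TYPE('d)) + 1) / real (card J))"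
      proof (rule one_step_error[OF S h fin(2) Jne pop_admissible iterate_bound_nonneg pop_abs_le])
        show "?hat x m S' \<in> borel_measurable (leb UNIV)" if "S' \<in> \<S>" for S'
          by (rule bfun_measurable[OF bfun_alpha_hat[OF h piece _ that]]) simp
        show "\<bar>?hat x m S' z\<bar> \<le> iterate_bound m" if "S' \<in> \<S>" for S' z
          by (rule alpha_hat_abs_le[OF h piece that])
        show "\<bar>E S (partial_residual (pop m) S) y - E S (partial_residual (pop m) S) z\<bar> \<le> \<epsilon>"
          if "y \<in> nbox h S z" for y z
          using sm S that Suc.prems(1) unfolding smooth_scale_def by simp
      qed
      also have "\<dots> \<le> ?c * (total_error (?hat x m) (pop m) + ?q)"
        using cJ N(1) step_const_nonneg[of "iterate_bound m" S]
        by (intro mult_left_mono) (auto simp: add.assoc intro!: divide_left_mono)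
      finally show "(\<integral>y. ?F S (merge I J (x, y)) \<partial>PX J) \<le> ?c * (total_error (?hat x m) (pop m) + ?q)" .
    qed
    also have "\<dots> = ?c * ((\<integral>x. total_error (?hat x m) (pop m) \<partial>PX I) + ?q)"
      using PI.bfun_integrable[OF bfun_total_error[where m=m and k=m and T=T and U=I and piece=piece, OF h piece UI]] by (simp add: PI.prob_space)
    also have "\<dots> \<le> ?c * (iterate_const m * ?q + ?q)"
      by (intro mult_left_mono add_mono Suc.IH order_refl step_const_nonneg UI fin) (use Suc.prems(1) in auto)
    finally show ?thesis .
  qed
  interpret PU: prob_space "PX U" by (rule P.prob_space_PiM_const)
  have "(\<integral>X. total_error (?hat X (Suc m)) (pop (Suc m)) \<partial>PX U) = (\<Sum>S\<in>\<S>. \<integral>X. ?F S X \<partial>PX U)"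
    unfolding total_error_def by (intro Bochner_Integration.integral_sum PU.bfun_integrable bF)
  also have "\<dots> \<le> (\<Sum>S\<in>\<S>. step_const (iterate_bound m) S * (iterate_const m * ?q + ?q))"
    by (rule sum_mono) (rule FS)
  also have "\<dots> = iterate_const (Suc m) * ?q"
    by (simp only: sum_distrib_right[symmetric] iterate_const.simps distrib_right mult.assoc mult_1)
  finally show ?case .
qed

end

section \<open>Regularity of the population iterates\<close>

locale regular_missing_data = missing_data f a \<S> r lam \<kappa> c C A
  for f a :: "('d::finite \<Rightarrow> real) \<Rightarrow> real" and \<S> r lam \<kappa> c C A +
  assumes a_ucont: "ucont a"
    and rho_ucont: "\<And>S. S \<in> \<S> \<Longrightarrow> ucont (\<rho> S)"
    and kappa_cont: "\<And>S \<epsilon>. S \<in> \<S> \<Longrightarrow> 0 < \<epsilon> \<Longrightarrow> \<exists>\<delta>>0. \<forall>x x'. (\<forall>i. \<bar>x i - x' i\<bar> \<le> \<delta>) \<longrightarrow>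
      tv_dist (cond S x) (cond S x') \<le> \<epsilon>"
begin

text \<open>Moving x changes the integrand and the conditional law. The first change is controlled
  by uniform continuity of \<phi>, the second by \<open>tv_dist_integral\<close>.\<close>

lemma ucont_E:
  assumes S: "S \<in> \<S>" and \<phi>: "bfun (leb UNIV) \<phi>" "ucont \<phi>"
  shows "ucont (E S \<phi>)"
  unfolding ucont_def
proof (intro allI impI)
  fix \<epsilon> :: real assume \<epsilon>: "0 < \<epsilon>"
  obtain B where B: "0 \<le> B" "\<And>x. \<bar>\<phi> x\<bar> \<le> B" using bfun_bound[OF \<phi>(1)] by blast
  obtain \<delta>1 where 1: "0 < \<delta>1" "\<And>x y. (\<And>i. \<bar>x i - y i\<bar> \<le> \<delta>1) \<Longrightarrow> \<bar>\<phi> x - \<phi> y\<bar> \<le> \<epsilon> / 2"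
    using ucontD[OF \<phi>(2), of "\<epsilon> / 2"] \<epsilon> by (metis half_gt_zero)
  have e4: "0 < \<epsilon> / (4 * (B + 1))" using \<epsilon> B(1) by (intro divide_pos_pos) auto
  obtain \<delta>2 where 2: "0 < \<delta>2" "\<And>x x'. (\<forall>i. \<bar>x i - x' i\<bar> \<le> \<delta>2) \<Longrightarrow>
      tv_dist (cond S x) (cond S x') \<le> \<epsilon> / (4 * (B + 1))"
    using kappa_cont[OF S e4] by blast
  show "\<exists>\<delta>>0. \<forall>x y. (\<forall>i. \<bar>x i - y i\<bar> \<le> \<delta>) \<longrightarrow> \<bar>E S \<phi> x - E S \<phi> y\<bar> \<le> \<epsilon>"
  proof (intro exI[of _ "min \<delta>1 \<delta>2"] conjI allI impI)
    fix x x' :: "'d \<Rightarrow> real" assume d: "\<forall>i. \<bar>x i - x' i\<bar> \<le> min \<delta>1 \<delta>2"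
    interpret K: prob_space "cond S x" by (rule kappa_prob[OF S])
    let ?f = "\<lambda>x y. \<phi> (merge S (-S) (x, y))"
    have bf: "bfun (cond S x) (?f x)" "bfun (cond S x) (?f x')"
      using bfun_section[OF S \<phi>(1), where x=x] bfun_section[OF S \<phi>(1), where x=x']
        bfun_cong_sets[of "cond S x" "cond S x'"]
      by (simp_all add: kappa_prob(2)[OF S])
    have "\<bar>\<integral>y. ?f x y - ?f x' y \<partial>cond S x\<bar> \<le> \<epsilon> / 2"
    proof (rule K.integral_abs_le_const_bfun[OF bfun_diff[OF bf]])
      fix y
      show "\<bar>?f x y - ?f x' y\<bar> \<le> \<epsilon> / 2"
        by (rule 1(2)) (use d 1(1) in \<open>auto simp: merge_def\<close>)
    qed
    then have s1: "\<bar>E S \<phi> x - (\<integral>y. ?f x' y \<partial>cond S x)\<bar> \<le> \<epsilon> / 2"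
      unfolding E_def using K.bfun_integrable[OF bf(1)] K.bfun_integrable[OF bf(2)] by simp
    have "\<bar>(\<integral>y. ?f x' y \<partial>cond S x) - (\<integral>y. ?f x' y \<partial>cond S x')\<bar> \<le>
        2 * B * tv_dist (cond S x) (cond S x')"
      by (rule tv_dist_integral) (use kappa_prob[OF S] bfun_measurable[OF bf(2)] B in auto)
    also have "\<dots> \<le> 2 * B * (\<epsilon> / (4 * (B + 1)))"
      using 2(2)[of x x'] d B(1) by (intro mult_left_mono) auto
    also have "\<dots> \<le> \<epsilon> / 2" using \<epsilon> B(1) by (simp add: field_simps)
    finally show "\<bar>E S \<phi> x - E S \<phi> x'\<bar> \<le> \<epsilon>" using s1 unfolding E_def by linarith
  qed (use 1 2 in simp)
qed

lemma ucont_w: assumes S: "S \<in> \<S>" shows "ucont (w S)"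
proof -
  have "w S x = 1 - 1 / (1 + lam S * \<rho> S x)" for x
    using lam_rho_pos[OF S, of x] by (simp add: w_def field_simps)
  moreover have "ucont (\<lambda>x. 1 - 1 / (1 + lam S * \<rho> S x))"
    by (intro ucont_diff ucont_const ucont_inverse ucont_add ucont_cmult rho_ucont S)
      (use less_imp_le[OF lam_rho_pos[OF S]] in auto)
  ultimately show ?thesis by (simp add: ucont_def)
qed

lemma ucont_partial_residual:
  "(\<And>S'. S' \<in> \<S> \<Longrightarrow> ucont (\<alpha> S')) \<Longrightarrow> ucont (partial_residual \<alpha> S)"
  unfolding partial_residual_def[abs_def] by (intro ucont_diff a_ucont ucont_sum) auto

lemma ucont_pop: "S \<in> \<S> \<Longrightarrow> ucont (pop m S)"
proof (induction m arbitrary: S)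
  case 0
  then show ?case by (simp add: ucont_const)
next
  case (Suc m)
  have b: "bfun (leb UNIV) (E S (partial_residual (pop m) S))"
    by (rule bfun_E[OF Suc.prems bfun_partial_residual[OF pop_admissible]])
  have "ucont (update (pop m) S)"
    unfolding update_def[abs_def]
    by (rule ucont_mult[OF ucont_w[OF Suc.prems] _ bfun_w[OF Suc.prems] bfun_diff[OF b bfun_const]])
      (intro ucont_diff ucont_const ucont_E Suc.prems bfun_partial_residual pop_admissible
        ucont_partial_residual Suc.IH)
  then show ?case unfolding pop.simps by (intro ucont_add ucont_cmult Suc)
qed

lemma exists_smooth_scale:
  assumes \<epsilon>: "0 < \<epsilon>"
  shows "\<exists>h. 0 < h \<and> h < 1 \<and> smooth_scale h M \<epsilon>"
proof -
  have "\<exists>\<delta>>0. \<forall>x y. y \<in> nbox \<delta> S x \<longrightarrow>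
      \<bar>E S (partial_residual (pop k) S) y - E S (partial_residual (pop k) S) x\<bar> \<le> \<epsilon>" if S: "S \<in> \<S>" for S k
  proof -
    have "ucont (E S (partial_residual (pop k) S))"
      by (intro ucont_E S bfun_partial_residual pop_admissible ucont_partial_residual ucont_pop)
    then obtain \<delta> where \<delta>: "0 < \<delta>" "\<And>x y. (\<And>i. i \<in> S \<Longrightarrow> \<bar>x i - y i\<bar> \<le> \<delta>) \<Longrightarrow>
        \<bar>E S (partial_residual (pop k) S) x - E S (partial_residual (pop k) S) y\<bar> \<le> \<epsilon>"
      using ucont_dependsD[OF _ E_dep \<epsilon>] by blast
    then show ?thesis by (intro exI[of _ \<delta>]) (auto simp: nbox_def abs_minus_commute)
  qed
  then obtain \<delta> where \<delta>: "\<And>S k. S \<in> \<S> \<Longrightarrow> 0 < \<delta> S k" "\<And>S k x y. S \<in> \<S> \<Longrightarrow> y \<in> nbox (\<delta> S k) S x \<Longrightarrow>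
      \<bar>E S (partial_residual (pop k) S) y - E S (partial_residual (pop k) S) x\<bar> \<le> \<epsilon>"
    by metis
  \<comment> \<open>A minimum over the finitely many sets and iterates concerned; the entry 1/2
    keeps the set nonempty and h below 1.\<close>
  define h where "h = Min (insert (1/2) ((\<lambda>(S, k). \<delta> S k) ` (\<S> \<times> {..<M})))"
  have h0: "0 < h" unfolding h_def using \<delta>(1) by (subst Min_gr_iff) auto
  have h1: "h < 1" unfolding h_def by (rule le_less_trans[OF Min_le[of _ "1/2"]]) auto
  have hle: "h \<le> \<delta> S k" if "S \<in> \<S>" "k < M" for S k
    unfolding h_def by (rule Min_le) (use that in auto)
  have "smooth_scale h M \<epsilon>"
    unfolding smooth_scale_def
  proof (intro allI impI ballI)
    fix k S x y assume k: "k < M" and S: "S \<in> \<S>" and y: "y \<in> nbox h S x"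
    then have "y \<in> nbox (\<delta> S k) S x" using hle[OF S k] by (force simp: nbox_def)
    then show "\<bar>E S (partial_residual (pop k) S) y - E S (partial_residual (pop k) S) x\<bar> \<le> \<epsilon>"
      by (rule \<delta>(2)[OF S])
  qed
  then show ?thesis using h0 h1 by blast
qed

end

section \<open>The cross-fitting estimator\<close>

text \<open>The second half has n - \<lceil>n/2\<rceil> points. The fraction 1/3 is attained there
  at n = 3, which is why small n are checked one by one.\<close>

lemma half_properties:
  assumes "2 \<le> n"
  shows "finite (half n l)" "half n 1 \<inter> half n 2 = {}" "half n 1 \<union> half n 2 = {1..n}"
    "l \<in> {1, 2} \<Longrightarrow> half n l \<subseteq> {1..n}"
    "l \<in> {1, 2} \<Longrightarrow> real n / 3 \<le> real (card (half n l))"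
    "real (card (half n 1)) + real (card (half n 2)) = real n"
proof -
  define k where "k = nat \<lceil>real n / 2\<rceil>"
  have k: "real n / 2 \<le> real k" "real k < real n / 2 + 1" unfolding k_def by linarith+
  have kn: "k \<le> n" using k(2) assms by linarith
  have h1: "half n 1 = {1..k}" and h2: "half n 2 = {k + 1..n}" by (auto simp: half_def k_def)
  show "finite (half n l)" by (simp add: half_def)
  show "half n 1 \<inter> half n 2 = {}" "half n 1 \<union> half n 2 = {1..n}" unfolding h1 h2 using kn by auto
  show "half n l \<subseteq> {1..n}" if "l \<in> {1, 2}" using that h1 h2 kn by auto
  have c: "real (card (half n 1)) = real k" "real (card (half n 2)) = real n - real k"
    unfolding h1 h2 using kn by (auto simp: of_nat_diff)
  then show "real (card (half n 1)) + real (card (half n 2)) = real n" by simp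
  show "real n / 3 \<le> real (card (half n l))" if l: "l \<in> {1, 2}"
  proof (cases "l = 1")
    case True
    then show ?thesis using c(1) k(1) by simp
  next
    case False
    then have "l = 2" using l by simp
    moreover have "real n / 3 \<le> real n - real k"
    proof -
      consider "n = 2" | "n = 3" | "n = 4" | "n = 5" | "6 \<le> n" using assms by linarith
      then show ?thesis
      proof cases
        case 1 then show ?thesis using k(2) kn k(1) by (simp add: k_def)
      next
        case 2 then show ?thesis using k(2) by (simp add: k_def)
      next
        case 3 then show ?thesis using k(2) by (simp add: k_def)
      next
        case 4 then show ?thesis using k(2) by (simp add: k_def)
      next
        case 5 then show ?thesis using k(2) by simp
      qed
    qed
    ultimately show ?thesis using c(2) by simp
  qed
qed

lemma measurable_zero_fill: "(\<lambda>x i. if i \<in> S then x i else (0::real)) \<in> leb S \<rightarrow>\<^sub>M leb (UNIV :: 'd::finite set)"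
proof (rule measurable_PiM_single')
  show "(\<lambda>x. if i \<in> S then x i else (0::real)) \<in> leb S \<rightarrow>\<^sub>M lborel" for i :: 'd
    by (cases "i \<in> S") (auto intro: measurable_component_singleton)
qed auto

lemma alpha_hat_piece_cong:
  assumes "\<And>k. k \<in> {1..m} \<Longrightarrow> piece k = piece' k"
  shows "alpha_hat \<S> a r lam h T piece X m = alpha_hat \<S> a r lam h T piece' X m"
  using assms
proof (induction m)
  case (Suc m)
  have "alpha_hat \<S> a r lam h T piece X m = alpha_hat \<S> a r lam h T piece' X m"
    by (rule Suc.IH) (use Suc.prems in auto)
  then show ?case using Suc.prems[of "Suc m"] by simp
qed simp

lemma integral_linear_sum:
  fixes G :: "'a \<Rightarrow> real"
  assumes "integrable M G" "\<And>i. i \<in> I \<Longrightarrow> integrable M (H i)"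
  shows "(\<integral>x. p * G x + q * (\<Sum>i\<in>I. H i x) \<partial>M) = p * (\<integral>x. G x \<partial>M) + q * (\<Sum>i\<in>I. \<integral>x. H i x \<partial>M)"
proof -
  have "integrable M (\<lambda>x. \<Sum>i\<in>I. H i x)" by (rule Bochner_Integration.integrable_sum) fact
  then show ?thesis using assms by (simp add: Bochner_Integration.integral_sum)
qed

lemma integral_pair_sum_square:
  assumes p: "prob_space M" "prob_space L" and b: "bfun M U" "bfun L V" and z: "(\<integral>x. U x \<partial>M) = 0"
  shows "(\<integral>\<omega>. (U (fst \<omega>) + V (snd \<omega>))^2 \<partial>(M \<Otimes>\<^sub>M L)) = (\<integral>x. (U x)^2 \<partial>M) + (\<integral>y. (V y)^2 \<partial>L)"
proof -
  interpret M: prob_space M by fact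
  interpret L: prob_space L by fact
  interpret PL: prob_space "M \<Otimes>\<^sub>M L" by (rule prob_space_pair[OF p])
  have bb: "bfun (M \<Otimes>\<^sub>M L) (\<lambda>\<omega>. U (fst \<omega>))" "bfun (M \<Otimes>\<^sub>M L) (\<lambda>\<omega>. V (snd \<omega>))"
    by (rule bfun_comp[OF b(1)], simp, rule bfun_comp[OF b(2)], simp)
  have i: "integrable (M \<Otimes>\<^sub>M L) (\<lambda>\<omega>. (U (fst \<omega>))^2)" "integrable (M \<Otimes>\<^sub>M L) (\<lambda>\<omega>. (V (snd \<omega>))^2)"
    "integrable (M \<Otimes>\<^sub>M L) (\<lambda>\<omega>. U (fst \<omega>) * V (snd \<omega>))"
    by (intro PL.bfun_integrable bfun_intros bb)+
  have e: "(U (fst \<omega>) + V (snd \<omega>))^2 = (U (fst \<omega>))^2 + 2 * (U (fst \<omega>) * V (snd \<omega>)) + (V (snd \<omega>))^2" for \<omega>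
    by (simp add: power2_eq_square algebra_simps)
  have "(\<integral>\<omega>. (U (fst \<omega>) + V (snd \<omega>))^2 \<partial>(M \<Otimes>\<^sub>M L)) =
      (\<integral>\<omega>. (U (fst \<omega>))^2 \<partial>(M \<Otimes>\<^sub>M L)) + 2 * (\<integral>\<omega>. U (fst \<omega>) * V (snd \<omega>) \<partial>(M \<Otimes>\<^sub>M L)) + (\<integral>\<omega>. (V (snd \<omega>))^2 \<partial>(M \<Otimes>\<^sub>M L))"
    unfolding e using i by simp
  moreover have "(\<integral>\<omega>. U (fst \<omega>) * V (snd \<omega>) \<partial>(M \<Otimes>\<^sub>M L)) = 0"
    using integral_pair_mult[OF p b] z by simp
  moreover have "(\<integral>\<omega>. (U (fst \<omega>))^2 \<partial>(M \<Otimes>\<^sub>M L)) = (\<integral>x. (U x)^2 \<partial>M)"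
    using integral_pair_mult[OF p bfun_power[OF b(1), of 2] bfun_const[of L 1]] by (simp add: L.prob_space)
  moreover have "(\<integral>\<omega>. (V (snd \<omega>))^2 \<partial>(M \<Otimes>\<^sub>M L)) = (\<integral>y. (V y)^2 \<partial>L)"
    using integral_pair_mult[OF p bfun_const[of M 1] bfun_power[OF b(2), of 2]] by (simp add: M.prob_space)
  ultimately show ?thesis by simp
qed

text \<open>The limiting constant must be sharp, so the leading term keeps a coefficient close to 1;
  the remainder tends to 0 and can bear the large factor 1 + 1/\<gamma>.\<close>

lemma add_square_le_weighted:
  assumes "0 < \<gamma>" shows "(x + y)^2 \<le> (1 + \<gamma>) * x^2 + (1 + 1 / \<gamma>) * (y :: real)^2"
proof -
  have "0 \<le> (\<gamma> * x - y)^2 / \<gamma>" using assms by simp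
  also have "\<dots> = \<gamma> * x^2 - 2 * x * y + 1 / \<gamma> * y^2"
    using assms by (simp add: power2_eq_square field_simps)
  finally show ?thesis by (simp add: power2_eq_square algebra_simps)
qed

lemma convex_combination_square_le:
  assumes "0 \<le> p" "0 \<le> q" "p + q = 1"
  shows "(p * x + q * y)^2 \<le> x^2 + (y :: real)^2"
proof -
  have "0 \<le> p * q * (x - y)^2" using assms by simp
  then have "(p * x + q * y)^2 \<le> p * (p + q) * x^2 + q * (p + q) * y^2"
    by (simp add: power2_eq_square algebra_simps)
  also have "\<dots> \<le> x^2 + y^2"
    using assms mult_right_mono[of p 1 "x^2"] mult_right_mono[of q 1 "y^2"] by simp
  finally show ?thesis .
qed

text \<open>\<open>p n\<close> uses the highest level k whose threshold has been passed by n, and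
  the default as long as there is none. Each level is eventually reached, so the levels used tend to
  infinity.\<close>

lemma diagonal_choice:
  fixes G :: "nat \<Rightarrow> 'p \<Rightarrow> bool" and R :: "nat \<Rightarrow> nat \<Rightarrow> 'p \<Rightarrow> bool"
  assumes default: "\<And>n. m \<le> n \<Longrightarrow> G n p0"
    and ev: "\<And>k. \<exists>p. \<forall>\<^sub>F n in sequentially. G n p \<and> R k n p"
  shows "\<exists>p. (\<forall>n\<ge>m. G n (p n)) \<and> (\<forall>k. \<forall>\<^sub>F n in sequentially. \<exists>j\<ge>k. R j n (p n))"
proof -
  have "\<forall>k. \<exists>p n0. \<forall>n\<ge>n0. G n p \<and> R k n p" using ev unfolding eventually_sequentially by blast
  then obtain u n0 where u: "\<And>k n. n0 k \<le> n \<Longrightarrow> G n (u k) \<and> R k n (u k)" by metis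
  \<comment> \<open>The condition k \<le> n keeps the set finite even if all thresholds are
    small.\<close>
  define K where "K n = {k. k \<le> n \<and> n0 k \<le> n}" for n
  have fin: "finite (K n)" for n unfolding K_def by (rule finite_subset[of _ "{..n}"]) auto
  define p where "p n = (if K n = {} then p0 else u (Max (K n)))" for n
  have "G n (p n)" if "m \<le> n" for n
  proof (cases "K n = {}")
    case False
    then have "Max (K n) \<in> K n" by (rule Max_in[OF fin])
    then have "n0 (Max (K n)) \<le> n" by (simp add: K_def)
    then show ?thesis using u False by (simp add: p_def)
  qed (simp add: p_def default[OF that])
  moreover have "\<forall>\<^sub>F n in sequentially. \<exists>j\<ge>k. R j n (p n)" for k
  proof (rule eventually_sequentiallyI)
    fix n assume "max k (n0 k) \<le> n"
    then have k: "k \<in> K n" by (simp add: K_def)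
    then have "Max (K n) \<in> K n" by (intro Max_in[OF fin]) auto
    then have "n0 (Max (K n)) \<le> n" by (simp add: K_def)
    moreover have "K n \<noteq> {}" using k by blast
    ultimately have "R (Max (K n)) n (p n)" using u by (simp add: p_def)
    then show "\<exists>j\<ge>k. R j n (p n)" using Max_ge[OF fin k] by blast
  qed
  ultimately show ?thesis by blast
qed

section \<open>Averages over the observed samples\<close>

context missing_data
begin

abbreviation "MX n \<equiv> \<Pi>\<^sub>M i\<in>{1..n::nat}. P"
abbreviation "MY N \<equiv> \<Pi>\<^sub>M S\<in>\<S>. \<Pi>\<^sub>M j\<in>{1..N S::nat}. Q S"

lemma data_law_f: "data_law \<S> r n N f = MX n \<Otimes>\<^sub>M MY N"
  by (simp add: data_law_def)

lemma measurable_MX: "i \<in> I \<Longrightarrow> (\<lambda>X. X i) \<in> PX I \<rightarrow>\<^sub>M leb UNIV"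
  using measurable_component_singleton[of i I "\<lambda>_. P"] by (simp cong: measurable_cong_sets)

lemma measurable_MY:
  assumes "S \<in> \<S>" "j \<in> {1..N S}" shows "(\<lambda>Y. Y S j) \<in> MY N \<rightarrow>\<^sub>M leb S"
proof -
  have "(\<lambda>y. y S j) \<in> MY N \<rightarrow>\<^sub>M Q S"
    by (rule measurable_compose[where f="\<lambda>y. y S" and g="\<lambda>z. z j"])
      (use assms in \<open>auto intro: measurable_component_singleton\<close>)
  then show ?thesis by (simp cong: measurable_cong_sets)
qed

lemma bfun_MY:
  assumes S: "S \<in> \<S>" "j \<in> {1..N S}" and \<phi>: "bfun (leb UNIV) \<phi>" "depends_on S \<phi>"
  shows "bfun (MY N) (\<lambda>Y. \<phi> (Y S j))"
proof (rule bfun_comp[where f=\<phi> and g="\<lambda>Y. Y S j"])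
  show "bfun (leb S) \<phi>" using bfun_Q[OF \<phi>] bfun_cong_sets[OF sets_biased_law] by blast
  show "(\<lambda>Y. Y S j) \<in> MY N \<rightarrow>\<^sub>M leb S" by (rule measurable_MY[where N=N, OF S])
qed

text \<open>The second bound gains nothing from the sample size; it serves where the average is
  multiplied by another small factor, the deviation of \<open>rho_hat\<close> from 1.\<close>

lemma avg_Y_integrals:
  assumes S: "S \<in> \<S>" "1 \<le> N S" and \<phi>: "bfun (leb UNIV) \<phi>" "depends_on S \<phi>"
  shows "(\<integral>Y. (avg {1..N S} (\<lambda>j. \<phi> (Y S j)) - (\<integral>y. \<phi> y \<partial>Q S))^2 \<partial>MY N) \<le> (\<integral>y. (\<phi> y)^2 \<partial>Q S) / real (N S)"
    "(\<integral>Y. (avg {1..N S} (\<lambda>j. \<phi> (Y S j)))^2 \<partial>MY N) \<le> (\<integral>y. (\<phi> y)^2 \<partial>Q S)"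
proof -
  interpret QS: prob_space "Q S" by (rule prob_space_Q[OF S(1)])
  note b = bfun_Q[OF \<phi>]
  have I: "finite {1..N S}" "{1..N S} \<noteq> {}" using S(2) by auto
  have comp: "(\<integral>Y. F (Y S) \<partial>MY N) = (\<integral>y. F y \<partial>(\<Pi>\<^sub>M j\<in>{1..N S}. Q S))"
    if "F \<in> borel_measurable (\<Pi>\<^sub>M j\<in>{1..N S}. Q S)" for F :: "(nat \<Rightarrow> 'd \<Rightarrow> real) \<Rightarrow> real"
    by (rule integral_PiM_component[where M="\<lambda>S. \<Pi>\<^sub>M j\<in>{1..N S}. Q S", OF prob_space_data_Y S(1) that])
  have bavg: "bfun (\<Pi>\<^sub>M j\<in>{1..N S}. Q S) (\<lambda>y. avg {1..N S} (\<lambda>j. \<phi> (y j)))"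
    by (intro bfun_avg QS.bfun_PiM_component b)
  show "(\<integral>Y. (avg {1..N S} (\<lambda>j. \<phi> (Y S j)) - (\<integral>y. \<phi> y \<partial>Q S))^2 \<partial>MY N) \<le> (\<integral>y. (\<phi> y)^2 \<partial>Q S) / real (N S)"
    using comp[OF bfun_measurable[OF bfun_power[OF bfun_diff[OF bavg bfun_const]]]]
      QS.integral_avg_deviation_le[OF I b] by simp
  show "(\<integral>Y. (avg {1..N S} (\<lambda>j. \<phi> (Y S j)))^2 \<partial>MY N) \<le> (\<integral>y. (\<phi> y)^2 \<partial>Q S)"
    using comp[OF bfun_measurable[OF bfun_power[OF bavg]]] QS.integral_avg_square_le[OF I b] by simp
qed

text \<open>Inverse weighting: division by the normalised sampling weight undoes the bias of the
  sample on \<open>S\<close>, at the price of the factor 1/c in second moments.\<close>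

lemma integral_Q_weighted:
  assumes S: "S \<in> \<S>" and \<phi>: "bfun (leb UNIV) \<phi>" "depends_on S \<phi>"
  shows "bfun (leb UNIV) (\<lambda>x. \<phi> x / \<rho> S x)" "depends_on S (\<lambda>x. \<phi> x / \<rho> S x)"
    "(\<integral>x. \<phi> x / \<rho> S x \<partial>Q S) = (\<integral>x. \<phi> x \<partial>P)"
    "(\<integral>x. (\<phi> x / \<rho> S x)^2 \<partial>Q S) = (\<integral>x. (\<phi> x)^2 / \<rho> S x \<partial>P)"
    "(\<integral>x. (\<phi> x)^2 / \<rho> S x \<partial>P) \<le> (\<integral>x. (\<phi> x)^2 \<partial>P) / c"
proof -
  show b: "bfun (leb UNIV) (\<lambda>x. \<phi> x / \<rho> S x)"
    by (rule bfun_divide_ge[OF \<phi>(1) bfun_rho[OF S] rho_ge[OF S] cC(1)])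
  show d: "depends_on S (\<lambda>x. \<phi> x / \<rho> S x)"
    using \<phi>(2) rho_dep[OF S] unfolding depends_on_def by metis
  have p: "\<rho> S x \<noteq> 0" for x using rho_pos[OF S, of x] by simp
  show "(\<integral>x. \<phi> x / \<rho> S x \<partial>Q S) = (\<integral>x. \<phi> x \<partial>P)"
    using integral_Q[OF S bfun_measurable[OF b] d] p by simp
  have "depends_on S (\<lambda>x. (\<phi> x / \<rho> S x)^2)" using d by (simp add: depends_on_def)
  from integral_Q[OF S bfun_measurable[OF bfun_power[OF b]] this]
  show "(\<integral>x. (\<phi> x / \<rho> S x)^2 \<partial>Q S) = (\<integral>x. (\<phi> x)^2 / \<rho> S x \<partial>P)"
    using p by (simp add: power_divide power2_eq_square)
  have "(\<integral>x. (\<phi> x)^2 / \<rho> S x \<partial>P) \<le> (\<integral>x. (\<phi> x)^2 / c \<partial>P)"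
  proof (rule P.bfun_integral_mono)
    show "bfun P (\<lambda>x. (\<phi> x)^2 / \<rho> S x)" "bfun P (\<lambda>x. (\<phi> x)^2 / c)"
      unfolding bfun_P by (intro bfun_divide_ge[OF _ bfun_rho[OF S] rho_ge[OF S] cC(1)] bfun_intros \<phi>(1))+
    show "(\<phi> x)^2 / \<rho> S x \<le> (\<phi> x)^2 / c" for x
      using rho_ge[OF S] rho_pos[OF S] cC(1) by (intro divide_left_mono) auto
  qed
  then show "(\<integral>x. (\<phi> x)^2 / \<rho> S x \<partial>P) \<le> (\<integral>x. (\<phi> x)^2 \<partial>P) / c" by simp
qed

text \<open>The estimation error of an oracle that uses \<open>pop m\<close> and the exactly
  normalised weights; the parameter is already subtracted inside \<open>residual\<close>.\<close>

definition leading_term :: "nat \<Rightarrow> nat \<Rightarrow> ('d set \<Rightarrow> nat) \<Rightarrow> 'd data \<Rightarrow> real" where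
  "leading_term m n N \<omega> = avg {1..n} (\<lambda>i. residual (pop m) (fst \<omega> i)) +
     (\<Sum>S\<in>\<S>. avg {1..N S} (\<lambda>j. pop m S (snd \<omega> S j) / \<rho> S (snd \<omega> S j)))"

lemma bfun_leading_term: "bfun (data_law \<S> r n N f) (leading_term m n N)"
proof -
  have X: "bfun (MX n) (\<lambda>X. residual (pop m) (X i))" if "i \<in> {1..n}" for i
    by (rule bfun_comp[OF bfun_residual[OF pop_admissible] measurable_MX[OF that]])
  have Y: "bfun (MY N) (\<lambda>Y. pop m S (Y S j) / \<rho> S (Y S j))" if "S \<in> \<S>" "j \<in> {1..N S}" for S j
    using bfun_MY[where N=N, OF that integral_Q_weighted(1,2)[OF that(1) admissibleD(1,2)[OF pop_admissible that(1)]]] .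
  show ?thesis
    unfolding leading_term_def[abs_def] data_law_f
    by (intro bfun_add bfun_avg bfun_sum bfun_comp[OF X] bfun_comp[OF Y]) auto
qed

text \<open>Complete and partial samples are independent and all terms are centred, so variances add
  without remainder. Once n / N S is replaced by its limit 1 / lam S, this is the objective at
  \<open>pop m\<close>.\<close>

lemma leading_term_risk:
  assumes n: "1 \<le> n" and N: "\<And>S. S \<in> \<S> \<Longrightarrow> 1 \<le> N S"
  shows "real n * (\<integral>\<omega>. (leading_term m n N \<omega>)^2 \<partial>data_law \<S> r n N f) =
    (\<integral>x. (residual (pop m) x)^2 \<partial>P) + (\<Sum>S\<in>\<S>. real n / real (N S) * (\<integral>x. (pop m S x)^2 / \<rho> S x \<partial>P))"
proof -
  let ?U = "\<lambda>X. avg {1..n} (\<lambda>i. residual (pop m) (X i))"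
  let ?\<psi> = "\<lambda>S y. avg {1..N S} (\<lambda>j. pop m S (y j) / \<rho> S (y j))"
  let ?V = "\<lambda>Y. \<Sum>S\<in>\<S>. ?\<psi> S (Y S)"
  have I: "finite {1..n}" "{1..n} \<noteq> {}" using n by auto
  have br: "bfun P (residual (pop m))" using bfun_residual[OF pop_admissible] bfun_P by blast
  have bU: "bfun (MX n) ?U" by (intro bfun_avg P.bfun_PiM_component br)
  have U0: "(\<integral>X. ?U X \<partial>MX n) = 0"
    using P.integral_avg[OF I br] integral_residual[OF pop_admissible] by simp
  have U2: "(\<integral>X. (?U X)^2 \<partial>MX n) = (\<integral>x. (residual (pop m) x)^2 \<partial>P) / real n"
    using P.integral_avg_centered_square[OF I br integral_residual[OF pop_admissible]] by simp
  note pa = admissibleD[OF pop_admissible]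
  let ?F = "\<lambda>S. (\<integral>x. (pop m S x)^2 / \<rho> S x \<partial>P) / real (N S)"
  let ?G = "\<lambda>S. \<Pi>\<^sub>M j\<in>{1..N S}. Q S"
  have \<psi>: "bfun (?G S) (?\<psi> S)" "(\<integral>y. ?\<psi> S y \<partial>(?G S)) = 0"
    "(\<integral>y. (?\<psi> S y)^2 \<partial>(?G S)) = ?F S" if S: "S \<in> \<S>" for S
  proof -
    interpret QS: prob_space "Q S" by (rule prob_space_Q[OF S])
    have J: "finite {1..N S}" "{1..N S} \<noteq> {}" using N[OF S] by auto
    note iq = integral_Q_weighted[OF S pa(1,2)[OF S], of m]
    have b: "bfun (Q S) (\<lambda>x. pop m S x / \<rho> S x)" by (rule bfun_Q[OF iq(1,2)])
    have z: "(\<integral>x. pop m S x / \<rho> S x \<partial>Q S) = 0" using iq(3) pa(3)[OF S] by simp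
    show "bfun (?G S) (?\<psi> S)" by (intro bfun_avg QS.bfun_PiM_component b)
    show "(\<integral>y. ?\<psi> S y \<partial>(?G S)) = 0" using QS.integral_avg[OF J b] z by simp
    show "(\<integral>y. (?\<psi> S y)^2 \<partial>(?G S)) = ?F S"
      using QS.integral_avg_centered_square[OF J b z] iq(4) by simp
  qed
  have bV: "bfun (MY N) ?V"
    by (intro bfun_sum bfun_comp[OF \<psi>(1)]) auto
  have V2: "(\<integral>Y. (?V Y)^2 \<partial>MY N) = (\<Sum>S\<in>\<S>. ?F S)"
    by (rule trans[OF integral_PiM_sum_square[OF finite_S prob_space_data_Y \<psi>(1,2)] sum.cong[OF refl \<psi>(3)]])
  have "(\<integral>\<omega>. (leading_term m n N \<omega>)^2 \<partial>data_law \<S> r n N f) = (\<integral>\<omega>. (?U (fst \<omega>) + ?V (snd \<omega>))^2 \<partial>(MX n \<Otimes>\<^sub>M MY N))"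
    by (simp add: leading_term_def data_law_f)
  also have "\<dots> = (\<integral>x. (residual (pop m) x)^2 \<partial>P) / real n + (\<Sum>S\<in>\<S>. ?F S)"
    by (simp only: integral_pair_sum_square[OF prob_space_data_X prob_space_data_YY bU bV U0] U2 V2)
  finally show ?thesis using n by (simp add: distrib_left sum_distrib_left)
qed

section \<open>The estimator for fixed sample sizes and tuning parameters\<close>

context
  fixes n M :: nat and N :: "'d set \<Rightarrow> nat" and D :: "nat \<Rightarrow> nat \<Rightarrow> nat \<Rightarrow> nat \<Rightarrow> nat set" and h T :: real
  assumes h: "0 < h" and M: "1 \<le> M" "2 * M \<le> n" and D: "balanced_split D"
    and N: "\<And>S. S \<in> \<S> \<Longrightarrow> 1 \<le> N S"
begin

text \<open>\<open>balanced_split\<close> leaves \<open>D n M l k\<close> arbitrary for k outside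
  {1..M}; emptying those sets makes every piece finite.\<close>

definition piece :: "nat \<Rightarrow> nat \<Rightarrow> nat set" where
  "piece l k = (if k \<in> {1..M} then D n M l k else {})"

definition fitted :: "nat \<Rightarrow> (nat \<Rightarrow> 'd \<Rightarrow> real) \<Rightarrow> 'd set \<Rightarrow> ('d \<Rightarrow> real) \<Rightarrow> real" where
  "fitted l X = alpha_hat \<S> a r lam h T (piece l) X M"

lemma n_ge_2: "2 \<le> n" using M by linarith

text \<open>The size bound holds because sizes differ by at most 1: the half has at most M (p + 1)
  points if one of its M pieces has p.\<close>

lemma piece_properties:
  assumes "l \<in> {1, 2}"
  shows "disjoint_family_on (piece l) {1..M}" "(\<Union>k\<in>{1..M}. piece l k) = half n l"
    "finite (piece l k)" "k \<in> {1..M} \<Longrightarrow> real (card (half n l)) / real M - 1 \<le> real (card (piece l k))"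
    "k \<in> {1..M} \<Longrightarrow> piece l k \<subseteq> half n l"
proof -
  have B: "disjoint_family_on (D n M l) {1..M}" "(\<Union>m\<in>{1..M}. D n M l m) = half n l"
    "\<forall>m\<in>{1..M}. \<forall>m'\<in>{1..M}. card (D n M l m) \<le> card (D n M l m') + 1"
    using D assms M unfolding balanced_split_def by blast+
  show d: "disjoint_family_on (piece l) {1..M}" using B(1) by (simp add: piece_def disjoint_family_on_def)
  show u: "(\<Union>k\<in>{1..M}. piece l k) = half n l" using B(2) by (simp add: piece_def)
  have fin: "finite (piece l k)" for k
  proof (cases "k \<in> {1..M}")
    case True
    then have "piece l k \<subseteq> half n l" using u by blast
    then show ?thesis using half_properties(1)[OF n_ge_2] by (rule finite_subset)
  qed (simp only: piece_def if_False finite.emptyI)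
  then show "finite (piece l k)" .
  show "piece l k \<subseteq> half n l" if "k \<in> {1..M}" using u that by blast
  show "real (card (half n l)) / real M - 1 \<le> real (card (piece l k))" if k: "k \<in> {1..M}"
  proof -
    have "card (half n l) = (\<Sum>j\<in>{1..M}. card (piece l j))"
      unfolding u[symmetric] by (rule card_UN_disjoint) (use d fin in \<open>auto simp: disjoint_family_on_def\<close>)
    also have "\<dots> \<le> (\<Sum>j\<in>{1..M}. card (piece l k) + 1)"
      by (intro sum_mono) (use B(3) k in \<open>auto simp: piece_def\<close>)
    also have "\<dots> = M * (card (piece l k) + 1)" by simp
    finally have "real (card (half n l)) \<le> real (M * (card (piece l k) + 1))" by (rule of_nat_mono)
    then have "real (card (half n l)) \<le> (real (card (piece l k)) + 1) * real M" by (simp add: algebra_simps)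
    moreover have "0 < real M" using M(1) by simp
    ultimately show ?thesis by (simp add: divide_le_eq algebra_simps)
  qed
qed

text \<open>In the quotient of \<open>r_hat\<close> and r the unknown \<open>R S\<close> cancels, so
  the fold is written with \<open>rho_hat\<close>, which has mean 1.\<close>

lemma theta_fold_eq:
  "theta_fold \<S> a r lam D n N h T M l \<omega> =
    avg (half n (3 - l)) (\<lambda>i. a (fst \<omega> i) - (\<Sum>S\<in>\<S>. fitted l (fst \<omega>) S (fst \<omega> i))) +
    (\<Sum>S\<in>\<S>. rho_hat (fst \<omega>) (half n (3 - l)) S *
      avg {1..N S} (\<lambda>j. fitted l (fst \<omega>) S (snd \<omega> S j) / \<rho> S (snd \<omega> S j)))"
proof -
  have al: "alpha_hat \<S> a r lam h T (D n M l) (fst \<omega>) M = fitted l (fst \<omega>)"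
    unfolding fitted_def by (rule alpha_hat_piece_cong) (simp add: piece_def)
  have "fitted l (fst \<omega>) S y * r_hat r (fst \<omega>) (half n (3 - l)) S / r S y =
      rho_hat (fst \<omega>) (half n (3 - l)) S * (fitted l (fst \<omega>) S y / \<rho> S y)" if S: "S \<in> \<S>" for S y
    unfolding r_hat_eq[OF S] r_eq[OF S] using R_pos[OF S] by simp
  then show ?thesis
    unfolding theta_fold_def case_prod_unfold Let_def al avg_cmult[symmetric] by simp
qed

lemma fitted_abs_le: "l \<in> {1, 2} \<Longrightarrow> S \<in> \<S> \<Longrightarrow> \<bar>fitted l X S x\<bar> \<le> iterate_bound M"
  unfolding fitted_def by (rule alpha_hat_abs_le[OF h piece_properties(3)])

lemma fitted_dep: "l \<in> {1, 2} \<Longrightarrow> S \<in> \<S> \<Longrightarrow> depends_on S (fitted l X S)"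
  unfolding fitted_def by (rule alpha_hat_dep[OF h piece_properties(3)])

lemma fitted_cong:
  assumes "l \<in> {1, 2}" "\<And>i. i \<in> half n l \<Longrightarrow> X i = X' i" shows "fitted l X = fitted l X'"
  unfolding fitted_def
  by (rule alpha_hat_cong[OF h piece_properties(3)[OF assms(1)]])
    (use piece_properties(5)[OF assms(1)] assms(2) in blast)

lemma measurable_fitted:
  assumes "l \<in> {1, 2}" "S \<in> \<S>" "x \<in> L \<rightarrow>\<^sub>M leb UNIV"
    and X: "\<And>i. i \<in> half n l \<Longrightarrow> (\<lambda>z. X z i) \<in> L \<rightarrow>\<^sub>M leb UNIV"
  shows "(\<lambda>z. fitted l (X z) S (x z)) \<in> borel_measurable L"
  unfolding fitted_def
  by (rule measurable_alpha_hat[OF h piece_properties(3)[OF assms(1)] assms(2,3)])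
    (use piece_properties(5)[OF assms(1)] X in blast)

text \<open>A partial observation is a point of R^S, and the fitted function is measurable on the
  full space; filling in zeros leads from one to the other without changing the value.\<close>

lemma measurable_fitted_Y:
  assumes l: "l \<in> {1, 2}" and S: "S \<in> \<S>" and y: "y \<in> L \<rightarrow>\<^sub>M leb S"
    and X: "\<And>i. i \<in> half n l \<Longrightarrow> (\<lambda>z. X z i) \<in> L \<rightarrow>\<^sub>M leb UNIV"
  shows "(\<lambda>z. fitted l (X z) S (y z)) \<in> borel_measurable L"
proof -
  have "(\<lambda>z. fitted l (X z) S (\<lambda>i. if i \<in> S then y z i else 0)) \<in> borel_measurable L"
    by (rule measurable_fitted[OF l S measurable_compose[OF y measurable_zero_fill] X])
  moreover have "fitted l (X z) S (\<lambda>i. if i \<in> S then y z i else 0) = fitted l (X z) S (y z)" for z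
    by (rule depends_onD[OF fitted_dep[OF l S]]) simp
  ultimately show ?thesis by simp
qed

lemma bfun_fitted: "l \<in> {1, 2} \<Longrightarrow> S \<in> \<S> \<Longrightarrow> bfun (leb UNIV) (fitted l X S)"
  by (rule bfunI[OF measurable_fitted[where X="\<lambda>_. X" and x="\<lambda>x. x"] fitted_abs_le]) auto

lemma bfun_theta_fold:
  assumes l: "l \<in> {1, 2}"
  shows "bfun (data_law \<S> r n N f) (theta_fold \<S> a r lam D n N h T M l)"
proof -
  let ?\<Omega> = "MX n \<Otimes>\<^sub>M MY N"
  have "3 - l \<in> {1, 2}" using l by auto
  then have sub: "half n l \<subseteq> {1..n}" "half n (3 - l) \<subseteq> {1..n}"
    using half_properties(4)[OF n_ge_2] l by blast+
  have X: "(\<lambda>\<omega>. fst \<omega> i) \<in> ?\<Omega> \<rightarrow>\<^sub>M leb UNIV" if "i \<in> {1..n}" for i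
    by (rule measurable_compose[OF measurable_fst measurable_MX[OF that]])
  have Y: "(\<lambda>\<omega>. snd \<omega> S j) \<in> ?\<Omega> \<rightarrow>\<^sub>M leb S" if "S \<in> \<S>" "j \<in> {1..N S}" for S j
    by (rule measurable_compose[OF measurable_snd measurable_MY[where N=N, OF that]])
  have Xl: "(\<lambda>\<omega>. fst \<omega> i) \<in> ?\<Omega> \<rightarrow>\<^sub>M leb UNIV" if "i \<in> half n l" for i
    by (rule X) (use sub that in auto)
  have b1: "bfun ?\<Omega> (\<lambda>\<omega>. fitted l (fst \<omega>) S (fst \<omega> i))" if "S \<in> \<S>" "i \<in> half n (3 - l)" for S i
    by (rule bfunI[OF measurable_fitted[OF l that(1) X Xl] fitted_abs_le[OF l that(1)]])
      (use sub that in auto)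
  have b2: "bfun ?\<Omega> (\<lambda>\<omega>. fitted l (fst \<omega>) S (snd \<omega> S j))" if "S \<in> \<S>" "j \<in> {1..N S}" for S j
    by (rule bfunI[OF measurable_fitted_Y[OF l that(1) Y[OF that] Xl] fitted_abs_le[OF l that(1)]])
  have b3: "bfun ?\<Omega> (\<lambda>\<omega>. rho_hat (fst \<omega>) (half n (3 - l)) S)" if "S \<in> \<S>" for S
    unfolding rho_hat_def by (intro bfun_avg bfun_comp[OF bfun_rho[OF that] X]) (use sub in auto)
  have b4: "bfun ?\<Omega> (\<lambda>\<omega>. \<rho> S (snd \<omega> S j))" if "S \<in> \<S>" "j \<in> {1..N S}" for S j
    by (rule bfun_comp[OF bfun_MY[where N=N, OF that bfun_rho[OF that(1)] rho_dep[OF that(1)]] measurable_snd])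
  have b5: "bfun ?\<Omega> (\<lambda>\<omega>. a (fst \<omega> i))" if "i \<in> half n (3 - l)" for i
    by (rule bfun_comp[OF bfun_a X]) (use sub that in auto)
  show ?thesis
    unfolding theta_fold_eq[abs_def] data_law_f
    by (intro bfun_add bfun_avg bfun_diff bfun_sum bfun_mult b1 b3 b5
        bfun_divide_ge[OF b2 b4 rho_ge cC(1)])
qed

lemma cross_fit_estimator: "cross_fit \<S> a r lam D n N h T M \<in> estimators \<S> n N"
proof -
  have "bfun (data_law \<S> r n N f) (cross_fit \<S> a r lam D n N h T M)"
    unfolding cross_fit_def[abs_def]
    by (intro bfun_divide_const bfun_add bfun_mult bfun_const bfun_theta_fold) auto
  then show ?thesis
    using bfun_measurable[of "data_law \<S> r n N f"] measurable_cong_sets[OF sets_data_law refl]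
    unfolding estimators_def by blast
qed

text \<open>What a fold loses against its oracle version, which has \<open>pop M\<close> in place of
  the fitted functions and 1 in place of \<open>rho_hat\<close>.\<close>

definition fold_error :: "nat \<Rightarrow> 'd data \<Rightarrow> real" where
  "fold_error l \<omega> = theta_fold \<S> a r lam D n N h T M l \<omega> -
    (avg (half n (3 - l)) (\<lambda>i. a (fst \<omega> i) - (\<Sum>S\<in>\<S>. pop M S (fst \<omega> i))) +
     (\<Sum>S\<in>\<S>. avg {1..N S} (\<lambda>j. pop M S (snd \<omega> S j) / \<rho> S (snd \<omega> S j))))"

lemma bfun_fold_error:
  assumes l: "l \<in> {1, 2}" shows "bfun (data_law \<S> r n N f) (fold_error l)"
proof -
  have "3 - l \<in> {1, 2}" using l by auto
  then have sub: "half n (3 - l) \<subseteq> {1..n}" by (rule half_properties(4)[OF n_ge_2])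
  have X: "bfun (MX n) (\<lambda>X. a (X i) - (\<Sum>S\<in>\<S>. pop M S (X i)))" if "i \<in> half n (3 - l)" for i
  proof -
    have "bfun (leb UNIV) (\<lambda>x. a x - (\<Sum>S\<in>\<S>. pop M S x))"
      by (intro bfun_diff bfun_sum bfun_a admissibleD(1)[OF pop_admissible])
    then show ?thesis by (rule bfun_comp[OF _ measurable_MX]) (use that sub in auto)
  qed
  have Y: "bfun (MY N) (\<lambda>Y. pop M S (Y S j) / \<rho> S (Y S j))" if "S \<in> \<S>" "j \<in> {1..N S}" for S j
    using bfun_MY[where N=N, OF that integral_Q_weighted(1,2)[OF that(1) admissibleD(1,2)[OF pop_admissible that(1)]]] .
  show ?thesis
    unfolding fold_error_def[abs_def]
    by (intro bfun_diff bfun_theta_fold[OF l]) (unfold data_law_f, intro bfun_add bfun_avg bfun_sum bfun_comp[OF X] bfun_comp[OF Y], auto)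
qed

lemma cross_fit_decomposition:
  "cross_fit \<S> a r lam D n N h T M \<omega> - theta a f = leading_term M n N \<omega> +
    (real (card (half n 2)) * fold_error 1 \<omega> + real (card (half n 1)) * fold_error 2 \<omega>) / real n"
proof -
  let ?c1 = "real (card (half n 1))" and ?c2 = "real (card (half n 2))"
  let ?g = "\<lambda>i. a (fst \<omega> i) - (\<Sum>S\<in>\<S>. pop M S (fst \<omega> i))"
  let ?y = "\<Sum>S\<in>\<S>. avg {1..N S} (\<lambda>j. pop M S (snd \<omega> S j) / \<rho> S (snd \<omega> S j))"
  note hp = half_properties[OF n_ge_2]
  have n0: "0 < real n" using n_ge_2 by simp
  have c: "0 < ?c1" "0 < ?c2" using hp(5)[of 1] hp(5)[of 2] n0 by auto
  have s: "sum ?g (half n 1) + sum ?g (half n 2) = sum ?g {1..n}"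
    using sum.union_disjoint[OF hp(1) hp(1) hp(2), of ?g] hp(3) by simp
  have "avg {1..n} (\<lambda>i. residual (pop M) (fst \<omega> i)) = avg {1..n} ?g - theta a f"
    using n_ge_2 unfolding residual_def by (subst avg_diff) (simp add: avg_const)
  then have o: "leading_term M n N \<omega> = sum ?g {1..n} / real n - theta a f + ?y"
    by (simp add: leading_term_def avg_def)
  have "?c2 * avg (half n 2) ?g = sum ?g (half n 2)" "?c1 * avg (half n 1) ?g = sum ?g (half n 1)"
    using c by (auto simp: avg_def)
  note g = this
  have "?c2 * (u + ?y) + ?c1 * (v + ?y) = (?c2 * u + ?c1 * v) + (?c1 + ?c2) * ?y" for u v
    by (simp only: algebra_simps)
  note this[of "avg (half n 2) ?g" "avg (half n 1) ?g"]
  then have "?c2 * (avg (half n 2) ?g + ?y) + ?c1 * (avg (half n 1) ?g + ?y) = sum ?g {1..n} + real n * ?y"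
    unfolding g hp(6) s[symmetric] by (simp only: add.commute)
  then have "(?c2 * (avg (half n 2) ?g + ?y) + ?c1 * (avg (half n 1) ?g + ?y)) / real n = sum ?g {1..n} / real n + ?y"
    using n0 by (simp add: add_divide_distrib)
  moreover have "theta_fold \<S> a r lam D n N h T M 1 \<omega> = fold_error 1 \<omega> + (avg (half n 2) ?g + ?y)"
    "theta_fold \<S> a r lam D n N h T M 2 \<omega> = fold_error 2 \<omega> + (avg (half n 1) ?g + ?y)"
    by (simp_all add: fold_error_def numeral_2_eq_2)
  ultimately show ?thesis
    unfolding cross_fit_def o by (simp add: distrib_left add_divide_distrib)
qed

definition fit_error :: "nat \<Rightarrow> real" where
  "fit_error l = (\<integral>X. total_error (fitted l X) (pop M) \<partial>PiM (half n l) (\<lambda>_. P))"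

text \<open>Given the fitting half, the difference between fitted and population functions is fixed.
  Its average over the other half and its inversely weighted average over the biased samples have
  the same mean and enter with opposite signs, so only variances proportional to its squared length
  remain. The deviation of \<open>rho_hat\<close> from 1 multiplies an average of
  \<open>pop M\<close> with mean zero, a product of two small factors, which gives the last
  term.\<close>

lemma fold_error_risk:
  assumes l: "l \<in> {1, 2}"
  shows "(\<integral>\<omega>. (fold_error l \<omega>)^2 \<partial>data_law \<S> r n N f) \<le>
    2 * s * fit_error l / real (card (half n (3 - l))) +
    6 * s * (\<Sum>S\<in>\<S>. fit_error l * (1 / (c * real (N S)) + C^2 / (c * real (card (half n (3 - l))))) +
      C^2 * (iterate_bound M)^2 / (c * real (card (half n (3 - l))) * real (N S)))"
proof -
  define H1 H2 where "H1 = half n l" and "H2 = half n (3 - l)"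
  define k where "k = real (card H2)"
  define B where "B = iterate_bound M"
  note hp = half_properties[OF n_ge_2]
  have H: "H1 \<inter> H2 = {}" "H1 \<union> H2 = {1..n}" "finite H1" "finite H2"
    using hp(1-3) l by (auto simp: H1_def H2_def)
  have l3: "3 - l \<in> {1, 2}" using l by auto
  have k0: "0 < k" unfolding k_def H2_def using hp(5)[OF l3] n_ge_2 by linarith
  then have H2ne: "H2 \<noteq> {}" by (auto simp: k_def)
  interpret X1: prob_space "PX H1" by (rule P.prob_space_PiM_const)
  interpret X2: prob_space "PX H2" by (rule P.prob_space_PiM_const)
  interpret Y: prob_space "MY N" by (rule prob_space_data_YY)
  have pX: "prob_space (MX n)" by (rule prob_space_data_X)
  define F where "F \<omega> = (fold_error l \<omega>)^2" for \<omega>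
  have bF: "bfun (MX n \<Otimes>\<^sub>M MY N) F"
    unfolding F_def[abs_def] data_law_f[symmetric] by (intro bfun_power bfun_fold_error l)
  define e where "e x S = (\<integral>z. (fitted l x S z - pop M S z)^2 \<partial>P)" for x S
  have e0: "0 \<le> e x S" for x S by (simp add: e_def)
  have te: "total_error (fitted l x) (pop M) = (\<Sum>S\<in>\<S>. e x S)" for x by (simp add: total_error_def e_def)
  define bound where "bound x = 2 * (s * (\<Sum>S\<in>\<S>. e x S) / k) + 6 * s * (\<Sum>S\<in>\<S>. e x S / (c * real (N S)) +
      C^2 / k * (e x S / c) + C^2 / k * (B^2 / (c * real (N S))))" for x
  have inner: "(\<integral>y. \<integral>Y. F (merge H1 H2 (x, y), Y) \<partial>MY N \<partial>PX H2) \<le> bound x"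
    if x: "x \<in> space (PX H1)" for x
  proof -
    define \<Delta> where "\<Delta> S z = fitted l x S z - pop M S z" for S z
    have fx: "fitted l (merge H1 H2 (x, y)) = fitted l x" for y
      by (rule fitted_cong[OF l]) (use H in \<open>simp add: H1_def\<close>)
    have b\<Delta>: "bfun (leb UNIV) (\<Delta> S)" and d\<Delta>: "depends_on S (\<Delta> S)" if S: "S \<in> \<S>" for S
    proof -
      show "bfun (leb UNIV) (\<Delta> S)"
        unfolding \<Delta>_def[abs_def] by (intro bfun_diff bfun_fitted[OF l S] admissibleD(1)[OF pop_admissible S])
      show "depends_on S (\<Delta> S)"
        using fitted_dep[OF l S, of x] admissibleD(2)[OF pop_admissible S, of M]
        unfolding \<Delta>_def depends_on_def by metis
    qed
    have e\<Delta>: "e x S = (\<integral>z. (\<Delta> S z)^2 \<partial>P)" for S by (simp add: e_def \<Delta>_def)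
    \<comment> \<open>The common mean of both averages of \<Delta>: directly on the complete half,
      and by inverse weighting on the biased sample.\<close>
    define \<mu> where "\<mu> S = (\<integral>z. \<Delta> S z \<partial>P)" for S
    let ?aY = "\<lambda>\<phi> S Y. avg {1..N S} (\<lambda>j. \<phi> (Y S j) / \<rho> S (Y S j))"
    define U where "U y = avg H2 (\<lambda>i. \<Sum>S\<in>\<S>. \<Delta> S (y i)) - (\<Sum>S\<in>\<S>. \<mu> S)" for y
    define Rm where "Rm S y = rho_hat y H2 S - 1" for S y
    have dec: "fold_error l (merge H1 H2 (x, y), Y) = - U y +
      (\<Sum>S\<in>\<S>. (?aY (\<Delta> S) S Y - \<mu> S) + Rm S y * ?aY (\<Delta> S) S Y + Rm S y * ?aY (pop M S) S Y)" for y Y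
    proof -
      have mi: "merge H1 H2 (x, y) i = y i" if "i \<in> H2" for i using H that by simp
      have ac: "avg H2 (\<lambda>i. G (merge H1 H2 (x, y) i)) = avg H2 (\<lambda>i. G (y i))" for G :: "('d \<Rightarrow> real) \<Rightarrow> real"
        unfolding avg_def using mi by (intro arg_cong2[where f="(/)"] sum.cong) auto
      have rh: "rho_hat (merge H1 H2 (x, y)) H2 S = 1 + Rm S y" for S
        unfolding Rm_def rho_hat_def ac by simp
      have ya: "?aY (fitted l x S) S Y = ?aY (\<Delta> S) S Y + ?aY (pop M S) S Y" for S
        unfolding avg_add[symmetric] \<Delta>_def by (simp add: diff_divide_distrib)
      let ?G = "\<lambda>y. avg H2 (\<lambda>i. a (y i) - (\<Sum>S\<in>\<S>. fitted l x S (y i))) - avg H2 (\<lambda>i. a (y i) - (\<Sum>S\<in>\<S>. pop M S (y i)))"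
      have xa: "?G y =
          - avg H2 (\<lambda>i. \<Sum>S\<in>\<S>. \<Delta> S (y i))"
      proof -
        have "?G y =
          avg H2 (\<lambda>i. -1 * (\<Sum>S\<in>\<S>. \<Delta> S (y i)))"
          unfolding avg_diff[symmetric] \<Delta>_def sum_subtractf by simp
        then show ?thesis unfolding avg_cmult by simp
      qed
      have "fold_error l (merge H1 H2 (x, y), Y) =
          (?G y) +
          (\<Sum>S\<in>\<S>. (1 + Rm S y) * ?aY (fitted l x S) S Y - ?aY (pop M S) S Y)"
        unfolding fold_error_def theta_fold_eq fst_conv snd_conv fx H2_def[symmetric] rh sum_subtractf
        using ac[of "\<lambda>z. a z - (\<Sum>S\<in>\<S>. fitted l x S z)"] ac[of "\<lambda>z. a z - (\<Sum>S\<in>\<S>. pop M S z)"] by simp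
      also have "(\<Sum>S\<in>\<S>. (1 + Rm S y) * ?aY (fitted l x S) S Y - ?aY (pop M S) S Y) =
          (\<Sum>S\<in>\<S>. ((?aY (\<Delta> S) S Y - \<mu> S) + Rm S y * ?aY (\<Delta> S) S Y + Rm S y * ?aY (pop M S) S Y) + \<mu> S)"
        unfolding ya by (intro sum.cong refl) (simp add: algebra_simps)
      finally show ?thesis unfolding xa U_def sum.distrib by linarith
    qed
    define V where "V S Y = ?aY (\<Delta> S) S Y - \<mu> S" for S Y
    define A1 where "A1 S Y = ?aY (\<Delta> S) S Y" for S Y
    define A2 where "A2 S Y = ?aY (pop M S) S Y" for S Y
    have bY: "bfun (MY N) (V S)" "bfun (MY N) (A1 S)" "bfun (MY N) (A2 S)" if S: "S \<in> \<S>" for S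
      unfolding V_def[abs_def] A1_def[abs_def] A2_def[abs_def]
      by (intro bfun_diff bfun_const bfun_avg bfun_MY[where N=N, OF S _ integral_Q_weighted(1,2)[OF S]] b\<Delta>[OF S] d\<Delta>[OF S]
          admissibleD(1,2)[OF pop_admissible S]; assumption)+
    let ?F = "\<lambda>S Y y. (V S Y)^2 + (Rm S y)^2 * (A1 S Y)^2 + (Rm S y)^2 * (A2 S Y)^2"
    have pw: "F (merge H1 H2 (x, y), Y) \<le> 2 * (U y)^2 + 6 * s * (\<Sum>S\<in>\<S>. ?F S Y y)" for y Y
    proof -
      let ?t = "\<lambda>S. V S Y + Rm S y * A1 S Y + Rm S y * A2 S Y"
      have "F (merge H1 H2 (x, y), Y) = (- U y + (\<Sum>S\<in>\<S>. ?t S))^2"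
        unfolding F_def dec V_def A1_def A2_def ..
      also have "\<dots> \<le> 2 * (- U y)^2 + 2 * (\<Sum>S\<in>\<S>. ?t S)^2" by (rule two_square_le)
      also have "\<dots> \<le> 2 * (- U y)^2 + 2 * (s * (\<Sum>S\<in>\<S>. (?t S)^2))"
        by (intro add_left_mono mult_left_mono sum_square_le) simp
      also have "\<dots> \<le> 2 * (- U y)^2 + 2 * (s * (\<Sum>S\<in>\<S>. 3 * ((V S Y)^2 + (Rm S y * A1 S Y)^2 + (Rm S y * A2 S Y)^2)))"
        by (intro add_left_mono mult_left_mono sum_mono three_square_le) auto
      also have "\<dots> = 2 * (U y)^2 + 6 * s * (\<Sum>S\<in>\<S>. ?F S Y y)"
        by (simp only: sum_distrib_left[symmetric] power_mult_distrib power2_minus)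
      finally show ?thesis .
    qed
    have IV: "(\<integral>Y. (V S Y)^2 \<partial>MY N) \<le> e x S / (c * real (N S))"
      and IA1: "(\<integral>Y. (A1 S Y)^2 \<partial>MY N) \<le> e x S / c"
      and IA2: "(\<integral>Y. (A2 S Y)^2 \<partial>MY N) \<le> B^2 / (c * real (N S))" if S: "S \<in> \<S>" for S
    proof -
      note iq = integral_Q_weighted[OF S b\<Delta>[OF S] d\<Delta>[OF S]]
      note ip = integral_Q_weighted[OF S admissibleD(1,2)[OF pop_admissible S], of M]
      have NS: "0 < real (N S)" using N[OF S] by simp
      have "(\<integral>Y. (V S Y)^2 \<partial>MY N) \<le> (\<integral>y. (\<Delta> S y / \<rho> S y)^2 \<partial>Q S) / real (N S)"
        using avg_Y_integrals(1)[where N=N, OF S N[OF S] iq(1,2)] unfolding V_def \<mu>_def iq(3) .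
      also have "\<dots> \<le> (e x S / c) / real (N S)"
        using iq(4,5) NS unfolding e\<Delta> by (intro divide_right_mono) auto
      finally show "(\<integral>Y. (V S Y)^2 \<partial>MY N) \<le> e x S / (c * real (N S))" by simp
      show "(\<integral>Y. (A1 S Y)^2 \<partial>MY N) \<le> e x S / c"
        using avg_Y_integrals(2)[where N=N, OF S N[OF S] iq(1,2)] iq(4,5) unfolding A1_def e\<Delta> by simp
      \<comment> \<open>\<open>pop M S\<close> has mean zero, so this average is centred and gains
        the factor 1 / N S.\<close>
      have "(\<integral>Y. (A2 S Y)^2 \<partial>MY N) \<le> (\<integral>y. (pop M S y / \<rho> S y)^2 \<partial>Q S) / real (N S)"
        using avg_Y_integrals(1)[where N=N, OF S N[OF S] ip(1,2)] admissibleD(3)[OF pop_admissible S, of M]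
        unfolding A2_def ip(3) by simp
      also have "\<dots> \<le> (B^2 / c) / real (N S)"
      proof (intro divide_right_mono)
        have "(\<integral>x. (pop M S x)^2 \<partial>P) \<le> B^2"
        proof (rule P.integral_le_const_bfun)
          show "bfun P (\<lambda>x. (pop M S x)^2)"
            unfolding bfun_P by (intro bfun_power admissibleD(1)[OF pop_admissible S])
          show "(pop M S x)^2 \<le> B^2" for x
            using pop_abs_le[OF S, of M x] iterate_bound_nonneg[of M] unfolding B_def
            by (metis abs_le_square_iff abs_of_nonneg)
        qed
        then have "(\<integral>x. (pop M S x)^2 \<partial>P) / c \<le> B^2 / c" using cC(1) by (intro divide_right_mono) auto
        then show "(\<integral>y. (pop M S y / \<rho> S y)^2 \<partial>Q S) \<le> B^2 / c" using ip(4,5) by linarith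
      qed simp
      finally show "(\<integral>Y. (A2 S Y)^2 \<partial>MY N) \<le> B^2 / (c * real (N S))" by simp
    qed
    let ?b2 = "\<lambda>y. 2 * (U y)^2 + 6 * s * (\<Sum>S\<in>\<S>. e x S / (c * real (N S)) + (Rm S y)^2 * (e x S / c) + (Rm S y)^2 * (B^2 / (c * real (N S))))"
    have innerY: "(\<integral>Y. F (merge H1 H2 (x, y), Y) \<partial>MY N) \<le> ?b2 y" if y: "y \<in> space (PX H2)" for y
    proof -
      have sp: "merge H1 H2 (x, y) \<in> space (MX n)"
        using x y H(2) measurable_space[OF measurable_merge[of H1 H2 "\<lambda>_. P"], of "(x, y)"] by (simp add: space_pair_measure)
      have "(\<integral>Y. F (merge H1 H2 (x, y), Y) \<partial>MY N) \<le>
          (\<integral>Y. 2 * (U y)^2 + 6 * s * (\<Sum>S\<in>\<S>. ?F S Y y) \<partial>MY N)"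
        by (rule Y.bfun_integral_mono[OF bfun_section_pair[OF bF sp] _ pw])
          (intro bfun_add bfun_mult bfun_const bfun_sum bfun_power bY)
      also have "\<dots> = 2 * (U y)^2 + 6 * s * (\<Sum>S\<in>\<S>. (\<integral>Y. (V S Y)^2 \<partial>MY N) +
          (Rm S y)^2 * (\<integral>Y. (A1 S Y)^2 \<partial>MY N) + (Rm S y)^2 * (\<integral>Y. (A2 S Y)^2 \<partial>MY N))"
      proof -
        have i: "integrable (MY N) (\<lambda>Y. (V S Y)^2)" "integrable (MY N) (\<lambda>Y. (A1 S Y)^2)" "integrable (MY N) (\<lambda>Y. (A2 S Y)^2)"
          if "S \<in> \<S>" for S by (intro Y.bfun_integrable bfun_power bY[OF that])+
        have t: "(\<integral>Y. ?F S Y y \<partial>MY N) =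
            (\<integral>Y. (V S Y)^2 \<partial>MY N) + (Rm S y)^2 * (\<integral>Y. (A1 S Y)^2 \<partial>MY N) + (Rm S y)^2 * (\<integral>Y. (A2 S Y)^2 \<partial>MY N)"
          if "S \<in> \<S>" for S using i[OF that] by simp
        have it: "integrable (MY N) (\<lambda>Y. ?F S Y y)"
          if "S \<in> \<S>" for S using i[OF that] by simp
        have "integrable (MY N) (\<lambda>Y. (U y)^2)" "(\<integral>Y. (U y)^2 \<partial>MY N) = (U y)^2"
          by (rule Y.bfun_integrable[OF bfun_const]) (simp only: lebesgue_integral_const Y.prob_space scaleR_one)
        note G = this
        show ?thesis
          by (rule trans[OF integral_linear_sum[OF G(1)]], erule it) (simp only: t G(2) cong: sum.cong)
      qed
      also have "\<dots> \<le> ?b2 y"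
        by (intro add_left_mono mult_left_mono sum_mono add_mono IV IA1 IA2) auto
      finally show ?thesis .
    qed
    have bU: "bfun (PX H2) U"
      unfolding U_def[abs_def]
      by (intro bfun_diff bfun_const bfun_avg bfun_sum bfun_comp[OF b\<Delta> measurable_MX])
    have bR: "bfun (PX H2) (Rm S)" if "S \<in> \<S>" for S
      unfolding Rm_def[abs_def] rho_hat_def
      by (intro bfun_diff bfun_const bfun_avg bfun_comp[OF bfun_rho[OF that] measurable_MX])
    have IU: "(\<integral>y. (U y)^2 \<partial>PX H2) \<le> s * (\<Sum>S\<in>\<S>. e x S) / k"
    proof -
      let ?\<phi> = "\<lambda>z. \<Sum>S\<in>\<S>. \<Delta> S z"
      have b\<phi>: "bfun P ?\<phi>" unfolding bfun_P by (intro bfun_sum b\<Delta>)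
      have m: "(\<Sum>S\<in>\<S>. \<mu> S) = (\<integral>z. ?\<phi> z \<partial>P)"
        unfolding \<mu>_def by (rule Bochner_Integration.integral_sum[symmetric]) (rule integrable_bfun[OF b\<Delta>])
      have "(\<integral>y. (U y)^2 \<partial>PX H2) \<le> (\<integral>z. (?\<phi> z)^2 \<partial>P) / k"
        unfolding U_def m k_def by (rule P.integral_avg_deviation_le[OF H(4) H2ne b\<phi>])
      also have "(\<integral>z. (?\<phi> z)^2 \<partial>P) \<le> (\<integral>z. s * (\<Sum>S\<in>\<S>. (\<Delta> S z)^2) \<partial>P)"
        by (rule P.bfun_integral_mono[OF bfun_power[OF b\<phi>] _ sum_square_le])
          (unfold bfun_P, intro bfun_mult bfun_const bfun_sum bfun_power b\<Delta>)
      also have "\<dots> = s * (\<Sum>S\<in>\<S>. e x S)"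
        unfolding e\<Delta> using integrable_bfun[OF bfun_power[OF b\<Delta>]]
        by (simp add: Bochner_Integration.integral_sum)
      finally show ?thesis using k0 by (simp add: divide_right_mono)
    qed
    have IR: "(\<integral>y. (Rm S y)^2 \<partial>PX H2) \<le> C^2 / k" if "S \<in> \<S>" for S
      unfolding Rm_def k_def by (rule integral_rho_hat[OF that H(4) H2ne])
    have "(\<integral>y. \<integral>Y. F (merge H1 H2 (x, y), Y) \<partial>MY N \<partial>PX H2) \<le> (\<integral>y. ?b2 y \<partial>PX H2)"
    proof (rule integral_mono)
      have "(\<lambda>y. merge H1 H2 (x, y)) \<in> PX H2 \<rightarrow>\<^sub>M MX n"
        using measurable_compose[OF measurable_Pair1'[OF x] measurable_merge[of H1 H2 "\<lambda>_. P"]] H(2) by simp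
      then have "bfun (PX H2) (\<lambda>y. \<integral>Y. F (merge H1 H2 (x, y), Y) \<partial>MY N)"
        by (rule bfun_comp[OF bfun_integral_pair[OF Y.prob_space_axioms bF]])
      then show "integrable (PX H2) (\<lambda>y. \<integral>Y. F (merge H1 H2 (x, y), Y) \<partial>MY N)"
        by (rule X2.bfun_integrable)
      show "integrable (PX H2) ?b2"
        by (intro X2.bfun_integrable bfun_add bfun_mult bfun_const bfun_sum bfun_power bU bR)
    qed (rule innerY)
    also have "\<dots> = 2 * (\<integral>y. (U y)^2 \<partial>PX H2) + 6 * s * (\<Sum>S\<in>\<S>. e x S / (c * real (N S)) +
        (\<integral>y. (Rm S y)^2 \<partial>PX H2) * (e x S / c) + (\<integral>y. (Rm S y)^2 \<partial>PX H2) * (B^2 / (c * real (N S))))"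
    proof -
      have iU: "integrable (PX H2) (\<lambda>y. (U y)^2)" by (intro X2.bfun_integrable bfun_power bU)
      have iR: "integrable (PX H2) (\<lambda>y. (Rm S y)^2)" if "S \<in> \<S>" for S
        by (intro X2.bfun_integrable bfun_power bR that)
      have gen: "integrable (PX H2) (\<lambda>y. p + (Rm S y)^2 * q + (Rm S y)^2 * u)"
        "(\<integral>y. p + (Rm S y)^2 * q + (Rm S y)^2 * u \<partial>PX H2) =
          p + (\<integral>y. (Rm S y)^2 \<partial>PX H2) * q + (\<integral>y. (Rm S y)^2 \<partial>PX H2) * u"
        if "S \<in> \<S>" for S and p q u :: real
        using iR[OF that] by (simp_all add: X2.prob_space)
      show ?thesis
        by (rule trans[OF integral_linear_sum[OF iU]], erule gen(1)) (simp only: gen(2) cong: sum.cong)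
   qed
    also have "\<dots> \<le> bound x"
      unfolding bound_def using cC(1) e0
      by (intro add_mono mult_left_mono sum_mono IU mult_right_mono IR order_refl) auto
    finally show ?thesis .
  qed
  have bmX: "bfun (MX n) (\<lambda>X. \<integral>Y. F (X, Y) \<partial>MY N)"
    by (rule bfun_integral_pair[OF Y.prob_space_axioms bF])
  have be: "bfun (PX H1) (\<lambda>x. e x S)" if S: "S \<in> \<S>" for S
    unfolding e_def fitted_def
    by (rule bfun_error_S[OF h piece_properties(3)[OF l] S]) (simp add: H1_def piece_properties(5)[OF l])
  let ?H = "\<Sum>S\<in>\<S>. fit_error l * (1 / (c * real (N S)) + C^2 / (c * k)) + C^2 * B^2 / (c * k * real (N S))"
  have "(\<integral>\<omega>. F \<omega> \<partial>data_law \<S> r n N f) = (\<integral>X. \<integral>Y. F (X, Y) \<partial>MY N \<partial>MX n)"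
  proof -
    interpret MXp: prob_space "MX n" by (rule pX)
    interpret pp: pair_sigma_finite "MX n" "MY N" ..
    interpret PL: prob_space "MX n \<Otimes>\<^sub>M MY N" by (rule prob_space_pair[OF pX Y.prob_space_axioms])
    show ?thesis unfolding data_law_f
      by (rule pp.integral_fst'[symmetric]) (rule PL.bfun_integrable[OF bF])
  qed
  also have "\<dots> = (\<integral>x. \<integral>y. \<integral>Y. F (merge H1 H2 (x, y), Y) \<partial>MY N \<partial>PX H2 \<partial>PX H1)"
    using PiM_fold_bfun[OF H(1,3,4), of "\<lambda>_. P" "\<lambda>X. \<integral>Y. F (X, Y) \<partial>MY N"] P.prob_space_axioms bmX H(2) by simp
  also have "\<dots> \<le> (\<integral>x. bound x \<partial>PX H1)"
  proof (rule integral_mono)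
    have "bfun (PX H1 \<Otimes>\<^sub>M PX H2) (\<lambda>z. \<integral>Y. F (merge H1 H2 z, Y) \<partial>MY N)"
      by (rule bfun_comp[OF bmX]) (use measurable_merge[of H1 H2 "\<lambda>_. P"] H(2) in simp)
    then show "integrable (PX H1) (\<lambda>x. \<integral>y. \<integral>Y. F (merge H1 H2 (x, y), Y) \<partial>MY N \<partial>PX H2)"
      by (intro X1.bfun_integrable bfun_integral_pair[OF X2.prob_space_axioms])
    show "integrable (PX H1) bound"
      unfolding bound_def[abs_def]
      by (intro X1.bfun_integrable bfun_add bfun_mult bfun_divide_const bfun_const bfun_sum be)
  qed (rule inner)
  also have "\<dots> \<le> 2 * s * fit_error l / k + 6 * s * (?H)"
  proof -
    have b_eq: "bound x = 2 * s / k * (\<Sum>S\<in>\<S>. e x S) + 6 * s * (\<Sum>S\<in>\<S>. e x S * (1 / (c * real (N S)) + C^2 / (c * k)) +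
        C^2 * B^2 / (c * k * real (N S)))" for x
      unfolding bound_def by (simp add: distrib_left ac_simps)
    have fe: "fit_error l = (\<Sum>S\<in>\<S>. \<integral>x. e x S \<partial>PX H1)"
      unfolding fit_error_def te H1_def[symmetric]
      by (rule Bochner_Integration.integral_sum) (rule X1.bfun_integrable[OF be])
    have feS: "(\<integral>x. e x S \<partial>PX H1) \<le> fit_error l" if "S \<in> \<S>" for S
      unfolding fe by (rule member_le_sum[OF that]) (auto intro!: Bochner_Integration.integral_nonneg e0)
    have ie: "integrable (PX H1) (\<lambda>x. e x S)" if "S \<in> \<S>" for S by (rule X1.bfun_integrable[OF be[OF that]])
    have gen: "integrable (PX H1) (\<lambda>x. e x S * q + u)"
        "(\<integral>x. e x S * q + u \<partial>PX H1) = (\<integral>x. e x S \<partial>PX H1) * q + u"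
      if "S \<in> \<S>" for S and q u :: real using ie[OF that] by (simp_all add: X1.prob_space)
    have ies: "integrable (PX H1) (\<lambda>x. \<Sum>S\<in>\<S>. e x S)" by (rule Bochner_Integration.integrable_sum[OF ie])
    have "(\<integral>x. bound x \<partial>PX H1) = 2 * s / k * fit_error l + 6 * s * (\<Sum>S\<in>\<S>. (\<integral>x. e x S \<partial>PX H1) * (1 / (c * real (N S)) + C^2 / (c * k)) +
        C^2 * B^2 / (c * k * real (N S)))"
      unfolding b_eq fe
      by (rule trans[OF integral_linear_sum[OF ies]], erule gen(1))
        (simp only: gen(2) Bochner_Integration.integral_sum[OF ie] cong: sum.cong)
    also have "\<dots> \<le> 2 * s / k * fit_error l + 6 * s * (?H)"
      using k0 cC(1) by (intro add_mono mult_left_mono sum_mono mult_right_mono feS order_refl) auto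
    finally show ?thesis by simp
  qed
  finally show ?thesis unfolding F_def k_def H2_def B_def .
qed

text \<open>Each half has at least n/3 points and each piece at least a fraction 1/M of its half
  minus one, whence the common lower bound n / (3 M) - 1 on the piece sizes.\<close>

lemma fit_error_le:
  assumes sm: "smooth_scale h M \<epsilon>" and l: "l \<in> {1, 2}" and N0: "0 < real n / (3 * real M) - 1"
  shows "fit_error l \<le>
    iterate_const M * (\<epsilon>^2 + tail T + (real (cell_count h T TYPE('d)) + 1) / (real n / (3 * real M) - 1))"
  unfolding fit_error_def fitted_def
proof (rule alpha_hat_error[OF h _ _ N0 _ sm order_refl])
  note pp = piece_properties[OF l]
  have n2: "2 \<le> n" using M by linarith
  show "finite (piece l m)" for m by (rule pp(3))
  show "disjoint_family_on (piece l) {1..M}" by (rule pp(1))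
  show "finite (half n l)" by (rule half_properties(1)[OF n2])
  show "piece l k \<subseteq> half n l" if "k \<in> {1..M}" for k by (rule pp(5)[OF that])
  show "real n / (3 * real M) - 1 \<le> real (card (piece l m))" if "m \<in> {1..M}" for m
  proof -
    have "real n / (3 * real M) = (real n / 3) / real M" by simp
    also have "\<dots> \<le> real (card (half n l)) / real M"
      by (rule divide_right_mono[OF half_properties(5)[OF n2 l]]) simp
    finally show ?thesis using pp(4)[OF that] by linarith
  qed
qed

lemma scaled_fold_error_risk:
  assumes l: "l \<in> {1, 2}" and q: "0 \<le> q" "\<And>S. S \<in> \<S> \<Longrightarrow> real n / real (N S) \<le> q"
    and \<phi>: "fit_error l \<le> \<phi>"
  shows "real n * (\<integral>\<omega>. (fold_error l \<omega>)^2 \<partial>data_law \<S> r n N f) \<le>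
    (6 * s + 6 * s * s * (q / c + 3 * C^2 / c)) * \<phi> + 18 * s * s * C^2 * (iterate_bound M)^2 * q / c / real n"
proof -
  define k where "k = real (card (half n (3 - l)))"
  define B where "B = (iterate_bound M)^2"
  define e where "e = fit_error l"
  have n2: "2 \<le> n" and n0: "0 < real n" using M by linarith+
  have "3 - l \<in> {1, 2}" using l by auto
  then have k: "real n / 3 \<le> k" unfolding k_def by (rule half_properties(5)[OF n2])
  then have k0: "0 < k" using n0 by linarith
  have nk: "real n / k \<le> 3" "1 / k \<le> 3 / real n" using k k0 n0 by (simp_all add: field_simps)
  have e0: "0 \<le> e" unfolding e_def fit_error_def
    by (intro Bochner_Integration.integral_nonneg total_error_nonneg)
  have e\<phi>: "e \<le> \<phi>" using \<phi> by (simp add: e_def)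
  have \<phi>0: "0 \<le> \<phi>" using e0 e\<phi> by simp
  have B0: "0 \<le> B" by (simp add: B_def)
  have t1: "real n * (2 * s * e / k) \<le> 6 * s * \<phi>"
  proof -
    have "real n * (2 * s * e / k) = 2 * s * (e * (real n / k))" by simp
    also have "\<dots> \<le> 2 * s * (\<phi> * 3)"
      using nk(1) e\<phi> \<phi>0 k0 by (intro mult_left_mono mult_mono) auto
    finally show ?thesis by simp
  qed
  let ?F = "\<lambda>S. e * (1 / (c * real (N S)) + C^2 / (c * k)) + C^2 * B / (c * k * real (N S))"
  have t2: "real n * (?F S) \<le>
      \<phi> * (q / c + 3 * C^2 / c) + 3 * C^2 * B * q / c / real n" if S: "S \<in> \<S>" for S
  proof -
    have NS: "0 < real (N S)" using N[OF S] by simp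
    have "real n * (?F S) =
        e * ((real n / real (N S)) / c + C^2 / c * (real n / k)) + C^2 * B / c * ((real n / real (N S)) * (1 / k))"
      by (simp add: algebra_simps)
    also have "\<dots> \<le> \<phi> * (q / c + C^2 / c * 3) + C^2 * B / c * (q * (3 / real n))"
      using q(1) q(2)[OF S] nk e\<phi> \<phi>0 cC(1) n0 NS k0 B0
      by (intro add_mono mult_mono divide_right_mono mult_left_mono add_nonneg_nonneg divide_nonneg_nonneg mult_nonneg_nonneg) auto
    finally show ?thesis by (simp add: mult.commute mult.left_commute)
  qed
  have "real n * (\<integral>\<omega>. (fold_error l \<omega>)^2 \<partial>data_law \<S> r n N f) \<le>
    real n * (2 * s * e / k + 6 * s * (\<Sum>S\<in>\<S>. ?F S))"
    using fold_error_risk[OF l] unfolding k_def B_def e_def by (intro mult_left_mono) auto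
  also have "\<dots> = real n * (2 * s * e / k) +
      6 * s * (\<Sum>S\<in>\<S>. real n * (?F S))"
    unfolding sum_distrib_left[symmetric] by (simp only: algebra_simps)
  also have "\<dots> \<le> 6 * s * \<phi> + 6 * s * (\<Sum>S\<in>\<S>. \<phi> * (q / c + 3 * C^2 / c) + 3 * C^2 * B * q / c / real n)"
    by (intro add_mono t1 mult_left_mono sum_mono t2) auto
  also have "\<dots> = (6 * s + 6 * s * s * (q / c + 3 * C^2 / c)) * \<phi> + 18 * s * s * C^2 * B * q / c / real n"
    unfolding sum_constant by (simp add: algebra_simps)
  finally show ?thesis by (simp only: B_def)
qed

text \<open>The rate condition bounds n / N S by (1 + 1/n) / lam S, and \<open>il S\<close> is the
  reciprocal of lam S times the normalised weight.\<close>

lemma leading_term_risk_le: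
  assumes rate: "\<And>S. S \<in> \<S> \<Longrightarrow> \<bar>real n * lam S / real (N S) - 1\<bar> \<le> 1 / real n"
  shows "real n * (\<integral>\<omega>. (leading_term M n N \<omega>)^2 \<partial>data_law \<S> r n N f) \<le> (1 + 1 / real n) * obj (pop M)"
proof -
  have n1: "1 \<le> n" using M by linarith
  let ?F = "\<lambda>S. real n / real (N S) * (\<integral>x. (pop M S x)^2 / \<rho> S x \<partial>P)"
  have t: "?F S \<le>
      (1 + 1 / real n) * (\<integral>x. (pop M S x)^2 * il S x \<partial>P)" if S: "S \<in> \<S>" for S
  proof -
    let ?I = "\<integral>x. (pop M S x)^2 * il S x \<partial>P"
    have I0: "0 \<le> ?I" 
      by (intro Bochner_Integration.integral_nonneg mult_nonneg_nonneg) 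
        (use lam_rho_pos[OF S] in \<open>auto simp: il_def intro: less_imp_le\<close>)
    have "(pop M S x)^2 / \<rho> S x = lam S * ((pop M S x)^2 * il S x)" for x
      using lam_pos[OF S] by (simp add: il_def)
    then have "?F S = real n * lam S / real (N S) * ?I" by simp
    also have "\<dots> \<le> (1 + 1 / real n) * ?I"
      using rate[OF S] by (intro mult_right_mono I0) linarith
    finally show ?thesis .
  qed
  have "real n * (\<integral>\<omega>. (leading_term M n N \<omega>)^2 \<partial>data_law \<S> r n N f) =
      (\<integral>x. (residual (pop M) x)^2 \<partial>P) + (\<Sum>S\<in>\<S>. ?F S)"
    by (rule leading_term_risk[OF n1 N])
  also have "\<dots> \<le> (1 + 1 / real n) * (\<integral>x. (residual (pop M) x)^2 \<partial>P) +
      (\<Sum>S\<in>\<S>. (1 + 1 / real n) * (\<integral>x. (pop M S x)^2 * il S x \<partial>P))"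
    by (intro add_mono sum_mono t) (auto simp: distrib_right)
  also have "\<dots> = (1 + 1 / real n) * obj (pop M)"
    unfolding objective_admissible[OF pop_admissible] sum_distrib_left[symmetric] by (simp only: distrib_left)
  finally show ?thesis .
qed

lemma scaled_risk_cross_fit_le:
  assumes rate: "\<And>S. S \<in> \<S> \<Longrightarrow> \<bar>real n * lam S / real (N S) - 1\<bar> \<le> 1 / real n"
    and q: "0 \<le> q" "\<And>S. S \<in> \<S> \<Longrightarrow> real n / real (N S) \<le> q"
    and \<phi>: "\<And>l. l \<in> {1, 2} \<Longrightarrow> fit_error l \<le> \<phi>" and \<gamma>: "0 < \<gamma>"
  shows "scaled_risk \<S> a r n N f (cross_fit \<S> a r lam D n N h T M) \<le> ennreal (
    (1 + \<gamma>) * ((1 + 1 / real n) * obj (pop M)) + (1 + 1 / \<gamma>) * (2 * (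
    (6 * s + 6 * s * s * (q / c + 3 * C^2 / c)) * \<phi> + 18 * s * s * C^2 * (iterate_bound M)^2 * q / c / real n)))"
proof -
  let ?L = "data_law \<S> r n N f"
  interpret L: prob_space ?L by (rule prob_space_data)
  define Z where "Z \<omega> = cross_fit \<S> a r lam D n N h T M \<omega> - theta a f" for \<omega>
  define F where "F l \<omega> = fold_error l \<omega>" for l \<omega>
  define b where "b = (6 * s + 6 * s * s * (q / c + 3 * C^2 / c)) * \<phi> + 18 * s * s * C^2 * (iterate_bound M)^2 * q / c / real n"
  have n2: "2 \<le> n" and n0: "0 < real n" using M by linarith+
  define p1 p2 where "p1 = real (card (half n 2)) / real n" and "p2 = real (card (half n 1)) / real n"
  have p: "0 \<le> p1" "0 \<le> p2" "p1 + p2 = 1"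
    using half_properties(6)[OF n2] n0 by (auto simp: p1_def p2_def add_divide_distrib[symmetric])
  have dec: "Z \<omega> = leading_term M n N \<omega> + (p1 * F 1 \<omega> + p2 * F 2 \<omega>)" for \<omega>
    unfolding Z_def F_def p1_def p2_def cross_fit_decomposition
    by (simp only: add_divide_distrib times_divide_eq_left)
  have bF: "bfun ?L (F l)" if "l \<in> {1, 2}" for l
    unfolding F_def[abs_def] by (rule bfun_fold_error[OF that])
  have bF1: "bfun ?L (F 1)" and bF2: "bfun ?L (F 2)" using bF by auto
  have bZ: "bfun ?L Z"
    unfolding dec[abs_def] by (intro bfun_add bfun_leading_term bfun_mult bfun_const bF1 bF2)
  have pw: "(Z \<omega>)^2 \<le> (1 + \<gamma>) * (leading_term M n N \<omega>)^2 + (1 + 1 / \<gamma>) * ((F 1 \<omega>)^2 + (F 2 \<omega>)^2)" for \<omega>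
    unfolding dec
    by (rule order_trans[OF add_square_le_weighted[OF \<gamma>]])
      (use \<gamma> in \<open>intro add_left_mono mult_left_mono convex_combination_square_le[OF p]; simp\<close>)
  let ?F = "(1 + \<gamma>) * (\<integral>\<omega>. (leading_term M n N \<omega>)^2 \<partial>?L) + (1 + 1 / \<gamma>) * ((\<integral>\<omega>. (F 1 \<omega>)^2 \<partial>?L) + (\<integral>\<omega>. (F 2 \<omega>)^2 \<partial>?L))"
  let ?G = "real n * (\<integral>\<omega>. (Z \<omega>)^2 \<partial>?L)"
  have "(\<integral>\<omega>. (Z \<omega>)^2 \<partial>?L) \<le> (\<integral>\<omega>. (1 + \<gamma>) * (leading_term M n N \<omega>)^2 + (1 + 1 / \<gamma>) * ((F 1 \<omega>)^2 + (F 2 \<omega>)^2) \<partial>?L)"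
    by (rule L.bfun_integral_mono[OF bfun_power[OF bZ] _ pw])
      (intro bfun_add bfun_mult bfun_const bfun_power bfun_leading_term bF1 bF2)
  also have "\<dots> = ?F"
    using L.bfun_integrable[OF bfun_power[OF bfun_leading_term]] L.bfun_integrable[OF bfun_power[OF bF1]]
      L.bfun_integrable[OF bfun_power[OF bF2]] by simp
  finally have "?G \<le> real n * (?F)"
    by (rule mult_left_mono) simp
  also have "\<dots> = (1 + \<gamma>) * (real n * (\<integral>\<omega>. (leading_term M n N \<omega>)^2 \<partial>?L)) +
      (1 + 1 / \<gamma>) * (real n * (\<integral>\<omega>. (F 1 \<omega>)^2 \<partial>?L) + real n * (\<integral>\<omega>. (F 2 \<omega>)^2 \<partial>?L))"
    by (simp only: algebra_simps)
  also have "\<dots> \<le> (1 + \<gamma>) * ((1 + 1 / real n) * obj (pop M)) + (1 + 1 / \<gamma>) * (b + b)"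
    unfolding F_def b_def using \<gamma>
    by (intro add_mono mult_left_mono leading_term_risk_le rate scaled_fold_error_risk q \<phi>) auto
  finally have main: "?G \<le> (1 + \<gamma>) * ((1 + 1 / real n) * obj (pop M)) + (1 + 1 / \<gamma>) * (2 * b)"
    by simp
  have "scaled_risk \<S> a r n N f (cross_fit \<S> a r lam D n N h T M) = (\<integral>\<^sup>+\<omega>. ennreal (real n * (Z \<omega>)^2) \<partial>?L)"
    by (simp add: scaled_risk_def Z_def)
  also have "\<dots> = ennreal (\<integral>\<omega>. real n * (Z \<omega>)^2 \<partial>?L)"
    by (rule nn_integral_eq_integral) (intro L.bfun_integrable bfun_mult bfun_const bfun_power bZ, simp)
  also have "\<dots> = ennreal (?G)" by simp
  finally show ?thesis unfolding b_def[symmetric] using main by (simp add: ennreal_leI)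
qed

end

end

section \<open>Choice of the tuning parameters\<close>

context regular_missing_data
begin

text \<open>M is chosen first, from the optimisation error; \<gamma> and \<delta> depend on the
  constants belonging to M; h then controls the bias and T the tail. With all of them fixed, the
  sampling errors, including the cell count divided by the piece size, vanish as n grows.\<close>

lemma exists_tuning:
  fixes nS :: "nat \<Rightarrow> 'd set \<Rightarrow> nat"
  assumes D: "balanced_split D"
    and N: "\<And>n S. 1 \<le> n \<Longrightarrow> S \<in> \<S> \<Longrightarrow> 1 \<le> nS n S"
    and rate: "\<And>n S. 1 \<le> n \<Longrightarrow> S \<in> \<S> \<Longrightarrow> \<bar>real n * lam S / real (nS n S) - 1\<bar> \<le> 1 / real n"
    and e: "0 < e"
  shows "\<exists>h T M. 0 < h \<and> h < 1 \<and> 1 \<le> T \<and> 1 \<le> M \<and> (\<forall>\<^sub>F n in sequentially.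
    scaled_risk \<S> a r n (nS n) f (cross_fit \<S> a r lam D n (nS n) h T M) \<le> ennreal (efficiency_bound + e))"
proof -
  obtain m where m: "obj (pop m) \<le> efficiency_bound + e / 4" using pop_nearly_optimal[of "e / 4"] e by auto
  \<comment> \<open>The estimator needs M \<ge> 1; by \<open>descent\<close> one further step does
    not raise the objective.\<close>
  define M where "M = Suc m"
  define W where "W = obj (pop M)"
  have W: "W \<le> efficiency_bound + e / 4" 
  proof -
    have "0 \<le> \<eta> * gap (pop m)" using gap_nonneg eta_bounds by simp
    then show ?thesis using descent[of m] m unfolding W_def M_def by linarith
  qed
  have W0: "0 \<le> W" unfolding W_def by (rule objective_nonneg)
  have M1: "1 \<le> M" by (simp add: M_def)
  \<comment> \<open>A crude uniform bound on n / nS: for n \<ge> 1 the rate condition gives n lam_S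
    / nS \<le> 2.\<close>
  define q where "q = (\<Sum>S\<in>\<S>. 2 / lam S)"
  have q0: "0 \<le> q" unfolding q_def using lam_pos by (intro sum_nonneg) (auto intro: less_imp_le)
  have q: "real n / real (nS n S) \<le> q" if n: "1 \<le> n" and S: "S \<in> \<S>" for n S
  proof -
    have "1 / real n \<le> 1" using n by simp
    then have "real n / real (nS n S) * lam S \<le> 2" using rate[OF n S] by (simp add: abs_le_iff)
    then have "real n / real (nS n S) \<le> 2 / lam S" using lam_pos[OF S] by (simp add: le_divide_eq)
    also have "\<dots> \<le> q" unfolding q_def
      using lam_pos by (intro member_le_sum[OF S]) (auto intro: less_imp_le)
    finally show ?thesis .
  qed
  have cancel: "x * (e / (4 * x)) = e / 4" "x * (e / (8 * x) + e / (8 * x)) = e / 4" if "0 < x" for x :: real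
    using that by (simp_all add: field_simps)
  define \<gamma> where "\<gamma> = e / (4 * (W + 1))"
  have \<gamma>: "0 < \<gamma>" "\<gamma> * W \<le> e / 4"
  proof -
    show "0 < \<gamma>" using e W0 by (simp add: \<gamma>_def)
    have "\<gamma> * W \<le> \<gamma> * (W + 1)" using \<open>0 < \<gamma>\<close> by simp
    also have "\<dots> = e / 4" unfolding \<gamma>_def using cancel[of "W + 1"] W0 by (simp only: mult.commute)
    finally show "\<gamma> * W \<le> e / 4" .
  qed
  define G1 where "G1 = 6 * s + 6 * s * s * (q / c + 3 * C^2 / c)"
  define G2 where "G2 = 18 * s * s * C^2 * (iterate_bound M)^2 * q / c"
  have G10: "0 \<le> G1" unfolding G1_def using q0 cC(1) by (intro add_nonneg_nonneg mult_nonneg_nonneg divide_nonneg_nonneg) auto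
  define K where "K = (1 + 1 / \<gamma>) * (2 * (G1 * iterate_const M))"
  have K0: "0 \<le> K" unfolding K_def using \<gamma>(1) G10 iterate_const_nonneg[of M] by simp
  \<comment> \<open>\<delta> will bound both the squared smoothing bias and the tail; adding 1 to K
    keeps the quotient meaningful for K = 0.\<close>
  define \<delta> where "\<delta> = e / (8 * (K + 1))"
  have \<delta>0: "0 < \<delta>" using e K0 by (simp add: \<delta>_def)
  have K\<delta>: "K * (\<delta> + \<delta>) < e / 2"
  proof -
    have "K * (\<delta> + \<delta>) < (K + 1) * (\<delta> + \<delta>)" using \<delta>0 by simp
    also have "\<dots> = e / 4" unfolding \<delta>_def using cancel[of "K + 1"] K0 by simp
    finally show ?thesis using e by simp
  qed
  define \<epsilon> where "\<epsilon> = sqrt \<delta>"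
  have \<epsilon>: "0 < \<epsilon>" "\<epsilon>^2 = \<delta>" using \<delta>0 by (simp_all add: \<epsilon>_def)
  obtain h where h: "0 < h" "h < 1" "smooth_scale h M \<epsilon>" using exists_smooth_scale[OF \<epsilon>(1), of M] by blast
  have "(\<lambda>j. tail (real j)) \<longlonglongrightarrow> 0"
    using tail_tendsto_0[of P] P.prob_space_axioms unfolding tail_def by simp
  then have "\<forall>\<^sub>F j in sequentially. tail (real j) < \<delta> \<and> 1 \<le> j"
    using order_tendstoD(2)[OF _ \<delta>0] eventually_ge_at_top[of 1] by (intro eventually_conj) auto
  then obtain j :: nat where j: "tail (real j) < \<delta>" "1 \<le> j" by (auto simp: eventually_sequentially)
  define T where "T = real j"
  define c0 where "c0 = real (cell_count h T TYPE('d)) + 1"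
  define \<phi> where "\<phi> n = iterate_const M * (\<epsilon>^2 + tail T + c0 / (real n / (3 * real M) - 1))" for n :: nat
  define bd where "bd n = (1 + \<gamma>) * ((1 + 1 / real n) * W) + (1 + 1 / \<gamma>) * (2 * (G1 * \<phi> n + G2 / real n))" for n :: nat
  have M0: "0 < real M" using M1 by simp
  have lim1: "(\<lambda>n. 1 / real n) \<longlonglongrightarrow> 0" "(\<lambda>n. G2 / real n) \<longlonglongrightarrow> 0"
    by (rule lim_const_over_n)+
  have lim2: "(\<lambda>n. c0 / (real n / (3 * real M) - 1)) \<longlonglongrightarrow> 0"
    using M0 by real_asymp
  have lim\<phi>: "\<phi> \<longlonglongrightarrow> iterate_const M * (\<epsilon>^2 + tail T + 0)"
    unfolding \<phi>_def[abs_def] by (intro tendsto_intros lim2)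
  let ?F = "2 * (G1 * (iterate_const M * (\<epsilon>^2 + tail T + 0)) + 0)"
  have "bd \<longlonglongrightarrow> (1 + \<gamma>) * ((1 + 0) * W) + (1 + 1 / \<gamma>) * (?F)"
    unfolding bd_def[abs_def] by (intro tendsto_intros lim1 lim\<phi>)
  moreover have "(1 + \<gamma>) * ((1 + 0) * W) + (1 + 1 / \<gamma>) * (?F) <
      efficiency_bound + e"
  proof -
    have "(1 + \<gamma>) * ((1 + 0) * W) + (1 + 1 / \<gamma>) * (?F) =
        W + \<gamma> * W + K * (\<delta> + tail T)" unfolding K_def \<epsilon>(2) by (simp only: add_0_right algebra_simps)
    also have "\<dots> \<le> W + \<gamma> * W + K * (\<delta> + \<delta>)"
      using j(1) K0 unfolding T_def by (intro add_left_mono mult_left_mono) auto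
    also have "\<dots> < efficiency_bound + e" using W \<gamma>(2) K\<delta> by linarith
    finally show ?thesis .
  qed
  ultimately have ev: "\<forall>\<^sub>F n in sequentially. bd n < efficiency_bound + e" by (rule order_tendstoD(2))
  have "\<forall>\<^sub>F n in sequentially.
    scaled_risk \<S> a r n (nS n) f (cross_fit \<S> a r lam D n (nS n) h T M) \<le> ennreal (efficiency_bound + e)"
    using ev eventually_gt_at_top[of "6 * M"]
  proof eventually_elim
    case (elim n)
    have n: "1 \<le> n" "2 * M \<le> n" using elim(2) by linarith+
    have n0: "0 < real n / (3 * real M) - 1"
    proof -
      have "3 * real M < real n" using elim(2) by simp
      then show ?thesis using M0 by (simp add: field_simps)
    qed
    have "fit_error n M D h T l \<le> \<phi> n" if "l \<in> {1, 2}" for l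
      unfolding \<phi>_def c0_def by (rule fit_error_le[OF h(1) M1 n(2) D N[OF n(1)] h(3) that n0])
    from scaled_risk_cross_fit_le[OF h(1) M1 n(2) D N[OF n(1)] rate[OF n(1)] q0 q[OF n(1)] this \<gamma>(1)]
    have "scaled_risk \<S> a r n (nS n) f (cross_fit \<S> a r lam D n (nS n) h T M) \<le> ennreal (bd n)"
      unfolding bd_def W_def G1_def G2_def .
    also have "\<dots> \<le> ennreal (efficiency_bound + e)" using elim(1) by (intro ennreal_leI) simp
    finally show ?case .
  qed
  moreover have "1 \<le> T" using j(2) by (simp add: T_def)
  ultimately show ?thesis using h(1,2) M1 by blast
qed

theorem cross_fit_attains_efficiency_bound:
  fixes nS :: "nat \<Rightarrow> 'd set \<Rightarrow> nat"
  assumes D: "balanced_split D"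
    and N: "\<And>n S. 1 \<le> n \<Longrightarrow> S \<in> \<S> \<Longrightarrow> 1 \<le> nS n S"
    and rate: "\<And>n S. 1 \<le> n \<Longrightarrow> S \<in> \<S> \<Longrightarrow> \<bar>real n * lam S / real (nS n S) - 1\<bar> \<le> 1 / real n"
  shows "\<exists>(h :: nat \<Rightarrow> real) (T :: nat \<Rightarrow> real) (M :: nat \<Rightarrow> nat).
    (\<forall>n\<ge>2. 0 < h n \<and> h n < 1 \<and> 1 \<le> T n \<and> 1 \<le> M n \<and> 2 * M n \<le> n \<and>
       cross_fit \<S> a r lam D n (nS n) (h n) (T n) (M n) \<in> estimators \<S> n (nS n)) \<and>
    limsup (\<lambda>n. scaled_risk \<S> a r n (nS n) f (cross_fit \<S> a r lam D n (nS n) (h n) (T n) (M n)))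
      \<le> ennreal efficiency_bound"
proof -
  define risk where "risk n = (\<lambda>(h, T, M). scaled_risk \<S> a r n (nS n) f (cross_fit \<S> a r lam D n (nS n) h T M))" for n
  define G :: "nat \<Rightarrow> real \<times> real \<times> nat \<Rightarrow> bool" where
    "G n = (\<lambda>(h, T, M). 0 < h \<and> h < 1 \<and> 1 \<le> T \<and> 1 \<le> M \<and> 2 * M \<le> n)" for n
  have "\<exists>p. \<forall>\<^sub>F n in sequentially. G n p \<and> risk n p \<le> ennreal (efficiency_bound + inverse (real (Suc k)))" for k
  proof -
    obtain h T M where p: "0 < h" "h < 1" "1 \<le> T" "1 \<le> M" and
      ev: "\<forall>\<^sub>F n in sequentially. scaled_risk \<S> a r n (nS n) f (cross_fit \<S> a r lam D n (nS n) h T M) \<le>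
        ennreal (efficiency_bound + inverse (real (Suc k)))"
      using exists_tuning[where nS=nS and e="inverse (real (Suc k))", OF D N rate] by auto
    have "\<forall>\<^sub>F n in sequentially. G n (h, T, M) \<and> risk n (h, T, M) \<le> ennreal (efficiency_bound + inverse (real (Suc k)))"
      using ev eventually_ge_at_top[of "2 * M"] by eventually_elim (use p in \<open>auto simp: G_def risk_def\<close>)
    then show ?thesis by blast
  qed
  \<comment> \<open>A tuning that is admissible from n = 2 on, used until the first level of
    accuracy is reached.\<close>
  moreover have "G n (1 / 2, 1, 1)" if "2 \<le> n" for n using that by (simp add: G_def)
  ultimately obtain p where G: "\<And>n. 2 \<le> n \<Longrightarrow> G n (p n)"
    and p: "\<And>k. \<forall>\<^sub>F n in sequentially. \<exists>j\<ge>k. risk n (p n) \<le> ennreal (efficiency_bound + inverse (real (Suc j)))"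
    using diagonal_choice[of 2 G "(1 / 2, 1, 1)" "\<lambda>k n p. risk n p \<le> ennreal (efficiency_bound + inverse (real (Suc k)))"]
    by blast
  have V0: "0 \<le> efficiency_bound"
    using H_prod_nonempty objective_nonneg by (intro cINF_greatest) auto
  have lim: "limsup (\<lambda>n. risk n (p n)) \<le> ennreal efficiency_bound"
  proof (rule ennreal_le_epsilon)
    fix e :: real assume e: "0 < e"
    obtain k where k: "inverse (real (Suc k)) < e" using reals_Archimedean[OF e] by blast
    show "limsup (\<lambda>n. risk n (p n)) \<le> ennreal efficiency_bound + ennreal e"
    proof (rule Limsup_bounded)
      show "\<forall>\<^sub>F n in sequentially. risk n (p n) \<le> ennreal efficiency_bound + ennreal e"
        using p[of k]
      proof eventually_elim
        case (elim n)
        then obtain j where j: "k \<le> j" "risk n (p n) \<le> ennreal (efficiency_bound + inverse (real (Suc j)))" by blast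
        have "inverse (real (Suc j)) \<le> inverse (real (Suc k))" using j(1) by (intro le_imp_inverse_le) auto
        then have "ennreal (efficiency_bound + inverse (real (Suc j))) \<le> ennreal (efficiency_bound + e)"
          using k by (intro ennreal_leI) linarith
        also have "\<dots> = ennreal efficiency_bound + ennreal e" using V0 e by simp
        finally show ?case using j(2) by (rule order_trans[rotated])
      qed
    qed
  qed
  define hh TT MM where "hh n = fst (p n)" and "TT n = fst (snd (p n))" and "MM n = snd (snd (p n))" for n
  have pn: "p n = (hh n, TT n, MM n)" for n by (simp add: hh_def TT_def MM_def)
  have tun: "0 < hh n \<and> hh n < 1 \<and> 1 \<le> TT n \<and> 1 \<le> MM n \<and> 2 * MM n \<le> n" if "2 \<le> n" for n
    using G[OF that] unfolding pn G_def by simp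
  moreover have "cross_fit \<S> a r lam D n (nS n) (hh n) (TT n) (MM n) \<in> estimators \<S> n (nS n)" if n: "2 \<le> n" for n
    using tun[OF n] N[of n] n by (intro cross_fit_estimator D) auto
  moreover have "limsup (\<lambda>n. scaled_risk \<S> a r n (nS n) f (cross_fit \<S> a r lam D n (nS n) (hh n) (TT n) (MM n))) \<le> ennreal efficiency_bound"
    using lim unfolding risk_def pn by simp
  ultimately show ?thesis by blast
qed

end

section \<open>From Hoelder conditions to uniform continuity\<close>

lemma exists_powr_le:
  assumes "0 < L" "0 < \<beta>" "0 < (\<epsilon> :: real)"
  shows "\<exists>\<delta>>0. \<delta> \<le> 1 \<and> (\<forall>t. 0 \<le> t \<and> t \<le> \<delta> \<longrightarrow> L * t powr \<beta> \<le> \<epsilon>)"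
proof -
  \<comment> \<open>The solution of L t^\<beta> = \<epsilon>, capped at 1 because the Hoelder
    conditions compare only points at distance at most 1.\<close>
  define \<delta> where "\<delta> = min 1 ((\<epsilon> / L) powr (1 / \<beta>))"
  have d: "0 < \<delta>" "\<delta> \<le> 1" using assms by (auto simp: \<delta>_def)
  have "L * t powr \<beta> \<le> \<epsilon>" if t: "0 \<le> t" "t \<le> \<delta>" for t
  proof -
    have "t powr \<beta> \<le> ((\<epsilon> / L) powr (1 / \<beta>)) powr \<beta>"
      using t assms by (intro powr_mono2) (auto simp: \<delta>_def)
    also have "\<dots> = \<epsilon> / L" using assms by (simp add: powr_powr)
    finally show ?thesis using assms(1) by (simp add: le_divide_eq mult.commute)
  qed
  then show ?thesis using d by blast
qed

lemma hoelder_imp_ucont: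
  fixes \<phi> :: "('d::finite \<Rightarrow> real) \<Rightarrow> real"
  assumes "0 < L" "0 < \<beta>"
    and \<phi>: "\<And>x x'. sup_norm S (\<lambda>i. x i - x' i) \<le> 1 \<Longrightarrow> \<bar>\<phi> x - \<phi> x'\<bar> \<le> L * sup_norm S (\<lambda>i. x i - x' i) powr \<beta>"
  shows "ucont \<phi>"
  unfolding ucont_def
proof (intro allI impI)
  fix \<epsilon> :: real assume "0 < \<epsilon>"
  then obtain \<delta> where d: "0 < \<delta>" "\<delta> \<le> 1" "\<And>t. 0 \<le> t \<Longrightarrow> t \<le> \<delta> \<Longrightarrow> L * t powr \<beta> \<le> \<epsilon>"
    using exists_powr_le[OF assms(1,2)] by blast
  have "\<bar>\<phi> x - \<phi> y\<bar> \<le> \<epsilon>" if xy: "\<forall>i. \<bar>x i - y i\<bar> \<le> \<delta>" for x y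
  proof -
    have "sup_norm S (\<lambda>i. x i - y i) \<le> \<delta>" using d(1) xy by (subst sup_norm_le_iff) auto
    then have "\<bar>\<phi> x - \<phi> y\<bar> \<le> L * sup_norm S (\<lambda>i. x i - y i) powr \<beta>"
      "L * sup_norm S (\<lambda>i. x i - y i) powr \<beta> \<le> \<epsilon>"
      using \<phi> d(2,3) sup_norm_nonneg order_trans by blast+
    then show ?thesis by linarith
  qed
  then show "\<exists>\<delta>>0. \<forall>x y. (\<forall>i. \<bar>x i - y i\<bar> \<le> \<delta>) \<longrightarrow> \<bar>\<phi> x - \<phi> y\<bar> \<le> \<epsilon>" using d(1) by blast
qed

theorem theorem1:
  fixes f a :: "('d::finite \<Rightarrow> real) \<Rightarrow> real"
    and \<S> :: "'d set set"
    and r :: "'d set \<Rightarrow> ('d \<Rightarrow> real) \<Rightarrow> real"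
    and lam :: "'d set \<Rightarrow> real"
    and nS :: "nat \<Rightarrow> 'd set \<Rightarrow> nat"
    and D :: "nat \<Rightarrow> nat \<Rightarrow> nat \<Rightarrow> nat \<Rightarrow> nat set"
    and c C \<beta>1 \<beta>2 \<beta>3 L1 L2 L3 :: real
  assumes dim: "CARD('d) \<ge> 2"
    and f: "prob_density f"
    and \<S>: "\<S> \<noteq> {}" "UNIV \<notin> \<S>"
    and r_meas: "\<And>S. S \<in> \<S> \<Longrightarrow> r S \<in> borel_measurable (leb UNIV)"
    and r_dep: "\<And>S. S \<in> \<S> \<Longrightarrow> depends_on S (r S)"
    and r_pos: "\<And>S x. S \<in> \<S> \<Longrightarrow> 0 < r S x"
    and a_meas: "a \<in> borel_measurable (leb UNIV)"
    and split: "balanced_split D"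
    and a_bdd: "bounded (range a)"
    and cC: "0 < c" "c \<le> C"
    and r_bar: "\<And>S x. S \<in> \<S> \<Longrightarrow> c \<le> r_bar r f S x \<and> r_bar r f S x \<le> C"
    and const_pos: "0 < \<beta>1" "0 < \<beta>2" "0 < \<beta>3" "0 < L1" "0 < L2" "0 < L3"
    and A1: "\<And>x x'. sup_norm UNIV (\<lambda>i. x i - x' i) \<le> 1 \<Longrightarrow>
               \<bar>a x - a x'\<bar> \<le> L1 * sup_norm UNIV (\<lambda>i. x i - x' i) powr \<beta>1"
    and A2: "\<And>S. S \<in> \<S> \<Longrightarrow>
               \<exists>\<kappa>. cond_dist f S \<kappa> \<and>
                 (\<forall>x\<in>space (leb S). \<forall>x'\<in>space (leb S). sup_norm S (\<lambda>i. x i - x' i) \<le> 1 \<longrightarrow>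
                    tv_dist (\<kappa> x) (\<kappa> x') \<le> L2 * sup_norm S (\<lambda>i. x i - x' i) powr \<beta>2)"
    and A3: "\<And>S x x'. S \<in> \<S> \<Longrightarrow> sup_norm S (\<lambda>i. x i - x' i) \<le> 1 \<Longrightarrow>
               \<bar>r_bar r f S x - r_bar r f S x'\<bar> \<le> L3 * sup_norm S (\<lambda>i. x i - x' i) powr \<beta>3"
    and nS_pos: "\<And>n S. n \<ge> 1 \<Longrightarrow> S \<in> \<S> \<Longrightarrow> nS n S \<ge> 1"
    and lam_pos: "\<And>S. S \<in> \<S> \<Longrightarrow> 0 < lam S"
    and nS_lim: "\<And>S. S \<in> \<S> \<Longrightarrow> (\<lambda>n. real (nS n S) / real n) \<longlonglongrightarrow> lam S"
    and nS_rate: "\<And>n S. n \<ge> 1 \<Longrightarrow> S \<in> \<S> \<Longrightarrow>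
                    \<bar>real n * lam S / real (nS n S) - 1\<bar> \<le> 1 / real n"
  shows
    "(\<exists>(h :: nat \<Rightarrow> real) (T :: nat \<Rightarrow> real) (M :: nat \<Rightarrow> nat).
        (\<forall>n\<ge>2. 0 < h n \<and> h n < 1 \<and> 1 \<le> T n \<and> 1 \<le> M n \<and> 2 * M n \<le> n \<and>
           cross_fit \<S> a r lam D n (nS n) (h n) (T n) (M n) \<in> estimators \<S> n (nS n)) \<and>
        limsup (\<lambda>n. scaled_risk \<S> a r n (nS n) f
                      (cross_fit \<S> a r lam D n (nS n) (h n) (T n) (M n)))
          \<le> ennreal (INF \<alpha>\<in>H_prod f \<S>. objective f \<S> a r lam \<alpha>)) \<and>
     (\<forall>\<theta> :: nat \<Rightarrow> 'd data \<Rightarrow> real. (\<forall>n\<ge>1. \<theta> n \<in> estimators \<S> n (nS n)) \<longrightarrow>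
        ennreal (INF \<alpha>\<in>H_prod f \<S>. objective f \<S> a r lam \<alpha>)
          \<le> (SUP I\<in>{I. finite I \<and> I \<noteq> {} \<and> I \<subseteq> Lsq f}.
               liminf (\<lambda>n. MAX h\<in>I.
                 scaled_risk \<S> a r n (nS n) (perturb f (\<lambda>x. real n powr (- 1 / 2) * h x)) (\<theta> n))))"
proof -
  obtain A where A: "\<And>x. \<bar>a x\<bar> \<le> A" using a_bdd unfolding bounded_iff by auto
  have "\<forall>S\<in>\<S>. \<exists>\<kappa>. cond_dist f S \<kappa> \<and>
      (\<forall>x\<in>space (leb S). \<forall>x'\<in>space (leb S). sup_norm S (\<lambda>i. x i - x' i) \<le> 1 \<longrightarrow>
        tv_dist (\<kappa> x) (\<kappa> x') \<le> L2 * sup_norm S (\<lambda>i. x i - x' i) powr \<beta>2)"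
    using A2 by blast
  \<comment> \<open>(A2) asserts a good version for each \<open>S\<close> separately; one family is
    fixed so that it can be a parameter of the locale.\<close>
  from bchoice[OF this] obtain \<kappa> where all: "\<forall>S\<in>\<S>. cond_dist f S (\<kappa> S) \<and>
      (\<forall>x\<in>space (leb S). \<forall>x'\<in>space (leb S). sup_norm S (\<lambda>i. x i - x' i) \<le> 1 \<longrightarrow>
        tv_dist (\<kappa> S x) (\<kappa> S x') \<le> L2 * sup_norm S (\<lambda>i. x i - x' i) powr \<beta>2)" ..
  then have \<kappa>: "\<And>S. S \<in> \<S> \<Longrightarrow> cond_dist f S (\<kappa> S)"
    and tv: "\<And>S x x'. S \<in> \<S> \<Longrightarrow> x \<in> space (leb S) \<Longrightarrow> x' \<in> space (leb S) \<Longrightarrow> sup_norm S (\<lambda>i. x i - x' i) \<le> 1 \<Longrightarrow>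
      tv_dist (\<kappa> S x) (\<kappa> S x') \<le> L2 * sup_norm S (\<lambda>i. x i - x' i) powr \<beta>2"
    by blast+
  interpret regular_missing_data f a \<S> r lam \<kappa> c C A
  proof
    show "ucont a" by (rule hoelder_imp_ucont[OF const_pos(4,1) A1])
    show "ucont (r_bar r f S)" if S: "S \<in> \<S>" for S by (rule hoelder_imp_ucont[OF const_pos(6,3) A3[OF S]])
    show "\<exists>\<delta>>0. \<forall>x x'. (\<forall>i. \<bar>x i - x' i\<bar> \<le> \<delta>) \<longrightarrow> tv_dist (\<kappa> S (restrict x S)) (\<kappa> S (restrict x' S)) \<le> \<epsilon>"
      if S: "S \<in> \<S>" and \<epsilon>: "0 < \<epsilon>" for S \<epsilon>
    proof -
      obtain \<delta> where d: "0 < \<delta>" "\<delta> \<le> 1" "\<And>t. 0 \<le> t \<Longrightarrow> t \<le> \<delta> \<Longrightarrow> L2 * t powr \<beta>2 \<le> \<epsilon>"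
        using exists_powr_le[OF const_pos(5,2) \<epsilon>] by blast
      have "tv_dist (\<kappa> S (restrict x S)) (\<kappa> S (restrict x' S)) \<le> \<epsilon>" if xy: "\<forall>i. \<bar>x i - x' i\<bar> \<le> \<delta>" for x x'
      proof -
        have sp: "restrict z S \<in> space (leb S)" for z by (simp add: space_PiM)
        have "sup_norm S (\<lambda>i. restrict x S i - restrict x' S i) \<le> \<delta>" using d(1) xy by (subst sup_norm_le_iff) auto
        then have "tv_dist (\<kappa> S (restrict x S)) (\<kappa> S (restrict x' S)) \<le>
            L2 * sup_norm S (\<lambda>i. restrict x S i - restrict x' S i) powr \<beta>2"
          "L2 * sup_norm S (\<lambda>i. restrict x S i - restrict x' S i) powr \<beta>2 \<le> \<epsilon>"
          using tv[OF S sp sp, of x x'] d(2,3) sup_norm_nonneg order_trans by blast+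
        then show ?thesis by linarith
      qed
      then show ?thesis using d(1) by blast
    qed
  qed (use f \<S> r_meas r_dep r_pos a_meas A cC r_bar lam_pos \<kappa> in auto)
  have "ennreal efficiency_bound
      \<le> (SUP I\<in>{I. finite I \<and> I \<noteq> {} \<and> I \<subseteq> Lsq f}.
           liminf (\<lambda>n. MAX h\<in>I.
             scaled_risk \<S> a r n (nS n) (perturb f (\<lambda>x. real n powr (- 1 / 2) * h x)) (\<theta> n)))"
    if "\<forall>n\<ge>1. \<theta> n \<in> estimators \<S> n (nS n)" for \<theta> :: "nat \<Rightarrow> 'd data \<Rightarrow> real"
    by (rule local_minimax_lower_bound[where est=\<theta> and nS=nS, OF nS_lim]) (use that in auto)
  with cross_fit_attains_efficiency_bound[where nS=nS and D=D, OF split nS_pos nS_rate]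
  show ?thesis by (intro conjI allI impI)
qed

end
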